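(* For all $(\delta y,\delta v)\in\hat C(\bar y,\bar v)$, there exists $(\alpha,\beta,\mu)\in\hat\Lambda_L(\bar y,\bar v)$ such that $$\hat\Omega[\alpha,\beta,\mu](\delta y,\delta v)\ge0.$$
   Context: **Time crisis problem and standing assumptions.** Fix $T>0$, positive integers $n,m,l$ and $x_0\in\mathbb{R}^n$; $|\cdot|$ is the Euclidean norm. $U\subset\mathbb{R}^m$ is non-empty and closed; $f:\mathbb{R}^n\times\mathbb{R}^m\to\mathbb{R}^n$ is of class $C^2$; there are $c_1,c_2>0$ with $|f(x,u)|\le c_1|x|+c_2$ for all $x\in\mathbb{R}^n$, $u\in U$; for every $x$ the set $\{f(x,u):u\in U\}$ is non-empty, compact and convex; $\phi:\mathbb{R}^n\to\mathbb{R}$ is of class $C^2$; $K\subset\mathbb{R}^n$ is closed with non-empty interior, $K^c$ is its complement and $\mathds{1}_{K^c}$ the indicator function of $K^c$ (value $1$ on $K^c$, $0$ on $K$). Let $\mathcal{U}$ be the set of measurable $u:[0,T]\to U$ and, for $u\in\mathcal{U}$, let $x_u$ be the unique solution on $[0,T]$ of $\dot x=f(x,u)$, $x(0)=x_0$. The time crisis problem is to minimize over $u\in\mathcal{U}$ the cost $J_T(u)=\phi(x_u(T))+\int_0^T\mathds{1}_{K^c}(x_u(t))\,dt$. Fix a global minimizer $\bar u\in\mathcal{U}$ and set $\bar x=x_{\bar u}$. It is assumed that: - There is $c:\mathbb{R}^m\to\mathbb{R}^l$ of class $C^2$ with $U=\{u: c_i(u)\le 0,\ 1\le i\le l\}$,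 and there are $\varepsilon,\delta>0$ such that, with $I(t)=\{i: c_i(\bar u(t))\ge-\delta\}$, one has $\varepsilon|\xi|\le\big|\sum_{i\in I(t)}\xi_i\nabla c_i(\bar u(t))\big|$ for all $\xi\in\mathbb{R}^{I(t)}$, for a.e. $t\in(0,T)$. - There is $g:\mathbb{R}^n\to\mathbb{R}$ of class $C^2$ with $K=\{x: g(x)\le 0\}$. - $\bar x$ has exactly one crossing time $\bar\tau\in(0,T)$; it is a transverse crossing time from $K$ to $K^c$: there is $\eta>0$ with $\bar x(t)\in K$ for $t\in(\bar\tau-\eta,\bar\tau]$ and $\bar x(t)\in K^c$ for $t\in(\bar\tau,\bar\tau+\eta)$; $\bar u$ is left- and right-continuous at $\bar\tau$ (one-sided limits $\bar u(\bar\tau^\pm)$ exist); and $\dot{\bar x}(\bar\tau^\pm)\cdot\nabla g(\bar x(\bar\tau))\ne0$, where $\dot{\bar x}(\bar\tau^\pm)=f(\bar x(\bar\tau),\bar u(\bar\tau^\pm))$. Moreover $g(\bar x(t))\neq0$ for all $t\in[0,T]\setminus\{\bar\tau\}$ (so $x_0\in\mathrm{Int}(K)$). **Time change.** For $\tau\in(0,T)$, $\pi_\tau:[0,2]\to[0,T]$ is $\pi_\tau(s)=\tau s$ for $s\in[0,1]$ and $\pi_\tau(s)=(T-\tau)s+2\tau-T$ for $s\in[1,2]$. Set $\tilde u=\bar u\circ\pi_{\bar\tau}$, $\tilde x=\bar x\circ\pi_{\bar\tau}$. **Problem $(\mathrm{P})$.** Write $y=(y^{(1)},y^{(2)},\xi)\in\mathbb{R}^{n}\times\mathbb{R}^n\times\mathbb{R}$,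 $v=(v^{(1)},v^{(2)})\in\mathbb{R}^m\times\mathbb{R}^m$, and $$F(y,v)=\big(\xi f(y^{(1)},v^{(1)}),\ (T-\xi)f(y^{(2)},v^{(2)}),\ 0\big),\qquad G(y_0,y_1)=\big(y_0^{(1)},\ \xi_0,\ y_0^{(2)}-y_1^{(1)},\ g(y_1^{(1)})\big)\in\mathbb{R}^{2n+2},$$ the four blocks of $G$ being denoted $G_1,G_2,G_3,G_4$; $C=\{x_0\}\times(0,T)\times\{0_{\mathbb{R}^n}\}\times\{0\}$, $\psi(y)=\phi(y^{(2)})+T-\xi$. $\mathcal{T}$ is the set of pairs $(y,v)$ with $v:[0,1]\to U\times U$ measurable and $y$ a solution of $\frac{dy}{ds}(s)=F(y(s),v(s))$ on $[0,1]$. Problem $(\mathrm{P})$ is: minimize $\psi(y(1))$ over $(y,v)\in\mathcal{T}$ subject to $G(y(0),y(1))\in C$. The reference pair is $\bar y(s)=(\tilde x(s),\tilde x(s+1),\bar\tau)$, $\bar v(s)=(\tilde u(s),\tilde u(s+1))$, $s\in[0,1]$; it is a weak minimum of $(\mathrm{P})$, i.e. $(\bar y,\bar v)\in\mathcal T$, $G(\bar y(0),\bar y(1))\in C$, and there is $\varepsilon>0$ such that $\psi(\bar y(1))\le\psi(y(1))$ for all $(y,v)\in\mathcal T$ with $G(y(0),y(1))\in C$, $|y(0)-\bar y(0)|\le\varepsilon$, $\|v-\bar v\|_{L^\infty(0,1;\mathbb{R}^{2m})}\le\varepsilon$. **Lagrange multipliers of $(\mathrm{P})$.** Let $\hat H(y,q,v)=q\cdot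 F(y,v)$ for $q=(p^{(1)},p^{(2)},\lambda)\in\mathbb{R}^{2n+1}$ and $\hat H^a(y,q,v,\mu)=\hat H(y,q,v)+\mu^{(1)}\cdot c(v^{(1)})+\mu^{(2)}\cdot c(v^{(2)})$ for $\mu=(\mu^{(1)},\mu^{(2)})\in\mathbb{R}^{2l}$. $\hat\Lambda_L(\bar y,\bar v)$ is the set of non-zero triplets $(\alpha,\beta,\mu)\in[0,\infty)\times\mathbb{R}^{2n+2}\times L^\infty(0,1;\mathbb{R}^{2l})$, $\beta=(\beta_1,\beta_2,\beta_3,\beta_4)\in\mathbb{R}^{n}\times\mathbb{R}\times\mathbb{R}^n\times\mathbb{R}$, such that: - $\beta_2=0$, and for a.e. $s\in[0,1]$, $\mu(s)\ge0$ and $\mu^{(1)}(s)\cdot c(\bar v^{(1)}(s))+\mu^{(2)}(s)\cdot c(\bar v^{(2)}(s))=0$; - there is an absolutely continuous $q:[0,1]\to\mathbb{R}^{2n+1}$ with $\frac{dq}{ds}(s)=-\nabla_y\hat H(\bar y(s),q(s),\bar v(s))$ for a.e. $s$, $-q(0)=\nabla_{y_0}G(\bar y(0),\bar y(1))\beta$ and $q(1)=\nabla_{y_1}G(\bar y(0),\bar y(1))\beta+\alpha\nabla\psi(\bar y(1))$, where $\nabla_{y_i}G$ denotes the transpose of the partial Jacobian of $G$ with respect to $y_i$; - $\nabla_v\hat H^a(\bar y(s),q(s),\bar v(s),\mu(s))=0$ for a.e. $s\in[0,1]$. The costate $q$ is uniquely determined by $(\alpha,\beta,\mu)$. **Critical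 cone.** $\hat C(\bar y,\bar v)$ is the set of $(\delta y,\delta v)\in H^1(0,1;\mathbb{R}^{2n+1})\times L^2(0,1;\mathbb{R}^{2m})$, $\delta y=(\delta y^{(1)},\delta y^{(2)},\delta\xi)$, $\delta v=(\delta v^{(1)},\delta v^{(2)})$, such that $\frac{d}{ds}\delta y(s)=DF(\bar y(s),\bar v(s))(\delta y(s),\delta v(s))$ for a.e. $s\in(0,1)$; $D\psi(\bar y(1))\delta y(1)\le0$; $DG_i(\bar y(0),\bar y(1))(\delta y(0),\delta y(1))=0$ for $i=1,3,4$; and for $j=1,2$, all $i=1,\dots,l$ and a.e. $s\in(0,1)$, $c_i(\bar v^{(j)}(s))=0$ implies $Dc_i(\bar v^{(j)}(s))\delta v^{(j)}(s)=0$. **Quadratic form.** With $q$ the costate of $(\alpha,\beta,\mu)$, the Hessian of $\hat H^a$ being taken with respect to $(y,v)$ only and $B(z)^2$ meaning $B(z,z)$ for a bilinear form $B$, $$\hat\Omega[\alpha,\beta,\mu](\delta y,\delta v)=\alpha D^2\psi(\bar y(1))(\delta y(1))^2+\beta\cdot D^2G(\bar y(0),\bar y(1))(\delta y(0),\delta y(1))^2+\int_0^1D^2\hat H^a(\bar y(s),q(s),\bar v(s),\mu(s))(\delta y(s),\delta v(s))^2\,ds.$$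
   Formalization: The minimizer ū is additionally assumed essentially bounded on [0,T]; without this the set of Lagrange multipliers can be empty (unbounded ū with U=ℝ), so the claim fails as stated. *)

theory Defs
  imports "HOL-Analysis.Analysis"
begin

text \<open>
  The derivative is taken in the Banach space of bounded linear maps, so that it can be iterated:
  \<open>fderiv (fderiv f) x h k\<close> is the second derivative of \<open>f\<close> at \<open>x\<close> applied to \<open>(h, k)\<close>.
\<close>

definition fderiv ::
  "('a::real_normed_vector \<Rightarrow> 'b::real_normed_vector) \<Rightarrow> 'a \<Rightarrow> 'a \<Rightarrow>\<^sub>L 'b"
  where "fderiv f x = Blinfun (frechet_derivative f (at x))"

lemma fderiv_has_derivative:
  assumes "f differentiable (at x)"
  shows "(f has_derivative blinfun_apply (fderiv f x)) (at x)"
proof -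
  have "(f has_derivative frechet_derivative f (at x)) (at x)"
    using assms frechet_derivative_works by blast
  then show ?thesis
    unfolding fderiv_def
    using bounded_linear_Blinfun_apply[OF has_derivative_bounded_linear] by metis
qed

definition C2 :: "('a::real_normed_vector \<Rightarrow> 'b::real_normed_vector) \<Rightarrow> bool"
  where "C2 f \<longleftrightarrow>
    (\<forall>x. f differentiable (at x)) \<and>
    (\<forall>x. fderiv f differentiable (at x)) \<and>
    continuous_on UNIV (fderiv (fderiv f))"

definition grad :: "('a::real_inner \<Rightarrow> real) \<Rightarrow> 'a \<Rightarrow> 'a"
  where "grad f x = (THE d. GDERIV f x :> d)"

text \<open>
  Elements of the Lebesgue spaces are represented by functions on the whole real line of which
  only the values on \<open>{a..b}\<close> matter; elements of \<open>H\<^sup>1\<close> by their absolutely continuous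
  representative.
\<close>

definition abs_cont_on :: "real \<Rightarrow> real \<Rightarrow> (real \<Rightarrow> 'a::real_normed_vector) \<Rightarrow> bool"
  where "abs_cont_on a b x \<longleftrightarrow>
    (\<forall>\<epsilon>>0. \<exists>\<delta>>0. \<forall>d. d division_of (\<Union>d) \<and> \<Union>d \<subseteq> {a..b} \<and> (\<Sum>k\<in>d. measure lborel k) < \<delta>
        \<longrightarrow> (\<Sum>k\<in>d. norm (x (interval_upperbound k) - x (interval_lowerbound k))) < \<epsilon>)"

definition Linf_on :: "real \<Rightarrow> real \<Rightarrow> (real \<Rightarrow> 'a::euclidean_space) \<Rightarrow> bool"
  where "Linf_on a b w \<longleftrightarrow>
    w \<in> borel_measurable (lebesgue_on {a..b}) \<and>
    (\<exists>M. AE s in lebesgue_on {a..b}. norm (w s) \<le> M)"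

definition L2_on :: "real \<Rightarrow> real \<Rightarrow> (real \<Rightarrow> 'a::euclidean_space) \<Rightarrow> bool"
  where "L2_on a b w \<longleftrightarrow>
    w \<in> borel_measurable (lebesgue_on {a..b}) \<and>
    integrable (lebesgue_on {a..b}) (\<lambda>s. (norm (w s))\<^sup>2)"

definition H1_on :: "real \<Rightarrow> real \<Rightarrow> (real \<Rightarrow> 'a::euclidean_space) \<Rightarrow> bool"
  where "H1_on a b w \<longleftrightarrow>
    abs_cont_on a b w \<and>
    (\<exists>w'. L2_on a b w' \<and>
       (AE s in lebesgue_on {a..b}. (w has_vector_derivative w' s) (at s within {a..b})))"

definition controls :: "real \<Rightarrow> 'v::euclidean_space set \<Rightarrow> (real \<Rightarrow> 'v) set"
  where "controls T U =
    {u. u \<in> borel_measurable (lebesgue_on {0..T}) \<and> (\<forall>t\<in>{0..T}. u t \<in> U)}"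

text \<open>Solutions of the controlled equation are understood in the sense of Caratheodory.\<close>

definition is_state ::
  "real \<Rightarrow> ('y::euclidean_space \<times> 'v \<Rightarrow> 'y) \<Rightarrow> 'y \<Rightarrow> (real \<Rightarrow> 'v) \<Rightarrow> (real \<Rightarrow> 'y) \<Rightarrow> bool"
  where "is_state T f x0 u x \<longleftrightarrow>
    abs_cont_on 0 T x \<and> x 0 = x0 \<and>
    (AE t in lebesgue_on {0..T}. (x has_vector_derivative f (x t, u t)) (at t within {0..T}))"

definition crisis_cost ::
  "real \<Rightarrow> ('y::euclidean_space \<Rightarrow> real) \<Rightarrow> 'y set \<Rightarrow> (real \<Rightarrow> 'y) \<Rightarrow> real"
  where "crisis_cost T \<phi> K x = \<phi> (x T) + (LINT t|lebesgue_on {0..T}. indicator (- K) (x t))"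

definition crosses_out :: "'y set \<Rightarrow> (real \<Rightarrow> 'y) \<Rightarrow> real \<Rightarrow> bool"
  where "crosses_out K x \<tau> \<longleftrightarrow>
    (\<exists>\<eta>>0. (\<forall>t\<in>{\<tau> - \<eta><..\<tau>}. x t \<in> K) \<and> (\<forall>t\<in>{\<tau><..<\<tau> + \<eta>}. x t \<in> - K))"

definition crosses_in :: "'y set \<Rightarrow> (real \<Rightarrow> 'y) \<Rightarrow> real \<Rightarrow> bool"
  where "crosses_in K x \<tau> \<longleftrightarrow>
    (\<exists>\<eta>>0. (\<forall>t\<in>{\<tau> - \<eta><..<\<tau>}. x t \<in> - K) \<and> (\<forall>t\<in>{\<tau>..<\<tau> + \<eta>}. x t \<in> K))"

definition time_change :: "real \<Rightarrow> real \<Rightarrow> real \<Rightarrow> real"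
  where "time_change T \<tau> s = (if s \<le> 1 then \<tau> * s else (T - \<tau>) * s + 2 * \<tau> - T)"

type_synonym 'n state2 = "(real ^ 'n) \<times> (real ^ 'n) \<times> real"
type_synonym 'm control2 = "(real ^ 'm) \<times> (real ^ 'm)"
type_synonym 'n endpoint = "(real ^ 'n) \<times> real \<times> (real ^ 'n) \<times> real"
type_synonym ('n, 'l) multiplier = "real \<times> 'n endpoint \<times> (real \<Rightarrow> (real ^ 'l) \<times> (real ^ 'l))"

definition ref_y :: "real \<Rightarrow> real \<Rightarrow> (real \<Rightarrow> real ^ 'n) \<Rightarrow> real \<Rightarrow> 'n state2"
  where "ref_y T \<tau> x s = ((x \<circ> time_change T \<tau>) s, (x \<circ> time_change T \<tau>) (s + 1), \<tau>)"

definition ref_v :: "real \<Rightarrow> real \<Rightarrow> (real \<Rightarrow> real ^ 'm) \<Rightarrow> real \<Rightarrow> 'm control2"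
  where "ref_v T \<tau> u s = ((u \<circ> time_change T \<tau>) s, (u \<circ> time_change T \<tau>) (s + 1))"

definition dyn2 ::
  "real \<Rightarrow> ((real ^ 'n) \<times> (real ^ 'm) \<Rightarrow> real ^ 'n) \<Rightarrow> 'n state2 \<times> 'm control2 \<Rightarrow> 'n state2"
  where "dyn2 T f = (\<lambda>((y1, y2, \<xi>), (v1, v2)).
    (\<xi> *\<^sub>R f (y1, v1), (T - \<xi>) *\<^sub>R f (y2, v2), 0))"

text \<open>The two arguments of \<open>endpoint_map g\<close> are the values of the state at times 0 and 1.\<close>

definition endpoint_map ::
  "(real ^ 'n \<Rightarrow> real) \<Rightarrow> 'n state2 \<times> 'n state2 \<Rightarrow> 'n endpoint"
  where "endpoint_map g = (\<lambda>((a1, a2, \<xi>0), (b1, b2, \<xi>1)). (a1, \<xi>0, a2 - b1, g b1))"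

definition final_cost :: "real \<Rightarrow> (real ^ 'n \<Rightarrow> real) \<Rightarrow> 'n state2 \<Rightarrow> real"
  where "final_cost T \<phi> = (\<lambda>(y1, y2, \<xi>). \<phi> y2 + T - \<xi>)"

definition hamiltonian ::
  "real \<Rightarrow> ((real ^ 'n) \<times> (real ^ 'm) \<Rightarrow> real ^ 'n) \<Rightarrow>
    'n state2 \<Rightarrow> 'n state2 \<Rightarrow> 'm control2 \<Rightarrow> real"
  where "hamiltonian T f y q v = q \<bullet> dyn2 T f (y, v)"

definition aug_hamiltonian ::
  "real \<Rightarrow> ((real ^ 'n) \<times> (real ^ 'm) \<Rightarrow> real ^ 'n) \<Rightarrow> (real ^ 'm \<Rightarrow> real ^ 'l) \<Rightarrow>
    'n state2 \<Rightarrow> 'n state2 \<Rightarrow> 'm control2 \<Rightarrow> (real ^ 'l) \<times> (real ^ 'l) \<Rightarrow> real"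
  where "aug_hamiltonian T f c y q v \<mu> =
    hamiltonian T f y q v + fst \<mu> \<bullet> c (fst v) + snd \<mu> \<bullet> c (snd v)"

text \<open>The transpose of a Jacobian is the adjoint of the derivative.\<close>

definition is_costate ::
  "real \<Rightarrow> ((real ^ 'n) \<times> (real ^ 'm) \<Rightarrow> real ^ 'n) \<Rightarrow> (real ^ 'n \<Rightarrow> real) \<Rightarrow> (real ^ 'n \<Rightarrow> real) \<Rightarrow>
    (real \<Rightarrow> 'n state2) \<Rightarrow> (real \<Rightarrow> 'm control2) \<Rightarrow> real \<Rightarrow> 'n endpoint \<Rightarrow>
    (real \<Rightarrow> 'n state2) \<Rightarrow> bool"
  where "is_costate T f \<phi> g y v \<alpha> \<beta> q \<longleftrightarrow>
    abs_cont_on 0 1 q \<and>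
    (AE s in lebesgue_on {0..1}.
       (q has_vector_derivative - grad (\<lambda>z. hamiltonian T f z (q s) (v s)) (y s))
         (at s within {0..1})) \<and>
    - q 0 = adjoint (fderiv (\<lambda>z. endpoint_map g (z, y 1)) (y 0)) \<beta> \<and>
    q 1 = adjoint (fderiv (\<lambda>z. endpoint_map g (y 0, z)) (y 1)) \<beta>
          + \<alpha> *\<^sub>R grad (final_cost T \<phi>) (y 1)"

text \<open>
  A triplet is non-zero as an element of the product space, i.e. the component \<open>\<mu>\<close> is compared
  with 0 up to null sets.
\<close>

definition lagrange_multipliers ::
  "real \<Rightarrow> ((real ^ 'n) \<times> (real ^ 'm) \<Rightarrow> real ^ 'n) \<Rightarrow> (real ^ 'n \<Rightarrow> real) \<Rightarrow> (real ^ 'n \<Rightarrow> real) \<Rightarrow>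
    (real ^ 'm \<Rightarrow> real ^ 'l) \<Rightarrow> (real \<Rightarrow> 'n state2) \<Rightarrow> (real \<Rightarrow> 'm control2) \<Rightarrow>
    ('n, 'l) multiplier set"
  where "lagrange_multipliers T f \<phi> g c y v = {(\<alpha>, \<beta>, \<mu>).
    0 \<le> \<alpha> \<and> Linf_on 0 1 \<mu> \<and>
    \<not> (\<alpha> = 0 \<and> \<beta> = 0 \<and> (AE s in lebesgue_on {0..1}. \<mu> s = 0)) \<and>
    fst (snd \<beta>) = 0 \<and>
    (AE s in lebesgue_on {0..1}.
       (\<forall>i. 0 \<le> fst (\<mu> s) $ i \<and> 0 \<le> snd (\<mu> s) $ i) \<and>
       fst (\<mu> s) \<bullet> c (fst (v s)) + snd (\<mu> s) \<bullet> c (snd (v s)) = 0) \<and>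
    (\<exists>q. is_costate T f \<phi> g y v \<alpha> \<beta> q \<and>
       (AE s in lebesgue_on {0..1}.
          grad (\<lambda>w. aug_hamiltonian T f c (y s) (q s) w (\<mu> s)) (v s) = 0))}"

definition critical_cone ::
  "real \<Rightarrow> ((real ^ 'n) \<times> (real ^ 'm) \<Rightarrow> real ^ 'n) \<Rightarrow> (real ^ 'n \<Rightarrow> real) \<Rightarrow> (real ^ 'n \<Rightarrow> real) \<Rightarrow>
    (real ^ 'm \<Rightarrow> real ^ 'l) \<Rightarrow> (real \<Rightarrow> 'n state2) \<Rightarrow> (real \<Rightarrow> 'm control2) \<Rightarrow>
    ((real \<Rightarrow> 'n state2) \<times> (real \<Rightarrow> 'm control2)) set"
  where "critical_cone T f \<phi> g c y v = {(\<delta>y, \<delta>v).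
    H1_on 0 1 \<delta>y \<and> L2_on 0 1 \<delta>v \<and>
    (AE s in lebesgue_on {0..1}.
       (\<delta>y has_vector_derivative fderiv (dyn2 T f) (y s, v s) (\<delta>y s, \<delta>v s))
         (at s within {0..1})) \<and>
    fderiv (final_cost T \<phi>) (y 1) (\<delta>y 1) \<le> 0 \<and>
    (case fderiv (endpoint_map g) (y 0, y 1) (\<delta>y 0, \<delta>y 1) of
       (d1, d2, d3, d4) \<Rightarrow> d1 = 0 \<and> d3 = 0 \<and> d4 = 0) \<and>
    (\<forall>i. AE s in lebesgue_on {0..1}.
       (c (fst (v s)) $ i = 0 \<longrightarrow> fderiv (\<lambda>w. c w $ i) (fst (v s)) (fst (\<delta>v s)) = 0) \<and>
       (c (snd (v s)) $ i = 0 \<longrightarrow> fderiv (\<lambda>w. c w $ i) (snd (v s)) (snd (\<delta>v s)) = 0))}"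

text \<open>
  The costate is determined by \<open>(\<alpha>, \<beta>)\<close> on \<open>{0..1}\<close> only; the choice outside this interval does
  not affect the quadratic form below.
\<close>

definition costate ::
  "real \<Rightarrow> ((real ^ 'n) \<times> (real ^ 'm) \<Rightarrow> real ^ 'n) \<Rightarrow> (real ^ 'n \<Rightarrow> real) \<Rightarrow> (real ^ 'n \<Rightarrow> real) \<Rightarrow>
    (real \<Rightarrow> 'n state2) \<Rightarrow> (real \<Rightarrow> 'm control2) \<Rightarrow> real \<Rightarrow> 'n endpoint \<Rightarrow> (real \<Rightarrow> 'n state2)"
  where "costate T f \<phi> g y v \<alpha> \<beta> = (SOME q. is_costate T f \<phi> g y v \<alpha> \<beta> q)"

definition Omega ::
  "real \<Rightarrow> ((real ^ 'n) \<times> (real ^ 'm) \<Rightarrow> real ^ 'n) \<Rightarrow> (real ^ 'n \<Rightarrow> real) \<Rightarrow> (real ^ 'n \<Rightarrow> real) \<Rightarrow>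
    (real ^ 'm \<Rightarrow> real ^ 'l) \<Rightarrow> (real \<Rightarrow> 'n state2) \<Rightarrow> (real \<Rightarrow> 'm control2) \<Rightarrow>
    ('n, 'l) multiplier \<Rightarrow> (real \<Rightarrow> 'n state2) \<times> (real \<Rightarrow> 'm control2) \<Rightarrow> real"
  where "Omega T f \<phi> g c y v = (\<lambda>(\<alpha>, \<beta>, \<mu>) (\<delta>y, \<delta>v).
    let q = costate T f \<phi> g y v \<alpha> \<beta> in
    \<alpha> * fderiv (fderiv (final_cost T \<phi>)) (y 1) (\<delta>y 1) (\<delta>y 1)
    + \<beta> \<bullet> fderiv (fderiv (endpoint_map g)) (y 0, y 1) (\<delta>y 0, \<delta>y 1) (\<delta>y 0, \<delta>y 1)
    + (LINT s|lebesgue_on {0..1}.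
         fderiv (fderiv (\<lambda>(z, w). aug_hamiltonian T f c z (q s) w (\<mu> s))) (y s, v s)
           (\<delta>y s, \<delta>v s) (\<delta>y s, \<delta>v s)))"

end

theory Submission
  imports Defs
begin

text \<open>
  In the time variable \<open>s\<close> the crossing time is the parameter \<open>\<xi>\<close>. As \<open>g \<circ> xbar\<close> reaches \<open>0\<close> with positive
  speed \<open>\<gamma>\<close>, a nearby trajectory with \<open>g (y1 1) > 0\<close> leaves \<open>K\<close> at most \<open>2 * g (y1 1) / \<gamma>\<close> too early in the
  original time. Hence, with \<open>k = 2 / \<gamma>\<close>, the function \<open>\<phi> (y2 1) - \<xi> + k * max 0 (g (y1 1))\<close> is minimised by
  the reference trajectory among all nearby ones: the constraint \<open>g (y1 1) = 0\<close> is exactly penalised.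

  The qualification of the control constraints yields a bounded measurable right inverse of the gradients
  of the almost active constraints, so the control multipliers are explicit functions of the costate. Along
  a bounded direction tangent to the almost active constraints, the second-order expansion of the penalised
  cost over all second-order feasible corrections gives a convex set of pairs \<open>(b, a)\<close> in the plane with
  \<open>0 \<le> b + k * max 0 a\<close>; a separating line provides \<open>\<kappa> \<in> {0..k}\<close> with \<open>0 \<le> b + \<kappa> * a\<close>, and this \<open>\<kappa>\<close> is the
  multiplier of the constraint \<open>g (y1 1) = 0\<close>. Everything is affine in \<open>\<kappa>\<close>, so a critical direction in \<open>L\<^sup>2\<close> is
  handled by truncation, a correction that restores criticality, and compactness of \<open>{0..k}\<close>.
\<close>

section \<open>Absolutely continuous functions\<close>

text \<open>Two difficulties shape the proof. The endpoint constraint \<open>g (y1 1) = 0\<close>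
  may be degenerate along the tangent directions, and a general multiplier rule could then return
  \<open>\<alpha> = 0\<close>. Penalisation removes the question: the competitors belong to the
  original crisis problem and are admissible whatever the sign of \<open>g (y1 1)\<close>, so
  \<open>\<alpha> = 1\<close> throughout, and the penalty constant bounds the remaining multiplier.
  The penalty is one-sided because a nearby arc ending with \<open>g (y1 1) \<le> 0\<close> has not
  left \<open>K\<close> before the time \<open>\<xi>\<close>; hence \<open>\<kappa> \<ge> 0\<close>.
  Secondly, \<open>v + \<sigma> h + \<sigma>\<^sup>2 w\<close> must satisfy the control constraints
  at every time with one common \<open>\<sigma>\<close>. A critical direction in L2 is unbounded and
  is tangent only where a constraint is exactly active, so it is first cut down to bounded
  directions that are tangent with a margin. The \<open>\<kappa>\<close> found for such a direction
  depends on it; only its bound \<open>k\<close> is uniform, and this is what makes the passage to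
  the limit possible.\<close>

abbreviation leb01 :: "real measure"
  where "leb01 \<equiv> lebesgue_on {0..1}"

abbreviation fderiv2 :: "('a::real_normed_vector \<Rightarrow> 'b::real_normed_vector) \<Rightarrow> 'a \<Rightarrow> 'a \<Rightarrow>\<^sub>L 'a \<Rightarrow>\<^sub>L 'b"
  where "fderiv2 f \<equiv> fderiv (fderiv f)"

lemma AE_lebesgue_on_iff_negligible:
  "(AE s in lebesgue_on {a..b::real}. P s) \<longleftrightarrow> (\<exists>N. negligible N \<and> (\<forall>s\<in>{a..b} - N. P s))"
proof -
  have "(AE s in lebesgue_on {a..b::real}. P s) \<longleftrightarrow> (\<exists>N. negligible N \<and> {s. \<not> (s \<in> {a..b} \<longrightarrow> P s)} \<subseteq> N)"
    by (simp add: AE_restrict_space_iff eventually_ae_filter_negligible)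
  also have "\<dots> \<longleftrightarrow> (\<exists>N. negligible N \<and> (\<forall>s\<in>{a..b} - N. P s))"
    by (intro ex_cong1 conj_cong refl) blast
  finally show ?thesis .
qed

lemma AE_lebesgue_onE:
  assumes "AE s in lebesgue_on {a..b::real}. P s"
  obtains N where "negligible N" "\<forall>s\<in>{a..b} - N. P s"
  using assms unfolding AE_lebesgue_on_iff_negligible by blast

lemma AE_lebesgue_onI:
  assumes "negligible N" "\<And>s. s \<in> {a..b} - N \<Longrightarrow> P s"
  shows "AE s in lebesgue_on {a..b::real}. P s"
  using assms unfolding AE_lebesgue_on_iff_negligible by blast

text \<open>The fundamental theorem of calculus by gauges. Where the derivative exists,
  differentiability controls each tagged interval as in the classical proof. The remaining tags lie
  in a null set, covered by an open set so small that absolute continuity bounds the increments over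
  all intervals tagged there.\<close>

lemma abs_cont_on_has_integral:
  fixes x :: "real \<Rightarrow> 'a::euclidean_space"
  assumes ac: "abs_cont_on a b x" and ab: "a \<le> b"
    and der: "AE s in lebesgue_on {a..b}. (x has_vector_derivative g s) (at s within {a..b})"
  shows "(g has_integral (x b - x a)) {a..b}"
proof (cases "a = b")
  case True
  then show ?thesis by (simp add: has_integral_refl)
next
  case False
  with ab have ab': "a < b" by simp
  obtain N where N: "negligible N"
    and der: "\<forall>s\<in>{a..b} - N. (x has_vector_derivative g s) (at s within {a..b})"
    by (rule AE_lebesgue_onE[OF der])
  \<comment> \<open>With the value 0 on \<open>N\<close>, a tag in \<open>N\<close> contributes only
    the increment of \<open>x\<close> to the error.\<close>
  define f' where "f' s = (if s \<in> N then 0 else g s)" for s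
  have "(f' has_integral (x b - x a)) {a..b}"
    unfolding has_integral_factor_content box_real[symmetric]
  proof safe
    fix e :: real
    assume "e > 0"
    then have e2: "e/2 * (b - a) > 0" using ab' by simp
    have "\<forall>s. \<exists>d>0. s \<in> {a..b} - N \<longrightarrow>
         (\<forall>y\<in>{a..b}. norm (y-s) < d \<longrightarrow> norm (x y - x s - (y-s) *\<^sub>R f' s) \<le> e/2 * norm (y-s))"
    proof
      fix s
      show "\<exists>d>0. s \<in> {a..b} - N \<longrightarrow>
         (\<forall>y\<in>{a..b}. norm (y-s) < d \<longrightarrow> norm (x y - x s - (y-s) *\<^sub>R f' s) \<le> e/2 * norm (y-s))"
      proof (cases "s \<in> {a..b} - N")
        case True
        then have "(x has_vector_derivative f' s) (at s within {a..b})" using der by (simp add: f'_def)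
        then show ?thesis
          unfolding has_vector_derivative_def has_derivative_within_alt using half_gt_zero[OF \<open>e > 0\<close>] by blast
      next
        case False
        then show ?thesis by (intro exI[of _ 1] conjI impI) (simp, blast)
      qed
    qed
    then obtain d where d: "\<And>s. 0 < d s"
      "\<And>s y. \<lbrakk>s \<in> {a..b} - N; y \<in> {a..b}; norm (y-s) < d s\<rbrakk>
            \<Longrightarrow> norm (x y - x s - (y-s) *\<^sub>R f' s) \<le> e/2 * norm (y-s)"
      by metis
    obtain \<delta> where "\<delta> > 0" and \<delta>: "\<And>d. d division_of (\<Union>d) \<Longrightarrow> \<Union>d \<subseteq> {a..b} \<Longrightarrow>
        (\<Sum>k\<in>d. measure lborel k) < \<delta> \<Longrightarrow>
        (\<Sum>k\<in>d. norm (x (interval_upperbound k) - x (interval_lowerbound k))) < e/2 * (b - a)"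
      using ac e2 unfolding abs_cont_on_def by meson
    obtain W where W: "open W" "N \<subseteq> W" "(W - N) \<in> lmeasurable" "emeasure lebesgue (W - N) < ennreal \<delta>"
      using sets_lebesgue_outer_open[of N \<delta>] N \<open>\<delta> > 0\<close> by (metis negligible_imp_sets)
    have Wm: "W \<in> lmeasurable" "measure lebesgue W < \<delta>"
    proof -
      have eq: "W = (W - N) \<union> N" using W by auto
      show "W \<in> lmeasurable"
        using W(3) N by (subst eq) (intro fmeasurable.Un, auto simp: negligible_iff_measure)
      have "measure lebesgue W \<le> measure lebesgue (W - N) + measure lebesgue N"
        using W(3) N by (subst eq) (intro measure_Un_le, auto simp: negligible_imp_sets)
      also have "\<dots> = measure lebesgue (W - N)" using N by (simp add: negligible_iff_measure)
      also have "\<dots> < \<delta>"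
        using W(4) \<open>\<delta> > 0\<close> W(3) by (simp add: emeasure_eq_measure2 fmeasurableD2 ennreal_less_iff)
      finally show "measure lebesgue W < \<delta>" .
    qed
    have "\<forall>s. \<exists>r>0. s \<in> N \<longrightarrow> ball s r \<subseteq> W"
      using W(1,2) openE by (metis subsetD zero_less_one)
    then obtain r where r: "\<And>s. 0 < r s" "\<And>s. s \<in> N \<Longrightarrow> ball s (r s) \<subseteq> W" by metis
    \<comment> \<open>Intervals tagged in \<open>N\<close> are forced into \<open>W\<close>, whose
      measure is below \<open>\<delta>\<close>; the others are short enough for the derivative
      estimate.\<close>
    define \<gamma> where "\<gamma> s = ball s (if s \<in> N then r s else d s)" for s
    show "\<exists>d. gauge d \<and> (\<forall>p. p tagged_division_of (cbox a b) \<and> d fine p \<longrightarrow>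
      norm ((\<Sum>(s, k)\<in>p. measure lborel k *\<^sub>R f' s) - (x b - x a)) \<le> e * measure lborel (cbox a b))"
    proof (rule exI, safe)
      show "gauge \<gamma>"
        unfolding \<gamma>_def by (rule gauge_ball_dependent) (use r d in auto)
    next
      fix p
      assume ptag: "p tagged_division_of cbox a b" and finep: "\<gamma> fine p"
      have fin: "finite p" using ptag by auto
      have ba: "b - a = (\<Sum>(s,K)\<in>p. Sup K - Inf K)" "x b - x a = (\<Sum>(s,K)\<in>p. x(Sup K) - x(Inf K))"
        using additive_tagged_division_1[where f= "\<lambda>x. x"] additive_tagged_division_1[where f= x]
              ab ptag by auto
      define p1 where "p1 = {q \<in> p. fst q \<in> N}"
      define p2 where "p2 = {q \<in> p. fst q \<notin> N}"
      have p12: "p = p1 \<union> p2" "p1 \<inter> p2 = {}" "finite p1" "finite p2"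
        using fin by (auto simp: p1_def p2_def)
      have "norm (\<Sum>(s, K) \<in> p2. (measure lborel K *\<^sub>R f' s) - (x (Sup K) - x (Inf K)))
            \<le> (\<Sum>n\<in>p2. e/2 * (case n of (s, k) \<Rightarrow> Sup k - Inf k))"
      proof (rule sum_norm_le,safe)
        fix s K
        assume sK: "(s, K) \<in> p2"
        then have "(s,K) \<in> p" "s \<notin> N" by (auto simp: p2_def)
        then have "s \<in> K" and kab: "K \<subseteq> cbox a b"
          using ptag by blast+
        then obtain u v where k: "K = cbox u v" and "s \<in> K" and kab: "K \<subseteq> cbox a b"
          using ptag \<open>(s, K) \<in> p\<close> by auto
        have "u \<le> v"
          using \<open>s \<in> K\<close> unfolding k by auto
        have "K \<subseteq> \<gamma> s" using finep \<open>(s, K) \<in> p\<close> by (rule fineD)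
        then have ball: "\<forall>y\<in>K. y \<in> ball s (d s)"
          using \<open>s \<notin> N\<close> by (auto simp: \<gamma>_def)
        have "u \<in> K" "v \<in> K"
          by (simp_all add: \<open>u \<le> v\<close> k)
        have "norm ((v - u) *\<^sub>R f' s - (x v - x u)) = norm (x u - x s - (u - s) *\<^sub>R f' s - (x v - x s - (v - s) *\<^sub>R f' s))"
          by (auto simp: algebra_simps)
        also have "\<dots> \<le> norm (x u - x s - (u - s) *\<^sub>R f' s) + norm (x v - x s - (v - s) *\<^sub>R f' s)"
          by (rule norm_triangle_ineq4)
        also have "\<dots> \<le> e/2 * norm (u - s) + e/2 * norm (v - s)"
        proof (rule add_mono)
          show "norm (x u - x s - (u - s) *\<^sub>R f' s) \<le> e/2 * norm (u - s)"
          proof (rule d)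
            show "norm (u - s) < d s"
              using \<open>u \<in> K\<close> ball by (auto simp: dist_real_def)
          qed (use \<open>s \<in> K\<close> \<open>u \<in> K\<close> kab \<open>s \<notin> N\<close> in auto)
          show "norm (x v - x s - (v - s) *\<^sub>R f' s) \<le> e/2 * norm (v - s)"
          proof (rule d)
            show "norm (v - s) < d s"
              using \<open>v \<in> K\<close> ball by (auto simp: dist_real_def)
          qed (use \<open>s \<in> K\<close> \<open>v \<in> K\<close> kab \<open>s \<notin> N\<close> in auto)
        qed
        also have "\<dots> \<le> e/2 * (Sup K - Inf K)"
          using \<open>s \<in> K\<close> by (auto simp: k interval_bounds_real[OF \<open>u \<le> v\<close>] field_simps)
        finally show "norm (measure lborel K *\<^sub>R f' s - (x (Sup K) - x (Inf K))) \<le> e/2 * (Sup K - Inf K)"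
          using \<open>u \<le> v\<close> by (simp add: k)
      qed
      also have "\<dots> \<le> (\<Sum>n\<in>p. e/2 * (case n of (s, k) \<Rightarrow> Sup k - Inf k))"
      proof (rule sum_mono2[OF fin])
        fix n assume "n \<in> p - p2"
        then obtain s K where n: "n = (s,K)" "(s,K) \<in> p" by (cases n) auto
        then obtain u v where k: "K = cbox u v" "s \<in> K" using ptag by blast
        then show "0 \<le> e/2 * (case n of (s, k) \<Rightarrow> Sup k - Inf k)" using \<open>e > 0\<close> n by auto
      qed (use p12 in auto)
      also have "\<dots> = e/2 * (b - a)" by (simp add: ba(1) sum_distrib_left)
      finally have P2: "norm (\<Sum>(s, K) \<in> p2. (measure lborel K *\<^sub>R f' s) - (x (Sup K) - x (Inf K))) \<le> e/2 * (b - a)" .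
      have part: "p1 tagged_partial_division_of cbox a b"
        using ptag unfolding tagged_division_of_def p1_def
        by (auto intro: tagged_partial_division_subset)
      let ?D = "snd ` p1"
      have D: "?D division_of (\<Union>?D)" by (rule partial_division_of_tagged_division[OF part])
      have Dab: "\<Union>?D \<subseteq> {a..b}" using tagged_partial_division_ofD(3)[OF part] by fastforce
      have DW: "\<Union>?D \<subseteq> W"
      proof
        fix y assume "y \<in> \<Union>?D"
        then obtain s K where "(s,K) \<in> p1" "y \<in> K" by auto
        then have "s \<in> N" "(s,K) \<in> p" by (auto simp: p1_def)
          then have "K \<subseteq> \<gamma> s" using finep by (metis fineD)
        then show "y \<in> W" using r(2)[of s] \<open>y \<in> K\<close> \<open>s \<in> N\<close> by (auto simp: \<gamma>_def)
      qed
      have "(\<Sum>k\<in>?D. measure lborel k) = (\<Sum>k\<in>?D. measure lebesgue k)"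
        by (rule sum.cong) (use D in \<open>auto dest!: division_ofD(4)\<close>)
      also have "\<dots> = measure lebesgue (\<Union>?D)" by (rule content_division[OF D])
      also have "\<dots> \<le> measure lebesgue W"
        using DW Wm(1) D by (intro measure_mono_fmeasurable) (auto intro: lmeasurable_division fmeasurableD)
      also have "\<dots> < \<delta>" by (rule Wm)
      finally have small: "(\<Sum>k\<in>?D. norm (x (interval_upperbound k) - x (interval_lowerbound k))) < e/2 * (b - a)"
        using \<delta>[OF D Dab] by blast
      have bd: "x (Sup K) = x (interval_upperbound K)" "x (Inf K) = x (interval_lowerbound K)"
        if "(s,K) \<in> p1" for s K
      proof -
        have "(s,K) \<in> p" using that by (auto simp: p1_def)
        then obtain u v where k: "K = cbox u v" "s \<in> K" using ptag by blast
        then have "u \<le> v" by auto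
        then show "x (Sup K) = x (interval_upperbound K)" "x (Inf K) = x (interval_lowerbound K)"
          using k by (auto simp: interval_bounds_real)
      qed
      have "norm (\<Sum>(s, K) \<in> p1. (measure lborel K *\<^sub>R f' s) - (x (Sup K) - x (Inf K)))
          \<le> (\<Sum>(s,K)\<in>p1. norm (x (interval_upperbound K) - x (interval_lowerbound K)))"
        by (rule sum_norm_le) (use bd in \<open>auto simp: f'_def p1_def norm_minus_commute\<close>)
      also have "\<dots> = (\<Sum>k\<in>?D. norm (x (interval_upperbound k) - x (interval_lowerbound k)))"
      proof -
        have "sum ((\<lambda>k. norm (x (interval_upperbound k) - x (interval_lowerbound k)))) (snd ` p1)
            = sum ((\<lambda>k. norm (x (interval_upperbound k) - x (interval_lowerbound k))) \<circ> snd) p1"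
        proof (rule sum.reindex_nontrivial[OF p12(3)])
          \<comment> \<open>Two tags can share an interval only if its interior is empty; it is then
            a single point and contributes nothing.\<close>
          fix q q' assume q: "q \<in> p1" "q' \<in> p1" "q \<noteq> q'" "snd q = snd q'"
          obtain s K s' where qq: "q = (s,K)" "q' = (s',K)" using q by (metis prod.collapse)
          then have pp: "(s,K) \<in> p" "(s',K) \<in> p" "s \<noteq> s'" using q by (auto simp: p1_def)
          then have "interior K \<inter> interior K = {}"
            using ptag tagged_division_ofD(5)[OF ptag pp(1,2)] by auto
          moreover obtain u v where k: "K = cbox u v" "s \<in> K" using ptag pp by blast
          ultimately have "u = v" by auto
          then show "norm (x (interval_upperbound (snd q)) - x (interval_lowerbound (snd q))) = 0"
            using qq k by simp
        qed
        then show ?thesis by (simp add: case_prod_beta comp_def)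
      qed
      finally have P1: "norm (\<Sum>(s, K) \<in> p1. (measure lborel K *\<^sub>R f' s) - (x (Sup K) - x (Inf K))) \<le> e/2 * (b-a)"
        using small by linarith
      have "(\<Sum>(s, k)\<in>p. measure lborel k *\<^sub>R f' s) - (x b - x a) = (\<Sum>(s, K) \<in> p. (measure lborel K *\<^sub>R f' s) - (x (Sup K) - x (Inf K)))"
        by (simp add: ba(2) split_def sum_subtractf)
      also have "\<dots> = (\<Sum>(s, K) \<in> p1. (measure lborel K *\<^sub>R f' s) - (x (Sup K) - x (Inf K))) +
            (\<Sum>(s, K) \<in> p2. (measure lborel K *\<^sub>R f' s) - (x (Sup K) - x (Inf K)))"
        unfolding p12(1) by (rule sum.union_disjoint) (use p12 in auto)
      finally show "norm ((\<Sum>(s, k)\<in>p. measure lborel k *\<^sub>R f' s) - (x b - x a)) \<le> e * measure lborel (cbox a b)"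
        using norm_triangle_le[OF add_mono[OF P1 P2]] ab by (simp add: algebra_simps)
    qed
  qed
  then show ?thesis
    by (rule has_integral_spike[OF N, where f=f', rotated]) (simp add: f'_def)
qed

lemma abs_cont_on_subset:
  assumes "abs_cont_on a b x" "a \<le> c" "d \<le> b"
  shows "abs_cont_on c d x"
proof -
  have "{c..d} \<subseteq> {a..b}" using assms by auto
  then show ?thesis using assms(1) unfolding abs_cont_on_def by (meson subset_trans)
qed

lemma AE_lebesgue_on_subset:
  assumes "AE s in lebesgue_on {a..b::real}. P s" "{c..d} \<subseteq> {a..b}"
  shows "AE s in lebesgue_on {c..d}. P s"
  proof -
  obtain N where "negligible N" "\<forall>s\<in>{a..b} - N. P s" by (rule AE_lebesgue_onE[OF assms(1)])
  then show ?thesis using assms(2) by (intro AE_lebesgue_onI[of N]) auto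
qed

lemma AE_has_vector_derivative_subset:
  assumes "AE s in lebesgue_on {a..b::real}. (x has_vector_derivative g s) (at s within {a..b})" "{c..d} \<subseteq> {a..b}"
  shows "AE s in lebesgue_on {c..d}. (x has_vector_derivative g s) (at s within {c..d})"
  using AE_lebesgue_on_subset[OF assms]
  by (rule eventually_mono) (use assms(2) has_vector_derivative_within_subset in blast)

lemma abs_cont_on_has_integral_subinterval:
  fixes x :: "real \<Rightarrow> 'a::euclidean_space"
  assumes ac: "abs_cont_on a b x"
    and der: "AE s in lebesgue_on {a..b}. (x has_vector_derivative g s) (at s within {a..b})"
    and "a \<le> c" "c \<le> d" "d \<le> b"
  shows "(g has_integral (x d - x c)) {c..d}"
  by (rule abs_cont_on_has_integral[OF abs_cont_on_subset[OF ac] _ AE_has_vector_derivative_subset[OF der]])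
     (use assms in auto)

lemma lipschitz_on_abs_cont_on:
  fixes x :: "real \<Rightarrow> 'a::real_normed_vector"
  assumes "L-lipschitz_on {a..b} x"
  shows "abs_cont_on a b x"
  unfolding abs_cont_on_def
proof safe
  fix e :: real assume "e > 0"
  have L: "0 \<le> L" using assms lipschitz_on_nonneg by blast
  show "\<exists>\<delta>>0. \<forall>d. d division_of \<Union> d \<and> \<Union> d \<subseteq> {a..b} \<and> (\<Sum>k\<in>d. measure lborel k) < \<delta> \<longrightarrow>
       (\<Sum>k\<in>d. norm (x (interval_upperbound k) - x (interval_lowerbound k))) < e"
  proof (intro exI[of _ "e/(L+1)"] conjI allI impI)
    show "0 < e/(L+1)" using \<open>e > 0\<close> L by simp
    fix d assume d: "d division_of \<Union> d \<and> \<Union> d \<subseteq> {a..b} \<and> (\<Sum>k\<in>d. measure lborel k) < e/(L+1)"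
    have "(\<Sum>k\<in>d. norm (x (interval_upperbound k) - x (interval_lowerbound k))) \<le> (\<Sum>k\<in>d. L * measure lborel k)"
    proof (rule sum_mono)
      fix k assume k: "k \<in> d"
      obtain u v where uv: "k = cbox u v" "k \<noteq> {}" using d k by (metis division_ofD(3,4))
      then have le: "u \<le> v" by auto
      have "k \<subseteq> {a..b}" using d k by blast
      then have "u \<in> {a..b}" "v \<in> {a..b}" using uv le by auto
      then have "dist (x v) (x u) \<le> L * dist v u" using lipschitz_onD[OF assms] by blast
      then show "norm (x (interval_upperbound k) - x (interval_lowerbound k)) \<le> L * measure lborel k"
        using le uv by (simp add: dist_norm)
    qed
    also have "\<dots> = L * (\<Sum>k\<in>d. measure lborel k)" by (simp add: sum_distrib_left)
    also have "\<dots> \<le> (L+1) * (\<Sum>k\<in>d. measure lborel k)"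
      by (intro mult_right_mono sum_nonneg) auto
    also have "\<dots> < e" using d L by (simp add: field_simps)
    finally show "(\<Sum>k\<in>d. norm (x (interval_upperbound k) - x (interval_lowerbound k))) < e" .
  qed
qed

lemma AE_affine:
  assumes ae: "AE t in lebesgue_on {a..b::real}. P t" and m: "m \<noteq> 0"
    and sub: "\<And>s. s \<in> {c..d} \<Longrightarrow> m * s + k \<in> {a..b}"
  shows "AE s in lebesgue_on {c..d}. P (m * s + k)"
proof -
  obtain N where N: "negligible N" "\<forall>t\<in>{a..b} - N. P t"
    by (rule AE_lebesgue_onE[OF ae])
  let ?N = "(\<lambda>t. (t - k) / m) ` N"
  have "negligible ?N"
    by (rule negligible_differentiable_image_negligible[OF _ N(1)])
       (auto intro!: derivative_intros simp: differentiable_on_def m)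
  moreover have "P (m * s + k)" if "s \<in> {c..d} - ?N" for s
  proof -
    have 1: "m * s + k \<in> {a..b}" using that sub by auto
    have 2: "m * s + k \<notin> N"
    proof
      assume "m * s + k \<in> N"
      then have "(m * s + k - k) / m \<in> ?N" by blast
      then show False using that m by simp
    qed
    show ?thesis using N(2) 1 2 by blast
  qed
  ultimately show ?thesis by (rule AE_lebesgue_onI)
qed

lemma bounded_measurable_integrable:
  fixes g :: "real \<Rightarrow> 'a::euclidean_space"
  assumes "g \<in> borel_measurable (lebesgue_on {a..b})" "AE s in lebesgue_on {a..b}. norm (g s) \<le> B"
  shows "integrable (lebesgue_on {a..b}) g"
proof -
  interpret finite_measure "lebesgue_on {a..b}" by (rule finite_measure_lebesgue_on) auto
  show ?thesis using assms by (intro integrable_const_bound[where B=B]) auto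
qed

text \<open>Converse of \<open>abs_cont_on_has_integral\<close> for bounded integrands.
  \<open>integrable_ccontinuous_explicit\<close> gives the right derivative of the integral at
  almost every point; the left derivative comes from the same theorem for the reflected
  integrand.\<close>

lemma indefinite_integral_AE_derivative:
  fixes g :: "real \<Rightarrow> 'a::euclidean_space"
  assumes meas: "g \<in> borel_measurable (lebesgue_on {a..b})" and bd: "AE s in lebesgue_on {a..b}. norm (g s) \<le> B"
    and int: "\<And>t. t \<in> {a..b} \<Longrightarrow> (g has_integral (x t - x a)) {a..t}" and "0 \<le> B"
  shows "B-lipschitz_on {a..b} x"
    and "AE s in lebesgue_on {a..b}. (x has_vector_derivative g s) (at s within {a..b})" (is ?B)
proof -
  obtain N where N: "negligible N" "\<forall>s\<in>{a..b} - N. norm (g s) \<le> B"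
    by (rule AE_lebesgue_onE[OF bd])
  have diff: "(g has_integral (x t - x s)) {s..t}" if "a \<le> s" "s \<le> t" "t \<le> b" for s t
  proof -
    have "g integrable_on {a..t}" using int[of t] that by auto
    then have "g integrable_on {s..t}" using that integrable_subinterval_real by fastforce
    then obtain J where J: "(g has_integral J) {s..t}" by auto
    have "(g has_integral ((x s - x a) + J)) {a..t}"
      by (rule has_integral_combine[OF _ _ _ J]) (use int[of s] that in auto)
    moreover have "(g has_integral (x t - x a)) {a..t}" using int that by auto
    ultimately have "(x s - x a) + J = x t - x a" by (rule has_integral_unique)
    then have "J = x t - x s" by (simp add: algebra_simps)
    then show ?thesis using J by simp
  qed
  have le: "norm (x t - x s) \<le> B * (t - s)" if "a \<le> s" "s \<le> t" "t \<le> b" for s t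
  proof -
    have "((\<lambda>u. if u \<in> N then 0 else g u) has_integral (x t - x s)) (cbox s t)"
      by (rule has_integral_spike[OF N(1), where f=g]) (simp_all add: diff[OF that])
    then have "norm (x t - x s) \<le> B * measure lborel (cbox s t)"
    proof (rule has_integral_bound[OF \<open>0 \<le> B\<close>])
      fix u assume "u \<in> cbox s t"
      then have "u \<in> {a..b}" using that by simp
      then show "norm (if u \<in> N then 0 else g u) \<le> B" using N(2) \<open>0 \<le> B\<close> by simp
    qed
    then show ?thesis using that by simp
  qed
  show "B-lipschitz_on {a..b} x"
  proof (rule lipschitz_onI[OF _ \<open>0 \<le> B\<close>])
    fix s t assume "s \<in> {a..b}" "t \<in> {a..b}"
    then show "dist (x s) (x t) \<le> B * dist s t"
      using le[of s t] le[of t s] by (cases "s \<le> t") (auto simp: dist_norm norm_minus_commute)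
  qed
  \<comment> \<open>Extended by 0, the integrand is integrable on every interval, also on those that
    leave \<open>{a..b}\<close> or are reflected.\<close>
  define g0 where "g0 s = (if s \<in> {a..b} then g s else 0)" for s
  have "integrable (lebesgue_on {a..b}) g" by (rule bounded_measurable_integrable[OF meas bd])
  then have "g integrable_on {a..b}" by (rule integrable_on_lebesgue_on) auto
  then have g0U: "g0 integrable_on UNIV" unfolding g0_def by (simp only: integrable_restrict_UNIV)
  then have g0i: "g0 integrable_on cbox c d" for c d
    by (rule integrable_on_subcbox) auto
  have g0r: "(\<lambda>s. g0 (- s)) integrable_on cbox c d" for c d :: real
    using g0i[of "-d" "-c"] Henstock_Kurzweil_Integration.integrable_reflect_real[where f=g0 and a="-d" and b="-c"] by simp
  obtain N1 where N1: "negligible N1" "\<And>s e. s \<notin> N1 \<Longrightarrow> 0 < e \<Longrightarrow>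
      \<exists>d>0. \<forall>h. 0 < h \<and> h < d \<longrightarrow> norm (integral {s..s+h} g0 /\<^sub>R h - g0 s) < e"
    using integrable_ccontinuous_explicit[of g0, OF g0i] by (auto simp: algebra_simps)
  obtain N2 where N2: "negligible N2" "\<And>s e. s \<notin> N2 \<Longrightarrow> 0 < e \<Longrightarrow>
      \<exists>d>0. \<forall>h. 0 < h \<and> h < d \<longrightarrow> norm (integral {s..s+h} (\<lambda>s. g0 (-s)) /\<^sub>R h - g0 (-s)) < e"
    using integrable_ccontinuous_explicit[of "\<lambda>s. g0 (-s)", OF g0r] by (auto simp: algebra_simps)
  have refl: "integral {-s..h-s} (\<lambda>s. g0 (-s)) = integral {s-h..s} g0" for s h
    using Henstock_Kurzweil_Integration.integral_reflect_real[where f=g0 and a="s-h" and b=s] by (simp add: algebra_simps)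
  let ?N = "N1 \<union> uminus ` N2 \<union> {a,b}"
  have neg: "negligible ?N"
  proof -
    have "negligible (uminus ` N2)"
      by (rule negligible_differentiable_image_negligible[OF _ N2(1)])
         (auto intro!: derivative_intros simp: differentiable_on_def)
    then show ?thesis using N1 by simp
  qed
  have "(x has_vector_derivative g s) (at s within {a..b})" if s: "s \<in> {a..b} - ?N" for s
  proof -
    have sab: "a < s" "s < b" using s by auto
    have sN2: "-s \<notin> N2"
    proof
      assume "-s \<in> N2"
      then have "- (- s) \<in> uminus ` N2" by (rule imageI)
      then show False using s by simp
    qed
    show ?thesis
      unfolding has_vector_derivative_def has_derivative_within_alt
    proof (intro conjI allI impI)
      show "bounded_linear (\<lambda>h. h *\<^sub>R g s)" by (rule bounded_linear_scaleR_left)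
      fix e :: real assume "e > 0"
      obtain d1 where d1: "d1 > 0" "\<And>h. 0 < h \<Longrightarrow> h < d1 \<Longrightarrow> norm (integral {s..s+h} g0 /\<^sub>R h - g0 s) < e"
        using N1(2)[of s e] s \<open>e > 0\<close> by auto
      obtain d2 where d2: "d2 > 0" "\<And>h. 0 < h \<Longrightarrow> h < d2 \<Longrightarrow> norm (integral {s-h..s} g0 /\<^sub>R h - g0 s) < e"
        using N2(2)[OF sN2 \<open>e > 0\<close>] by (auto simp: refl)
      show "\<exists>d>0. \<forall>y\<in>{a..b}. norm (y - s) < d \<longrightarrow> norm (x y - x s - (y - s) *\<^sub>R g s) \<le> e * norm (y - s)"
      proof (intro exI[of _ "min d1 d2"] conjI ballI impI)
        show "0 < min d1 d2" using d1 d2 by simp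
        fix y assume y: "y \<in> {a..b}" "norm (y - s) < min d1 d2"
        have g0I: "integral {c..d} g0 = x d - x c" if "a \<le> c" "c \<le> d" "d \<le> b" for c d
        proof -
          have "(g0 has_integral (x d - x c)) {c..d}"
            by (rule has_integral_eq[OF _ diff[OF that]]) (use that in \<open>auto simp: g0_def\<close>)
          then show ?thesis by blast
        qed
        have scale: "norm (z - h *\<^sub>R w) \<le> e * h" if "norm (z /\<^sub>R h - w) < e" "h > 0" for z w :: 'a and h
        proof -
          have "z - h *\<^sub>R w = h *\<^sub>R (z /\<^sub>R h - w)" using that by (simp add: algebra_simps)
          then show ?thesis using that by (simp add: mult.commute)
        qed
        consider "y = s" | "y > s" | "y < s" by linarith
        then show "norm (x y - x s - (y - s) *\<^sub>R g s) \<le> e * norm (y - s)"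
        proof cases
          case 2
          have "norm (integral {s..s+(y-s)} g0 /\<^sub>R (y-s) - g0 s) < e" by (rule d1(2)) (use 2 y in auto)
          then have "norm (integral {s..s+(y-s)} g0 - (y-s) *\<^sub>R g0 s) \<le> e * (y-s)" by (rule scale) (use 2 in simp)
          moreover have "integral {s..s+(y-s)} g0 = x y - x s" using g0I[of s y] 2 y sab by simp
          moreover have "g0 s = g s" using sab by (simp add: g0_def)
          ultimately show ?thesis using 2 by simp
        next
          case 3
          have "norm (integral {s-(s-y)..s} g0 /\<^sub>R (s-y) - g0 s) < e" by (rule d2(2)) (use 3 y in auto)
          then have "norm (integral {s-(s-y)..s} g0 - (s-y) *\<^sub>R g0 s) \<le> e * (s-y)" by (rule scale) (use 3 in simp)
          moreover have "integral {s-(s-y)..s} g0 = x s - x y" using g0I[of y s] 3 y sab by simp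
          moreover have "g0 s = g s" using sab by (simp add: g0_def)
          moreover have "norm (x y - x s - (y - s) *\<^sub>R g s) = norm (x s - x y - (s-y) *\<^sub>R g s)"
            by (subst norm_minus_commute) (simp add: algebra_simps)
          ultimately show ?thesis using 3 by simp
        qed simp
      qed
    qed
  qed
  then show ?B
    by (rule AE_lebesgue_onI[OF neg])
qed

section \<open>Lipschitz paths\<close>

text \<open>Functions of class W^{1,inf} with the derivative named explicitly, up to null sets. With
  bounded controls the state, linearised and adjoint equations all have solutions in this class, and
  it is stable under products, so integration by parts is immediate.\<close>

definition lip_path :: "(real \<Rightarrow> 'a::euclidean_space) \<Rightarrow> (real \<Rightarrow> 'a) \<Rightarrow> bool"
  where "lip_path x d \<longleftrightarrow> (\<exists>L. L-lipschitz_on {0..1} x) \<and>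
    (AE s in leb01. (x has_vector_derivative d s) (at s within {0..1}))"

lemma lip_path_abs_cont: "lip_path x d \<Longrightarrow> abs_cont_on 0 1 x"
  using lipschitz_on_abs_cont_on by (auto simp: lip_path_def)

lemma lip_path_deriv:
  "lip_path x d \<Longrightarrow> AE s in leb01. (x has_vector_derivative d s) (at s within {0..1})"
  by (simp add: lip_path_def)

lemma lip_path_continuous: "lip_path x d \<Longrightarrow> continuous_on {0..1} x"
  using lipschitz_on_continuous_on by (auto simp: lip_path_def)

lemma lip_path_bounded:
  assumes "lip_path x d"
  obtains B where "0 < B" "\<forall>s\<in>{0..1}. norm (x s) \<le> B"
proof -
  have "bounded (x ` {0..1})"
    by (intro compact_imp_bounded compact_continuous_image lip_path_continuous[OF assms] compact_Icc)
  then obtain B where B: "\<forall>s\<in>{0..1}. norm (x s) \<le> B" unfolding bounded_iff by auto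
  show ?thesis
  proof (rule that[of "max B 1"])
    show "\<forall>s\<in>{0..1}. norm (x s) \<le> max B 1" using B by (simp add: le_max_iff_disj)
  qed simp
qed

lemma lip_path_has_integral:
  assumes "lip_path x d" "0 \<le> s" "s \<le> t" "t \<le> 1"
  shows "(d has_integral (x t - x s)) {s..t}"
  by (rule abs_cont_on_has_integral_subinterval[OF lip_path_abs_cont[OF assms(1)] lip_path_deriv[OF assms(1)] assms(2-)])

lemma lip_path_cong_AE:
  assumes "lip_path x d" "AE s in leb01. d s = e s"
  shows "lip_path x e"
  using assms(1) unfolding lip_path_def
  by (intro conjI; elim conjE) (use assms(2) in auto)

lemma lip_path_const: "lip_path (\<lambda>_. c) (\<lambda>_. 0)"
  unfolding lip_path_def by (auto intro: exI[of _ 0] lipschitz_on_constant)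

lemma lip_path_add:
  assumes "lip_path x d" "lip_path y e"
  shows "lip_path (\<lambda>s. x s + y s) (\<lambda>s. d s + e s)"
proof -
  obtain L M where "L-lipschitz_on {0..1} x" "M-lipschitz_on {0..1} y"
    using assms by (auto simp: lip_path_def)
  then have "(L + M)-lipschitz_on {0..1} (\<lambda>s. x s + y s)" by (rule lipschitz_on_add)
  moreover have "AE s in leb01. ((\<lambda>s. x s + y s) has_vector_derivative (d s + e s)) (at s within {0..1})"
    using lip_path_deriv[OF assms(1)] lip_path_deriv[OF assms(2)]
    by eventually_elim (rule has_vector_derivative_add)
  ultimately show ?thesis by (auto simp: lip_path_def)
qed

lemma lip_path_linear:
  assumes "bounded_linear f" "lip_path x d"
  shows "lip_path (\<lambda>s. f (x s)) (\<lambda>s. f (d s))"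
proof -
  obtain L where L: "L-lipschitz_on {0..1} x"
    using assms by (auto simp: lip_path_def)
  obtain M where "M-lipschitz_on UNIV f"
    using bounded_linear.lipschitz_boundE[OF assms(1)] by metis
  then have "(M * L)-lipschitz_on {0..1} (\<lambda>s. f (x s))"
    by (intro lipschitz_on_compose2[OF L]) (auto intro: lipschitz_on_subset)
  moreover have "AE s in leb01. ((\<lambda>s. f (x s)) has_vector_derivative f (d s)) (at s within {0..1})"
    using lip_path_deriv[OF assms(2)]
    by eventually_elim (rule bounded_linear.has_vector_derivative[OF assms(1)])
  ultimately show ?thesis by (auto simp: lip_path_def)
qed

lemma lip_path_diff:
  assumes "lip_path x d" "lip_path y e"
  shows "lip_path (\<lambda>s. x s - y s) (\<lambda>s. d s - e s)"
  using lip_path_add[OF assms(1) lip_path_linear[OF bounded_linear_minus[OF bounded_linear_ident] assms(2)]] by simp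

lemma lip_path_scaleR:
  assumes "lip_path x d"
  shows "lip_path (\<lambda>s. c *\<^sub>R x s) (\<lambda>s. c *\<^sub>R d s)"
  by (rule lip_path_linear[OF bounded_linear_scaleR_right assms])

lemma lip_path_Pair:
  assumes "lip_path x d" "lip_path y e"
  shows "lip_path (\<lambda>s. (x s, y s)) (\<lambda>s. (d s, e s))"
proof -
  have "bounded_linear (\<lambda>x. (x, 0))" "bounded_linear (\<lambda>y. (0, y))"
    by (intro bounded_linear_Pair bounded_linear_ident bounded_linear_zero)+
  from lip_path_add[OF lip_path_linear[OF this(1) assms(1)] lip_path_linear[OF this(2) assms(2)]]
  show ?thesis by simp
qed

lemma lip_path_inner:
  assumes "lip_path x d" "lip_path y e"
  shows "lip_path (\<lambda>s. x s \<bullet> y s) (\<lambda>s. d s \<bullet> y s + x s \<bullet> e s)"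
proof -
  obtain L M where L: "L-lipschitz_on {0..1} x" and M: "M-lipschitz_on {0..1} y"
    using assms by (auto simp: lip_path_def)
  obtain B where B: "0 < B" "\<forall>s\<in>{0..1}. norm (x s) \<le> B"
    by (rule lip_path_bounded[OF assms(1)])
  obtain C where C: "0 < C" "\<forall>s\<in>{0..1}. norm (y s) \<le> C"
    by (rule lip_path_bounded[OF assms(2)])
  have LM: "0 \<le> L" "0 \<le> M" using lipschitz_on_nonneg[OF L] lipschitz_on_nonneg[OF M] by simp_all
  have "(L * C + B * M)-lipschitz_on {0..1} (\<lambda>s. x s \<bullet> y s)"
  proof (rule lipschitz_onI)
    fix s t :: real assume st: "s \<in> {0..1}" "t \<in> {0..1}"
    have "norm (x s \<bullet> y s - x t \<bullet> y t) = norm ((x s - x t) \<bullet> y s + x t \<bullet> (y s - y t))"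
      by (simp add: inner_diff)
    also have "\<dots> \<le> norm (x s - x t) * norm (y s) + norm (x t) * norm (y s - y t)"
      by (intro norm_triangle_le add_mono) (simp_all add: Cauchy_Schwarz_ineq2)
    also have "\<dots> \<le> (L * dist s t) * C + B * (M * dist s t)"
      using lipschitz_onD[OF L st] lipschitz_onD[OF M st] B C st LM
      by (intro add_mono mult_mono) (auto simp: dist_norm intro: order_less_imp_le)
    finally show "dist (x s \<bullet> y s) (x t \<bullet> y t) \<le> (L * C + B * M) * dist s t"
      by (simp add: dist_norm algebra_simps)
  qed (use LM B C in auto)
  moreover have "AE s in leb01. ((\<lambda>s. x s \<bullet> y s) has_vector_derivative (d s \<bullet> y s + x s \<bullet> e s)) (at s within {0..1})"
    using lip_path_deriv[OF assms(1)] lip_path_deriv[OF assms(2)]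
  proof eventually_elim
    case (elim s)
    from bounded_bilinear.has_vector_derivative[OF bounded_bilinear_inner elim]
    show ?case by (simp add: add.commute)
  qed
  ultimately show ?thesis by (auto simp: lip_path_def)
qed

text \<open>Adjoint equations prescribe the value at 1; reversing time reduces them to
  \<open>picard\<close> and \<open>lip_path_gronwall\<close>, which start from 0.\<close>

lemma lip_path_reverse:
  assumes "lip_path x d"
  shows "lip_path (\<lambda>s. x (1 - s)) (\<lambda>s. - d (1 - s))"
proof -
  obtain L where L: "L-lipschitz_on {0..1} x" using assms by (auto simp: lip_path_def)
  have "L-lipschitz_on {0..1} (\<lambda>s. x (1 - s))"
  proof (rule lipschitz_onI)
    fix s t :: real assume "s \<in> {0..1}" "t \<in> {0..1}"
    then have "dist (x (1 - s)) (x (1 - t)) \<le> L * dist (1 - s) (1 - t)" by (intro lipschitz_onD[OF L]) auto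
    then show "dist (x (1 - s)) (x (1 - t)) \<le> L * dist s t" by (simp add: dist_real_def abs_minus_commute)
  qed (rule lipschitz_on_nonneg[OF L])
  moreover have "AE s in leb01. ((\<lambda>s. x (1 - s)) has_vector_derivative (- d (1 - s))) (at s within {0..1})"
  proof -
    have "AE s in leb01. (x has_vector_derivative d (-1 * s + 1)) (at (-1 * s + 1) within {0..1})"
      by (rule AE_affine[OF lip_path_deriv[OF assms]]) auto
    then show ?thesis
    proof eventually_elim
      case (elim s)
      have im: "(\<lambda>s. 1 - s) ` {0..1} = {0..1::real}" by (auto simp: image_iff intro: bexI[of _ "1 - _"])
      have "((\<lambda>s. 1 - s) has_vector_derivative (-1)) (at s within {0..1})"
        by (auto intro!: derivative_eq_intros)
      from vector_diff_chain_within[OF this, of x "d (1 - s)"] elim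
      show ?case by (simp add: im comp_def)
    qed
  qed
  ultimately show ?thesis by (auto simp: lip_path_def)
qed

lemma lip_pathI_integral:
  assumes "d \<in> borel_measurable leb01" "\<And>s. s \<in> {0..1} \<Longrightarrow> norm (d s) \<le> B"
    and "\<And>t. t \<in> {0..1} \<Longrightarrow> (d has_integral (x t - x 0)) {0..t}"
  shows "lip_path x d"
proof -
  have "AE s in leb01. norm (d s) \<le> max B 0"
    using AE_space by eventually_elim (use assms(2) in force)
  from indefinite_integral_AE_derivative[OF assms(1) this assms(3)]
  show ?thesis by (auto simp: lip_path_def)
qed

section \<open>Gronwall estimates and existence of solutions in the sense of Caratheodory\<close>

lemma gronwall_integral:
  fixes \<phi> :: "real \<Rightarrow> real"
  assumes cont: "continuous_on {0..1} \<phi>" and L: "0 \<le> L"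
    and le: "\<And>t. t \<in> {0..1} \<Longrightarrow> \<phi> t \<le> c + L * integral {0..t} \<phi>" and t: "t \<in> {0..1}"
  shows "\<phi> t \<le> c * exp (L * t)"
proof -
  define I where "I t = integral {0..t} \<phi>" for t
  \<comment> \<open>The right-hand side of the hypothesis damped by the exponential; the hypothesis
    makes its derivative nonpositive.\<close>
  define \<Psi> where "\<Psi> t = (c + L * I t) * exp (- L * t)" for t
  define \<Psi>' where "\<Psi>' s = L * \<phi> s * exp (- L * s) + (c + L * I s) * (- L * exp (- L * s))" for s
  have dI: "(I has_real_derivative \<phi> s) (at s within {0..t})" if "s \<in> {0..t}" for s
  proof -
    have "(I has_real_derivative \<phi> s) (at s within {0..1})"
      unfolding I_def using integral_has_real_derivative[OF cont, of s] that t by auto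
    then show ?thesis by (rule DERIV_subset) (use t in auto)
  qed
  have "(\<Psi>' has_integral (\<Psi> t - \<Psi> 0)) {0..t}"
  proof (rule fundamental_theorem_of_calculus)
    show "0 \<le> t" using t by simp
    fix s assume s: "s \<in> {0..t}"
    have "(\<Psi> has_real_derivative \<Psi>' s) (at s within {0..t})"
      unfolding \<Psi>_def \<Psi>'_def
      by (rule derivative_eq_intros dI[OF s] refl | simp)+
    then show "(\<Psi> has_vector_derivative \<Psi>' s) (at s within {0..t})"
      by (simp add: has_real_derivative_iff_has_vector_derivative)
  qed
  moreover have "\<Psi>' s \<le> 0" if "s \<in> {0..t}" for s
  proof -
    have "\<Psi>' s = L * exp (- L * s) * (\<phi> s - (c + L * I s))" by (simp add: \<Psi>'_def algebra_simps)
    also have "\<dots> \<le> 0" using le[of s] that t L by (intro mult_nonneg_nonpos) (auto simp: I_def)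
    finally show ?thesis .
  qed
  ultimately have "\<Psi> t - \<Psi> 0 \<le> 0" by (rule has_integral_le[OF _ has_integral_0])
  then have "(c + L * I t) * exp (- L * t) \<le> c" by (simp add: \<Psi>_def I_def)
  then have "c + L * I t \<le> c * exp (L * t)"
    by (simp add: exp_minus field_simps)
  then show ?thesis using le[OF t] by (simp add: I_def)
qed

text \<open>The forcing \<open>b\<close> is merely integrable: the difference between a square
  integrable direction and its truncation admits no better bound.\<close>

lemma gronwall:
  fixes x :: "real \<Rightarrow> 'a::euclidean_space"
  assumes ac: "abs_cont_on 0 1 x" and cont: "continuous_on {0..1} x"
    and der: "AE s in leb01. (x has_vector_derivative d s) (at s within {0..1})"
    and le: "AE s in leb01. norm (d s) \<le> L * norm (x s) + b s"
    and b: "b integrable_on {0..1}" "\<And>s. s \<in> {0..1} \<Longrightarrow> 0 \<le> b s" and L: "0 \<le> L" and t: "t \<in> {0..1}"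
  shows "norm (x t) \<le> (norm (x 0) + integral {0..1} b) * exp L"
proof -
  obtain N where N: "negligible N" "\<forall>s\<in>{0..1} - N. norm (d s) \<le> L * norm (x s) + b s"
    by (rule AE_lebesgue_onE[OF le])
  define c where "c = norm (x 0) + integral {0..1} b"
  have c0: "0 \<le> c" unfolding c_def using integral_nonneg[OF b] by simp
  have "norm (x t) \<le> c + L * integral {0..t} (\<lambda>s. norm (x s))" if t: "t \<in> {0..1}" for t
  proof -
    have dI: "(d has_integral (x t - x 0)) {0..t}"
      by (rule abs_cont_on_has_integral_subinterval[OF ac der]) (use t in auto)
    let ?d = "\<lambda>s. if s \<in> N then 0 else d s"
    have d'I: "(?d has_integral (x t - x 0)) {0..t}"
      by (rule has_integral_spike[OF N(1) _ dI]) simp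
    have bt: "b integrable_on {0..t}" using integrable_subinterval_real[OF b(1), of 0 t] t by auto
    have xt: "(\<lambda>s. norm (x s)) integrable_on {0..t}"
      by (rule integrable_continuous_real) (use t cont in \<open>auto intro!: continuous_intros intro: continuous_on_subset\<close>)
    have I2: "(\<lambda>s. L * norm (x s) + b s) integrable_on {0..t}"
      by (intro integrable_add integrable_on_mult_right xt bt)
    have "norm (integral {0..t} ?d) \<le> integral {0..t} (\<lambda>s. L * norm (x s) + b s)"
    proof (rule integral_norm_bound_integral[OF _ I2])
      show "?d integrable_on {0..t}" using d'I by (rule has_integral_integrable)
      fix s assume "s \<in> {0..t}"
      then have s: "s \<in> {0..1}" using t by auto
      show "norm (?d s) \<le> L * norm (x s) + b s"
        using N(2) s b(2)[OF s] L by (cases "s \<in> N") auto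
    qed
    also have "\<dots> = L * integral {0..t} (\<lambda>s. norm (x s)) + integral {0..t} b"
      using xt bt by (simp add: integral_add integrable_on_mult_right)
    also have "integral {0..t} b \<le> integral {0..1} b"
      by (rule integral_subset_le) (use t b bt in auto)
    finally have "norm (x t - x 0) \<le> L * integral {0..t} (\<lambda>s. norm (x s)) + integral {0..1} b"
      using integral_unique[OF d'I] by simp
    moreover have "norm (x t) \<le> norm (x 0) + norm (x t - x 0)" using norm_triangle_sub by blast
    ultimately show ?thesis by (simp add: c_def)
  qed
  then have "norm (x t) \<le> c * exp (L * t)"
    by (intro gronwall_integral[OF _ L _ t]) (auto intro!: continuous_intros cont)
  also have "\<dots> \<le> c * exp L"
    using t L c0 by (intro mult_left_mono) (auto simp: mult_left_le)
  finally show ?thesis by (simp add: c_def)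
qed

lemma lip_path_gronwall:
  assumes x: "lip_path x d" and le: "AE s in leb01. norm (d s) \<le> L * norm (x s) + e"
    and "0 \<le> e" "0 \<le> L" and t: "t \<in> {0..1}"
  shows "norm (x t) \<le> (norm (x 0) + e) * exp L"
  using gronwall[OF lip_path_abs_cont[OF x] lip_path_continuous[OF x] lip_path_deriv[OF x] le _ _ \<open>0 \<le> L\<close> t] \<open>0 \<le> e\<close>
  by (auto simp: integrable_const_ivl)

text \<open>Contraction in a sup norm with exponential weight: the substitution
  \<open>x s = exp (2 * K * s) *\<^sub>R w s\<close> turns the weighted norm into the plain one, and
  the integral operator then has Lipschitz constant 1/2 on the whole interval, so no short intervals
  have to be patched together.\<close>

lemma picard:
  fixes h :: "real \<Rightarrow> 'a::euclidean_space \<Rightarrow> 'a"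
  assumes meas: "\<And>z. continuous_on {0..1} z \<Longrightarrow> (\<lambda>s. h s (z s)) \<in> borel_measurable leb01"
    and lip: "\<And>s y z. s \<in> {0..1} \<Longrightarrow> norm (h s y - h s z) \<le> L * norm (y - z)"
    and bd: "\<And>s. s \<in> {0..1} \<Longrightarrow> norm (h s 0) \<le> B"
  obtains x where "x 0 = a" "lip_path x (\<lambda>s. h s (x s))"
proof -
  define K where "K = max L 0 + 1"
  have K: "0 < K" by (simp add: K_def)
  have lip': "norm (h s y - h s z) \<le> K * norm (y - z)" if "s \<in> {0..1}" for s y z
  proof -
    have "norm (h s y - h s z) \<le> L * norm (y - z)" by (rule lip[OF that])
    also have "\<dots> \<le> K * norm (y - z)" by (rule mult_right_mono) (auto simp: K_def)
    finally show ?thesis .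
  qed
  have hb: "norm (h s z) \<le> K * norm z + B" if "s \<in> {0..1}" for s z
  proof -
    have "norm (h s z) \<le> norm (h s z - h s 0) + norm (h s 0)"
      by (metis norm_triangle_sub add.commute)
    then show ?thesis using lip'[OF that, of z 0] bd[OF that] by simp
  qed
  have hbd: "\<exists>M. \<forall>s\<in>{0..1}. norm (h s (z s)) \<le> M" if z: "continuous_on {0..1} z" for z
  proof -
    have "bounded (z ` {0..1})" by (intro compact_imp_bounded compact_continuous_image z compact_Icc)
    then obtain C where C: "\<forall>s\<in>{0..1}. norm (z s) \<le> C" unfolding bounded_iff by auto
    have "norm (h s (z s)) \<le> K * C + B" if "s \<in> {0..1}" for s
    proof -
      have "K * norm (z s) \<le> K * C" using C that K by (intro mult_left_mono) auto
      then show ?thesis using hb[OF that, of "z s"] by linarith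
    qed
    then show ?thesis by blast
  qed
  have hint: "(\<lambda>s. h s (z s)) integrable_on {0..t}" if z: "continuous_on {0..1} z" and t: "t \<in> {0..1}" for z t
  proof -
    obtain M where "\<forall>s\<in>{0..1}. norm (h s (z s)) \<le> M" using hbd[OF z] by blast
    then have "AE s in leb01. norm (h s (z s)) \<le> M" using AE_space by (auto elim: eventually_mono)
    then have "integrable leb01 (\<lambda>s. h s (z s))" by (rule bounded_measurable_integrable[OF meas[OF z]])
    then have "(\<lambda>s. h s (z s)) integrable_on {0..1}" by (rule integrable_on_lebesgue_on) auto
    then show ?thesis by (rule integrable_subinterval_real) (use t in auto)
  qed
  \<comment> \<open>Clamping to \<open>{0..1}\<close> turns functions on the interval into bounded
    continuous functions on the line, the complete space in which the fixed point is sought.\<close>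
  define cl :: "real \<Rightarrow> real" where "cl t = max 0 (min 1 t)" for t
  have cl: "cl t \<in> {0..1}" for t by (auto simp: cl_def)
  define W :: "(real \<Rightarrow> 'a) \<Rightarrow> real \<Rightarrow> 'a" where "W w s = exp (2 * K * s) *\<^sub>R w s" for w s
  define J where "J w t = exp (- 2 * K * t) *\<^sub>R (a + integral {0..t} (\<lambda>s. h s (W w s)))" for w t
  define \<Phi> where "\<Phi> w = Bcontfun (J (apply_bcontfun w) \<circ> cl)" for w :: "real \<Rightarrow>\<^sub>C 'a"
  have Wc: "continuous_on {0..1} (W (apply_bcontfun w))" for w :: "real \<Rightarrow>\<^sub>C 'a"
    unfolding W_def by (intro continuous_intros continuous_on_apply_bcontfun)
  have Jc: "continuous_on {0..1} (J (apply_bcontfun w))" for w :: "real \<Rightarrow>\<^sub>C 'a"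
    unfolding J_def by (intro continuous_intros indefinite_integral_continuous_1 hint Wc) simp
  have \<Phi>: "apply_bcontfun (\<Phi> w) = J (apply_bcontfun w) \<circ> cl" for w
  proof -
    have "bounded (J (apply_bcontfun w) ` {0..1})"
      by (intro compact_imp_bounded compact_continuous_image Jc compact_Icc)
    then obtain C where C: "\<forall>s\<in>{0..1}. norm (J (apply_bcontfun w) s) \<le> C" unfolding bounded_iff by auto
    have "J (apply_bcontfun w) \<circ> cl \<in> bcontfun"
    proof (rule bcontfun_normI[where b=C])
      show "continuous_on UNIV (J (apply_bcontfun w) \<circ> cl)"
        by (rule continuous_on_compose) (auto simp: cl_def intro!: continuous_intros continuous_on_subset[OF Jc])
      show "norm ((J (apply_bcontfun w) \<circ> cl) s) \<le> C" for s using C cl by (metis comp_apply)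
    qed
    then show ?thesis unfolding \<Phi>_def by (rule Bcontfun_inverse)
  qed
  have contr: "dist (\<Phi> w) (\<Phi> v) \<le> 1/2 * dist w v" for w v
  proof (rule dist_bound)
    fix t
    define u where "u = cl t"
    have u: "u \<in> {0..1}" using cl by (simp add: u_def)
    define D where "D = dist w v"
    have D: "norm (apply_bcontfun w s - apply_bcontfun v s) \<le> D" for s
      unfolding D_def by (metis dist_bounded dist_norm)
    \<comment> \<open>The rate \<open>2 * K\<close> of the weight against the Lipschitz constant
      \<open>K\<close> is what produces the factor 1/2.\<close>
    have eI: "((\<lambda>s. K * D * exp (2 * K * s)) has_integral (D/2 * exp (2 * K * u) - D/2 * exp (2 * K * 0))) {0..u}"
      by (rule fundamental_theorem_of_calculus)
         (use u K in \<open>auto intro!: derivative_eq_intros simp flip: has_real_derivative_iff_has_vector_derivative\<close>)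
    have "norm (integral {0..u} (\<lambda>s. h s (W (apply_bcontfun w) s) - h s (W (apply_bcontfun v) s)))
        \<le> integral {0..u} (\<lambda>s. K * D * exp (2 * K * s))"
    proof (rule integral_norm_bound_integral)
      show "(\<lambda>s. h s (W (apply_bcontfun w) s) - h s (W (apply_bcontfun v) s)) integrable_on {0..u}"
        by (intro integrable_diff hint Wc u)
      show "(\<lambda>s. K * D * exp (2 * K * s)) integrable_on {0..u}" using eI by (rule has_integral_integrable)
      fix s assume "s \<in> {0..u}"
      then have s: "s \<in> {0..1}" using u by auto
      have "norm (h s (W (apply_bcontfun w) s) - h s (W (apply_bcontfun v) s)) \<le> K * norm (W (apply_bcontfun w) s - W (apply_bcontfun v) s)"
        by (rule lip'[OF s])
      also have "\<dots> = K * exp (2 * K * s) * norm (apply_bcontfun w s - apply_bcontfun v s)"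
        by (simp add: W_def flip: scaleR_diff_right)
      also have "\<dots> \<le> K * exp (2 * K * s) * D" by (rule mult_left_mono[OF D]) (use K in simp)
      finally show "norm (h s (W (apply_bcontfun w) s) - h s (W (apply_bcontfun v) s)) \<le> K * D * exp (2 * K * s)"
        by (simp add: algebra_simps)
    qed
    also have "\<dots> = D/2 * exp (2 * K * u) - D/2" using integral_unique[OF eI] by simp
    finally have le: "norm (integral {0..u} (\<lambda>s. h s (W (apply_bcontfun w) s)) - integral {0..u} (\<lambda>s. h s (W (apply_bcontfun v) s)))
        \<le> D/2 * exp (2 * K * u)"
    proof -
      assume "norm (integral {0..u} (\<lambda>s. h s (W (apply_bcontfun w) s) - h s (W (apply_bcontfun v) s))) \<le> D/2 * exp (2 * K * u) - D/2"
      moreover have "0 \<le> D" by (simp add: D_def)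
      ultimately show ?thesis by (subst Henstock_Kurzweil_Integration.integral_diff[OF hint[OF Wc u] hint[OF Wc u], symmetric]) simp
    qed
    have "dist (apply_bcontfun (\<Phi> w) t) (apply_bcontfun (\<Phi> v) t) = exp (- 2 * K * u) *
        norm (integral {0..u} (\<lambda>s. h s (W (apply_bcontfun w) s)) - integral {0..u} (\<lambda>s. h s (W (apply_bcontfun v) s)))"
      by (simp add: \<Phi> J_def dist_norm flip: u_def scaleR_diff_right)
    also have "\<dots> \<le> exp (- 2 * K * u) * (D/2 * exp (2 * K * u))"
      by (rule mult_left_mono[OF le]) simp
    also have "\<dots> = D/2" by (simp add: exp_minus)
    finally show "dist (apply_bcontfun (\<Phi> w) t) (apply_bcontfun (\<Phi> v) t) \<le> 1/2 * dist w v" by (simp add: D_def)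
  qed
  obtain w where w: "\<Phi> w = w"
    using banach_fix_type[of "1/2" \<Phi>] contr by auto
  define x where "x = W (apply_bcontfun w)"
  have xc: "continuous_on {0..1} x" unfolding x_def by (rule Wc)
  have xeq: "x t = a + integral {0..t} (\<lambda>s. h s (x s))" if t: "t \<in> {0..1}" for t
  proof -
    have "cl t = t" using t by (auto simp: cl_def)
    then have "apply_bcontfun w t = J (apply_bcontfun w) t" using \<Phi>[of w] w by (metis comp_apply)
    then show ?thesis
      unfolding x_def W_def[of _ t] J_def by (simp add: exp_minus)
  qed
  have x0: "x 0 = a" using xeq[of 0] by simp
  obtain M where M: "\<forall>s\<in>{0..1}. norm (h s (x s)) \<le> M" using hbd[OF xc] by blast
  have "lip_path x (\<lambda>s. h s (x s))"
  proof (rule lip_pathI_integral[OF meas[OF xc]])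
    show "norm (h s (x s)) \<le> M" if "s \<in> {0..1}" for s using M that by blast
    show "((\<lambda>s. h s (x s)) has_integral (x t - x 0)) {0..t}" if t: "t \<in> {0..1}" for t
      using integrable_integral[OF hint[OF xc t]] xeq[OF t] x0 by simp
  qed
  with x0 show ?thesis by (rule that)
qed

section \<open>Calculus of twice differentiable maps\<close>

text \<open>\<open>C2\<close> amounts to differentiability with a derivative in this class. A
  closure rule for \<open>C2\<close> thus needs only the formula for the first derivative and the
  closure rules for \<open>C1\<close>.\<close>

definition C1 :: "('a::real_normed_vector \<Rightarrow> 'b::real_normed_vector) \<Rightarrow> bool"
  where "C1 f \<longleftrightarrow> (\<exists>f'. (\<forall>x. (f has_derivative blinfun_apply (f' x)) (at x)) \<and> continuous_on UNIV f')"

lemma fderiv_eqI: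
  assumes "(f has_derivative blinfun_apply f') (at x)"
  shows "fderiv f x = f'"
proof -
  have "f differentiable (at x)" using assms by (auto simp: differentiable_def)
  from fderiv_has_derivative[OF this] assms have "blinfun_apply (fderiv f x) = blinfun_apply f'"
    by (rule has_derivative_unique)
  then show ?thesis by (simp add: blinfun_apply_inject)
qed

lemma C2I:
  assumes "\<And>x. (f has_derivative blinfun_apply (f' x)) (at x)" "C1 f'"
  shows "C2 f" "fderiv f = f'"
proof -
  show f': "fderiv f = f'" using fderiv_eqI assms(1) by blast
  obtain f'' where f'': "\<And>x. (f' has_derivative blinfun_apply (f'' x)) (at x)" "continuous_on UNIV f''"
    using assms(2) unfolding C1_def by auto
  have "fderiv f' = f''" using fderiv_eqI f''(1) by blast
  then show "C2 f"
    unfolding C2_def f' using assms(1) f'' by (auto simp: differentiable_def)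
qed

lemma C2_has_derivative: "C2 f \<Longrightarrow> (f has_derivative blinfun_apply (fderiv f x)) (at x)"
  by (simp add: C2_def fderiv_has_derivative)

lemma C2_has_derivative2: "C2 f \<Longrightarrow> (fderiv f has_derivative blinfun_apply (fderiv2 f x)) (at x)"
  by (simp add: C2_def fderiv_has_derivative)

lemma C2_imp_C1_fderiv: "C2 f \<Longrightarrow> C1 (fderiv f)"
  unfolding C1_def using C2_has_derivative2[of f] by (intro exI[of _ "fderiv2 f"]) (simp add: C2_def)

lemma C2_continuous_fderiv: "C2 f \<Longrightarrow> continuous_on UNIV (fderiv f)"
  by (rule has_derivative_continuous_on[where f'="\<lambda>x. blinfun_apply (fderiv2 f x)"]) (rule C2_has_derivative2)

lemma C2_continuous_fderiv2: "C2 f \<Longrightarrow> continuous_on UNIV (fderiv2 f)"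
  by (simp add: C2_def)

lemma C2_continuous: "C2 f \<Longrightarrow> continuous_on UNIV f"
  by (rule has_derivative_continuous_on[where f'="\<lambda>x. blinfun_apply (fderiv f x)"]) (rule C2_has_derivative)

lemma C2_imp_C1: "C2 f \<Longrightarrow> C1 f"
  unfolding C1_def using C2_has_derivative[of f] C2_continuous_fderiv[of f] by (intro exI[of _ "fderiv f"]) simp

lemma C1_continuous: "C1 f \<Longrightarrow> continuous_on UNIV f"
  unfolding C1_def by (auto intro: has_derivative_continuous_on)

lemma C1_const: "C1 (\<lambda>_. c)"
  unfolding C1_def by (intro exI[of _ "\<lambda>_. 0"] conjI allI has_derivative_eq_rhs[OF has_derivative_const]) auto

lemma C1_linear_compose:
  assumes "bounded_linear L" "C1 f"
  shows "C1 (\<lambda>x. L (f x))"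
proof -
  obtain f' where f': "\<And>x. (f has_derivative blinfun_apply (f' x)) (at x)" "continuous_on UNIV f'"
    using assms(2) unfolding C1_def by auto
  have "((\<lambda>x. L (f x)) has_derivative blinfun_apply (Blinfun L o\<^sub>L f' x)) (at x)" for x
    by (rule has_derivative_eq_rhs[OF bounded_linear.has_derivative[OF assms(1) f'(1)]])
       (simp add: fun_eq_iff bounded_linear_Blinfun_apply[OF assms(1)])
  moreover have "continuous_on UNIV (\<lambda>x. Blinfun L o\<^sub>L f' x)"
    by (intro bounded_bilinear.continuous_on[OF bounded_bilinear_blinfun_compose] continuous_on_const f')
  ultimately show ?thesis unfolding C1_def by (intro exI[of _ "\<lambda>x. Blinfun L o\<^sub>L f' x"]) simp
qed

lemma C1_add:
  assumes "C1 f" "C1 g"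
  shows "C1 (\<lambda>x. f x + g x)"
proof -
  obtain f' where f': "\<And>x. (f has_derivative blinfun_apply (f' x)) (at x)" "continuous_on UNIV f'"
    using assms(1) unfolding C1_def by auto
  obtain g' where g': "\<And>x. (g has_derivative blinfun_apply (g' x)) (at x)" "continuous_on UNIV g'"
    using assms(2) unfolding C1_def by auto
  have "((\<lambda>x. f x + g x) has_derivative blinfun_apply (f' x + g' x)) (at x)" for x
    by (rule has_derivative_eq_rhs[OF has_derivative_add[OF f'(1) g'(1)]]) (simp add: fun_eq_iff plus_blinfun.rep_eq)
  moreover have "continuous_on UNIV (\<lambda>x. f' x + g' x)" by (intro continuous_intros f' g')
  ultimately show ?thesis unfolding C1_def by (intro exI[of _ "\<lambda>x. f' x + g' x"]) simp
qed

lemma has_derivative_bilinear_blinfun: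
  assumes B: "bounded_bilinear B"
    and f: "(f has_derivative blinfun_apply f') (at x)" and g: "(g has_derivative blinfun_apply g') (at x)"
  shows "((\<lambda>x. B (f x) (g x)) has_derivative
     blinfun_apply ((Blinfun (B (f x)) o\<^sub>L g') + (Blinfun (\<lambda>y. B y (g x)) o\<^sub>L f'))) (at x)"
  by (rule has_derivative_eq_rhs[OF bounded_bilinear.FDERIV[OF B f g]])
     (simp add: fun_eq_iff plus_blinfun.rep_eq bounded_linear_Blinfun_apply bounded_bilinear.bounded_linear_right[OF B]
      bounded_bilinear.bounded_linear_left[OF B])

lemma bounded_linear_bilinear_Blinfun:
  assumes B: "bounded_bilinear B"
  shows "bounded_linear (\<lambda>a. Blinfun (B a))" "bounded_linear (\<lambda>b. Blinfun (\<lambda>a. B a b))" (is ?B)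
proof -
  interpret bounded_bilinear B by (rule B)
  have "(\<lambda>a. Blinfun (B a)) = prod_right"
    by (intro ext blinfun_eqI) (simp add: bounded_linear_Blinfun_apply bounded_linear_right prod_right.rep_eq)
  then show "bounded_linear (\<lambda>a. Blinfun (B a))" by (simp only: bounded_linear_prod_right)
  have "(\<lambda>b. Blinfun (\<lambda>a. B a b)) = prod_left"
    by (intro ext blinfun_eqI) (simp add: bounded_linear_Blinfun_apply bounded_linear_left prod_left.rep_eq)
  then show ?B by (simp only: bounded_linear_prod_left)
qed

lemma C1_bilinear:
  assumes B: "bounded_bilinear B" and fg: "C1 f" "C1 g"
  shows "C1 (\<lambda>x. B (f x) (g x))"
proof -
  obtain f' where f': "\<And>x. (f has_derivative blinfun_apply (f' x)) (at x)" "continuous_on UNIV f'"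
    using fg(1) unfolding C1_def by auto
  obtain g' where g': "\<And>x. (g has_derivative blinfun_apply (g' x)) (at x)" "continuous_on UNIV g'"
    using fg(2) unfolding C1_def by auto
  let ?D = "\<lambda>x. (Blinfun (B (f x)) o\<^sub>L g' x) + (Blinfun (\<lambda>y. B y (g x)) o\<^sub>L f' x)"
  have "((\<lambda>x. B (f x) (g x)) has_derivative blinfun_apply (?D x)) (at x)" for x
    by (rule has_derivative_bilinear_blinfun[OF B f'(1) g'(1)])
  moreover have "continuous_on UNIV ?D"
    by (intro continuous_on_add bounded_bilinear.continuous_on[OF bounded_bilinear_blinfun_compose] f' g'
      bounded_linear.continuous_on[OF bounded_linear_bilinear_Blinfun(1)[OF B]]
      bounded_linear.continuous_on[OF bounded_linear_bilinear_Blinfun(2)[OF B]] C1_continuous fg)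
  ultimately show ?thesis unfolding C1_def by (intro exI[of _ ?D]) simp
qed

lemma C1_compose:
  assumes "C1 g" "C1 f"
  shows "C1 (\<lambda>x. g (f x))"
proof -
  obtain f' where f': "\<And>x. (f has_derivative blinfun_apply (f' x)) (at x)" "continuous_on UNIV f'"
    using assms(2) unfolding C1_def by auto
  obtain g' where g': "\<And>x. (g has_derivative blinfun_apply (g' x)) (at x)" "continuous_on UNIV g'"
    using assms(1) unfolding C1_def by auto
  let ?D = "\<lambda>x. g' (f x) o\<^sub>L f' x"
  have "((\<lambda>x. g (f x)) has_derivative blinfun_apply (?D x)) (at x)" for x
    by (rule has_derivative_eq_rhs[OF has_derivative_compose[OF f'(1) g'(1)]]) (simp add: fun_eq_iff)
  moreover have "continuous_on UNIV ?D"
    by (intro bounded_bilinear.continuous_on[OF bounded_bilinear_blinfun_compose] f'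
      continuous_on_compose2[OF g'(2)] C1_continuous assms) simp
  ultimately show ?thesis unfolding C1_def by (intro exI[of _ ?D]) simp
qed

lemma C2_affine:
  assumes "bounded_linear L"
  shows "C2 (\<lambda>x. L x + b)" "fderiv (\<lambda>x. L x + b) = (\<lambda>_. Blinfun L)"
proof -
  have *: "((\<lambda>x. L x + b) has_derivative blinfun_apply (Blinfun L)) (at x)" for x
    unfolding bounded_linear_Blinfun_apply[OF assms]
    by (auto intro!: derivative_eq_intros bounded_linear_imp_has_derivative assms)
  show "C2 (\<lambda>x. L x + b)" "fderiv (\<lambda>x. L x + b) = (\<lambda>_. Blinfun L)"
    by (rule C2I[OF * C1_const])+
qed

lemma C2_linear: "bounded_linear L \<Longrightarrow> C2 L"
  using C2_affine(1)[of L 0] by simp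

lemma C2_const: "C2 (\<lambda>_. c)"
  using C2_affine(1)[OF bounded_linear_zero, of c] by simp

lemma fderiv_linear: "bounded_linear L \<Longrightarrow> fderiv L x h = L h"
  using C2_affine(2)[of L 0] by (simp add: bounded_linear_Blinfun_apply)

lemma C2_add:
  assumes "C2 f" "C2 g"
  shows "C2 (\<lambda>x. f x + g x)" "fderiv (\<lambda>x. f x + g x) = (\<lambda>x. fderiv f x + fderiv g x)"
proof -
  have *: "((\<lambda>x. f x + g x) has_derivative blinfun_apply (fderiv f x + fderiv g x)) (at x)" for x
    by (rule has_derivative_eq_rhs[OF has_derivative_add[OF C2_has_derivative C2_has_derivative, OF assms]]) (simp add: fun_eq_iff plus_blinfun.rep_eq)
  show "C2 (\<lambda>x. f x + g x)" "fderiv (\<lambda>x. f x + g x) = (\<lambda>x. fderiv f x + fderiv g x)"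
    by (rule C2I[OF * C1_add[OF C2_imp_C1_fderiv C2_imp_C1_fderiv, OF assms]])+
qed

lemma C2_bilinear:
  assumes B: "bounded_bilinear B" and fg: "C2 f" "C2 g"
  shows "C2 (\<lambda>x. B (f x) (g x))"
  by (rule C2I(1), rule has_derivative_bilinear_blinfun[OF B C2_has_derivative[OF fg(1)] C2_has_derivative[OF fg(2)]])
     (intro C1_add C1_bilinear[OF bounded_bilinear_blinfun_compose] C2_imp_C1_fderiv fg C2_imp_C1
      C1_linear_compose[OF bounded_linear_bilinear_Blinfun(1)[OF B]]
      C1_linear_compose[OF bounded_linear_bilinear_Blinfun(2)[OF B]])

lemma fderiv_bilinear:
  assumes B: "bounded_bilinear B" and fg: "C2 f" "C2 g"
  shows "fderiv (\<lambda>x. B (f x) (g x)) x h = B (f x) (fderiv g x h) + B (fderiv f x h) (g x)"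
  unfolding fderiv_eqI[OF has_derivative_bilinear_blinfun[OF B C2_has_derivative[OF fg(1)] C2_has_derivative[OF fg(2)]]]
  by (simp add: plus_blinfun.rep_eq bounded_linear_Blinfun_apply bounded_bilinear.bounded_linear_right[OF B]
      bounded_bilinear.bounded_linear_left[OF B])

lemma C2_compose:
  assumes "C2 g" "C2 f"
  shows "C2 (\<lambda>x. g (f x))" "fderiv (\<lambda>x. g (f x)) = (\<lambda>x. fderiv g (f x) o\<^sub>L fderiv f x)"
proof -
  have *: "((\<lambda>x. g (f x)) has_derivative blinfun_apply (fderiv g (f x) o\<^sub>L fderiv f x)) (at x)" for x
    by (rule has_derivative_eq_rhs[OF has_derivative_compose[OF C2_has_derivative[OF assms(2)] C2_has_derivative[OF assms(1)]]])
       (simp add: fun_eq_iff)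
  have **: "C1 (\<lambda>x. fderiv g (f x) o\<^sub>L fderiv f x)"
    by (rule C1_bilinear[OF bounded_bilinear_blinfun_compose C1_compose[OF C2_imp_C1_fderiv[OF assms(1)] C2_imp_C1[OF assms(2)]]
        C2_imp_C1_fderiv[OF assms(2)]])
  show "C2 (\<lambda>x. g (f x))" "fderiv (\<lambda>x. g (f x)) = (\<lambda>x. fderiv g (f x) o\<^sub>L fderiv f x)"
    by (rule C2I[OF * **])+
qed

lemma C2_linear_compose: "bounded_linear L \<Longrightarrow> C2 f \<Longrightarrow> C2 (\<lambda>x. L (f x))"
  by (rule C2_compose(1)[OF C2_linear])

lemma C2_Pair:
  assumes "C2 f" "C2 g"
  shows "C2 (\<lambda>x. (f x, g x))"
proof -
  have bl: "bounded_linear (\<lambda>x. (x, 0))" "bounded_linear (\<lambda>y. (0, y))"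
    by (intro bounded_linear_Pair bounded_linear_ident bounded_linear_zero)+
  from C2_add(1)[OF C2_linear_compose[OF bl(1) assms(1)] C2_linear_compose[OF bl(2) assms(2)]]
  show ?thesis by simp
qed

lemma fderiv_linear_compose:
  assumes "bounded_linear L" "C2 f"
  shows "fderiv (\<lambda>x. L (f x)) x h = L (fderiv f x h)"
  by (simp add: C2_compose(2)[OF C2_linear[OF assms(1)] assms(2)] fderiv_linear[OF assms(1)])

lemma fderiv2_linear_compose:
  assumes L: "bounded_linear L" and f: "C2 f"
  shows "fderiv (fderiv (\<lambda>x. L (f x))) x h k = L (fderiv2 f x h k)"
proof -
  have eq: "fderiv (\<lambda>x. L (f x)) = (\<lambda>x. Blinfun L o\<^sub>L fderiv f x)"
    by (intro ext blinfun_eqI) (simp add: fderiv_linear_compose[OF assms] bounded_linear_Blinfun_apply[OF L])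
  have bl: "bounded_linear (\<lambda>A. Blinfun L o\<^sub>L A)"
    by (rule bounded_bilinear.bounded_linear_right[OF bounded_bilinear_blinfun_compose])
  have "((\<lambda>x. Blinfun L o\<^sub>L fderiv f x) has_derivative (\<lambda>h. Blinfun L o\<^sub>L fderiv2 f x h)) (at x)"
    by (rule bounded_linear.has_derivative[OF bl C2_has_derivative2[OF f]])
  moreover have "bounded_linear (\<lambda>h. Blinfun L o\<^sub>L fderiv2 f x h)"
    by (rule bounded_linear_compose[OF bl blinfun.bounded_linear_right])
  ultimately have "fderiv (fderiv (\<lambda>x. L (f x))) x = Blinfun (\<lambda>h. Blinfun L o\<^sub>L fderiv2 f x h)"
    unfolding eq by (intro fderiv_eqI) (simp only: bounded_linear_Blinfun_apply)
  then show ?thesis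
    by (simp add: bounded_linear_Blinfun_apply L \<open>bounded_linear (\<lambda>h. Blinfun L o\<^sub>L fderiv2 f x h)\<close>)
qed

text \<open>An affine inner map has no second derivative, so the Hessian is simply pulled back.
  Projections to blocks of variables, frozen arguments and the shift from \<open>\<xi>\<close> to
  \<open>T - \<xi>\<close> all enter in this form.\<close>

lemma fderiv_compose_affine:
  assumes A: "bounded_linear A" and f: "C2 f"
  shows "C2 (\<lambda>x. f (A x + b))" "fderiv (\<lambda>x. f (A x + b)) x h = fderiv f (A x + b) (A h)" (is ?B)
    "fderiv (fderiv (\<lambda>x. f (A x + b))) x h k = fderiv2 f (A x + b) (A h) (A k)" (is ?C)
proof -
  show "C2 (\<lambda>x. f (A x + b))" by (rule C2_compose(1)[OF f C2_affine(1)[OF A]])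
  have eq: "fderiv (\<lambda>x. f (A x + b)) = (\<lambda>x. fderiv f (A x + b) o\<^sub>L Blinfun A)"
    unfolding C2_compose(2)[OF f C2_affine(1)[OF A]] C2_affine(2)[OF A] ..
  show ?B
    by (simp add: eq bounded_linear_Blinfun_apply[OF A])
  have bl: "bounded_linear (\<lambda>B. B o\<^sub>L Blinfun A)"
    by (rule bounded_bilinear.bounded_linear_left[OF bounded_bilinear_blinfun_compose])
  have dA: "((\<lambda>x. A x + b) has_derivative A) (at x)"
    by (auto intro!: derivative_eq_intros bounded_linear_imp_has_derivative A)
  have "((\<lambda>x. fderiv f (A x + b) o\<^sub>L Blinfun A) has_derivative (\<lambda>h. fderiv2 f (A x + b) (A h) o\<^sub>L Blinfun A)) (at x)"
    by (rule bounded_linear.has_derivative[OF bl has_derivative_compose[OF dA C2_has_derivative2[OF f]]])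
  moreover have bl2: "bounded_linear (\<lambda>h. fderiv2 f (A x + b) (A h) o\<^sub>L Blinfun A)"
    by (intro bounded_linear_compose[OF bl] bounded_linear_compose[OF blinfun.bounded_linear_right A])
  ultimately have "fderiv (fderiv (\<lambda>x. f (A x + b))) x = Blinfun (\<lambda>h. fderiv2 f (A x + b) (A h) o\<^sub>L Blinfun A)"
    unfolding eq by (intro fderiv_eqI) (simp only: bounded_linear_Blinfun_apply)
  then show ?C
    by (simp add: bounded_linear_Blinfun_apply bl2 A)
qed

lemma fderiv2_add:
  assumes "C2 f" "C2 g"
  shows "fderiv (fderiv (\<lambda>x. f x + g x)) x h k = fderiv2 f x h k + fderiv2 g x h k"
proof -
  have "((\<lambda>x. fderiv f x + fderiv g x) has_derivative blinfun_apply (fderiv2 f x + fderiv2 g x)) (at x)"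
    by (rule has_derivative_eq_rhs[OF has_derivative_add[OF C2_has_derivative2 C2_has_derivative2, OF assms]]) (simp add: fun_eq_iff plus_blinfun.rep_eq)
  from fderiv_eqI[OF this] show ?thesis by (simp add: C2_add(2)[OF assms] plus_blinfun.rep_eq)
qed

section \<open>Uniform Taylor estimates on balls\<close>

lemma C2_bounded_derivatives:
  fixes f :: "'a::euclidean_space \<Rightarrow> 'b::real_normed_vector"
  assumes "C2 f"
  obtains C where "0 < C" "\<forall>x. norm x \<le> R \<longrightarrow> norm (f x) \<le> C \<and> norm (fderiv f x) \<le> C \<and> norm (fderiv2 f x) \<le> C"
proof -
  have c: "compact (cball (0::'a) R)" by simp
  have "bounded (f ` cball 0 R)"
    by (intro compact_imp_bounded compact_continuous_image c continuous_on_subset[OF C2_continuous[OF assms]]) simp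
  then obtain A1 where A1: "\<forall>x\<in>cball 0 R. norm (f x) \<le> A1" by (auto simp: bounded_iff)
  have "bounded (fderiv f ` cball 0 R)"
    by (intro compact_imp_bounded compact_continuous_image c continuous_on_subset[OF C2_continuous_fderiv[OF assms]]) simp
  then obtain A2 where A2: "\<forall>x\<in>cball 0 R. norm (fderiv f x) \<le> A2" by (auto simp: bounded_iff)
  have "bounded (fderiv2 f ` cball 0 R)"
    by (intro compact_imp_bounded compact_continuous_image c continuous_on_subset[OF C2_continuous_fderiv2[OF assms]]) simp
  then obtain A3 where A3: "\<forall>x\<in>cball 0 R. norm (fderiv2 f x) \<le> A3" by (auto simp: bounded_iff)
  show ?thesis
    by (rule that[of "max 1 (max A1 (max A2 A3))"]) (use A1 A2 A3 in \<open>auto simp: le_max_iff_disj\<close>)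
qed

lemma norm_fderiv_blinfun_le:
  assumes "norm (A :: 'a::real_normed_vector \<Rightarrow>\<^sub>L 'b::real_normed_vector) \<le> C"
  shows "norm (A h) \<le> C * norm h"
  using norm_blinfun[of A h] assms by (meson mult_right_mono norm_ge_zero order_trans)

lemma C2_taylor1:
  fixes f :: "'a::euclidean_space \<Rightarrow> 'b::real_normed_vector"
  assumes f: "C2 f"
  obtains C where "0 < C"
    "\<forall>x y. norm x \<le> R \<longrightarrow> norm y \<le> R \<longrightarrow> norm (f y - f x) \<le> C * norm (y - x) \<and>
      norm (fderiv f y - fderiv f x) \<le> C * norm (y - x) \<and>
      norm (f y - f x - fderiv f x (y - x)) \<le> C * (norm (y - x))\<^sup>2"
proof -
  obtain C where C: "0 < C" "\<forall>x. norm x \<le> R \<longrightarrow> norm (f x) \<le> C \<and> norm (fderiv f x) \<le> C \<and> norm (fderiv2 f x) \<le> C"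
    by (rule C2_bounded_derivatives[OF f])
  have conv: "convex (cball (0::'a) R)" by simp
  have D: "(f has_derivative blinfun_apply (fderiv f x)) (at x within S)"
    "(fderiv f has_derivative blinfun_apply (fderiv2 f x)) (at x within S)" for x S
    by (rule has_derivative_at_withinI[OF C2_has_derivative[OF f]] has_derivative_at_withinI[OF C2_has_derivative2[OF f]])+
  have l1: "norm (f y - f x) \<le> C * norm (y - x)" if "norm x \<le> R" "norm y \<le> R" for x y
    by (rule differentiable_bound[OF conv D(1)]) (use C that in \<open>auto simp flip: norm_blinfun.rep_eq\<close>)
  have l2: "norm (fderiv f y - fderiv f x) \<le> C * norm (y - x)" if "norm x \<le> R" "norm y \<le> R" for x y
    by (rule differentiable_bound[OF conv D(2)]) (use C that in \<open>auto simp flip: norm_blinfun.rep_eq\<close>)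
  have l3: "norm (f y - f x - fderiv f x (y - x)) \<le> C * (norm (y - x))\<^sup>2" if xy: "norm x \<le> R" "norm y \<le> R" for x y
  proof -
    have "norm (f y - f x - fderiv f x (y - x)) \<le> norm (y - x) * (C * norm (y - x))"
    proof (rule differentiable_bound_linearization[where S="closed_segment x y"])
      show "x + t *\<^sub>R (y - x) \<in> closed_segment x y" if "t \<in> {0..1}" for t
        using that by (auto simp: in_segment algebra_simps)
      show "(f has_derivative blinfun_apply (fderiv f z)) (at z within closed_segment x y)" for z by (rule D)
      fix z assume z: "z \<in> closed_segment x y"
      have "closed_segment x y \<subseteq> cball 0 R" by (rule closed_segment_subset) (use xy in auto)
      then have zR: "norm z \<le> R" using z by auto
      have "onorm (blinfun_apply (fderiv f z) - blinfun_apply (fderiv f x)) = norm (fderiv f z - fderiv f x)"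
        by (simp add: norm_blinfun.rep_eq minus_blinfun.rep_eq fun_diff_def)
      also have "\<dots> \<le> C * norm (z - x)" by (rule l2) (use xy zR in auto)
      also have "\<dots> \<le> C * norm (y - x)"
        using C segment_bound1[OF z] by (intro mult_left_mono) (auto simp: norm_minus_commute)
      finally show "onorm (blinfun_apply (fderiv f z) - blinfun_apply (fderiv f x)) \<le> C * norm (y - x)" .
    qed simp
    then show ?thesis by (simp add: power2_eq_square algebra_simps)
  qed
  show ?thesis by (rule that[OF C(1)]) (use l1 l2 l3 in blast)
qed

text \<open>The second derivative is only continuous, so the remainder is o(|h|^2) without a rate;
  uniformity in the base point comes from uniform continuity on a compact ball.\<close>

lemma C2_taylor2:
  fixes f :: "'a::euclidean_space \<Rightarrow> 'b::real_normed_vector"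
  assumes f: "C2 f" and e: "0 < e"
  obtains d where "0 < d"
    "\<forall>x h. norm x \<le> R \<longrightarrow> norm h \<le> d \<longrightarrow>
      norm (f (x + h) - f x - fderiv f x h - (1/2) *\<^sub>R fderiv2 f x h h) \<le> e * (norm h)\<^sup>2"
proof -
  have "uniformly_continuous_on (cball (0::'a) (R + 1)) (fderiv2 f)"
    by (intro compact_uniformly_continuous continuous_on_subset[OF C2_continuous_fderiv2[OF f]]) auto
  then obtain d0 where d0: "d0 > 0" "\<And>x y. x \<in> cball 0 (R+1) \<Longrightarrow> y \<in> cball 0 (R+1) \<Longrightarrow> dist y x < d0 \<Longrightarrow>
      dist (fderiv2 f y) (fderiv2 f x) < e"
    unfolding uniformly_continuous_on_def using e by metis
  \<comment> \<open>The bound 1 keeps \<open>x + h\<close> in the ball of radius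
    \<open>R + 1\<close>; the half makes the distance strictly smaller than
    \<open>d0\<close>.\<close>
  define d where "d = min 1 (d0/2)"
  have "norm (f (x + h) - f x - fderiv f x h - (1/2) *\<^sub>R fderiv2 f x h h) \<le> e * (norm h)\<^sup>2"
    if x: "norm x \<le> R" and h: "norm h \<le> d" for x h
  proof -
    have ball: "z \<in> cball 0 (R+1) \<and> dist z x < d0" if "z \<in> closed_segment x (x + h)" for z
    proof -
      have "norm (z - x) \<le> norm h" using segment_bound1[OF that] by (simp add: norm_minus_commute)
      moreover have "norm z \<le> norm x + norm (z - x)" by (rule norm_triangle_sub)
      ultimately show ?thesis using x h d0(1) by (auto simp: d_def dist_norm)
    qed
    have lin: "norm (fderiv f (x + t *\<^sub>R h) - fderiv f x - fderiv2 f x (t *\<^sub>R h)) \<le> norm (t *\<^sub>R h) * e" if t: "t \<in> {0..1}" for t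
    proof -
      have seg: "closed_segment x (x + t *\<^sub>R h) \<subseteq> closed_segment x (x + h)"
        by (rule closed_segment_subset) (use t in \<open>auto simp: in_segment algebra_simps\<close>)
      have "norm (fderiv f (x + t *\<^sub>R h) - fderiv f x - fderiv2 f x ((x + t *\<^sub>R h) - x)) \<le> norm ((x + t *\<^sub>R h) - x) * e"
      proof (rule differentiable_bound_linearization[where S="closed_segment x (x + t *\<^sub>R h)"])
        show "x + r *\<^sub>R (x + t *\<^sub>R h - x) \<in> closed_segment x (x + t *\<^sub>R h)" if "r \<in> {0..1}" for r
          using that by (auto simp: in_segment algebra_simps)
        show "(fderiv f has_derivative blinfun_apply (fderiv2 f z)) (at z within closed_segment x (x + t *\<^sub>R h))" for z
          by (rule has_derivative_at_withinI[OF C2_has_derivative2[OF f]])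
        fix z assume z: "z \<in> closed_segment x (x + t *\<^sub>R h)"
        have "onorm (blinfun_apply (fderiv2 f z) - blinfun_apply (fderiv2 f x)) = norm (fderiv2 f z - fderiv2 f x)"
          by (simp add: norm_blinfun.rep_eq minus_blinfun.rep_eq fun_diff_def)
        also have "\<dots> \<le> e"
          using d0(2)[of x z] ball[of z] ball[of x] z seg by (auto simp: dist_norm intro: order_less_imp_le)
        finally show "onorm (blinfun_apply (fderiv2 f z) - blinfun_apply (fderiv2 f x)) \<le> e" .
      qed simp
      then show ?thesis by simp
    qed
    \<comment> \<open>Remainder along the segment. Its derivative is the first order remainder of
      \<open>fderiv f\<close> applied to \<open>h\<close>, which \<open>lin\<close> bounds; the mean
      value inequality finishes the proof.\<close>
    define r where "r t = f (x + t *\<^sub>R h) - f x - t *\<^sub>R fderiv f x h - (t\<^sup>2/2) *\<^sub>R fderiv2 f x h h" for t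
    have dr: "(r has_derivative (\<lambda>u. u *\<^sub>R ((fderiv f (x + t *\<^sub>R h) - fderiv f x - fderiv2 f x (t *\<^sub>R h)) h))) (at t within {0..1})" for t
    proof -
      have a: "((\<lambda>t. x + t *\<^sub>R h) has_derivative (\<lambda>u. u *\<^sub>R h)) (at t within {0..1})"
        by (auto intro!: derivative_eq_intros)
      have 1: "((\<lambda>t. f (x + t *\<^sub>R h)) has_derivative (\<lambda>u. fderiv f (x + t *\<^sub>R h) (u *\<^sub>R h))) (at t within {0..1})"
        by (rule has_derivative_compose[OF a C2_has_derivative[OF f]])
      show ?thesis
        unfolding r_def
        by (rule derivative_eq_intros 1 refl)+
           (auto simp: fun_eq_iff blinfun.bilinear_simps algebra_simps)
    qed
    have "norm (r 1 - r 0) \<le> (e * (norm h)\<^sup>2) * norm (1 - 0 :: real)"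
    proof (rule differentiable_bound[OF _ dr])
      show "convex {0..1::real}" by simp
      fix t :: real assume t: "t \<in> {0..1}"
      let ?v = "(fderiv f (x + t *\<^sub>R h) - fderiv f x - fderiv2 f x (t *\<^sub>R h)) h"
      have "norm ?v \<le> norm (t *\<^sub>R h) * e * norm h" by (rule norm_fderiv_blinfun_le[OF lin[OF t]])
      also have "\<dots> \<le> norm h * e * norm h"
        using t e by (intro mult_right_mono) (auto simp: mult_left_le_one_le)
      finally have "norm ?v \<le> e * (norm h)\<^sup>2" by (simp add: power2_eq_square algebra_simps)
      then show "onorm (\<lambda>u. u *\<^sub>R ?v) \<le> e * (norm h)\<^sup>2"
        by (intro onorm_bound) (use e in \<open>auto simp: mult.commute intro!: mult_left_mono\<close>)
    qed auto
    then show ?thesis by (simp add: r_def)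
  qed
  moreover have "0 < d" using d0 by (simp add: d_def)
  ultimately show ?thesis by (intro that[of d]) auto
qed

section \<open>Controlled equations and their linearisations\<close>

lemma continuous_borel_lebesgue_on:
  fixes x :: "real \<Rightarrow> 'a::euclidean_space"
  shows "continuous_on {0..1} x \<Longrightarrow> x \<in> borel_measurable leb01"
  by (rule continuous_imp_measurable_on_sets_lebesgue) auto

lemma borel_measurable_affine_extension:
  fixes w :: "real \<Rightarrow> 'a::euclidean_space"
  assumes w: "w \<in> borel_measurable (lebesgue_on {a..b})" and m: "m \<noteq> 0"
  shows "(\<lambda>t. if m * t + k \<in> {a..b} then w (m * t + k) else 0) \<in> borel_measurable lebesgue"
proof -
  have 1: "(\<lambda>t. if t \<in> {a..b} then w t else 0) \<in> borel_measurable lebesgue"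
    by (subst borel_measurable_if) (simp_all add: w)
  have "(\<lambda>s::real. k + (\<Sum>j\<in>Basis. (m * (s \<bullet> j)) *\<^sub>R j)) \<in> lebesgue \<rightarrow>\<^sub>M lebesgue"
    by (rule lebesgue_affine_measurable) (use m in simp)
  then have 2: "(\<lambda>s. m * s + k) \<in> lebesgue \<rightarrow>\<^sub>M lebesgue" by (simp add: add.commute)
  show ?thesis using measurable_compose[OF 2 1] .
qed

lemma borel_measurable_affine_lebesgue_on:
  fixes w :: "real \<Rightarrow> 'a::euclidean_space"
  assumes w: "w \<in> borel_measurable (lebesgue_on {a..b})" and m: "m \<noteq> 0"
    and sub: "\<And>s. s \<in> {c..d} \<Longrightarrow> m * s + k \<in> {a..b}"
  shows "(\<lambda>s. w (m * s + k)) \<in> borel_measurable (lebesgue_on {c..d})"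
proof -
  have "(\<lambda>s. if m * s + k \<in> {a..b} then w (m * s + k) else 0) \<in> borel_measurable lebesgue"
    by (rule borel_measurable_affine_extension[OF w m])
  then have "(\<lambda>s. if m * s + k \<in> {a..b} then w (m * s + k) else 0) \<in> borel_measurable (lebesgue_on {c..d})"
    by (rule measurable_restrict_space1)
  then show ?thesis by (rule measurable_cong[THEN iffD1, rotated]) (use sub in auto)
qed

text \<open>The bound holds at every point of \<open>{0..1}\<close>, not almost everywhere, so that
  estimates along controls are pointwise and carry no null sets. The reference controls are brought
  into this form by \<open>bounded_modification\<close>.\<close>

definition bmeas :: "(real \<Rightarrow> 'a::euclidean_space) \<Rightarrow> bool"
  where "bmeas v \<longleftrightarrow> v \<in> borel_measurable leb01 \<and> (\<exists>M. \<forall>s\<in>{0..1}. norm (v s) \<le> M)"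

lemma bmeasD1: "bmeas v \<Longrightarrow> v \<in> borel_measurable leb01"
  by (simp add: bmeas_def)

lemma bmeas_boundE:
  assumes "bmeas v"
  obtains M where "0 < M" "\<forall>s\<in>{0..1}. norm (v s) \<le> M"
proof -
  from assms obtain M where M: "\<forall>s\<in>{0..1}. norm (v s) \<le> M" by (auto simp: bmeas_def)
  show ?thesis by (rule that[of "max 1 M"]) (use M in \<open>auto simp: le_max_iff_disj\<close>)
qed

lemma bmeas_integrable:
  assumes "bmeas v"
  shows "v integrable_on {0..1}" "integrable leb01 v"
proof -
  obtain M where M: "\<forall>s\<in>{0..1}. norm (v s) \<le> M" using assms by (auto simp: bmeas_def)
  have "AE s in leb01. norm (v s) \<le> M" using AE_space by eventually_elim (use M in auto)
  then show 1: "integrable leb01 v" by (rule bounded_measurable_integrable[OF bmeasD1[OF assms]])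
  show "v integrable_on {0..1}" by (rule integrable_on_lebesgue_on[OF 1]) simp
qed

lemma bmeas_continuous:
  assumes "continuous_on {0..1} x"
  shows "bmeas x"
proof -
  have "bounded (x ` {0..1})" by (intro compact_imp_bounded compact_continuous_image assms compact_Icc)
  then show ?thesis using continuous_borel_lebesgue_on[OF assms] by (auto simp: bmeas_def bounded_iff)
qed

lemma bmeas_lip_path: "lip_path x d \<Longrightarrow> bmeas x"
  by (rule bmeas_continuous[OF lip_path_continuous])

lemma bmeas_const: "bmeas (\<lambda>_. c)"
  by (rule bmeas_continuous) simp

lemma bmeas_Pair:
  assumes "bmeas x" "bmeas y"
  shows "bmeas (\<lambda>s. (x s, y s))"
proof -
  obtain M where M: "\<forall>s\<in>{0..1}. norm (x s) \<le> M" using assms by (auto simp: bmeas_def)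
  obtain N where N: "\<forall>s\<in>{0..1}. norm (y s) \<le> N" using assms by (auto simp: bmeas_def)
  have "norm (x s, y s) \<le> M + N" if "s \<in> {0..1}" for s
    using norm_Pair_le[of "x s" "y s"] M N that by fastforce
  moreover have "(\<lambda>s. (x s, y s)) \<in> borel_measurable leb01"
    by (intro borel_measurable_Pair bmeasD1 assms)
  ultimately show ?thesis unfolding bmeas_def by blast
qed

lemma bmeas_continuous_compose:
  fixes f :: "'a::euclidean_space \<Rightarrow> 'b::euclidean_space"
  assumes f: "continuous_on UNIV f" and x: "bmeas x"
  shows "bmeas (\<lambda>s. f (x s))"
proof -
  obtain M where M: "\<forall>s\<in>{0..1}. norm (x s) \<le> M" using x by (auto simp: bmeas_def)
  have "bounded (f ` cball 0 M)"
    by (intro compact_imp_bounded compact_continuous_image continuous_on_subset[OF f]) auto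
  then obtain C where C: "\<forall>y\<in>cball 0 M. norm (f y) \<le> C" by (auto simp: bounded_iff)
  have "(\<lambda>s. f (x s)) \<in> borel_measurable leb01"
    using borel_measurable_continuous_onI[OF f] bmeasD1[OF x] by (rule measurable_compose[rotated])
  then show ?thesis using C M by (auto simp: bmeas_def intro!: exI[of _ C])
qed

lemma bmeas_linear: "bounded_linear f \<Longrightarrow> bmeas x \<Longrightarrow> bmeas (\<lambda>s. f (x s))"
  for f :: "'a::euclidean_space \<Rightarrow> 'b::euclidean_space"
  by (rule bmeas_continuous_compose[OF linear_continuous_on])

lemma bmeas_add: "bmeas x \<Longrightarrow> bmeas y \<Longrightarrow> bmeas (\<lambda>s. x s + y s)"
  using bmeas_continuous_compose[of "\<lambda>p. fst p + snd p", OF _ bmeas_Pair] by (simp add: continuous_intros)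

lemma bmeas_diff: "bmeas x \<Longrightarrow> bmeas y \<Longrightarrow> bmeas (\<lambda>s. x s - y s)"
  using bmeas_continuous_compose[of "\<lambda>p. fst p - snd p", OF _ bmeas_Pair] by (simp add: continuous_intros)

lemma bmeas_scaleR: "bmeas x \<Longrightarrow> bmeas y \<Longrightarrow> bmeas (\<lambda>s. x s *\<^sub>R y s)"
  using bmeas_continuous_compose[of "\<lambda>p. fst p *\<^sub>R snd p", OF _ bmeas_Pair] by (simp add: continuous_intros)

lemma bmeas_mult: "bmeas x \<Longrightarrow> bmeas y \<Longrightarrow> bmeas (\<lambda>s. x s * y s :: real)"
  using bmeas_scaleR[of x y] by simp

lemma bmeas_inner: "bmeas x \<Longrightarrow> bmeas y \<Longrightarrow> bmeas (\<lambda>s. x s \<bullet> y s)"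
  using bmeas_continuous_compose[of "\<lambda>p. fst p \<bullet> snd p", OF _ bmeas_Pair] by (simp add: continuous_intros)

lemma bmeas_sum: "(\<And>i. i \<in> I \<Longrightarrow> bmeas (x i)) \<Longrightarrow> bmeas (\<lambda>s. \<Sum>i\<in>I. x i s)"
  by (induction I rule: infinite_finite_induct) (auto simp: bmeas_const intro: bmeas_add)

lemma bmeas_reverse:
  assumes "bmeas v" shows "bmeas (\<lambda>s. v (1 - s))"
proof -
  have "(\<lambda>s. v (-1 * s + 1)) \<in> borel_measurable leb01"
    by (rule borel_measurable_affine_lebesgue_on[OF bmeasD1[OF assms]]) auto
  moreover obtain M where "\<forall>s\<in>{0..1}. norm (v s) \<le> M" using assms by (auto simp: bmeas_def)
  then have "\<forall>s\<in>{0..1}. norm (v (1 - s)) \<le> M" by simp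
  ultimately show ?thesis by (auto simp: bmeas_def)
qed

lemma bmeas_fderiv:
  fixes F :: "'z::euclidean_space \<Rightarrow> 'a::euclidean_space"
  assumes F: "C2 F" and z: "bmeas z" and h: "bmeas h"
  shows "bmeas (\<lambda>s. fderiv F (z s) (h s))"
proof -
  have "continuous_on UNIV (\<lambda>q. fderiv F (fst q) (snd q))"
    by (intro bounded_bilinear.continuous_on[OF bounded_bilinear_blinfun_apply] continuous_intros
        continuous_on_compose2[OF C2_continuous_fderiv[OF F]]) auto
  from bmeas_continuous_compose[OF this bmeas_Pair[OF z h]] show ?thesis by simp
qed

lemma bmeas_fderiv2:
  fixes F :: "'z::euclidean_space \<Rightarrow> 'a::euclidean_space"
  assumes F: "C2 F" and z: "bmeas z" and h: "bmeas h" and k: "bmeas k"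
  shows "bmeas (\<lambda>s. fderiv2 F (z s) (h s) (k s))"
proof -
  have "continuous_on UNIV (\<lambda>q. fderiv2 F (fst q) (fst (snd q)) (snd (snd q)))"
    by (intro bounded_bilinear.continuous_on[OF bounded_bilinear_blinfun_apply] continuous_intros
        continuous_on_compose2[OF C2_continuous_fderiv2[OF F]]) auto
  from bmeas_continuous_compose[OF this bmeas_Pair[OF z bmeas_Pair[OF h k]]] show ?thesis by simp
qed

lemma bmeas_C2:
  fixes F :: "'z::euclidean_space \<Rightarrow> 'a::euclidean_space"
  shows "C2 F \<Longrightarrow> bmeas z \<Longrightarrow> bmeas (\<lambda>s. F (z s))"
  by (rule bmeas_continuous_compose[OF C2_continuous])

section \<open>Trajectories and linearised trajectories near a reference trajectory\<close>

lemma C2_path_constants: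
  fixes F :: "'x::euclidean_space \<times> 'v::euclidean_space \<Rightarrow> 'a::euclidean_space"
  assumes F: "C2 F" and x: "bmeas x" and v: "bmeas v"
  obtains K where "0 < K"
    "\<forall>s\<in>{0..1}. norm (fderiv F (x s, v s)) \<le> K \<and> norm (fderiv2 F (x s, v s)) \<le> K"
    "\<forall>s\<in>{0..1}. \<forall>y y' u u'. norm (y - x s) \<le> 1 \<longrightarrow> norm (y' - x s) \<le> 1 \<longrightarrow> norm (u - v s) \<le> 1 \<longrightarrow> norm (u' - v s) \<le> 1 \<longrightarrow>
       norm (F (y, u) - F (y', u')) \<le> K * (norm (y - y') + norm (u - u')) \<and>
       norm (F (y, u) - F (y', u') - fderiv F (y', u') (y - y', u - u')) \<le> K * (norm (y - y') + norm (u - u'))\<^sup>2"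
proof -
  obtain B where B: "\<forall>s\<in>{0..1}. norm (x s) \<le> B" using x by (auto simp: bmeas_def)
  obtain M where M: "\<forall>s\<in>{0..1}. norm (v s) \<le> M" using v by (auto simp: bmeas_def)
  obtain C where C: "0 < C" "\<forall>z. norm z \<le> B + M + 2 \<longrightarrow> norm (F z) \<le> C \<and> norm (fderiv F z) \<le> C \<and> norm (fderiv2 F z) \<le> C"
    by (rule C2_bounded_derivatives[OF F])
  obtain D where D: "0 < D"
    "\<forall>z z'. norm z \<le> B + M + 2 \<longrightarrow> norm z' \<le> B + M + 2 \<longrightarrow> norm (F z' - F z) \<le> D * norm (z' - z) \<and>
      norm (fderiv F z' - fderiv F z) \<le> D * norm (z' - z) \<and>
      norm (F z' - F z - fderiv F z (z' - z)) \<le> D * (norm (z' - z))\<^sup>2"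
    by (rule C2_taylor1[OF F])
  define K where "K = max C D"
  have K: "0 < K" "C \<le> K" "D \<le> K" using C(1) by (auto simp: K_def)
  have nb: "norm (y, u) \<le> B + M + 2" if "s \<in> {0..1}" "norm (y - x s) \<le> 1" "norm (u - v s) \<le> 1" for s y u
  proof -
    have "norm y \<le> norm (x s) + norm (y - x s)" "norm u \<le> norm (v s) + norm (u - v s)" by (rule norm_triangle_sub)+
    moreover have "norm (x s) \<le> B" "norm (v s) \<le> M" using B M that by auto
    ultimately show ?thesis using norm_Pair_le[of y u] that by linarith
  qed
  have 1: "norm (fderiv F (x s, v s)) \<le> K \<and> norm (fderiv2 F (x s, v s)) \<le> K" if "s \<in> {0..1}" for s
    using C(2) nb[OF that, of "x s" "v s"] K(2) by fastforce
  have 2: "norm (F (y, u) - F (y', u')) \<le> K * (norm (y - y') + norm (u - u')) \<and>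
       norm (F (y, u) - F (y', u') - fderiv F (y', u') (y - y', u - u')) \<le> K * (norm (y - y') + norm (u - u'))\<^sup>2"
    if s: "s \<in> {0..1}" and n: "norm (y - x s) \<le> 1" "norm (y' - x s) \<le> 1" "norm (u - v s) \<le> 1" "norm (u' - v s) \<le> 1" for s y y' u u'
  proof -
    let ?n = "norm ((y, u) - (y', u'))"
    have d: "?n \<le> norm (y - y') + norm (u - u')" using norm_Pair_le[of "y - y'" "u - u'"] by simp
    have "norm (F (y, u) - F (y', u')) \<le> D * ?n"
      "norm (F (y, u) - F (y', u') - fderiv F (y', u') ((y, u) - (y', u'))) \<le> D * ?n\<^sup>2"
      using D(2) nb[OF s n(1,3)] nb[OF s n(2,4)] by blast+
    moreover have "D * ?n \<le> K * (norm (y - y') + norm (u - u'))" using d K D by (intro mult_mono) auto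
    moreover have "D * ?n\<^sup>2 \<le> K * (norm (y - y') + norm (u - u'))\<^sup>2" using d K D by (intro mult_mono power_mono) auto
    ultimately show ?thesis by simp
  qed
  show ?thesis by (rule that[OF K(1)]) (use 1 2 in blast)+
qed

text \<open>The vector field is only locally Lipschitz in the state. Composed with the projection
  onto a ball that contains the reference with margin 1 it becomes globally Lipschitz, and the
  Gronwall estimate shows that for small perturbations the solution stays in the ball, so the
  projection is inactive.\<close>

lemma perturbed_solution:
  fixes F :: "'x::euclidean_space \<times> 'v::euclidean_space \<Rightarrow> 'x"
  assumes F: "C2 F" and vb: "bmeas vb" and xb: "lip_path xb (\<lambda>s. F (xb s, vb s))"
  obtains \<rho> C where "0 < \<rho>" "0 < C"
    "\<forall>a v e. bmeas v \<longrightarrow> (\<forall>s\<in>{0..1}. norm (v s - vb s) \<le> e) \<longrightarrow> norm (a - xb 0) \<le> e \<longrightarrow> e \<le> \<rho> \<longrightarrow>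
      (\<exists>x. x 0 = a \<and> lip_path x (\<lambda>s. F (x s, v s)) \<and> (\<forall>s\<in>{0..1}. norm (x s - xb s) \<le> C * e))"
proof -
  obtain B where B: "0 < B" "\<forall>s\<in>{0..1}. norm (xb s) \<le> B" by (rule lip_path_bounded[OF xb])
  obtain M where M: "0 < M" "\<forall>s\<in>{0..1}. norm (vb s) \<le> M" by (rule bmeas_boundE[OF vb])
  obtain K where K: "0 < K"
    "\<forall>z z'. norm z \<le> (B + 1) + (M + 1) \<longrightarrow> norm z' \<le> (B + 1) + (M + 1) \<longrightarrow> norm (F z' - F z) \<le> K * norm (z' - z) \<and>
      norm (fderiv F z' - fderiv F z) \<le> K * norm (z' - z) \<and>
      norm (F z' - F z - fderiv F z (z' - z)) \<le> K * (norm (z' - z))\<^sup>2"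
    by (rule C2_taylor1[OF F])
  obtain C0 where C0: "0 < C0" "\<forall>z. norm z \<le> (B + 1) + (M + 1) \<longrightarrow> norm (F z) \<le> C0 \<and> norm (fderiv F z) \<le> C0 \<and> norm (fderiv2 F z) \<le> C0"
    by (rule C2_bounded_derivatives[OF F])
  define P where "P = closest_point (cball (0::'x) (B + 1))"
  have Pin: "norm (P y) \<le> B + 1" for y
    using closest_point_in_set[of "cball (0::'x) (B + 1)" y] B(1) by (simp add: P_def)
  have Plip: "norm (P y - P z) \<le> norm (y - z)" for y z
    using closest_point_lipschitz[of "cball (0::'x) (B + 1)" y z] B(1) by (simp add: P_def dist_norm)
  have Pid: "P y = y" if "norm y \<le> B + 1" for y
    using closest_point_self[of y "cball 0 (B + 1)"] that by (simp add: P_def)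
  define C where "C = (1 + K) * exp K"
  \<comment> \<open>Then \<open>C * e \<le> 1\<close>, which keeps the solution within distance 1 of
    the reference; the other bound keeps the controls where the constants are valid.\<close>
  define \<rho> where "\<rho> = min 1 (1 / C)"
  have C: "0 < C" using K(1) by (simp add: C_def)
  have \<rho>: "0 < \<rho>" using C by (simp add: \<rho>_def)
  have "\<exists>x. x 0 = a \<and> lip_path x (\<lambda>s. F (x s, v s)) \<and> (\<forall>s\<in>{0..1}. norm (x s - xb s) \<le> C * e)"
    if v: "bmeas v" and ve: "\<forall>s\<in>{0..1}. norm (v s - vb s) \<le> e" and a: "norm (a - xb 0) \<le> e" and e: "e \<le> \<rho>" for a v e
  proof -
    have e0: "0 \<le> e" using a norm_ge_zero order_trans by blast
    have vM: "norm (v s) \<le> M + 1" if "s \<in> {0..1}" for s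
    proof -
      have "norm (v s) \<le> norm (vb s) + norm (v s - vb s)" by (rule norm_triangle_sub)
      also have "\<dots> \<le> M + 1" using M(2) ve that e by (intro add_mono) (auto simp: \<rho>_def intro: order_trans)
      finally show ?thesis .
    qed
    have nb: "norm (y, u) \<le> (B + 1) + (M + 1)" if "norm y \<le> B + 1" "norm u \<le> M + 1" for y :: 'x and u :: 'v
      using norm_Pair_le[of y u] that by linarith
    have lipF: "norm (F (y, u) - F (y', u')) \<le> K * (norm (y - y') + norm (u - u'))"
      if "norm y \<le> B + 1" "norm u \<le> M + 1" "norm y' \<le> B + 1" "norm u' \<le> M + 1" for y y' u u'
    proof -
      have "norm (F (y, u) - F (y', u')) \<le> K * norm ((y, u) - (y', u'))" using K(2) nb that by blast
      also have "\<dots> \<le> K * (norm (y - y') + norm (u - u'))"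
        using norm_Pair_le[of "y - y'" "u - u'"] K(1) by (intro mult_left_mono) auto
      finally show ?thesis .
    qed
    obtain x where x: "x 0 = a" "lip_path x (\<lambda>s. F (P (x s), v s))"
    proof (rule picard[of "\<lambda>s y. F (P y, v s)" K C0 a])
      fix z :: "real \<Rightarrow> 'x" assume z: "continuous_on {0..1} z"
      have "continuous_on UNIV P"
        unfolding P_def by (rule continuous_on_closest_point) (use B(1) in auto)
      then have "continuous_on {0..1} (\<lambda>s. P (z s))" by (rule continuous_on_compose2[OF _ z]) simp
      then show "(\<lambda>s. F (P (z s), v s)) \<in> borel_measurable leb01"
        by (intro bmeasD1 bmeas_C2[OF F] bmeas_Pair bmeas_continuous v)
    next
      fix s :: real and y z :: 'x assume s: "s \<in> {0..1}"
      have "norm (F (P y, v s) - F (P z, v s)) \<le> K * (norm (P y - P z) + norm (v s - v s))"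
        by (rule lipF) (use Pin vM[OF s] in auto)
      also have "\<dots> \<le> K * norm (y - z)" using Plip[of y z] K(1) by simp
      finally show "norm (F (P y, v s) - F (P z, v s)) \<le> K * norm (y - z)" .
    next
      fix s :: real assume s: "s \<in> {0..1}"
      show "norm (F (P 0, v s)) \<le> C0" using C0(2) nb[OF Pin vM[OF s]] by blast
    qed
    have "norm (x t - xb t) \<le> (norm (x 0 - xb 0) + K * e) * exp K" if t: "t \<in> {0..1}" for t
    proof (rule lip_path_gronwall[OF lip_path_diff[OF x(2) xb] _ _ _ t])
      have "norm (F (P (x s), v s) - F (xb s, vb s)) \<le> K * norm (x s - xb s) + K * e" if s: "s \<in> {0..1}" for s
      proof -
        have xbs: "norm (xb s) \<le> B + 1" using B(2) s by fastforce
        have vbs: "norm (vb s) \<le> M + 1" using M(2) s by fastforce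
        have "norm (F (P (x s), v s) - F (xb s, vb s)) \<le> K * (norm (P (x s) - xb s) + norm (v s - vb s))"
          by (rule lipF[OF Pin vM[OF s] xbs vbs])
        also have "\<dots> \<le> K * (norm (x s - xb s) + e)"
          using Plip[of "x s" "xb s"] Pid[OF xbs] ve s K(1) by (intro mult_left_mono add_mono) auto
        finally show ?thesis by (simp add: algebra_simps)
      qed
      then show "AE s in leb01. norm (F (P (x s), v s) - F (xb s, vb s)) \<le> K * norm (x s - xb s) + K * e"
        using AE_space by (auto elim: eventually_mono)
    qed (use K(1) e0 in auto)
    moreover have "(norm (x 0 - xb 0) + K * e) * exp K \<le> C * e"
    proof -
      have "(norm (x 0 - xb 0) + K * e) * exp K \<le> (e + K * e) * exp K" using a x(1) by (intro mult_right_mono) auto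
      then show ?thesis by (simp add: C_def algebra_simps)
    qed
    ultimately have est: "norm (x t - xb t) \<le> C * e" if "t \<in> {0..1}" for t using that by fastforce
    have "C * e \<le> 1"
    proof -
      have "C * e \<le> C * (1 / C)" using e C by (intro mult_left_mono) (auto simp: \<rho>_def)
      then show ?thesis using C by simp
    qed
    then have "P (x s) = x s" if "s \<in> {0..1}" for s
      using est[OF that] B(2) that norm_triangle_sub[of "x s" "xb s"] by (intro Pid) force
    then have "AE s in leb01. F (P (x s), v s) = F (x s, v s)"
      using AE_space by (auto elim: eventually_mono)
    then have "lip_path x (\<lambda>s. F (x s, v s))" by (rule lip_path_cong_AE[OF x(2)])
    then show ?thesis using x(1) est by blast
  qed
  then show ?thesis by (intro that[OF \<rho> C]) blast
qed

text \<open>Gronwall for \<open>x - xb - dx\<close>: the derivative is linear in this difference up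
  to the mismatch \<open>e\<close> of the controls and the Taylor remainder, which is of order
  \<open>r\<^sup>2\<close>.\<close>

lemma linearization_error:
  fixes F :: "'x::euclidean_space \<times> 'v::euclidean_space \<Rightarrow> 'x"
  assumes F: "C2 F" and vb: "bmeas vb" and xb: "lip_path xb (\<lambda>s. F (xb s, vb s))"
  obtains C where "0 < C"
    "\<forall>x v dx dv r e. 0 \<le> r \<longrightarrow> r \<le> 1 \<longrightarrow> lip_path x (\<lambda>s. F (x s, v s)) \<longrightarrow>
      lip_path dx (\<lambda>s. fderiv F (xb s, vb s) (dx s, dv s)) \<longrightarrow>
      (\<forall>s\<in>{0..1}. norm (x s - xb s) \<le> r \<and> norm (v s - vb s) \<le> r \<and> norm (v s - vb s - dv s) \<le> e) \<longrightarrow>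
      norm (x 0 - xb 0 - dx 0) \<le> e \<longrightarrow>
      (\<forall>s\<in>{0..1}. norm (x s - xb s - dx s) \<le> C * (e + r\<^sup>2))"
proof -
  obtain K where K: "0 < K"
    "\<forall>s\<in>{0..1}. norm (fderiv F (xb s, vb s)) \<le> K \<and> norm (fderiv2 F (xb s, vb s)) \<le> K"
    "\<forall>s\<in>{0..1}. \<forall>y y' u u'. norm (y - xb s) \<le> 1 \<longrightarrow> norm (y' - xb s) \<le> 1 \<longrightarrow> norm (u - vb s) \<le> 1 \<longrightarrow> norm (u' - vb s) \<le> 1 \<longrightarrow>
       norm (F (y, u) - F (y', u')) \<le> K * (norm (y - y') + norm (u - u')) \<and>
       norm (F (y, u) - F (y', u') - fderiv F (y', u') (y - y', u - u')) \<le> K * (norm (y - y') + norm (u - u'))\<^sup>2"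
    by (rule C2_path_constants[OF F bmeas_lip_path[OF xb] vb])
  define C where "C = (1 + 4 * K) * exp K"
  have C: "0 < C" using K(1) by (simp add: C_def)
  have "norm (x t - xb t - dx t) \<le> C * (e + r\<^sup>2)"
    if r: "0 \<le> r" "r \<le> 1" and x: "lip_path x (\<lambda>s. F (x s, v s))"
      and dx: "lip_path dx (\<lambda>s. fderiv F (xb s, vb s) (dx s, dv s))"
      and cl: "\<forall>s\<in>{0..1}. norm (x s - xb s) \<le> r \<and> norm (v s - vb s) \<le> r \<and> norm (v s - vb s - dv s) \<le> e"
      and x0: "norm (x 0 - xb 0 - dx 0) \<le> e" and t: "t \<in> {0..1}" for x v dx dv r e t
  proof -
    have e0: "0 \<le> e" using x0 norm_ge_zero order_trans by blast
    let ?z = "\<lambda>s. x s - xb s - dx s"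
    let ?d = "\<lambda>s. F (x s, v s) - F (xb s, vb s) - fderiv F (xb s, vb s) (dx s, dv s)"
    have "norm (?z t) \<le> (norm (?z 0) + (4 * K * r\<^sup>2 + K * e)) * exp K"
    proof (rule lip_path_gronwall[OF lip_path_diff[OF lip_path_diff[OF x xb] dx] _ _ _ t])
      have "norm (?d s) \<le> K * norm (?z s) + (4 * K * r\<^sup>2 + K * e)" if s: "s \<in> {0..1}" for s
      proof -
        let ?A = "fderiv F (xb s, vb s)"
        have c: "norm (x s - xb s) \<le> r" "norm (v s - vb s) \<le> r" "norm (v s - vb s - dv s) \<le> e" using cl s by auto
        define a where "a = norm (x s - xb s)"
        define b where "b = norm (v s - vb s)"
        define n where "n = norm (?z s)"
        define m where "m = norm (?z s, v s - vb s - dv s)"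
        have 1: "norm (F (x s, v s) - F (xb s, vb s) - ?A (x s - xb s, v s - vb s)) \<le> K * (a + b)\<^sup>2"
        proof -
          have "norm (x s - xb s) \<le> 1" "norm (xb s - xb s) \<le> 1" "norm (v s - vb s) \<le> 1" "norm (vb s - vb s) \<le> 1"
            using c r by auto
          then show ?thesis using K(3) s unfolding a_def b_def by blast
        qed
        have 2: "norm (?A (?z s, v s - vb s - dv s)) \<le> K * m"
          unfolding m_def by (rule norm_fderiv_blinfun_le) (use K(2) s in blast)
        have eq: "?d s = (F (x s, v s) - F (xb s, vb s) - ?A (x s - xb s, v s - vb s)) + ?A (?z s, v s - vb s - dv s)"
          using blinfun.diff_right[of ?A "(x s - xb s, v s - vb s)" "(dx s, dv s)"] by simp
        have le: "norm (?d s) \<le> K * (a + b)\<^sup>2 + K * m"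
          unfolding eq by (rule norm_triangle_le[OF add_mono[OF 1 2]])
        have ab: "0 \<le> a" "0 \<le> b" "a \<le> r" "b \<le> r" using c(1,2) by (simp_all add: a_def b_def)
        have mn: "m \<le> n + e" using norm_Pair_le[of "?z s" "v s - vb s - dv s"] c(3) unfolding m_def n_def by linarith
        have "K * (a + b)\<^sup>2 \<le> K * (2 * r)\<^sup>2" using ab K(1) by (intro mult_left_mono power_mono) simp_all
        moreover have "K * m \<le> K * (n + e)" using mn K(1) by (intro mult_left_mono) simp_all
        ultimately have "norm (?d s) \<le> K * (2 * r)\<^sup>2 + K * (n + e)" using le by linarith
        moreover have "K * (2 * r)\<^sup>2 + K * (n + e) = K * n + (4 * K * r\<^sup>2 + K * e)"
          by (simp add: algebra_simps power2_eq_square)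
        ultimately show ?thesis by (simp only: n_def)
      qed
      then show "AE s in leb01. norm (?d s) \<le> K * norm (?z s) + (4 * K * r\<^sup>2 + K * e)"
        using AE_space by (auto elim: eventually_mono)
    qed (use K(1) e0 in auto)
    also have "\<dots> \<le> (e + (4 * K * r\<^sup>2 + K * e)) * exp K" using x0 by (intro mult_right_mono) auto
    also have "\<dots> \<le> C * (e + r\<^sup>2)"
    proof -
      have "e + (4 * K * r\<^sup>2 + K * e) \<le> (1 + 4 * K) * (e + r\<^sup>2)"
        using K(1) e0 by (simp add: algebra_simps add_mono)
      from mult_right_mono[OF this exp_ge_zero[of K]] show ?thesis by (simp only: C_def ac_simps)
    qed
    finally show ?thesis .
  qed
  then show ?thesis by (intro that[OF C]) blast
qed

lemma linear_solution:
  fixes F :: "'x::euclidean_space \<times> 'v::euclidean_space \<Rightarrow> 'x"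
  assumes F: "C2 F" and vb: "bmeas vb" and xb: "bmeas xb" and dv: "bmeas dv"
  obtains dx where "dx 0 = a" "lip_path dx (\<lambda>s. fderiv F (xb s, vb s) (dx s, dv s))"
proof -
  obtain K where K: "0 < K"
    "\<forall>s\<in>{0..1}. norm (fderiv F (xb s, vb s)) \<le> K \<and> norm (fderiv2 F (xb s, vb s)) \<le> K"
    by (rule C2_path_constants[OF F xb vb])
  obtain M where M: "0 < M" "\<forall>s\<in>{0..1}. norm (dv s) \<le> M" by (rule bmeas_boundE[OF dv])
  show ?thesis
  proof (rule picard[of "\<lambda>s y. fderiv F (xb s, vb s) (y, dv s)" K "K * M" a])
    fix z :: "real \<Rightarrow> 'x" assume z: "continuous_on {0..1} z"
    show "(\<lambda>s. fderiv F (xb s, vb s) (z s, dv s)) \<in> borel_measurable leb01"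
      by (intro bmeasD1 bmeas_fderiv[OF F] bmeas_Pair bmeas_continuous vb xb dv z)
  next
    fix s :: real and y z :: 'x assume s: "s \<in> {0..1}"
    have "norm (fderiv F (xb s, vb s) (y - z, 0)) \<le> K * norm (y - z, 0::'v)"
      by (rule norm_fderiv_blinfun_le) (use K(2) s in blast)
    then show "norm (fderiv F (xb s, vb s) (y, dv s) - fderiv F (xb s, vb s) (z, dv s)) \<le> K * norm (y - z)"
      by (simp add: norm_Pair flip: blinfun.diff_right)
  next
    fix s :: real assume s: "s \<in> {0..1}"
    have "norm (fderiv F (xb s, vb s) (0, dv s)) \<le> K * norm (0::'x, dv s)"
      by (rule norm_fderiv_blinfun_le) (use K(2) s in blast)
    also have "\<dots> \<le> K * M" using M s K(1) by (simp add: norm_Pair)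
    finally show "norm (fderiv F (xb s, vb s) (0, dv s)) \<le> K * M" .
  qed (rule that)
qed

text \<open>Only the L1 norm of the control appears, and \<open>dx\<close> need not be Lipschitz:
  the bound is applied to the difference between a square integrable direction and its truncations,
  which is unbounded in general but tends to 0 in L1.\<close>

lemma linear_bound:
  fixes F :: "'x::euclidean_space \<times> 'v::euclidean_space \<Rightarrow> 'x"
  assumes F: "C2 F" and vb: "bmeas vb" and xb: "bmeas xb"
  obtains C where "0 < C"
    "\<forall>dx dv. abs_cont_on 0 1 dx \<longrightarrow> continuous_on {0..1} dx \<longrightarrow>
      (AE s in leb01. (dx has_vector_derivative fderiv F (xb s, vb s) (dx s, dv s)) (at s within {0..1})) \<longrightarrow>
      (\<lambda>s. norm (dv s)) integrable_on {0..1} \<longrightarrow>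
      (\<forall>t\<in>{0..1}. norm (dx t) \<le> C * (norm (dx 0) + integral {0..1} (\<lambda>s. norm (dv s))))"
proof -
  obtain K where K: "0 < K"
    "\<forall>s\<in>{0..1}. norm (fderiv F (xb s, vb s)) \<le> K \<and> norm (fderiv2 F (xb s, vb s)) \<le> K"
    by (rule C2_path_constants[OF F xb vb])
  define C where "C = (1 + K) * exp K"
  have C: "0 < C" using K(1) by (simp add: C_def)
  have "norm (dx t) \<le> C * (norm (dx 0) + integral {0..1} (\<lambda>s. norm (dv s)))"
    if ac: "abs_cont_on 0 1 dx" and co: "continuous_on {0..1} dx"
      and de: "AE s in leb01. (dx has_vector_derivative fderiv F (xb s, vb s) (dx s, dv s)) (at s within {0..1})"
      and dv: "(\<lambda>s. norm (dv s)) integrable_on {0..1}" and t: "t \<in> {0..1}" for dx dv t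
  proof -
    let ?I = "integral {0..1} (\<lambda>s. norm (dv s))"
    have "norm (fderiv F (xb s, vb s) (dx s, dv s)) \<le> K * norm (dx s) + K * norm (dv s)" if "s \<in> {0..1}" for s
    proof -
      have "norm (fderiv F (xb s, vb s) (dx s, dv s)) \<le> K * norm (dx s, dv s)"
        by (rule norm_fderiv_blinfun_le) (use K(2) that in blast)
      also have "\<dots> \<le> K * (norm (dx s) + norm (dv s))" using K(1) norm_Pair_le by (intro mult_left_mono) auto
      finally show ?thesis by (simp add: algebra_simps)
    qed
    then have ae: "AE s in leb01. norm (fderiv F (xb s, vb s) (dx s, dv s)) \<le> K * norm (dx s) + K * norm (dv s)"
      using AE_space by (auto elim: eventually_mono)
    have "norm (dx t) \<le> (norm (dx 0) + integral {0..1} (\<lambda>s. K * norm (dv s))) * exp K"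
      by (rule gronwall[OF ac co de ae integrable_on_mult_right[OF dv] _ _ t]) (use K(1) in auto)
    also have "\<dots> = (norm (dx 0) + K * ?I) * exp K" by simp
    also have "\<dots> \<le> ((1 + K) * (norm (dx 0) + ?I)) * exp K"
    proof (rule mult_right_mono)
      have "0 \<le> ?I" by (rule integral_nonneg[OF dv]) simp
      then show "norm (dx 0) + K * ?I \<le> (1 + K) * (norm (dx 0) + ?I)" using K(1) by (simp add: algebra_simps)
    qed simp
    finally show ?thesis by (simp add: C_def algebra_simps)
  qed
  then show ?thesis by (intro that[OF C]) blast
qed

section \<open>The adjoint equation and its duality identities\<close>

definition fderiv_adj :: "('x::euclidean_space \<times> 'v::euclidean_space \<Rightarrow> 'x) \<Rightarrow> 'x \<times> 'v \<Rightarrow> 'x \<Rightarrow> 'x"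
  where "fderiv_adj F z p = (\<Sum>b\<in>Basis. (p \<bullet> fderiv F z (b, 0)) *\<^sub>R b)"

lemma fderiv_adj_inner: "fderiv_adj F z p \<bullet> h = p \<bullet> fderiv F z (h, 0)"
proof -
  have bl: "linear (\<lambda>h. p \<bullet> fderiv F z (h, 0))"
    by (intro bounded_linear.linear bounded_linear_inner_right_comp bounded_linear_compose[OF blinfun.bounded_linear_right]
      bounded_linear_Pair bounded_linear_ident bounded_linear_zero)
  have "p \<bullet> fderiv F z (h, 0) = (\<lambda>h. p \<bullet> fderiv F z (h, 0)) (\<Sum>b\<in>Basis. (h \<bullet> b) *\<^sub>R b)"
    by (simp add: euclidean_representation)
  also have "\<dots> = (\<Sum>b\<in>Basis. (h \<bullet> b) * (p \<bullet> fderiv F z (b, 0)))"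
    by (subst linear_sum[OF bl]) (simp add: linear_scale[OF bl])
  also have "\<dots> = fderiv_adj F z p \<bullet> h"
    unfolding fderiv_adj_def inner_sum_left
    by (rule sum.cong[OF refl]) (simp add: inner_commute[of h])
  finally show ?thesis by simp
qed

lemma fderiv_adj_linear:
  "fderiv_adj F z (p + q) = fderiv_adj F z p + fderiv_adj F z q"
  "fderiv_adj F z (p - q) = fderiv_adj F z p - fderiv_adj F z q"
  "fderiv_adj F z (c *\<^sub>R p) = c *\<^sub>R fderiv_adj F z p"
  by (simp_all add: fderiv_adj_def inner_add_left inner_diff_left algebra_simps sum.distrib sum_subtractf scaleR_sum_right)

lemma norm_fderiv_adj_le:
  assumes "norm (fderiv F z) \<le> K"
  shows "norm (fderiv_adj F z p) \<le> K * norm p"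
proof -
  let ?q = "fderiv_adj F z p"
  have "(norm ?q)\<^sup>2 = p \<bullet> fderiv F z (?q, 0)" by (simp add: power2_norm_eq_inner fderiv_adj_inner)
  also have "\<dots> \<le> norm p * norm (fderiv F z (?q, 0))" by (rule norm_cauchy_schwarz)
  also have "\<dots> \<le> norm p * (K * norm (?q, 0 :: 'b))"
    by (intro mult_left_mono norm_fderiv_blinfun_le assms) simp
  finally have "norm ?q * norm ?q \<le> (K * norm p) * norm ?q" by (simp add: norm_Pair power2_eq_square algebra_simps)
  moreover have "0 \<le> K * norm p" using assms norm_ge_zero by (meson mult_nonneg_nonneg order_trans)
  ultimately show ?thesis by (cases "norm ?q = 0") (auto simp: mult_le_cancel_right)
qed

lemma bmeas_fderiv_adj:
  fixes F :: "'x::euclidean_space \<times> 'v::euclidean_space \<Rightarrow> 'x"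
  assumes F: "C2 F" and z: "bmeas z" and p: "bmeas p"
  shows "bmeas (\<lambda>s. fderiv_adj F (z s) (p s))"
  unfolding fderiv_adj_def
  by (intro bmeas_sum bmeas_scaleR bmeas_inner bmeas_fderiv bmeas_const F z p)

lemma adjoint_solution:
  fixes F :: "'x::euclidean_space \<times> 'v::euclidean_space \<Rightarrow> 'x"
  assumes F: "C2 F" and vb: "bmeas vb" and xb: "bmeas xb"
  obtains p where "p 1 = b" "lip_path p (\<lambda>s. - fderiv_adj F (xb s, vb s) (p s))"
proof -
  obtain K where K: "0 < K"
    "\<forall>s\<in>{0..1}. norm (fderiv F (xb s, vb s)) \<le> K \<and> norm (fderiv2 F (xb s, vb s)) \<le> K"
    by (rule C2_path_constants[OF F xb vb])
  obtain q where q: "q 0 = b" "lip_path q (\<lambda>s. fderiv_adj F (xb (1 - s), vb (1 - s)) (q s))"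
  proof (rule picard[of "\<lambda>s y. fderiv_adj F (xb (1 - s), vb (1 - s)) y" K 0 b])
    fix z :: "real \<Rightarrow> 'x" assume z: "continuous_on {0..1} z"
    show "(\<lambda>s. fderiv_adj F (xb (1 - s), vb (1 - s)) (z s)) \<in> borel_measurable leb01"
      by (intro bmeasD1 bmeas_fderiv_adj[OF F] bmeas_Pair bmeas_continuous bmeas_reverse vb xb z)
  next
    fix s :: real and y z :: 'x assume s: "s \<in> {0..1}"
    then have "1 - s \<in> {0..1}" by simp
    then show "norm (fderiv_adj F (xb (1 - s), vb (1 - s)) y - fderiv_adj F (xb (1 - s), vb (1 - s)) z) \<le> K * norm (y - z)"
      using K(2) by (subst fderiv_adj_linear(2)[symmetric]) (intro norm_fderiv_adj_le, blast)
  next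
    show "norm (fderiv_adj F (xb (1 - s), vb (1 - s)) 0) \<le> 0" for s by (simp add: fderiv_adj_def)
  qed
  show ?thesis
  proof (rule that[of "\<lambda>s. q (1 - s)"])
    show "lip_path (\<lambda>s. q (1 - s)) (\<lambda>s. - fderiv_adj F (xb s, vb s) (q (1 - s)))"
      using lip_path_reverse[OF q(2)] by simp
  qed (use q in simp)
qed

text \<open>The costate in \<open>Omega\<close> is an arbitrary absolutely continuous solution
  picked by \<open>SOME\<close>; this lemma identifies its components with the Lipschitz ones
  constructed here.\<close>

lemma adjoint_unique:
  fixes F :: "'x::euclidean_space \<times> 'v::euclidean_space \<Rightarrow> 'x"
  assumes F: "C2 F" and vb: "bmeas vb" and xb: "bmeas xb"
    and p: "abs_cont_on 0 1 p" "continuous_on {0..1} p"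
      "AE s in leb01. (p has_vector_derivative - fderiv_adj F (xb s, vb s) (p s)) (at s within {0..1})"
    and q: "lip_path q (\<lambda>s. - fderiv_adj F (xb s, vb s) (q s))" and eq: "p 1 = q 1" and t: "t \<in> {0..1}"
  shows "p t = q t"
proof -
  obtain K where K: "0 < K"
    "\<forall>s\<in>{0..1}. norm (fderiv F (xb s, vb s)) \<le> K \<and> norm (fderiv2 F (xb s, vb s)) \<le> K"
    by (rule C2_path_constants[OF F xb vb])
  obtain B where B: "0 < B" "\<forall>s\<in>{0..1}. norm (p s) \<le> B" by (rule bmeas_boundE[OF bmeas_continuous[OF p(2)]])
  \<comment> \<open>The equation itself bounds the derivative, so an absolutely continuous solution
    is already Lipschitz.\<close>
  have pL: "lip_path p (\<lambda>s. - fderiv_adj F (xb s, vb s) (p s))"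
  proof (rule lip_pathI_integral[where B="K * B"])
    have "bmeas (\<lambda>s. (-1) *\<^sub>R fderiv_adj F (xb s, vb s) (p s))"
      by (intro bmeas_scaleR bmeas_const bmeas_fderiv_adj F bmeas_Pair vb xb bmeas_continuous[OF p(2)])
    then show "(\<lambda>s. - fderiv_adj F (xb s, vb s) (p s)) \<in> borel_measurable leb01"
      by (simp add: bmeas_def)
    show "norm (- fderiv_adj F (xb s, vb s) (p s)) \<le> K * B" if "s \<in> {0..1}" for s
    proof -
      have "norm (fderiv_adj F (xb s, vb s) (p s)) \<le> K * norm (p s)" using K(2) that by (intro norm_fderiv_adj_le) blast
      also have "\<dots> \<le> K * B" using B(2) that K(1) by (intro mult_left_mono) auto
      finally show ?thesis by simp
    qed
    show "((\<lambda>s. - fderiv_adj F (xb s, vb s) (p s)) has_integral p t - p 0) {0..t}" if "t \<in> {0..1}" for t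
      by (rule abs_cont_on_has_integral_subinterval[OF p(1,3)]) (use that in auto)
  qed
  from lip_path_reverse[OF lip_path_diff[OF pL q]]
  have r: "lip_path (\<lambda>s. p (1 - s) - q (1 - s))
     (\<lambda>s. fderiv_adj F (xb (1 - s), vb (1 - s)) (p (1 - s) - q (1 - s)))"
    by (simp add: fderiv_adj_linear)
  have "norm (fderiv_adj F (xb (1 - s), vb (1 - s)) (p (1 - s) - q (1 - s))) \<le> K * norm (p (1 - s) - q (1 - s)) + 0"
    if "s \<in> {0..1}" for s
    using K(2) that by (simp add: norm_fderiv_adj_le)
  then have "AE s in leb01. norm (fderiv_adj F (xb (1 - s), vb (1 - s)) (p (1 - s) - q (1 - s)))
      \<le> K * norm (p (1 - s) - q (1 - s)) + 0"
    using AE_space by (auto elim: eventually_mono)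
  from lip_path_gronwall[OF r this, of "1 - t"] K(1) t eq show ?thesis by simp
qed

text \<open>Integration by parts. The adjoint state cancels the part of \<open>d\<close> that is
  linear in \<open>D\<close>, for every Lipschitz \<open>D\<close>; this is why the second order
  term of a perturbed trajectory never has to be computed.\<close>

lemma adjoint_identity:
  fixes F :: "'x::euclidean_space \<times> 'v::euclidean_space \<Rightarrow> 'x"
  assumes p: "lip_path p (\<lambda>s. - fderiv_adj F (xb s, vb s) (p s))" and D: "lip_path D d"
  shows "((\<lambda>s. p s \<bullet> (d s - fderiv F (xb s, vb s) (D s, 0))) has_integral (p 1 \<bullet> D 1 - p 0 \<bullet> D 0)) {0..1}"
proof -
  from lip_path_has_integral[OF lip_path_inner[OF p D], of 0 1]
  show ?thesis by (simp add: fderiv_adj_inner inner_diff_right)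
qed

lemma adjoint_linear_identity:
  fixes F :: "'x::euclidean_space \<times> 'v::euclidean_space \<Rightarrow> 'x"
  assumes p: "lip_path p (\<lambda>s. - fderiv_adj F (xb s, vb s) (p s))"
    and dx: "lip_path dx (\<lambda>s. fderiv F (xb s, vb s) (dx s, dv s))"
  shows "integral {0..1} (\<lambda>s. p s \<bullet> fderiv F (xb s, vb s) (0, dv s)) = p 1 \<bullet> dx 1 - p 0 \<bullet> dx 0"
proof -
  have "p s \<bullet> (fderiv F (xb s, vb s) (dx s, dv s) - fderiv F (xb s, vb s) (dx s, 0)) = p s \<bullet> fderiv F (xb s, vb s) (0, dv s)" for s
    by (simp flip: blinfun.diff_right)
  with adjoint_identity[OF p dx] show ?thesis by (simp add: integral_unique)
qed

section \<open>Second order expansion of perturbed trajectories\<close>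

lemma mult_left_mono3:
  fixes K :: real
  shows "0 \<le> K \<Longrightarrow> a \<le> a' \<Longrightarrow> b \<le> b' \<Longrightarrow> 0 \<le> a' \<Longrightarrow> 0 \<le> b \<Longrightarrow> K * a * b \<le> K * a' * b'"
  by (intro mult_mono mult_left_mono) auto

lemma taylor_quotient_split:
  fixes p :: "'a::real_inner"
  assumes "\<sigma> \<noteq> 0" and AH: "AH = a + \<sigma> *\<^sub>R d + \<sigma>\<^sup>2 *\<^sub>R w"
  shows "(p \<bullet> (X - Z - a) - \<sigma> * (p \<bullet> d)) / \<sigma>\<^sup>2 - (p \<bullet> w + 1/2 * (p \<bullet> b))
    = (p \<bullet> ((X - Z - AH - (1/2) *\<^sub>R B) + (1/2) *\<^sub>R (B - \<sigma>\<^sup>2 *\<^sub>R b))) / \<sigma>\<^sup>2"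
  using assms(1) unfolding AH inner_add_right inner_diff_right inner_scaleR_right
  by (simp add: field_simps)

text \<open>Tested with the adjoint state, the deviation of the trajectory leaves only its control
  part and the second derivative of \<open>F\<close>; in the latter the deviation may be replaced by
  its linear part. Hence an estimate of order \<open>\<sigma>\<^sup>2\<close> for the state
  suffices.\<close>

lemma second_order_expansion:
  fixes F :: "'x::euclidean_space \<times> 'v::euclidean_space \<Rightarrow> 'x"
  assumes F: "C2 F" and vb: "bmeas vb" and xb: "lip_path xb (\<lambda>s. F (xb s, vb s))"
    and p: "lip_path p (\<lambda>s. - fderiv_adj F (xb s, vb s) (p s))"
    and dv: "bmeas dv" and w: "bmeas w"
    and dx: "bmeas dx"
    and \<sigma>0: "0 < \<sigma>0" and C0: "0 < C0"
    and x: "\<And>\<sigma>. 0 < \<sigma> \<Longrightarrow> \<sigma> < \<sigma>0 \<Longrightarrow> lip_path (x \<sigma>) (\<lambda>s. F (x \<sigma> s, vb s + \<sigma> *\<^sub>R dv s + \<sigma>\<^sup>2 *\<^sub>R w s))"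
    and close: "\<And>\<sigma> s. 0 < \<sigma> \<Longrightarrow> \<sigma> < \<sigma>0 \<Longrightarrow> s \<in> {0..1} \<Longrightarrow> norm (x \<sigma> s - xb s - \<sigma> *\<^sub>R dx s) \<le> C0 * \<sigma>\<^sup>2"
  shows "((\<lambda>\<sigma>. (p 1 \<bullet> (x \<sigma> 1 - xb 1) - p 0 \<bullet> (x \<sigma> 0 - xb 0)
      - \<sigma> * integral {0..1} (\<lambda>s. p s \<bullet> fderiv F (xb s, vb s) (0, dv s))) / \<sigma>\<^sup>2)
    \<longlongrightarrow> integral {0..1} (\<lambda>s. p s \<bullet> fderiv F (xb s, vb s) (0, w s))
      + 1/2 * integral {0..1} (\<lambda>s. p s \<bullet> fderiv2 F (xb s, vb s) (dx s, dv s) (dx s, dv s))) (at_right 0)"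
    (is "(?f \<longlongrightarrow> ?l) _")
proof -
  let ?z = "\<lambda>s. (xb s, vb s)"
  let ?h = "\<lambda>s. (dx s, dv s)"
  have xm: "bmeas xb" by (rule bmeas_lip_path[OF xb])
  have pm: "bmeas p" by (rule bmeas_lip_path[OF p])
  obtain K where K: "0 < K"
    "\<forall>s\<in>{0..1}. norm (fderiv F (xb s, vb s)) \<le> K \<and> norm (fderiv2 F (xb s, vb s)) \<le> K"
    by (rule C2_path_constants[OF F xm vb])
  obtain P where P: "0 < P" "\<forall>s\<in>{0..1}. norm (p s) \<le> P" by (rule bmeas_boundE[OF pm])
  obtain Q where Q: "0 < Q" "\<forall>s\<in>{0..1}. norm (dx s, dv s) \<le> Q" by (rule bmeas_boundE[OF bmeas_Pair[OF dx dv]])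
  obtain W where W: "0 < W" "\<forall>s\<in>{0..1}. norm (w s) \<le> W" by (rule bmeas_boundE[OF w])
  obtain R where R: "0 < R" "\<forall>s\<in>{0..1}. norm (?z s) \<le> R" by (rule bmeas_boundE[OF bmeas_Pair[OF xm vb]])
  \<comment> \<open>\<open>A * \<sigma>\<^sup>2\<close> bounds the distance of state and control
    together from their linear parts.\<close>
  define A where "A = C0 + W"
  have A: "0 < A" using C0 W by (simp add: A_def)
  let ?I1 = "\<lambda>s. p s \<bullet> fderiv F (?z s) (0, dv s)"
  let ?I2 = "\<lambda>s. p s \<bullet> fderiv F (?z s) (0, w s)"
  let ?I3 = "\<lambda>s. p s \<bullet> fderiv2 F (?z s) (?h s) (?h s)"
  have int: "?I1 integrable_on {0..1}" "?I2 integrable_on {0..1}" "?I3 integrable_on {0..1}"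
    by (intro bmeas_integrable bmeas_inner pm bmeas_fderiv bmeas_fderiv2 F bmeas_Pair xm vb dx dv w bmeas_const)+
  have est: "norm (?f \<sigma> - ?l) \<le> P * (e * (Q + A * \<sigma>)\<^sup>2 + K * (Q + A * \<sigma>) * A * \<sigma>)"
    if \<sigma>: "0 < \<sigma>" "\<sigma> < \<sigma>0" and e: "0 < e" and d: "\<sigma> * (Q + A * \<sigma>) \<le> d"
      and tay: "\<forall>x h. norm x \<le> R \<longrightarrow> norm h \<le> d \<longrightarrow>
        norm (F (x + h) - F x - fderiv F x h - (1/2) *\<^sub>R fderiv2 F x h h) \<le> e * (norm h)\<^sup>2" for \<sigma> e d
  proof -
    let ?v = "\<lambda>s. vb s + \<sigma> *\<^sub>R dv s + \<sigma>\<^sup>2 *\<^sub>R w s"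
    let ?D = "\<lambda>s. x \<sigma> s - xb s"
    let ?H = "\<lambda>s. (?D s, \<sigma> *\<^sub>R dv s + \<sigma>\<^sup>2 *\<^sub>R w s)"
    have "((\<lambda>s. p s \<bullet> (F (x \<sigma> s, ?v s) - F (?z s) - fderiv F (?z s) (?D s, 0))) has_integral
        (p 1 \<bullet> ?D 1 - p 0 \<bullet> ?D 0)) {0..1}"
      by (rule adjoint_identity[OF p lip_path_diff[OF x[OF \<sigma>] xb]])
    then have "((\<lambda>s. (p s \<bullet> (F (x \<sigma> s, ?v s) - F (?z s) - fderiv F (?z s) (?D s, 0)) - \<sigma> * ?I1 s) / \<sigma>\<^sup>2 - (?I2 s + 1/2 * ?I3 s))
        has_integral (?f \<sigma> - ?l)) {0..1}"
      by (intro has_integral_diff has_integral_divide has_integral_add has_integral_mult_right integrable_integral int)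
    then have "norm (?f \<sigma> - ?l) \<le> P * (e * (Q + A * \<sigma>)\<^sup>2 + K * (Q + A * \<sigma>) * A * \<sigma>) * measure lborel (cbox 0 (1::real))"
      unfolding box_real[symmetric]
    proof (rule has_integral_bound[rotated])
      show "0 \<le> P * (e * (Q + A * \<sigma>)\<^sup>2 + K * (Q + A * \<sigma>) * A * \<sigma>)" using P Q A K e \<sigma> by simp
      fix s :: real assume "s \<in> cbox 0 1"
      then have s: "s \<in> {0..1}" by simp
      have H: "norm (?H s - \<sigma> *\<^sub>R ?h s) \<le> A * \<sigma>\<^sup>2"
      proof -
        have "norm (?H s - \<sigma> *\<^sub>R ?h s) = norm (?D s - \<sigma> *\<^sub>R dx s, \<sigma>\<^sup>2 *\<^sub>R w s)" by simp
        also have "\<dots> \<le> norm (?D s - \<sigma> *\<^sub>R dx s) + norm (\<sigma>\<^sup>2 *\<^sub>R w s)" by (rule norm_Pair_le)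
        also have "\<dots> \<le> C0 * \<sigma>\<^sup>2 + W * \<sigma>\<^sup>2"
        proof (rule add_mono[OF close[OF \<sigma> s]])
          have "norm (w s) \<le> W" using W(2) s by blast
          from mult_right_mono[OF this, of "\<sigma>\<^sup>2"] show "norm (\<sigma>\<^sup>2 *\<^sub>R w s) \<le> W * \<sigma>\<^sup>2" by (simp add: mult.commute)
        qed
        finally show ?thesis by (simp add: A_def algebra_simps)
      qed
      have hQ: "norm (?h s) \<le> Q" using Q(2) s by blast
      have hn: "norm (\<sigma> *\<^sub>R ?h s) \<le> \<sigma> * Q"
        unfolding norm_scaleR using mult_left_mono[OF hQ, of "\<sigma>"] \<sigma> by (simp only: abs_of_pos less_imp_le)
      have Hn: "norm (?H s) \<le> \<sigma> * (Q + A * \<sigma>)"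
      proof -
        have "norm (?H s) \<le> norm (\<sigma> *\<^sub>R ?h s) + norm (?H s - \<sigma> *\<^sub>R ?h s)" by (rule norm_triangle_sub)
        also have "\<dots> \<le> \<sigma> * Q + A * \<sigma>\<^sup>2" by (rule add_mono[OF hn H])
        also have "\<dots> = \<sigma> * (Q + A * \<sigma>)" by (simp add: algebra_simps power2_eq_square)
        finally show ?thesis .
      qed
      have eqF: "F (x \<sigma> s, ?v s) = F (?z s + ?H s)" by (simp add: algebra_simps)
      let ?r = "F (?z s + ?H s) - F (?z s) - fderiv F (?z s) (?H s) - (1/2) *\<^sub>R fderiv2 F (?z s) (?H s) (?H s)"
      have zR: "norm (?z s) \<le> R" using R(2) s by blast
      have r: "norm ?r \<le> e * (\<sigma> * (Q + A * \<sigma>))\<^sup>2"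
      proof -
        have "norm (?H s) \<le> d" using Hn d by (rule order_trans)
        with tay zR have "norm ?r \<le> e * (norm (?H s))\<^sup>2" by blast
        also have "\<dots> \<le> e * (\<sigma> * (Q + A * \<sigma>))\<^sup>2"
          by (rule mult_left_mono[OF power_mono[OF Hn norm_ge_zero] less_imp_le[OF e]])
        finally show ?thesis .
      qed
      let ?B = "fderiv2 F (?z s)"
      have B: "norm (?B h k) \<le> K * norm h * norm k" for h k
      proof -
        have "norm (?B h) \<le> K * norm h" by (rule norm_fderiv_blinfun_le) (use K(2) s in blast)
        then show ?thesis by (rule norm_fderiv_blinfun_le)
      qed
      let ?q = "?B (?H s) (?H s) - \<sigma>\<^sup>2 *\<^sub>R ?B (?h s) (?h s)"
      define b where "b = \<sigma> * (Q + A * \<sigma>)"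
      have b0: "0 \<le> b" using \<sigma> Q A by (simp add: b_def)
      have Qb: "\<sigma> * Q \<le> b" using \<sigma> A unfolding b_def by (intro mult_left_mono) simp_all
      have q: "norm ?q \<le> 2 * (K * b * (A * \<sigma>\<^sup>2))"
      proof -
        \<comment> \<open>Polarisation: each term pairs a factor of order
          \<open>\<sigma>\<^sup>2\<close> with one of order \<open>\<sigma>\<close>, so the
          difference is negligible against \<open>\<sigma>\<^sup>2\<close>.\<close>
        have eq: "?q = ?B (?H s - \<sigma> *\<^sub>R ?h s) (?H s) + ?B (\<sigma> *\<^sub>R ?h s) (?H s - \<sigma> *\<^sub>R ?h s)"
          unfolding blinfun.diff_left blinfun.diff_right blinfun.scaleR_left blinfun.scaleR_right
          by (simp add: power2_eq_square)
        have 1: "norm (?B (?H s - \<sigma> *\<^sub>R ?h s) (?H s)) \<le> K * b * (A * \<sigma>\<^sup>2)"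
        proof -
          have "K * norm (?H s - \<sigma> *\<^sub>R ?h s) * norm (?H s) \<le> K * (A * \<sigma>\<^sup>2) * b"
            unfolding b_def by (rule mult_left_mono3[OF _ H Hn]) (use K(1) A in simp_all)
          with B[of "?H s - \<sigma> *\<^sub>R ?h s" "?H s"] show ?thesis by (simp only: ac_simps)
        qed
        have 2: "norm (?B (\<sigma> *\<^sub>R ?h s) (?H s - \<sigma> *\<^sub>R ?h s)) \<le> K * b * (A * \<sigma>\<^sup>2)"
        proof -
          have "K * norm (\<sigma> *\<^sub>R ?h s) * norm (?H s - \<sigma> *\<^sub>R ?h s) \<le> K * b * (A * \<sigma>\<^sup>2)"
            by (rule mult_left_mono3[OF _ order_trans[OF hn Qb] H]) (use K(1) b0 in simp_all)
          with B[of "\<sigma> *\<^sub>R ?h s" "?H s - \<sigma> *\<^sub>R ?h s"] show ?thesis by (rule order_trans)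
        qed
        show ?thesis unfolding eq using norm_triangle_le[OF add_mono[OF 1 2]] by (simp only: mult_2)
      qed
      have AH: "fderiv F (?z s) (?H s) = fderiv F (?z s) (?D s, 0) + \<sigma> *\<^sub>R fderiv F (?z s) (0, dv s) + \<sigma>\<^sup>2 *\<^sub>R fderiv F (?z s) (0, w s)"
      proof -
        have "?H s = (?D s, 0) + \<sigma> *\<^sub>R (0, dv s) + \<sigma>\<^sup>2 *\<^sub>R (0, w s)" by simp
        then show ?thesis by (simp only: blinfun.add_right blinfun.scaleR_right)
      qed
      have split: "(p s \<bullet> (F (x \<sigma> s, ?v s) - F (?z s) - fderiv F (?z s) (?D s, 0)) - \<sigma> * ?I1 s) / \<sigma>\<^sup>2 - (?I2 s + 1/2 * ?I3 s)
          = (p s \<bullet> (?r + (1/2) *\<^sub>R ?q)) / \<sigma>\<^sup>2"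
        unfolding eqF by (rule taylor_quotient_split[OF _ AH]) (use \<sigma> in simp)
      have n: "norm (?r + (1/2) *\<^sub>R ?q) \<le> e * b\<^sup>2 + K * b * (A * \<sigma>\<^sup>2)"
      proof -
        have "norm ((1/2) *\<^sub>R ?q) \<le> K * b * (A * \<sigma>\<^sup>2)" using q by simp
        from norm_triangle_le[OF add_mono[OF r this]] show ?thesis by (simp only: b_def)
      qed
      have "norm (p s \<bullet> (?r + (1/2) *\<^sub>R ?q)) \<le> norm (p s) * norm (?r + (1/2) *\<^sub>R ?q)"
        using Cauchy_Schwarz_ineq2 by simp
      also have "\<dots> \<le> P * (e * b\<^sup>2 + K * b * (A * \<sigma>\<^sup>2))"
        by (rule mult_mono[OF _ n]) (use P s in auto)
      finally have "norm ((p s \<bullet> (?r + (1/2) *\<^sub>R ?q)) / \<sigma>\<^sup>2) \<le> P * (e * b\<^sup>2 + K * b * (A * \<sigma>\<^sup>2)) / \<sigma>\<^sup>2"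
        unfolding norm_divide by (simp add: divide_right_mono)
      also have "\<dots> = P * (e * (Q + A * \<sigma>)\<^sup>2 + K * (Q + A * \<sigma>) * A * \<sigma>)"
        using \<sigma>(1) unfolding b_def by (simp add: field_simps power2_eq_square)
      finally show "norm ((p s \<bullet> (F (x \<sigma> s, ?v s) - F (?z s) - fderiv F (?z s) (?D s, 0)) - \<sigma> * ?I1 s) / \<sigma>\<^sup>2 - (?I2 s + 1/2 * ?I3 s))
          \<le> P * (e * (Q + A * \<sigma>)\<^sup>2 + K * (Q + A * \<sigma>) * A * \<sigma>)"
        unfolding split .
    qed
    then show ?thesis by simp
  qed
  show ?thesis
  proof (rule tendstoI)
    fix \<epsilon> :: real assume \<epsilon>: "0 < \<epsilon>"
    \<comment> \<open>The Taylor error contributes at most \<open>P * e * (Q + A)\<^sup>2\<close>,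
      which is half of \<open>\<epsilon>\<close>; the last entry of \<open>\<sigma>1\<close> spends
      the other half on the polarisation error.\<close>
    define e where "e = \<epsilon> / (2 * P * (Q + A)\<^sup>2)"
    have e: "0 < e" using \<epsilon> P Q A by (simp add: e_def)
    obtain d where d: "0 < d" "\<forall>x h. norm x \<le> R \<longrightarrow> norm h \<le> d \<longrightarrow>
        norm (F (x + h) - F x - fderiv F x h - (1/2) *\<^sub>R fderiv2 F x h h) \<le> e * (norm h)\<^sup>2"
      by (rule C2_taylor2[OF F e])
    define \<sigma>1 where "\<sigma>1 = min (min \<sigma>0 1) (min (d / (Q + A)) (\<epsilon> / (2 * P * K * (Q + A) * A)))"
    have \<sigma>1: "0 < \<sigma>1" using \<sigma>0 d \<epsilon> P K Q A by (simp add: \<sigma>1_def)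
    have "dist (?f \<sigma>) ?l < \<epsilon>" if \<sigma>: "0 < \<sigma>" "\<sigma> < \<sigma>1" for \<sigma>
    proof -
      have s: "\<sigma> < \<sigma>0" "\<sigma> < 1" "\<sigma> < d / (Q + A)" "\<sigma> < \<epsilon> / (2 * P * K * (Q + A) * A)" using \<sigma> by (auto simp: \<sigma>1_def)
      have le: "Q + A * \<sigma> \<le> Q + A" using s(2) A by simp
      have "\<sigma> * (Q + A * \<sigma>) \<le> \<sigma> * (Q + A)" using le \<sigma> by (intro mult_left_mono) auto
      also have "\<dots> \<le> d" using s(3) Q A by (simp add: field_simps)
      finally have "norm (?f \<sigma> - ?l) \<le> P * (e * (Q + A * \<sigma>)\<^sup>2 + K * (Q + A * \<sigma>) * A * \<sigma>)"
        by (rule est[OF \<sigma>(1) s(1) e _ d(2)])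
      also have "\<dots> \<le> P * (e * (Q + A)\<^sup>2 + K * (Q + A) * A * \<sigma>)"
        using le P K A Q \<sigma> e by (intro mult_left_mono add_mono mult_right_mono power_mono) auto
      also have "\<dots> = \<epsilon>/2 + (P * K * (Q + A) * A) * \<sigma>"
        using P Q A by (simp add: e_def field_simps)
      also have "\<dots> < \<epsilon>/2 + \<epsilon>/2"
      proof -
        have "(P * K * (Q + A) * A) * \<sigma> < (P * K * (Q + A) * A) * (\<epsilon> / (2 * P * K * (Q + A) * A))"
          using s(4) P K Q A by (intro mult_strict_left_mono) auto
        also have "\<dots> = \<epsilon>/2" using P K Q A by simp
        finally show ?thesis by simp
      qed
      finally show ?thesis by (simp add: dist_norm)
    qed
    then show "eventually (\<lambda>\<sigma>. dist (?f \<sigma>) ?l < \<epsilon>) (at_right 0)"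
      unfolding eventually_at_right_field using \<sigma>1 by blast
  qed
qed

section \<open>Control constraints\<close>

lemma grad_inner:
  fixes f :: "'a::euclidean_space \<Rightarrow> real"
  assumes "C2 f"
  shows "grad f x \<bullet> h = fderiv f x h"
proof -
  define d where "d = (\<Sum>b\<in>Basis. fderiv f x b *\<^sub>R b)"
  have d: "fderiv f x h = h \<bullet> d" for h
  proof -
    have "fderiv f x h = fderiv f x (\<Sum>b\<in>Basis. (h \<bullet> b) *\<^sub>R b)" by (simp add: euclidean_representation)
    then show ?thesis by (simp add: blinfun.sum_right blinfun.scaleR_right d_def inner_sum_right mult.commute)
  qed
  have "blinfun_apply (fderiv f x) = (\<lambda>h. h \<bullet> d)" using d by blast
  then have "GDERIV f x :> d"
    using C2_has_derivative[OF assms, of x] by (simp add: gderiv_def)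
  moreover have "d' = d" if "GDERIV f x :> d'" for d'
  proof -
    have "(\<lambda>h. h \<bullet> d') = (\<lambda>h. h \<bullet> d)"
      using has_derivative_unique that \<open>GDERIV f x :> d\<close> unfolding gderiv_def by blast
    then have "(d' - d) \<bullet> d' = (d' - d) \<bullet> d" by metis
    then have "(d' - d) \<bullet> (d' - d) = 0" by (simp add: inner_diff_right)
    then show ?thesis by simp
  qed
  ultimately have "grad f x = d" unfolding grad_def by (rule the_equality)
  then show ?thesis by (simp add: d inner_commute)
qed

lemma C2_component: "C2 c \<Longrightarrow> C2 (\<lambda>u. c u $ i)"
  by (rule C2_linear_compose[OF bounded_linear_vec_nth])

lemma fderiv_component: "C2 c \<Longrightarrow> fderiv (\<lambda>u. c u $ i) x h = fderiv c x h $ i"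
  by (rule fderiv_linear_compose[OF bounded_linear_vec_nth])

lemma grad_component_inner:
  fixes c :: "'a::euclidean_space \<Rightarrow> real ^ 'l"
  shows "C2 c \<Longrightarrow> grad (\<lambda>u. c u $ i) x \<bullet> h = fderiv c x h $ i"
  by (simp add: grad_inner C2_component fderiv_component)

text \<open>The qualification as a property of a control value instead of a time. In this form it
  passes to both arcs and to modifications of the control on null sets.\<close>

definition grad_qualified :: "('a::euclidean_space \<Rightarrow> real ^ 'l) \<Rightarrow> real \<Rightarrow> real \<Rightarrow> 'a \<Rightarrow> bool"
  where "grad_qualified c \<epsilon> \<delta> u \<longleftrightarrow> (\<forall>\<xi> :: 'l \<Rightarrow> real. \<epsilon> * L2_set \<xi> {i. c u $ i \<ge> - \<delta>}
     \<le> norm (\<Sum>i\<in>{i. c u $ i \<ge> - \<delta>}. \<xi> i *\<^sub>R grad (\<lambda>u. c u $ i) u))"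

lemma borel_measurable_det:
  fixes A :: "'a \<Rightarrow> real ^ 'n ^ 'n"
  assumes "\<And>i j. (\<lambda>x. A x $ i $ j) \<in> borel_measurable M"
  shows "(\<lambda>x. det (A x)) \<in> borel_measurable M"
  unfolding det_def by (intro borel_measurable_sum borel_measurable_times borel_measurable_prod borel_measurable_const assms)

text \<open>Qualification makes the Gram matrix of the almost active gradients invertible, and
  solving with it gives combinations of these gradients dual to them. Cramer's rule writes the
  solution with determinants, so it is measurable in \<open>u\<close> although the set of almost
  active constraints jumps with \<open>u\<close>.\<close>

lemma qualified_right_inverse:
  fixes c :: "'a::euclidean_space \<Rightarrow> real ^ 'l"
  assumes c: "C2 c" and eps: "0 < \<epsilon>"
  obtains E :: "'a \<Rightarrow> 'l \<Rightarrow> 'a" where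
    "\<forall>i. (\<lambda>u. E u i) \<in> borel_measurable borel"
    "\<forall>u i. grad_qualified c \<epsilon> \<delta> u \<longrightarrow> c u $ i \<ge> - \<delta> \<longrightarrow> norm (E u i) \<le> 1 / \<epsilon>"
    "\<forall>u i k. grad_qualified c \<epsilon> \<delta> u \<longrightarrow> c u $ i \<ge> - \<delta> \<longrightarrow> c u $ k \<ge> - \<delta> \<longrightarrow>
       fderiv c u (E u i) $ k = (if k = i then 1 else 0)"
proof -
  define I where "I u = {i. c u $ i \<ge> - \<delta>}" for u
  define n where "n i u = grad (\<lambda>u. c u $ i) u" for i u
  \<comment> \<open>Padding with the identity on the remaining indices gives every \<open>u\<close>
    a matrix of the same size.\<close>
  define M :: "'a \<Rightarrow> real ^ 'l ^ 'l" where
    "M u = (\<chi> i j. if i \<in> I u \<and> j \<in> I u then n i u \<bullet> n j u else if i = j then 1 else 0)" for u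
  define Z :: "'a \<Rightarrow> 'l \<Rightarrow> real ^ 'l" where
    "Z u i = (\<chi> k. det (\<chi> a b. if b = k then (axis i 1 :: real ^ 'l) $ a else M u $ a $ b) / det (M u))" for u i
  define E where "E u i = (\<Sum>j\<in>UNIV. (if j \<in> I u then Z u i $ j else 0) *\<^sub>R n j u)" for u i
  have E': "E u i = (\<Sum>j\<in>I u. Z u i $ j *\<^sub>R n j u)" for u i
    unfolding E_def by (rule sum.mono_neutral_cong_right) auto
  have n: "n i u \<bullet> h = fderiv c u h $ i" for i u h
    unfolding n_def by (rule grad_component_inner[OF c])
  have neq: "n i u = (\<Sum>b\<in>Basis. (fderiv c u b $ i) *\<^sub>R b)" for i u
    by (rule euclidean_eqI) (simp add: n inner_sum_left inner_Basis if_distrib cong: if_cong)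
  have nc: "continuous_on UNIV (n i)" for i
    unfolding neq by (intro continuous_intros C2_continuous_fderiv[OF c])
  have nm: "n i \<in> borel_measurable borel" for i by (rule borel_measurable_continuous_onI[OF nc])
  have Im: "{u. i \<in> I u} \<in> sets borel" for i
  proof -
    have "(\<lambda>u. c u $ i) \<in> borel_measurable borel"
      by (rule borel_measurable_continuous_onI[OF C2_continuous[OF C2_component[OF c]]])
    then have "{u \<in> space borel. - \<delta> \<le> c u $ i} \<in> sets borel" by (intro borel_measurable_le) auto
    then show ?thesis by (simp add: I_def)
  qed
  have Ip: "Measurable.pred borel (\<lambda>u. i \<in> I u)" for i using Im[of i] by (simp add: pred_def)
  have Mm: "(\<lambda>u. M u $ i $ j) \<in> borel_measurable borel" for i j
    unfolding M_def using Ip[of i] Ip[of j] nm[of i] nm[of j] by simp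
  have Zm: "(\<lambda>u. Z u i $ k) \<in> borel_measurable borel" for i k
  proof -
    have "(\<lambda>u. det (\<chi> a b. if b = k then (axis i 1 :: real ^ 'l) $ a else M u $ a $ b)) \<in> borel_measurable borel"
    proof (rule borel_measurable_det)
      fix a b show "(\<lambda>u. (\<chi> a b. if b = k then (axis i 1 :: real ^ 'l) $ a else M u $ a $ b) $ a $ b) \<in> borel_measurable borel"
        using Mm[of a b] by (cases "b = k") auto
    qed
    then show ?thesis unfolding Z_def using borel_measurable_det[of M, OF Mm] by simp
  qed
  have Em: "(\<lambda>u. E u i) \<in> borel_measurable borel" for i
    unfolding E_def
    by (intro borel_measurable_sum borel_measurable_scaleR measurable_If Zm nm borel_measurable_const Ip[unfolded pred_def])
  have inv: "fderiv c u (E u i) $ k = (if k = i then 1 else 0)" "norm (E u i) \<le> 1 / \<epsilon>"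
    if q: "grad_qualified c \<epsilon> \<delta> u" and i: "i \<in> I u" and k: "k \<in> I u" for u i k
  proof -
    have qq: "\<epsilon> * L2_set \<xi> (I u) \<le> norm (\<Sum>i\<in>I u. \<xi> i *\<^sub>R n i u)" for \<xi> :: "'l \<Rightarrow> real"
      using q unfolding grad_qualified_def I_def n_def by blast
    have Mv: "(M u *v z) $ a = (if a \<in> I u then n a u \<bullet> (\<Sum>j\<in>I u. z $ j *\<^sub>R n j u) else z $ a)" for z a
    proof -
      have "(M u *v z) $ a = (\<Sum>j\<in>UNIV. (if a \<in> I u \<and> j \<in> I u then n a u \<bullet> n j u else if a = j then 1 else 0) * z $ j)"
        by (simp add: matrix_vector_mult_def M_def)
      also have "\<dots> = (if a \<in> I u then n a u \<bullet> (\<Sum>j\<in>I u. z $ j *\<^sub>R n j u) else z $ a)"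
      proof (cases "a \<in> I u")
        case True
        have "(\<Sum>j\<in>UNIV. (if a \<in> I u \<and> j \<in> I u then n a u \<bullet> n j u else if a = j then 1 else 0) * z $ j)
            = (\<Sum>j\<in>I u. (n a u \<bullet> n j u) * z $ j)"
          by (rule sum.mono_neutral_cong_right) (use True in auto)
        then show ?thesis using True by (simp add: inner_sum_right mult.commute)
      next
        case False
        have "(\<Sum>j\<in>UNIV. (if a \<in> I u \<and> j \<in> I u then n a u \<bullet> n j u else if a = j then 1 else 0) * z $ j)
            = (\<Sum>j\<in>{a}. z $ j)"
          by (rule sum.mono_neutral_cong_right) (use False in auto)
        then show ?thesis using False by simp
      qed
      finally show ?thesis .
    qed
    have ker: "z = 0" if z: "M u *v z = 0" for z
    proof -
      let ?x = "\<Sum>j\<in>I u. z $ j *\<^sub>R n j u"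
      have a: "n a u \<bullet> ?x = 0" if "a \<in> I u" for a using Mv[of z a] z that by simp
      have b: "z $ a = 0" if "a \<notin> I u" for a using Mv[of z a] z that by simp
      have "?x \<bullet> ?x = (\<Sum>j\<in>I u. z $ j * (n j u \<bullet> ?x))" by (simp add: inner_sum_left)
      also have "\<dots> = 0" by (rule sum.neutral) (simp add: a)
      finally have "?x = 0" by simp
      then have "\<epsilon> * L2_set (\<lambda>i. z $ i) (I u) \<le> 0" using qq[of "\<lambda>i. z $ i"] by simp
      then have "L2_set (\<lambda>i. z $ i) (I u) \<le> 0" using eps by (simp add: mult_le_0_iff)
      then have "L2_set (\<lambda>i. z $ i) (I u) = 0" using L2_set_nonneg[of "\<lambda>i. z $ i" "I u"] by linarith
      then have "z $ a = 0" if "a \<in> I u" for a using that by (simp add: L2_set_eq_0_iff)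
      with b show "z = 0" by (metis vec_eq_iff zero_index)
    qed
    have "det (M u) \<noteq> 0"
    proof -
      have "\<exists>B. B ** M u = mat 1" unfolding matrix_left_invertible_ker using ker by blast
      then have "invertible (M u)" by (simp add: invertible_left_inverse)
      then show ?thesis by (simp add: invertible_det_nz)
    qed
    then have MZ: "M u *v Z u i = axis i 1" unfolding Z_def by (subst cramer) auto
    have nE: "n a u \<bullet> E u i = (if a = i then 1 else 0)" if "a \<in> I u" for a
      using Mv[of "Z u i" a] that unfolding MZ E' by (simp add: axis_def)
    show "fderiv c u (E u i) $ k = (if k = i then 1 else 0)" using nE[OF k] by (simp add: n)
    \<comment> \<open>By duality the squared norm equals \<open>Z u i $ i\<close>, at most the norm
      of the coefficients, which qualification bounds by \<open>norm (E u i) / \<epsilon>\<close>;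
      one factor then cancels.\<close>
    have "(norm (E u i))\<^sup>2 = (\<Sum>j\<in>I u. Z u i $ j * (n j u \<bullet> E u i))"
      unfolding power2_norm_eq_inner by (subst E') (simp add: inner_sum_left)
    also have "\<dots> = (\<Sum>j\<in>I u. if j = i then Z u i $ i else 0)" by (rule sum.cong) (auto simp: nE)
    also have "\<dots> = Z u i $ i" using i by simp
    finally have 1: "(norm (E u i))\<^sup>2 = Z u i $ i" .
    have "Z u i $ i \<le> L2_set (\<lambda>j. Z u i $ j) (I u)" by (rule member_le_L2_set) (use i in auto)
    moreover have "\<epsilon> * L2_set (\<lambda>j. Z u i $ j) (I u) \<le> norm (E u i)" using qq[of "\<lambda>j. Z u i $ j"] by (simp only: E')
    ultimately have "\<epsilon> * (norm (E u i))\<^sup>2 \<le> norm (E u i)" using eps 1 by (metis mult_left_mono order_trans less_imp_le)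
    then have "\<epsilon> * norm (E u i) \<le> 1"
      by (cases "norm (E u i) = 0") (simp_all add: power2_eq_square)
    then show "norm (E u i) \<le> 1 / \<epsilon>" using eps by (simp add: field_simps)
  qed
  show ?thesis
  proof (rule that[of E])
    show "\<forall>i. (\<lambda>u. E u i) \<in> borel_measurable borel" using Em by blast
    show "\<forall>u i. grad_qualified c \<epsilon> \<delta> u \<longrightarrow> c u $ i \<ge> - \<delta> \<longrightarrow> norm (E u i) \<le> 1 / \<epsilon>"
      using inv(2) by (simp add: I_def)
    show "\<forall>u i k. grad_qualified c \<epsilon> \<delta> u \<longrightarrow> c u $ i \<ge> - \<delta> \<longrightarrow> c u $ k \<ge> - \<delta> \<longrightarrow>
       fderiv c u (E u i) $ k = (if k = i then 1 else 0)"
      using inv(1) by (simp add: I_def)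
  qed
qed

section \<open>Second order feasible corrections and the control multipliers\<close>

lemma bmeas_If:
  assumes "Measurable.pred leb01 P" "bmeas f" "bmeas g"
  shows "bmeas (\<lambda>s. if P s then f s else g s)"
proof -
  obtain M where M: "\<forall>s\<in>{0..1}. norm (f s) \<le> M" using assms by (auto simp: bmeas_def)
  obtain N where N: "\<forall>s\<in>{0..1}. norm (g s) \<le> N" using assms by (auto simp: bmeas_def)
  have "\<forall>s\<in>{0..1}. norm (if P s then f s else g s) \<le> max M N" using M N by (auto simp: le_max_iff_disj)
  moreover have "(\<lambda>s. if P s then f s else g s) \<in> borel_measurable leb01"
    by (rule measurable_If) (use assms bmeasD1 in \<open>auto simp: pred_def\<close>)
  ultimately show ?thesis unfolding bmeas_def by blast
qed

lemma bmeas_pred: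
  assumes "bmeas f" "bmeas g"
  shows "Measurable.pred leb01 (\<lambda>s. f s \<le> (g s :: real))"
    "Measurable.pred leb01 (\<lambda>s. f s < (g s :: real))"
  unfolding pred_def using assms
  by (intro borel_measurable_le borel_measurable_less bmeasD1; simp)+

lemma bmeas_vec:
  assumes "\<And>i. bmeas (f i)"
  shows "bmeas (\<lambda>s. (\<chi> i. f i s) :: real ^ 'n)"
proof -
  have "(\<chi> i. f i s) = (\<Sum>i\<in>UNIV. f i s *\<^sub>R (axis i 1 :: real ^ 'n))" for s
    using basis_expansion[of "(\<chi> i. f i s) :: real ^ 'n"] by (simp add: scalar_mult_eq_scaleR)
  then show ?thesis using assms by (simp add: bmeas_sum bmeas_scaleR bmeas_const)
qed

lemma bmeas_vec_nth: "bmeas f \<Longrightarrow> bmeas (\<lambda>s. f s $ i)" for f :: "real \<Rightarrow> real ^ 'n"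
  by (rule bmeas_linear[OF bounded_linear_vec_nth])

lemma integral_nonneg_AE_zero:
  fixes f :: "real \<Rightarrow> real"
  assumes f: "bmeas f" and le: "AE s in leb01. f s \<le> 0" and i: "0 \<le> integral {0..1} f"
  shows "AE s in leb01. f s = 0"
proof -
  let ?g = "\<lambda>s. - f s"
  have int: "integrable leb01 ?g" using bmeas_integrable(2)[OF f] by simp
  have ae: "AE s in leb01. 0 \<le> ?g s" using le by eventually_elim simp
  have "integral\<^sup>L leb01 ?g = - integral {0..1} f"
    using lebesgue_integral_eq_integral[OF bmeas_integrable(2)[OF f]] by simp
  then have "integral\<^sup>L leb01 ?g = 0" using integral_nonneg_AE[OF ae] i by linarith
  then have "AE s in leb01. ?g s = 0" using integral_nonneg_eq_0_iff_AE[OF int ae] by blast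
  then show ?thesis by simp
qed

text \<open>The expression is the coefficient of \<open>\<sigma>\<^sup>2\<close> in the expansion of
  \<open>c\<close> at \<open>v + \<sigma> dv + \<sigma>\<^sup>2 w\<close>. Both margins are uniform
  in time, \<open>\<epsilon>\<close> for what counts as active and \<open>\<rho>\<close> for the
  strict decrease, so that one \<open>\<sigma>\<close> can serve all times.\<close>

definition second_order_feasible where
  "second_order_feasible c v dv w \<longleftrightarrow> bmeas w \<and> (\<exists>\<epsilon>>0. \<exists>\<rho>>0. \<forall>s\<in>{0..1}. \<forall>i. c (v s) $ i \<ge> - \<epsilon> \<longrightarrow>
     fderiv c (v s) (w s) $ i + 1/2 * fderiv2 c (v s) (dv s) (dv s) $ i \<le> - \<rho>)"
  for c :: "'a::euclidean_space \<Rightarrow> real ^ 'l"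

text \<open>The quadratic term depends on \<open>dv\<close> alone, so the condition is affine in the
  correction. This is the source of the convexity behind the separation argument.\<close>

lemma second_order_feasible_convex:
  fixes c :: "'a::euclidean_space \<Rightarrow> real ^ 'l"
  assumes w: "second_order_feasible c v dv w" and w': "second_order_feasible c v dv w'" and t: "0 < t" "0 < t'" "t + t' = 1"
  shows "second_order_feasible c v dv (\<lambda>s. t *\<^sub>R w s + t' *\<^sub>R w' s)"
proof -
  let ?q = "\<lambda>s i. 1/2 * fderiv2 c (v s) (dv s) (dv s) $ i"
  obtain e r where 1: "bmeas w" "0 < e" "0 < r" "\<forall>s\<in>{0..1}. \<forall>i. c (v s) $ i \<ge> - e \<longrightarrow> fderiv c (v s) (w s) $ i + ?q s i \<le> - r"
    using w unfolding second_order_feasible_def by auto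
  obtain e' r' where 2: "bmeas w'" "0 < e'" "0 < r'" "\<forall>s\<in>{0..1}. \<forall>i. c (v s) $ i \<ge> - e' \<longrightarrow> fderiv c (v s) (w' s) $ i + ?q s i \<le> - r'"
    using w' unfolding second_order_feasible_def by auto
  have b: "bmeas (\<lambda>s. t *\<^sub>R w s + t' *\<^sub>R w' s)" by (intro bmeas_add bmeas_scaleR bmeas_const 1 2)
  have "fderiv c (v s) (t *\<^sub>R w s + t' *\<^sub>R w' s) $ i + ?q s i \<le> - min r r'"
    if s: "s \<in> {0..1}" "c (v s) $ i \<ge> - min e e'" for s i
  proof -
    have a: "fderiv c (v s) (w s) $ i + ?q s i \<le> - min r r'" proof -
      have "- e \<le> c (v s) $ i" using s(2) by simp
      then have "fderiv c (v s) (w s) $ i + ?q s i \<le> - r" using 1(4) s(1) by blast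
      then show ?thesis by linarith
    qed
    have a': "fderiv c (v s) (w' s) $ i + ?q s i \<le> - min r r'" proof -
      have "- e' \<le> c (v s) $ i" using s(2) by simp
      then have "fderiv c (v s) (w' s) $ i + ?q s i \<le> - r'" using 2(4) s(1) by blast
      then show ?thesis by linarith
    qed
    have "fderiv c (v s) (t *\<^sub>R w s + t' *\<^sub>R w' s) $ i + ?q s i
        = t * (fderiv c (v s) (w s) $ i + ?q s i) + t' * (fderiv c (v s) (w' s) $ i + ?q s i)"
    proof -
      have "?q s i = t * ?q s i + t' * ?q s i" using t(3) by (simp flip: distrib_right)
      then show ?thesis by (simp add: blinfun.add_right blinfun.scaleR_right algebra_simps)
    qed
    also have "\<dots> \<le> t * (- min r r') + t' * (- min r r')"
      by (intro add_mono mult_left_mono a a') (use t in auto)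
    also have "\<dots> = - min r r'" using t(3) by (metis distrib_right mult_1)
    finally show ?thesis .
  qed
  then show ?thesis unfolding second_order_feasible_def
    using b 1(2,3) 2(2,3) by (intro conjI exI[of _ "min e e'"] exI[of _ "min r r'"]) auto
qed

text \<open>One arc of the trajectory with its control. The right inverse \<open>E\<close> is a
  parameter so that both arcs share it and the multiplier of each arc is an explicit measurable
  function of its costate.\<close>

locale qualified_block =
  fixes c :: "'a::euclidean_space \<Rightarrow> real ^ 'l" and \<epsilon> \<delta> :: real and v :: "real \<Rightarrow> 'a" and E :: "'a \<Rightarrow> 'l \<Rightarrow> 'a"
  assumes c: "C2 c" and eps: "0 < \<epsilon>" and del: "0 < \<delta>" and v: "bmeas v"
    and qual: "\<And>s. s \<in> {0..1} \<Longrightarrow> grad_qualified c \<epsilon> \<delta> (v s)"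
    and feas: "\<And>s i. s \<in> {0..1} \<Longrightarrow> c (v s) $ i \<le> 0"
    and E_meas: "\<And>i. (\<lambda>u. E u i) \<in> borel_measurable borel"
    and E_bound: "\<And>u i. grad_qualified c \<epsilon> \<delta> u \<Longrightarrow> c u $ i \<ge> - \<delta> \<Longrightarrow> norm (E u i) \<le> 1 / \<epsilon>"
    and E_inv: "\<And>u i k. grad_qualified c \<epsilon> \<delta> u \<Longrightarrow> c u $ i \<ge> - \<delta> \<Longrightarrow> c u $ k \<ge> - \<delta> \<Longrightarrow>
       fderiv c u (E u i) $ k = (if k = i then 1 else 0)"
begin

definition e :: "'l \<Rightarrow> real \<Rightarrow> 'a" where "e i s = (if - \<delta> \<le> c (v s) $ i then E (v s) i else 0)"

text \<open>Forced by stationarity: testing the equation H + Dc^T m = 0 with \<open>e i\<close>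
  isolates the i-th entry of m when constraint \<open>i\<close> is almost active. The formula is
  linear in \<open>H\<close>, so a costate affine in \<open>\<kappa>\<close> yields a multiplier
  affine in \<open>\<kappa>\<close>.\<close>

definition mult :: "(real \<Rightarrow> 'a) \<Rightarrow> real \<Rightarrow> real ^ 'l" where "mult H s = (\<chi> i. - (H s \<bullet> e i s))"

lemma c_pred: "Measurable.pred leb01 (\<lambda>s. r \<le> c (v s) $ i)"
  by (rule bmeas_pred[OF bmeas_const bmeas_C2[OF C2_component[OF c] v]])

lemma e_inv:
  assumes "s \<in> {0..1}" "- \<delta> \<le> c (v s) $ k"
  shows "fderiv c (v s) (e i s) $ k = (if k = i then 1 else 0)"
  using E_inv[OF qual[OF assms(1)] _ assms(2)] assms(2) by (cases "k = i") (auto simp: e_def)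

lemma bmeas_e: "bmeas (e i)"
proof -
  have "(\<lambda>s. E (v s) i) \<in> borel_measurable leb01"
    by (rule measurable_compose[OF bmeasD1[OF v] E_meas])
  then have "e i \<in> borel_measurable leb01"
    unfolding e_def by (intro measurable_If borel_measurable_const c_pred[unfolded pred_def])
  moreover have "norm (e i s) \<le> 1 / \<epsilon>" if "s \<in> {0..1}" for s
    using E_bound[OF qual[OF that], of i] eps by (simp add: e_def)
  ultimately show ?thesis unfolding bmeas_def by blast
qed

lemma bmeas_mult_ctrl: "bmeas H \<Longrightarrow> bmeas (mult H)"
proof -
  assume H: "bmeas H"
  have "bmeas (\<lambda>s. (-1) * (H s \<bullet> e i s))" for i by (intro bmeas_mult bmeas_const bmeas_inner H bmeas_e)
  then have "bmeas (\<lambda>s. - (H s \<bullet> e i s))" for i by simp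
  from bmeas_vec[of "\<lambda>i s. - (H s \<bullet> e i s)", OF this] show ?thesis by (simp add: mult_def[abs_def])
qed

lemma inner_mult: "mult H s \<bullet> z = - (H s \<bullet> (\<Sum>i\<in>UNIV. z $ i *\<^sub>R e i s))"
  by (simp add: mult_def inner_vec_def inner_sum_right sum_negf mult.commute)

lemma mult_linear: "mult (\<lambda>s. H s + k *\<^sub>R H' s) s = mult H s + k *\<^sub>R mult H' s"
  by (simp add: mult_def vec_eq_iff inner_add_left algebra_simps)

text \<open>The coefficients make the second order term exactly \<open>- r\<close> on every almost
  active constraint. This supplies a correction to start from and, as \<open>r\<close> tends to 0,
  the sharp inequality at the end of \<open>multiplier\<close>.\<close>

lemma base_feasible:
  assumes dv: "bmeas dv" and r: "0 < r"
  shows "second_order_feasible c v dv (\<lambda>s. - (\<Sum>i\<in>UNIV. (1/2 * fderiv2 c (v s) (dv s) (dv s) $ i + r) *\<^sub>R e i s))"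
    (is "second_order_feasible c v dv ?w")
proof -
  let ?q = "\<lambda>s i. 1/2 * fderiv2 c (v s) (dv s) (dv s) $ i"
  have "bmeas (\<lambda>s. (-1) *\<^sub>R (\<Sum>i\<in>UNIV. (?q s i + r) *\<^sub>R e i s))"
    by (intro bmeas_scaleR bmeas_const bmeas_sum bmeas_add bmeas_mult bmeas_vec_nth bmeas_fderiv2 c v dv bmeas_e)
  then have 1: "bmeas ?w" by simp
  have "fderiv c (v s) (?w s) $ k + ?q s k \<le> - r" if s: "s \<in> {0..1}" "c (v s) $ k \<ge> - \<delta>" for s k
  proof -
    have "fderiv c (v s) (?w s) $ k = - (\<Sum>i\<in>UNIV. (?q s i + r) * fderiv c (v s) (e i s) $ k)"
      by (simp add: blinfun.minus_right blinfun.sum_right blinfun.scaleR_right)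
    also have "(\<Sum>i\<in>UNIV. (?q s i + r) * fderiv c (v s) (e i s) $ k) = (\<Sum>i\<in>UNIV. if k = i then ?q s i + r else 0)"
      by (rule sum.cong) (auto simp: e_inv[OF s])
    also have "\<dots> = ?q s k + r" by simp
    finally show ?thesis by linarith
  qed
  then show ?thesis unfolding second_order_feasible_def using 1 del r by blast
qed

text \<open>Such \<open>h\<close> are recession directions of the feasible corrections, which allows
  \<open>multiplier\<close> to scale them without bound.\<close>

lemma feasible_add:
  assumes w: "second_order_feasible c v dv w" and h: "bmeas h" and a: "0 < \<epsilon>'" and t: "0 \<le> t"
    and hc: "\<And>s i. s \<in> {0..1} \<Longrightarrow> c (v s) $ i \<ge> - \<epsilon>' \<Longrightarrow> fderiv c (v s) (h s) $ i \<le> 0"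
  shows "second_order_feasible c v dv (\<lambda>s. w s + t *\<^sub>R h s)"
proof -
  obtain a' r where 1: "bmeas w" "0 < a'" "0 < r" "\<forall>s\<in>{0..1}. \<forall>i. c (v s) $ i \<ge> - a' \<longrightarrow>
      fderiv c (v s) (w s) $ i + 1/2 * fderiv2 c (v s) (dv s) (dv s) $ i \<le> - r"
    using w unfolding second_order_feasible_def by auto
  have b: "bmeas (\<lambda>s. w s + t *\<^sub>R h s)" by (intro bmeas_add bmeas_scaleR bmeas_const 1 h)
  have "fderiv c (v s) (w s + t *\<^sub>R h s) $ i + 1/2 * fderiv2 c (v s) (dv s) (dv s) $ i \<le> - r"
    if s: "s \<in> {0..1}" "c (v s) $ i \<ge> - min a' \<epsilon>'" for s i
  proof -
    have "c (v s) $ i \<ge> - a'" "c (v s) $ i \<ge> - \<epsilon>'" using s(2) by auto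
    then have "fderiv c (v s) (w s) $ i + 1/2 * fderiv2 c (v s) (dv s) (dv s) $ i \<le> - r"
      "t * (fderiv c (v s) (h s) $ i) \<le> 0"
      using 1(4) hc[of s i] s(1) t by (blast, simp add: mult_nonneg_nonpos)
    then show ?thesis by (simp add: blinfun.add_right blinfun.scaleR_right)
  qed
  then show ?thesis unfolding second_order_feasible_def
    using b 1(2,3) a by (intro conjI exI[of _ "min a' \<epsilon>'"] exI[of _ r]) auto
qed

text \<open>A functional bounded below on the feasible corrections is nonnegative on their recession
  directions. Three choices of such directions give stationarity, sign and complementarity; the
  corrections of \<open>base_feasible\<close> with vanishing margin give the last
  inequality.\<close>

lemma multiplier:
  assumes H: "bmeas H" and dv: "bmeas dv"
    and opt: "\<And>w. second_order_feasible c v dv w \<Longrightarrow> 0 \<le> integral {0..1} (\<lambda>s. H s \<bullet> w s) + Q"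
  shows "AE s in leb01. \<forall>h. H s \<bullet> h + mult H s \<bullet> fderiv c (v s) h = 0" (is ?A)
    and "AE s in leb01. \<forall>i. 0 \<le> mult H s $ i" (is ?B)
    and "AE s in leb01. \<forall>i. mult H s $ i * c (v s) $ i = 0" (is ?C)
    and "0 \<le> 1/2 * integral {0..1} (\<lambda>s. mult H s \<bullet> fderiv2 c (v s) (dv s) (dv s)) + Q" (is ?D)
proof -
  let ?\<mu> = "mult H"
  have mu: "bmeas ?\<mu>" by (rule bmeas_mult_ctrl[OF H])
  have Hint: "(\<lambda>s. H s \<bullet> h s) integrable_on {0..1}" if "bmeas h" for h
    by (rule bmeas_integrable(1)[OF bmeas_inner[OF H that]])
  define w1 where "w1 = (\<lambda>s. - (\<Sum>i\<in>UNIV. (1/2 * fderiv2 c (v s) (dv s) (dv s) $ i + 1) *\<^sub>R e i s))"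
  have w1: "second_order_feasible c v dv w1" unfolding w1_def by (rule base_feasible[OF dv]) simp
  then have w1b: "bmeas w1" by (simp add: second_order_feasible_def)
  have dir: "0 \<le> integral {0..1} (\<lambda>s. H s \<bullet> h s)"
    if h: "bmeas h" and a: "0 < \<epsilon>'" and hc: "\<And>s i. s \<in> {0..1} \<Longrightarrow> c (v s) $ i \<ge> - \<epsilon>' \<Longrightarrow> fderiv c (v s) (h s) $ i \<le> 0" for h \<epsilon>'
  proof (rule ccontr)
    define J where "J = integral {0..1} (\<lambda>s. H s \<bullet> h s)"
    define J1 where "J1 = integral {0..1} (\<lambda>s. H s \<bullet> w1 s)"
    assume "\<not> 0 \<le> integral {0..1} (\<lambda>s. H s \<bullet> h s)"
    then have J: "J < 0" by (simp add: J_def)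
    \<comment> \<open>Large enough that \<open>J1 + t * J + Q \<le> - 1\<close>, against
      optimality.\<close>
    define t where "t = (\<bar>J1 + Q\<bar> + 1) / (- J)"
    have t: "0 \<le> t" unfolding t_def using J by (intro divide_nonneg_nonneg) auto
    have "0 \<le> integral {0..1} (\<lambda>s. H s \<bullet> (w1 s + t *\<^sub>R h s)) + Q"
      by (rule opt[OF feasible_add[OF w1 h a t hc]])
    also have "integral {0..1} (\<lambda>s. H s \<bullet> (w1 s + t *\<^sub>R h s)) = J1 + t * J"
    proof -
      have "((\<lambda>s. H s \<bullet> w1 s + t * (H s \<bullet> h s)) has_integral J1 + t * J) {0..1}"
        unfolding J1_def J_def by (intro has_integral_add has_integral_mult_right integrable_integral Hint w1b h)
      then show ?thesis by (simp add: inner_add_right integral_unique)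
    qed
    also have "t * J = - (\<bar>J1 + Q\<bar> + 1)" using J by (simp add: t_def)
    finally show False by linarith
  qed
  \<comment> \<open>The full gradient H + Dc^T m with m = \<open>?\<mu> s\<close>, which has to
    vanish.\<close>
  define G where "G s = H s + (\<Sum>b\<in>Basis. (?\<mu> s \<bullet> fderiv c (v s) b) *\<^sub>R b)" for s
  have Gh: "G s \<bullet> h = H s \<bullet> h + ?\<mu> s \<bullet> fderiv c (v s) h" for s h
  proof -
    have "fderiv c (v s) h = fderiv c (v s) (\<Sum>b\<in>Basis. (h \<bullet> b) *\<^sub>R b)" by (simp add: euclidean_representation)
    also have "\<dots> = (\<Sum>b\<in>Basis. (h \<bullet> b) *\<^sub>R fderiv c (v s) b)" by (simp add: blinfun.sum_right blinfun.scaleR_right)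
    finally have 1: "?\<mu> s \<bullet> fderiv c (v s) h = (\<Sum>b\<in>Basis. (h \<bullet> b) * (?\<mu> s \<bullet> fderiv c (v s) b))" by (simp add: inner_sum_right)
    show ?thesis unfolding 1 G_def by (simp add: inner_add_left inner_sum_left mult.commute inner_commute[of h])
  qed
  have Gb: "bmeas G"
    unfolding G_def by (intro bmeas_add H bmeas_sum bmeas_scaleR bmeas_inner mu bmeas_fderiv c v bmeas_const)
  \<comment> \<open>\<open>G\<close> corrected so as to be tangent to the almost active constraints.
    By the definition of \<open>mult\<close> its pairing with \<open>H\<close> is the squared norm
    of \<open>G\<close>, so moving along the opposite direction forces \<open>G\<close> to
    vanish.\<close>
  define h where "h s = G s - (\<Sum>i\<in>UNIV. (fderiv c (v s) (G s) $ i) *\<^sub>R e i s)" for s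
  have hb: "bmeas h"
    unfolding h_def by (intro bmeas_diff Gb bmeas_sum bmeas_scaleR bmeas_vec_nth bmeas_fderiv c v bmeas_e)
  have hk: "fderiv c (v s) (h s) $ k = 0" if s: "s \<in> {0..1}" "c (v s) $ k \<ge> - \<delta>" for s k
  proof -
    have "fderiv c (v s) (\<Sum>i\<in>UNIV. (fderiv c (v s) (G s) $ i) *\<^sub>R e i s) $ k
        = (\<Sum>i\<in>UNIV. (fderiv c (v s) (G s) $ i) * fderiv c (v s) (e i s) $ k)"
      by (simp add: blinfun.sum_right blinfun.scaleR_right)
    also have "\<dots> = (\<Sum>i\<in>UNIV. if k = i then fderiv c (v s) (G s) $ i else 0)"
      by (rule sum.cong) (auto simp: e_inv[OF s])
    also have "\<dots> = fderiv c (v s) (G s) $ k" by simp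
    finally show ?thesis unfolding h_def blinfun.diff_right by simp
  qed
  have Hh: "H s \<bullet> h s = G s \<bullet> G s" for s
    unfolding Gh[of s "G s"] inner_mult h_def by (simp add: inner_diff_right)
  have mh: "bmeas (\<lambda>s. - h s)" using bmeas_scaleR[OF bmeas_const hb, of "-1"] by simp
  have "0 \<le> integral {0..1} (\<lambda>s. H s \<bullet> (- h s))"
    by (rule dir[OF mh del]) (simp add: blinfun.minus_right hk)
  then have "0 \<le> integral {0..1} (\<lambda>s. - (G s \<bullet> G s))" by (simp add: Hh)
  moreover have "bmeas (\<lambda>s. - (G s \<bullet> G s))" using bmeas_mult[OF bmeas_const bmeas_inner[OF Gb Gb], of "-1"] by simp
  ultimately have "AE s in leb01. - (G s \<bullet> G s) = 0"
    by (intro integral_nonneg_AE_zero) auto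
  then show ?A
  proof eventually_elim
    case (elim s)
    then have "G s = 0" by simp
    then show ?case using Gh[of s] by simp
  qed
  have He: "H s \<bullet> e i s = - ?\<mu> s $ i" for s i by (simp add: mult_def)
  have pos: "AE s in leb01. 0 \<le> ?\<mu> s $ i" for i
  proof -
    have P: "Measurable.pred leb01 (\<lambda>s. ?\<mu> s $ i < 0)"
      by (rule bmeas_pred(2)[OF bmeas_vec_nth[OF mu] bmeas_const])
    \<comment> \<open>Where the multiplier is negative, the opposite of \<open>e i\<close> decreases
      constraint \<open>i\<close> and leaves the other almost active ones unchanged, while its
      pairing with \<open>H\<close> equals the negative multiplier.\<close>
    let ?h = "\<lambda>s. if ?\<mu> s $ i < 0 then (-1) *\<^sub>R e i s else 0"
    have hb: "bmeas ?h" by (intro bmeas_If P bmeas_scaleR bmeas_const bmeas_e)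
    have "0 \<le> integral {0..1} (\<lambda>s. H s \<bullet> ?h s)"
      by (rule dir[OF hb del]) (auto simp: blinfun.minus_right blinfun.zero_right e_inv)
    then have "AE s in leb01. H s \<bullet> ?h s = 0"
      by (intro integral_nonneg_AE_zero bmeas_inner H hb) (auto simp: He)
    then show ?thesis by eventually_elim (auto simp: He split: if_splits)
  qed
  then show ?B by (simp add: AE_all_countable)
  have small: "AE s in leb01. \<not> - a \<le> c (v s) $ i \<longrightarrow> ?\<mu> s $ i = 0" if a: "0 < a" "a \<le> \<delta>" for a i
  proof -
    \<comment> \<open>Constraint \<open>i\<close> has slack \<open>a\<close> wherever this is
      nonzero, so increasing it is harmless; the pairing with \<open>H\<close> is minus the
      multiplier, nonpositive by the sign condition, and therefore vanishes.\<close>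
    let ?h = "\<lambda>s. if - a \<le> c (v s) $ i then 0 else e i s"
    have hb: "bmeas ?h" by (intro bmeas_If c_pred bmeas_const bmeas_e)
    have "0 \<le> integral {0..1} (\<lambda>s. H s \<bullet> ?h s)"
    proof (rule dir[OF hb a(1)])
      fix s k assume s: "s \<in> {0..1}" "- a \<le> c (v s) $ k"
      then have "- \<delta> \<le> c (v s) $ k" using a by linarith
      from e_inv[OF s(1) this] s show "fderiv c (v s) (?h s) $ k \<le> 0" by (auto simp: blinfun.zero_right)
    qed
    moreover have "AE s in leb01. H s \<bullet> ?h s \<le> 0" using pos[of i] by eventually_elim (simp add: He)
    ultimately have "AE s in leb01. H s \<bullet> ?h s = 0"
      by (intro integral_nonneg_AE_zero bmeas_inner H hb)
    then show ?thesis by eventually_elim (auto simp: He split: if_splits)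
  qed
  have "AE s in leb01. ?\<mu> s $ i * c (v s) $ i = 0" for i
  proof -
    \<comment> \<open>Countably many margins exhaust the set where the constraint is
      inactive.\<close>
    have "AE s in leb01. \<forall>n::nat. \<not> - (\<delta> / Suc n) \<le> c (v s) $ i \<longrightarrow> ?\<mu> s $ i = 0"
      unfolding AE_all_countable using small[of "\<delta> / Suc _" i] del by (auto simp: divide_le_eq)
    then show ?thesis using AE_space
    proof eventually_elim
      case (elim s)
      show ?case
      proof (cases "c (v s) $ i = 0")
        case False
        then have neg: "c (v s) $ i < 0" using feas[of s i] elim(2) by (simp add: less_le)
        obtain n :: nat where n: "\<delta> / (- c (v s) $ i) < n" using reals_Archimedean2 by blast
        then have "\<delta> < real n * (- c (v s) $ i)" using neg by (simp add: field_simps)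
        also have "\<dots> \<le> real (Suc n) * (- c (v s) $ i)" using neg by (intro mult_right_mono) auto
        finally have "\<delta> / Suc n < - c (v s) $ i" by (simp add: divide_less_eq mult.commute)
        then have "\<not> - (\<delta> / Suc n) \<le> c (v s) $ i" by linarith
        then have "?\<mu> s $ i = 0" using elim(1) by blast
        then show ?thesis by simp
      qed simp
    qed
  qed
  then show ?C by (simp add: AE_all_countable)
  let ?q = "\<lambda>s. fderiv2 c (v s) (dv s) (dv s)"
  define one :: "real ^ 'l" where "one = (\<chi> i. 1)"
  have qb: "bmeas ?q" by (intro bmeas_fderiv2 c v dv)
  have int: "(\<lambda>s. ?\<mu> s \<bullet> ?q s) integrable_on {0..1}" "(\<lambda>s. ?\<mu> s \<bullet> one) integrable_on {0..1}"
    by (intro bmeas_integrable(1) bmeas_inner mu qb bmeas_const)+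
  define J where "J = integral {0..1} (\<lambda>s. ?\<mu> s \<bullet> one)"
  have "0 \<le> 1/2 * integral {0..1} (\<lambda>s. ?\<mu> s \<bullet> ?q s) + r * J + Q" if r: "0 < r" for r
  proof -
    let ?w = "\<lambda>s. - (\<Sum>i\<in>UNIV. (1/2 * ?q s $ i + r) *\<^sub>R e i s)"
    have "H s \<bullet> ?w s = 1/2 * (?\<mu> s \<bullet> ?q s) + r * (?\<mu> s \<bullet> one)" for s
    proof -
      have "H s \<bullet> ?w s = ?\<mu> s \<bullet> ((1/2) *\<^sub>R ?q s + r *\<^sub>R one)" unfolding inner_mult by (simp add: one_def)
      then show ?thesis by (simp add: inner_add_right)
    qed
    moreover have "((\<lambda>s. 1/2 * (?\<mu> s \<bullet> ?q s) + r * (?\<mu> s \<bullet> one)) has_integral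
        1/2 * integral {0..1} (\<lambda>s. ?\<mu> s \<bullet> ?q s) + r * J) {0..1}"
      unfolding J_def by (intro has_integral_add has_integral_mult_right integrable_integral int)
    ultimately have "integral {0..1} (\<lambda>s. H s \<bullet> ?w s) = 1/2 * integral {0..1} (\<lambda>s. ?\<mu> s \<bullet> ?q s) + r * J"
      by (simp add: integral_unique)
    then show ?thesis using opt[OF base_feasible[OF dv r]] by simp
  qed
  note lim = this
  show ?D
  proof (rule ccontr)
    define X where "X = 1/2 * integral {0..1} (\<lambda>s. ?\<mu> s \<bullet> ?q s) + Q"
    assume "\<not> ?D"
    then have X: "X < 0" by (simp add: X_def)
    define r where "r = - X / (2 * (\<bar>J\<bar> + 1))"
    have r: "0 < r" unfolding r_def using X by (intro divide_pos_pos) auto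
    have "r * J \<le> r * (\<bar>J\<bar> + 1)" using r by (intro mult_left_mono) auto
    also have "\<dots> = - X / 2" by (simp add: r_def field_simps)
    finally show False using lim[OF r] X by (simp add: X_def)
  qed
qed

end

section \<open>Families of perturbed trajectories\<close>

text \<open>Points with \<open>0 < a\<close> demand \<open>- b / a \<le> \<kappa>\<close>, points
  with \<open>a < 0\<close> demand \<open>\<kappa> \<le> b / (- a)\<close>. The demands are
  compatible because a convex combination of two such points lies on the axis \<open>a = 0\<close>,
  where \<open>b\<close> is nonnegative.\<close>

lemma separation_plane:
  fixes Z :: "(real \<times> real) set"
  assumes conv: "\<And>b a b' a' t t'. (b, a) \<in> Z \<Longrightarrow> (b', a') \<in> Z \<Longrightarrow> 0 < t \<Longrightarrow> 0 < t' \<Longrightarrow> t + t' = 1 \<Longrightarrow>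
      (t * b + t' * b', t * a + t' * a') \<in> Z"
    and k: "0 \<le> k" and pos: "\<And>b a. (b, a) \<in> Z \<Longrightarrow> 0 \<le> b + k * max 0 a"
  obtains \<kappa> where "0 \<le> \<kappa>" "\<kappa> \<le> k" "\<forall>b a. (b, a) \<in> Z \<longrightarrow> 0 \<le> b + \<kappa> * a"
proof -
  \<comment> \<open>The element 0 makes the supremum nonnegative, and defined even if no point has
    \<open>0 < a\<close>.\<close>
  define S where "S = insert 0 {- b / a | b a. (b, a) \<in> Z \<and> 0 < a}"
  have le_k: "x \<le> k" if "x \<in> S" for x
  proof -
    consider "x = 0" | b a where "x = - b / a" "(b, a) \<in> Z" "0 < a" using \<open>x \<in> S\<close> unfolding S_def by auto
    then show ?thesis
    proof cases
      case 2
      then have "0 \<le> b + k * a" using pos[of b a] by simp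
      then show ?thesis unfolding 2(1) pos_divide_le_eq[OF 2(3)] by linarith
    qed (use k in simp)
  qed
  then have bdd: "bdd_above S" by (auto simp: bdd_above_def)
  have ne: "S \<noteq> {}" by (simp add: S_def)
  define \<kappa> where "\<kappa> = Sup S"
  have up: "x \<le> \<kappa>" if "x \<in> S" for x unfolding \<kappa>_def by (rule cSup_upper[OF that bdd])
  have "0 \<le> \<kappa>" by (rule up) (simp add: S_def)
  moreover have "\<kappa> \<le> k" unfolding \<kappa>_def by (rule cSup_least[OF ne le_k])
  moreover have "0 \<le> b + \<kappa> * a" if Z: "(b, a) \<in> Z" for b a
  proof -
    consider "a = 0" | "0 < a" | "a < 0" by linarith
    then show ?thesis
    proof cases
      case 1
      then show ?thesis using pos[OF Z] by simp
    next
      case 2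
      then have "- b / a \<le> \<kappa>" using Z by (intro up) (auto simp: S_def)
      then show ?thesis unfolding pos_divide_le_eq[OF 2] by linarith
    next
      case 3
      have "\<kappa> \<le> b / (- a)"
        unfolding \<kappa>_def
      proof (rule cSup_least[OF ne])
        fix x assume "x \<in> S"
        then consider "x = 0" | b' a' where "x = - b' / a'" "(b', a') \<in> Z" "0 < a'" unfolding S_def by auto
        then show "x \<le> b / (- a)"
        proof cases
          case 1
          have "0 \<le> b" using pos[OF Z] 3 by simp
          then show ?thesis using 1 3 by (simp add: divide_nonneg_neg)
        next
          case 2
          \<comment> \<open>Weights of the point where the segment between the two points meets the
            axis.\<close>
          define t where "t = - a / (a' - a)"
          define t' where "t' = a' / (a' - a)"
          have tt: "0 < t" "0 < t'" unfolding t_def t'_def using 2 3 by (intro divide_pos_pos; simp)+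
          have "t + t' = (- a + a') / (a' - a)" unfolding t_def t'_def by (rule add_divide_distrib[symmetric])
          then have t1: "t + t' = 1" using 2 3 by simp
          have "(t * b' + t' * b, t * a' + t' * a) \<in> Z" by (rule conv[OF 2(2) Z tt t1])
          moreover have "t * a' + t' * a = 0" by (simp add: t_def t'_def)
          ultimately have "0 \<le> t * b' + t' * b" using pos by fastforce
          then have "0 \<le> (- a * b' + a' * b) / (a' - a)" by (simp add: t_def t'_def add_divide_distrib diff_divide_distrib)
          then have "0 \<le> - a * b' + a' * b" using 2 3 by (simp add: zero_le_divide_iff)
          then have le: "- b' * (- a) \<le> b * a'" by (simp add: mult.commute)
          have c: "0 < - a" using 3 by simp
          have "- b' \<le> (b * a') / (- a)" unfolding pos_le_divide_eq[OF c] by (rule le)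
          then show ?thesis unfolding 2(1) pos_divide_le_eq[OF 2(3)] by (simp only: times_divide_eq_left)
        qed
      qed
      moreover have "0 < - a" using 3 by simp
      ultimately have "\<kappa> * (- a) \<le> b" by (simp only: pos_le_divide_eq)
      then show ?thesis by simp
    qed
  qed
  ultimately show ?thesis by (intro that) blast+
qed

text \<open>The initial value is a family in \<open>\<sigma>\<close> because the second arc starts
  at the end of the perturbed first arc, which is known only up to order
  \<open>\<sigma>\<^sup>2\<close>.\<close>

lemma perturbation_family:
  fixes F :: "'x::euclidean_space \<times> 'v::euclidean_space \<Rightarrow> 'x"
  assumes F: "C2 F" and vb: "bmeas vb" and xb: "lip_path xb (\<lambda>s. F (xb s, vb s))"
    and dv: "bmeas dv" and w: "bmeas w"
    and dx: "lip_path dx (\<lambda>s. fderiv F (xb s, vb s) (dx s, dv s))"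
    and a: "0 < \<sigma>a" "0 < A" "\<forall>\<sigma>. 0 < \<sigma> \<longrightarrow> \<sigma> < \<sigma>a \<longrightarrow> norm (a \<sigma> - xb 0 - \<sigma> *\<^sub>R dx 0) \<le> A * \<sigma>\<^sup>2"
  obtains \<sigma>0 C0 x where "0 < \<sigma>0" "\<sigma>0 \<le> \<sigma>a" "0 < C0"
    "\<forall>\<sigma>. 0 < \<sigma> \<longrightarrow> \<sigma> < \<sigma>0 \<longrightarrow> x \<sigma> 0 = a \<sigma> \<and> lip_path (x \<sigma>) (\<lambda>s. F (x \<sigma> s, vb s + \<sigma> *\<^sub>R dv s + \<sigma>\<^sup>2 *\<^sub>R w s)) \<and>
      (\<forall>s\<in>{0..1}. norm (x \<sigma> s - xb s - \<sigma> *\<^sub>R dx s) \<le> C0 * \<sigma>\<^sup>2)"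
proof -
  obtain \<rho> C where \<rho>: "0 < \<rho>" and C: "0 < C" and ex:
    "\<forall>a v e. bmeas v \<longrightarrow> (\<forall>s\<in>{0..1}. norm (v s - vb s) \<le> e) \<longrightarrow> norm (a - xb 0) \<le> e \<longrightarrow> e \<le> \<rho> \<longrightarrow>
      (\<exists>x. x 0 = a \<and> lip_path x (\<lambda>s. F (x s, v s)) \<and> (\<forall>s\<in>{0..1}. norm (x s - xb s) \<le> C * e))"
    by (rule perturbed_solution[OF F vb xb])
  obtain C' where C': "0 < C'" and lin:
    "\<forall>x v dx dv r e. 0 \<le> r \<longrightarrow> r \<le> 1 \<longrightarrow> lip_path x (\<lambda>s. F (x s, v s)) \<longrightarrow>
      lip_path dx (\<lambda>s. fderiv F (xb s, vb s) (dx s, dv s)) \<longrightarrow>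
      (\<forall>s\<in>{0..1}. norm (x s - xb s) \<le> r \<and> norm (v s - vb s) \<le> r \<and> norm (v s - vb s - dv s) \<le> e) \<longrightarrow>
      norm (x 0 - xb 0 - dx 0) \<le> e \<longrightarrow>
      (\<forall>s\<in>{0..1}. norm (x s - xb s - dx s) \<le> C' * (e + r\<^sup>2))"
    by (rule linearization_error[OF F vb xb])
  obtain Q where Q: "0 < Q" "\<forall>s\<in>{0..1}. norm (dv s) \<le> Q" by (rule bmeas_boundE[OF dv])
  obtain W where W: "0 < W" "\<forall>s\<in>{0..1}. norm (w s) \<le> W" by (rule bmeas_boundE[OF w])
  obtain B where B: "0 < B" "\<forall>s\<in>{0..1}. norm (dx s) \<le> B" by (rule lip_path_bounded[OF dx])
  define e where "e = Q + W + A + B"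
  have e: "0 < e" using Q W B a by (simp add: e_def)
  define R where "R = e + C * e"
  have R: "0 < R" using e C by (simp add: R_def add_pos_pos)
  \<comment> \<open>The entry \<open>\<rho> / e\<close> puts the perturbation in the range of
    \<open>perturbed_solution\<close>; \<open>1 / R\<close> makes the total deviation at most 1, as
    \<open>linearization_error\<close> requires.\<close>
  define \<sigma>0 where "\<sigma>0 = min (min \<sigma>a 1) (min (\<rho> / e) (1 / R))"
  have \<sigma>0: "0 < \<sigma>0" using a e R \<rho> by (simp add: \<sigma>0_def)
  define C0 where "C0 = C' * (e + R\<^sup>2)"
  have C0: "0 < C0" using C' e by (simp add: C0_def add_pos_nonneg)
  have main: "\<exists>y. y 0 = a \<sigma> \<and> lip_path y (\<lambda>s. F (y s, vb s + \<sigma> *\<^sub>R dv s + \<sigma>\<^sup>2 *\<^sub>R w s)) \<and>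
      (\<forall>s\<in>{0..1}. norm (y s - xb s - \<sigma> *\<^sub>R dx s) \<le> C0 * \<sigma>\<^sup>2)" if \<sigma>: "0 < \<sigma>" "\<sigma> < \<sigma>0" for \<sigma>
  proof -
    have s: "\<sigma> < \<sigma>a" "\<sigma> < 1" "\<sigma> < \<rho> / e" "\<sigma> < 1 / R" using \<sigma> by (auto simp: \<sigma>0_def)
    have sq: "\<sigma>\<^sup>2 \<le> \<sigma>" using \<sigma> s(2) by (simp add: power2_eq_square mult_left_le)
    let ?v = "\<lambda>s. vb s + \<sigma> *\<^sub>R dv s + \<sigma>\<^sup>2 *\<^sub>R w s"
    have vm: "bmeas ?v" by (intro bmeas_add bmeas_scaleR bmeas_const vb dv w)
    have wle: "norm (\<sigma>\<^sup>2 *\<^sub>R w s) \<le> \<sigma>\<^sup>2 * W" if "s \<in> {0..1}" for s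
      using W(2) that by (simp add: mult_left_mono)
    have v1: "norm (?v s - vb s) \<le> \<sigma> * e" if "s \<in> {0..1}" for s
    proof -
      have "norm (?v s - vb s) \<le> norm (\<sigma> *\<^sub>R dv s) + norm (\<sigma>\<^sup>2 *\<^sub>R w s)"
        using norm_triangle_ineq[of "\<sigma> *\<^sub>R dv s" "\<sigma>\<^sup>2 *\<^sub>R w s"] by (simp add: add.assoc)
      also have "\<dots> \<le> \<sigma> * Q + \<sigma> * W"
      proof (rule add_mono)
        show "norm (\<sigma> *\<^sub>R dv s) \<le> \<sigma> * Q" using Q(2) that \<sigma> by simp
        have "\<sigma>\<^sup>2 * W \<le> \<sigma> * W" using sq W by (intro mult_right_mono) auto
        then show "norm (\<sigma>\<^sup>2 *\<^sub>R w s) \<le> \<sigma> * W" using wle[OF that] by linarith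
      qed
      also have "\<dots> = \<sigma> * (Q + W)" by (simp add: distrib_left)
      also have "\<dots> \<le> \<sigma> * e" using \<sigma> a(2) B(1) by (intro mult_left_mono) (auto simp: e_def)
      finally show ?thesis .
    qed
    have a0: "norm (a \<sigma> - xb 0 - \<sigma> *\<^sub>R dx 0) \<le> A * \<sigma>\<^sup>2" using a(3) \<sigma> s(1) by blast
    have a1: "norm (a \<sigma> - xb 0) \<le> \<sigma> * e"
    proof -
      have "norm (a \<sigma> - xb 0) \<le> norm (\<sigma> *\<^sub>R dx 0) + norm (a \<sigma> - xb 0 - \<sigma> *\<^sub>R dx 0)" by (rule norm_triangle_sub)
      also have "\<dots> \<le> \<sigma> * B + \<sigma> * A"
      proof (rule add_mono)
        show "norm (\<sigma> *\<^sub>R dx 0) \<le> \<sigma> * B" using B(2) \<sigma> by simp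
        have "A * \<sigma>\<^sup>2 \<le> A * \<sigma>" using sq a(2) by (intro mult_left_mono) auto
        then show "norm (a \<sigma> - xb 0 - \<sigma> *\<^sub>R dx 0) \<le> \<sigma> * A" using a0 by (simp only: mult.commute)
      qed
      also have "\<dots> = \<sigma> * (A + B)" by (simp add: distrib_left)
      also have "\<dots> \<le> \<sigma> * e" using \<sigma> Q(1) W(1) by (intro mult_left_mono) (auto simp: e_def)
      finally show ?thesis .
    qed
    have "\<sigma> * e \<le> \<rho>" using s(3) e by (simp add: field_simps)
    then have "\<exists>x. x 0 = a \<sigma> \<and> lip_path x (\<lambda>s. F (x s, ?v s)) \<and> (\<forall>s\<in>{0..1}. norm (x s - xb s) \<le> C * (\<sigma> * e))"
      using ex[rule_format, of ?v "\<sigma> * e" "a \<sigma>"] vm v1 a1 by blast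
    then obtain y where y: "y 0 = a \<sigma>" "lip_path y (\<lambda>s. F (y s, ?v s))" "\<forall>s\<in>{0..1}. norm (y s - xb s) \<le> C * (\<sigma> * e)"
      by (elim exE conjE) (rule that)
    have dxs: "lip_path (\<lambda>s. \<sigma> *\<^sub>R dx s) (\<lambda>s. fderiv F (xb s, vb s) (\<sigma> *\<^sub>R dx s, \<sigma> *\<^sub>R dv s))"
    proof -
      have "fderiv F (xb s, vb s) (\<sigma> *\<^sub>R dx s, \<sigma> *\<^sub>R dv s) = \<sigma> *\<^sub>R fderiv F (xb s, vb s) (dx s, dv s)" for s
        by (simp flip: blinfun.scaleR_right)
      then show ?thesis using lip_path_scaleR[OF dx, of \<sigma>] by simp
    qed
    have se: "0 \<le> \<sigma> * e" "0 \<le> C * (\<sigma> * e)" using \<sigma> e C by simp_all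
    have Re: "\<sigma> * R = \<sigma> * e + C * (\<sigma> * e)" by (simp add: R_def algebra_simps)
    have "norm (y s - xb s - \<sigma> *\<^sub>R dx s) \<le> C' * (\<sigma>\<^sup>2 * e + (\<sigma> * R)\<^sup>2)" if s': "s \<in> {0..1}" for s
    proof (rule lin[rule_format, of "\<sigma> * R" y ?v "\<lambda>s. \<sigma> *\<^sub>R dx s" "\<lambda>s. \<sigma> *\<^sub>R dv s" "\<sigma>\<^sup>2 * e"])
      show "0 \<le> \<sigma> * R" using \<sigma> R by simp
      show "\<sigma> * R \<le> 1" using s(4) R by (simp add: field_simps)
      show "lip_path y (\<lambda>s. F (y s, ?v s))" by (rule y)
      show "lip_path (\<lambda>s. \<sigma> *\<^sub>R dx s) (\<lambda>s. fderiv F (xb s, vb s) (\<sigma> *\<^sub>R dx s, \<sigma> *\<^sub>R dv s))" by (rule dxs)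
      fix s :: real assume s': "s \<in> {0..1}"
      have 1: "norm (y s - xb s) \<le> \<sigma> * R" using y(3) s' se(1) Re by fastforce
      have 2: "norm (?v s - vb s) \<le> \<sigma> * R" using v1[OF s'] se(2) Re by linarith
      have 3: "norm (?v s - vb s - \<sigma> *\<^sub>R dv s) \<le> \<sigma>\<^sup>2 * e"
      proof -
        have "\<sigma>\<^sup>2 * W \<le> \<sigma>\<^sup>2 * e" using Q B a by (intro mult_left_mono) (auto simp: e_def)
        then show ?thesis using wle[OF s'] by simp
      qed
      show "norm (y s - xb s) \<le> \<sigma> * R \<and> norm (?v s - vb s) \<le> \<sigma> * R \<and> norm (?v s - vb s - \<sigma> *\<^sub>R dv s) \<le> \<sigma>\<^sup>2 * e"
        using 1 2 3 by blast
    next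
      have "A \<le> e" using Q W B by (simp add: e_def)
      from mult_right_mono[OF this zero_le_power2[of \<sigma>]] have "A * \<sigma>\<^sup>2 \<le> \<sigma>\<^sup>2 * e" by (simp only: mult.commute)
      then show "norm (y 0 - xb 0 - \<sigma> *\<^sub>R dx 0) \<le> \<sigma>\<^sup>2 * e" using a0 y(1) by simp
    qed (rule s')
    moreover have "C' * (\<sigma>\<^sup>2 * e + (\<sigma> * R)\<^sup>2) = C0 * \<sigma>\<^sup>2" by (simp add: C0_def algebra_simps power_mult_distrib)
    ultimately show ?thesis using y(1,2) by auto
  qed
  define x where "x \<sigma> = (SOME y. y 0 = a \<sigma> \<and> lip_path y (\<lambda>s. F (y s, vb s + \<sigma> *\<^sub>R dv s + \<sigma>\<^sup>2 *\<^sub>R w s)) \<and>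
      (\<forall>s\<in>{0..1}. norm (y s - xb s - \<sigma> *\<^sub>R dx s) \<le> C0 * \<sigma>\<^sup>2))" for \<sigma>
  show ?thesis
  proof (rule that[OF \<sigma>0 _ C0])
    show "\<sigma>0 \<le> \<sigma>a" by (simp add: \<sigma>0_def)
    show "\<forall>\<sigma>. 0 < \<sigma> \<longrightarrow> \<sigma> < \<sigma>0 \<longrightarrow> x \<sigma> 0 = a \<sigma> \<and> lip_path (x \<sigma>) (\<lambda>s. F (x \<sigma> s, vb s + \<sigma> *\<^sub>R dv s + \<sigma>\<^sup>2 *\<^sub>R w s)) \<and>
      (\<forall>s\<in>{0..1}. norm (x \<sigma> s - xb s - \<sigma> *\<^sub>R dx s) \<le> C0 * \<sigma>\<^sup>2)"
    proof (intro allI impI)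
      fix \<sigma> :: real assume "0 < \<sigma>" "\<sigma> < \<sigma>0"
      from someI_ex[OF main[OF this]] show "x \<sigma> 0 = a \<sigma> \<and> lip_path (x \<sigma>) (\<lambda>s. F (x \<sigma> s, vb s + \<sigma> *\<^sub>R dv s + \<sigma>\<^sup>2 *\<^sub>R w s)) \<and>
      (\<forall>s\<in>{0..1}. norm (x \<sigma> s - xb s - \<sigma> *\<^sub>R dx s) \<le> C0 * \<sigma>\<^sup>2)" unfolding x_def .
    qed
  qed
qed

text \<open>A constraint with slack cannot be reached by a small perturbation. On an almost active
  one the first order term vanishes, and the strictly negative second order coefficient outweighs
  the remainder.\<close>

lemma feasible_perturbation:
  fixes c :: "'a::euclidean_space \<Rightarrow> real ^ 'l"
  assumes c: "C2 c" and v: "bmeas v" and feas: "\<And>s i. s \<in> {0..1} \<Longrightarrow> c (v s) $ i \<le> 0"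
    and dv: "bmeas dv" and w: "second_order_feasible c v dv w"
    and crit: "0 < a" "\<forall>s\<in>{0..1}. \<forall>i. c (v s) $ i \<ge> - a \<longrightarrow> fderiv c (v s) (dv s) $ i = 0"
  obtains \<sigma>0 where "0 < \<sigma>0" "\<forall>\<sigma>. 0 < \<sigma> \<longrightarrow> \<sigma> < \<sigma>0 \<longrightarrow> (\<forall>s\<in>{0..1}. \<forall>i. c (v s + \<sigma> *\<^sub>R dv s + \<sigma>\<^sup>2 *\<^sub>R w s) $ i \<le> 0)"
proof -
  obtain a' r where w': "bmeas w" "0 < a'" "0 < r" "\<forall>s\<in>{0..1}. \<forall>i. c (v s) $ i \<ge> - a' \<longrightarrow>
      fderiv c (v s) (w s) $ i + 1/2 * fderiv2 c (v s) (dv s) (dv s) $ i \<le> - r"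
    using w unfolding second_order_feasible_def by auto
  define b where "b = min a a'"
  have b: "0 < b" using crit w' by (simp add: b_def)
  obtain R where R: "0 < R" "\<forall>s\<in>{0..1}. norm (v s) \<le> R" by (rule bmeas_boundE[OF v])
  obtain Q where Q: "0 < Q" "\<forall>s\<in>{0..1}. norm (dv s) \<le> Q" by (rule bmeas_boundE[OF dv])
  obtain W where W: "0 < W" "\<forall>s\<in>{0..1}. norm (w s) \<le> W" by (rule bmeas_boundE[OF w'(1)])
  obtain K where K: "0 < K" "\<forall>x. norm x \<le> R \<longrightarrow> norm (c x) \<le> K \<and> norm (fderiv c x) \<le> K \<and> norm (fderiv2 c x) \<le> K"
    by (rule C2_bounded_derivatives[OF c])
  obtain L where L: "0 < L"
    "\<forall>x y. norm x \<le> R + 1 \<longrightarrow> norm y \<le> R + 1 \<longrightarrow> norm (c y - c x) \<le> L * norm (y - x) \<and>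
      norm (fderiv c y - fderiv c x) \<le> L * norm (y - x) \<and>
      norm (c y - c x - fderiv c x (y - x)) \<le> L * (norm (y - x))\<^sup>2"
    by (rule C2_taylor1[OF c])
  define B where "B = Q + W"
  have B: "0 < B" "Q \<le> B" "W \<le> B" using Q W by (auto simp: B_def)
  \<comment> \<open>Half of the margin \<open>r\<close> pays for the Taylor remainder, the other
    half for the mixed terms of the Hessian below.\<close>
  define e where "e = r / (2 * B\<^sup>2)"
  have e: "0 < e" using w' B by (simp add: e_def)
  obtain d where d: "0 < d" "\<forall>x h. norm x \<le> R \<longrightarrow> norm h \<le> d \<longrightarrow>
      norm (c (x + h) - c x - fderiv c x h - (1/2) *\<^sub>R fderiv2 c x h h) \<le> e * (norm h)\<^sup>2"
    by (rule C2_taylor2[OF c e])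
  define \<sigma>0 where "\<sigma>0 = min (min 1 (d / B)) (min (min (1 / B) (b / (L * B))) (r / (2 * K * B\<^sup>2)))"
  have \<sigma>0: "0 < \<sigma>0" using d B L K b w' by (simp add: \<sigma>0_def)
  have "c (v s + \<sigma> *\<^sub>R dv s + \<sigma>\<^sup>2 *\<^sub>R w s) $ i \<le> 0" if \<sigma>: "0 < \<sigma>" "\<sigma> < \<sigma>0" and s: "s \<in> {0..1}" for \<sigma> s i
  proof -
    have t: "\<sigma> < 1" "\<sigma> < d / B" "\<sigma> < 1 / B" "\<sigma> < b / (L * B)" "\<sigma> < r / (2 * K * B\<^sup>2)" using \<sigma> by (auto simp: \<sigma>0_def)
    define h where "h = \<sigma> *\<^sub>R dv s + \<sigma>\<^sup>2 *\<^sub>R w s"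
    have vR: "norm (v s) \<le> R" and dvQ: "norm (dv s) \<le> Q" and wW: "norm (w s) \<le> W" using R Q W s by auto
    have n1: "norm (\<sigma> *\<^sub>R dv s) \<le> \<sigma> * Q" using dvQ \<sigma> by simp
    have n2: "norm (\<sigma>\<^sup>2 *\<^sub>R w s) \<le> \<sigma>\<^sup>2 * W" using wW by (simp add: mult_left_mono)
    have sq: "\<sigma>\<^sup>2 \<le> \<sigma>" using \<sigma> t(1) by (simp add: power2_eq_square mult_left_le)
    have hB: "norm h \<le> \<sigma> * B"
    proof -
      have "norm h \<le> \<sigma> * Q + \<sigma>\<^sup>2 * W" unfolding h_def by (rule norm_triangle_le[OF add_mono[OF n1 n2]])
      also have "\<dots> \<le> \<sigma> * Q + \<sigma> * W" using sq W by (intro add_left_mono mult_right_mono) auto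
      finally show ?thesis by (simp add: B_def distrib_left)
    qed
    have eq: "v s + \<sigma> *\<^sub>R dv s + \<sigma>\<^sup>2 *\<^sub>R w s = v s + h" by (simp add: h_def)
    show ?thesis
    proof (cases "c (v s) $ i \<ge> - b")
      case False
      have "\<sigma> * B \<le> 1" using t(3) B by (simp add: field_simps)
      then have "norm (v s + h) \<le> R + 1" using norm_triangle_le[OF add_mono[OF vR hB]] by linarith
      moreover have vR': "norm (v s) \<le> R + 1" using vR by linarith
      ultimately have "norm (c (v s + h) - c (v s)) \<le> L * norm (v s + h - v s)" using L(2) vR' by blast
      also have "\<dots> \<le> L * (\<sigma> * B)" using hB L by (intro mult_left_mono) auto
      also have "\<dots> \<le> b" using t(4) L B by (simp add: field_simps)
      finally have "norm ((c (v s + h) - c (v s)) $ i) \<le> b" using component_le_norm_cart order_trans by (metis real_norm_def)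
      then show ?thesis unfolding eq using False by simp
    next
      case True
      have "h - \<sigma> *\<^sub>R dv s = \<sigma>\<^sup>2 *\<^sub>R w s" by (simp add: h_def)
      let ?D2 = "fderiv2 c (v s)"
      let ?X = "c (v s + h) - c (v s) - fderiv c (v s) h - (1/2) *\<^sub>R ?D2 h h"
      have "\<sigma> * B \<le> d" using t(2) B by (simp add: field_simps)
      then have "norm h \<le> d" using hB by linarith
      then have X: "norm ?X \<le> e * (norm h)\<^sup>2" using d(2) vR by blast
      have "e * (norm h)\<^sup>2 \<le> e * (\<sigma> * B)\<^sup>2" using hB e by (intro mult_left_mono power_mono) auto
      also have "\<dots> = \<sigma>\<^sup>2 * r / 2" using B by (simp add: e_def power_mult_distrib)
      finally have X2: "norm ?X \<le> \<sigma>\<^sup>2 * r / 2" using X by linarith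
      have D2: "norm (?D2 y z) \<le> K * norm y * norm z" for y z
      proof -
        have "norm (?D2 y) \<le> K * norm y" by (rule norm_fderiv_blinfun_le) (use K(2) vR in blast)
        then show ?thesis by (rule norm_fderiv_blinfun_le)
      qed
      \<comment> \<open>The Hessian at \<open>h\<close> differs from the one at
        \<open>\<sigma> *\<^sub>R dv s\<close> only by terms of order at least three in
        \<open>\<sigma>\<close>.\<close>
      let ?q = "?D2 h h - \<sigma>\<^sup>2 *\<^sub>R ?D2 (dv s) (dv s)"
      have qeq: "?q = ?D2 (\<sigma>\<^sup>2 *\<^sub>R w s) h + ?D2 (\<sigma> *\<^sub>R dv s) (\<sigma>\<^sup>2 *\<^sub>R w s)"
        unfolding h_def blinfun.add_left blinfun.add_right blinfun.scaleR_left blinfun.scaleR_right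
        by (simp add: power2_eq_square algebra_simps)
      have WB: "norm (\<sigma>\<^sup>2 *\<^sub>R w s) \<le> \<sigma>\<^sup>2 * B" using n2 mult_left_mono[OF B(3) zero_le_power2[of \<sigma>]] by linarith
      have QB: "norm (\<sigma> *\<^sub>R dv s) \<le> \<sigma> * B" using n1 mult_left_mono[OF B(2) less_imp_le[OF \<sigma>(1)]] by linarith
      have q1: "norm (?D2 (\<sigma>\<^sup>2 *\<^sub>R w s) h) \<le> K * (\<sigma>\<^sup>2 * B) * (\<sigma> * B)"
        by (rule order_trans[OF D2 mult_left_mono3[OF _ WB hB]]) (use K B in simp_all)
      have q2: "norm (?D2 (\<sigma> *\<^sub>R dv s) (\<sigma>\<^sup>2 *\<^sub>R w s)) \<le> K * (\<sigma> * B) * (\<sigma>\<^sup>2 * B)"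
        by (rule order_trans[OF D2 mult_left_mono3[OF _ QB WB]]) (use K B \<sigma> in simp_all)
      have "norm ?q \<le> K * (\<sigma>\<^sup>2 * B) * (\<sigma> * B) + K * (\<sigma> * B) * (\<sigma>\<^sup>2 * B)"
        unfolding qeq by (rule norm_triangle_le[OF add_mono[OF q1 q2]])
      also have "\<dots> = 2 * \<sigma>\<^sup>2 * ((K * B\<^sup>2) * \<sigma>)" by (simp add: power2_eq_square algebra_simps)
      also have "\<dots> \<le> 2 * \<sigma>\<^sup>2 * (r / 2)"
      proof (rule mult_left_mono)
        have "(2 * K * B\<^sup>2) * \<sigma> < r" using t(5) K B by (simp add: field_simps)
        then show "(K * B\<^sup>2) * \<sigma> \<le> r / 2" by simp
      qed simp
      finally have q: "norm ?q \<le> \<sigma>\<^sup>2 * r" by simp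
      have x1: "?X $ i \<le> \<sigma>\<^sup>2 * r / 2" using component_le_norm_cart[of ?X i] X2 by linarith
      have x2: "?q $ i \<le> \<sigma>\<^sup>2 * r" using component_le_norm_cart[of ?q i] q by linarith
      have "c (v s) $ i \<ge> - a" "c (v s) $ i \<ge> - a'" using True by (auto simp: b_def)
      then have x3: "fderiv c (v s) (dv s) $ i = 0"
        "fderiv c (v s) (w s) $ i + 1/2 * ?D2 (dv s) (dv s) $ i \<le> - r"
        using crit(2) w'(4) s by blast+
      have Dh: "fderiv c (v s) h $ i = \<sigma>\<^sup>2 * (fderiv c (v s) (w s) $ i)"
        unfolding h_def by (simp add: blinfun.add_right blinfun.scaleR_right x3(1))
      have "c (v s + h) $ i = c (v s) $ i + fderiv c (v s) h $ i + ?X $ i + 1/2 * ?q $ i + \<sigma>\<^sup>2 * (1/2 * ?D2 (dv s) (dv s) $ i)"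
        by (simp add: algebra_simps)
      also have "\<dots> = c (v s) $ i + ?X $ i + 1/2 * ?q $ i + \<sigma>\<^sup>2 * (fderiv c (v s) (w s) $ i + 1/2 * ?D2 (dv s) (dv s) $ i)"
        unfolding Dh by (simp only: distrib_left)
      also have "\<dots> \<le> 0 + \<sigma>\<^sup>2 * r / 2 + 1/2 * (\<sigma>\<^sup>2 * r) + \<sigma>\<^sup>2 * (- r)"
        by (intro add_mono mult_left_mono feas[OF s] x1 x2 x3(2)) simp_all
      also have "\<dots> = 0" by simp
      finally show ?thesis unfolding eq .
    qed
  qed
  then show ?thesis by (intro that[OF \<sigma>0]) blast
qed

text \<open>In the second limit the linear term is kept at the true deviation
  \<open>z \<sigma> - y\<close>: replacing it by \<open>\<sigma> *\<^sub>R d\<close> would leave an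
  error of the same order \<open>\<sigma>\<^sup>2\<close>. The adjoint state accounts for it in
  \<open>second_order\<close>.\<close>

lemma point_expansion:
  fixes h :: "'a::euclidean_space \<Rightarrow> real" and z :: "real \<Rightarrow> 'a"
  assumes h: "C2 h" and s0: "0 < \<sigma>0" and z: "\<And>\<sigma>. 0 < \<sigma> \<Longrightarrow> \<sigma> < \<sigma>0 \<Longrightarrow> norm (z \<sigma> - y - \<sigma> *\<^sub>R d) \<le> C0 * \<sigma>\<^sup>2"
  shows "((\<lambda>\<sigma>. (h (z \<sigma>) - h y) / \<sigma>) \<longlongrightarrow> fderiv h y d) (at_right 0)" (is ?A)
    and "((\<lambda>\<sigma>. (h (z \<sigma>) - h y - fderiv h y (z \<sigma> - y)) / \<sigma>\<^sup>2) \<longlongrightarrow> 1/2 * fderiv2 h y d d) (at_right 0)" (is ?B)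
proof -
  \<comment> \<open>The difference quotient tends to \<open>d\<close>; writing the deviation as
    \<open>\<sigma> *\<^sub>R e \<sigma>\<close> makes the powers of \<open>\<sigma>\<close>
    explicit.\<close>
  define e where "e \<sigma> = (z \<sigma> - y) /\<^sub>R \<sigma>" for \<sigma>
  have ev: "eventually (\<lambda>\<sigma>. 0 < \<sigma> \<and> \<sigma> < \<sigma>0) (at_right 0)"
    using eventually_at_right_real[OF s0] by (rule eventually_mono) auto
  have s_lim: "((\<lambda>\<sigma>::real. \<sigma>) \<longlongrightarrow> 0) (at_right 0)" by (rule tendsto_ident_at)
  have e_lim: "(e \<longlongrightarrow> d) (at_right 0)"
  proof (rule Lim_transform2[OF tendsto_const])
    show "((\<lambda>\<sigma>. d - e \<sigma>) \<longlongrightarrow> 0) (at_right 0)"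
    proof (rule Lim_null_comparison)
      show "eventually (\<lambda>\<sigma>. norm (d - e \<sigma>) \<le> C0 * \<sigma>) (at_right 0)"
        using ev
      proof eventually_elim
        case (elim \<sigma>)
        then have "d - e \<sigma> = (- 1 / \<sigma>) *\<^sub>R (z \<sigma> - y - \<sigma> *\<^sub>R d)" by (simp add: e_def algebra_simps divide_inverse)
        then have "norm (d - e \<sigma>) = norm (z \<sigma> - y - \<sigma> *\<^sub>R d) / \<sigma>" using elim by simp
        also have "\<dots> \<le> (C0 * \<sigma>\<^sup>2) / \<sigma>" using z[of \<sigma>] elim by (intro divide_right_mono) auto
        finally show ?case using elim by (simp add: power2_eq_square)
      qed
      show "((\<lambda>\<sigma>. C0 * \<sigma>) \<longlongrightarrow> 0) (at_right 0)" using tendsto_mult_right_zero[OF s_lim] .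
    qed
  qed
  have zeq: "eventually (\<lambda>\<sigma>. z \<sigma> = y + \<sigma> *\<^sub>R e \<sigma>) (at_right 0)"
    using ev by eventually_elim (simp add: e_def)
  have se_lim: "((\<lambda>\<sigma>. \<sigma> *\<^sub>R e \<sigma>) \<longlongrightarrow> 0) (at_right 0)" using tendsto_scaleR[OF s_lim e_lim] by simp
  let ?r = "\<lambda>k. h (y + k) - h y - fderiv h y k - 1/2 * fderiv2 h y k k"
  have r_lim: "((\<lambda>\<sigma>. ?r (\<sigma> *\<^sub>R e \<sigma>) / \<sigma>\<^sup>2) \<longlongrightarrow> 0) (at_right 0)"
  proof (rule tendstoI)
    fix \<epsilon> :: real assume \<epsilon>: "0 < \<epsilon>"
    define \<eta> where "\<eta> = \<epsilon> / (norm d + 1)\<^sup>2"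
    have dp: "0 < (norm d + 1)\<^sup>2" using norm_ge_zero[of d] by (intro zero_less_power) linarith
    have \<eta>: "0 < \<eta>" using \<epsilon> dp by (simp add: \<eta>_def)
    obtain t where t: "0 < t" "\<forall>x k. norm x \<le> norm y \<longrightarrow> norm k \<le> t \<longrightarrow>
        norm (h (x + k) - h x - fderiv h x k - (1/2) *\<^sub>R fderiv2 h x k k) \<le> \<eta> * (norm k)\<^sup>2"
      by (rule C2_taylor2[OF h \<eta>])
    have "eventually (\<lambda>\<sigma>. norm (\<sigma> *\<^sub>R e \<sigma>) < t) (at_right 0)"
      using tendstoD[OF se_lim t(1)] by simp
    moreover have "eventually (\<lambda>\<sigma>. dist (norm (e \<sigma>)) (norm d) < 1) (at_right 0)"
      by (rule tendstoD[OF tendsto_norm[OF e_lim]]) simp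
    ultimately show "eventually (\<lambda>\<sigma>. dist (?r (\<sigma> *\<^sub>R e \<sigma>) / \<sigma>\<^sup>2) 0 < \<epsilon>) (at_right 0)"
      using ev
    proof eventually_elim
      case (elim \<sigma>)
      have "norm (?r (\<sigma> *\<^sub>R e \<sigma>)) \<le> \<eta> * (norm (\<sigma> *\<^sub>R e \<sigma>))\<^sup>2" using t(2)[rule_format, of y "\<sigma> *\<^sub>R e \<sigma>"] elim(1) by simp
      also have "\<dots> = \<sigma>\<^sup>2 * (\<eta> * (norm (e \<sigma>))\<^sup>2)" by (simp add: power_mult_distrib)
      finally have "norm (?r (\<sigma> *\<^sub>R e \<sigma>)) / \<sigma>\<^sup>2 \<le> \<eta> * (norm (e \<sigma>))\<^sup>2" using elim(3) by (simp add: divide_le_eq mult.commute)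
      also have "\<dots> < \<eta> * (norm d + 1)\<^sup>2"
        using elim(2) \<eta> by (intro mult_strict_left_mono power_strict_mono) (auto simp: dist_real_def)
      also have "\<dots> = \<epsilon>" using dp by (simp add: \<eta>_def)
      finally show ?case by simp
    qed
  qed
  have q_lim: "((\<lambda>\<sigma>. fderiv2 h y (e \<sigma>) (e \<sigma>)) \<longlongrightarrow> fderiv2 h y d d) (at_right 0)"
    by (intro bounded_bilinear.tendsto[OF bounded_bilinear_blinfun_apply] tendsto_const e_lim)
  have f_lim: "((\<lambda>\<sigma>. fderiv h y (e \<sigma>)) \<longlongrightarrow> fderiv h y d) (at_right 0)"
    by (intro bounded_bilinear.tendsto[OF bounded_bilinear_blinfun_apply] tendsto_const e_lim)
  have "((\<lambda>\<sigma>. ?r (\<sigma> *\<^sub>R e \<sigma>) / \<sigma>\<^sup>2 + 1/2 * fderiv2 h y (e \<sigma>) (e \<sigma>)) \<longlongrightarrow> 0 + 1/2 * fderiv2 h y d d) (at_right 0)"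
    by (intro tendsto_add tendsto_mult tendsto_const r_lim q_lim)
  moreover have "eventually (\<lambda>\<sigma>. ?r (\<sigma> *\<^sub>R e \<sigma>) / \<sigma>\<^sup>2 + 1/2 * fderiv2 h y (e \<sigma>) (e \<sigma>)
      = (h (z \<sigma>) - h y - fderiv h y (z \<sigma> - y)) / \<sigma>\<^sup>2) (at_right 0)"
    using ev zeq
  proof eventually_elim
    case (elim \<sigma>)
    have "fderiv2 h y (\<sigma> *\<^sub>R e \<sigma>) (\<sigma> *\<^sub>R e \<sigma>) = \<sigma>\<^sup>2 * fderiv2 h y (e \<sigma>) (e \<sigma>)"
      by (simp add: blinfun.scaleR_right blinfun.scaleR_left power2_eq_square)
    then show ?case using elim by (simp add: field_simps)
  qed
  ultimately show 2: ?B
    using Lim_transform_eventually by fastforce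
  have "((\<lambda>\<sigma>. \<sigma> * ((h (z \<sigma>) - h y - fderiv h y (z \<sigma> - y)) / \<sigma>\<^sup>2) + fderiv h y (e \<sigma>)) \<longlongrightarrow> 0 * (1/2 * fderiv2 h y d d) + fderiv h y d) (at_right 0)"
    by (intro tendsto_add tendsto_mult s_lim 2 f_lim)
  moreover have "eventually (\<lambda>\<sigma>. \<sigma> * ((h (z \<sigma>) - h y - fderiv h y (z \<sigma> - y)) / \<sigma>\<^sup>2) + fderiv h y (e \<sigma>) = (h (z \<sigma>) - h y) / \<sigma>) (at_right 0)"
    using ev zeq
  proof eventually_elim
    case (elim \<sigma>)
    have "z \<sigma> - y = \<sigma> *\<^sub>R e \<sigma>" using elim by simp
    then have "fderiv h y (z \<sigma> - y) = \<sigma> * fderiv h y (e \<sigma>)" by (simp add: blinfun.scaleR_right)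
    then show ?case using elim(1) by (simp add: field_simps power2_eq_square)
  qed
  ultimately show ?A
    using Lim_transform_eventually by fastforce
qed

section \<open>The penalised problem\<close>

text \<open>The length of an arc is treated as a constant component of its control,
  \<open>\<xi>\<close> on the first arc and \<open>T - \<xi>\<close> on the second. Variations of
  the crossing time then enter like control variations.\<close>

definition scaled :: "('x::euclidean_space \<times> 'v::euclidean_space \<Rightarrow> 'x) \<Rightarrow> 'x \<times> (real \<times> 'v) \<Rightarrow> 'x"
  where "scaled f = (\<lambda>(x, r, u). r *\<^sub>R f (x, u))"

lemma scaled_apply: "scaled f (x, r, u) = r *\<^sub>R f (x, u)"
  by (simp add: scaled_def)

lemma bounded_linear_forget_scale: "bounded_linear (\<lambda>z :: 'x::euclidean_space \<times> (real \<times> 'v::euclidean_space). (fst z, snd (snd z)))"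
  by (intro bounded_linear_Pair bounded_linear_fst bounded_linear_compose[OF bounded_linear_snd bounded_linear_snd])

lemma bounded_linear_scale: "bounded_linear (\<lambda>z :: 'x::euclidean_space \<times> (real \<times> 'v::euclidean_space). fst (snd z))"
  by (intro bounded_linear_compose[OF bounded_linear_fst bounded_linear_snd])

lemma
  fixes f :: "'x::euclidean_space \<times> 'v::euclidean_space \<Rightarrow> 'x"
  assumes f: "C2 f"
  shows C2_scaled: "C2 (scaled f)"
    and fderiv_scaled: "fderiv (scaled f) (x, r, u) (h, \<rho>, k) = r *\<^sub>R fderiv f (x, u) (h, k) + \<rho> *\<^sub>R f (x, u)" (is ?B)
proof -
  have eq: "scaled f = (\<lambda>z. fst (snd z) *\<^sub>R f (fst z, snd (snd z)))" by (auto simp: scaled_def fun_eq_iff)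
  have f': "C2 (\<lambda>z :: 'x \<times> (real \<times> 'v). f (fst z, snd (snd z)))"
    using fderiv_compose_affine(1)[OF bounded_linear_forget_scale f, of 0] by simp
  show "C2 (scaled f)" unfolding eq
    by (rule C2_bilinear[OF bounded_bilinear_scaleR C2_linear[OF bounded_linear_scale] f'])
  have "fderiv (\<lambda>z :: 'x \<times> (real \<times> 'v). f (fst z, snd (snd z))) (x, r, u) (h, \<rho>, k) = fderiv f (x, u) (h, k)"
    using fderiv_compose_affine(2)[OF bounded_linear_forget_scale f, of 0] by simp
  then show ?B
    unfolding eq
    by (subst fderiv_bilinear[OF bounded_bilinear_scaleR C2_linear[OF bounded_linear_scale] f'])
       (simp add: fderiv_linear[OF bounded_linear_scale])
qed

text \<open>What the second order analysis uses of the crisis problem: two arcs joined at the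
  crossing and, in \<open>opt\<close>, minimality for the penalised cost among nearby pairs of
  joined arcs. The set \<open>K\<close> and the original time variable have disappeared.\<close>

locale crisis_core =
  fixes f :: "'x::euclidean_space \<times> 'v::euclidean_space \<Rightarrow> 'x" and c :: "'v \<Rightarrow> real ^ 'l"
    and \<phi> g :: "'x \<Rightarrow> real" and \<epsilon> \<delta> T \<tau> k \<rho> :: real and y1 y2 :: "real \<Rightarrow> 'x" and v1 v2 :: "real \<Rightarrow> 'v"
    and E :: "'v \<Rightarrow> 'l \<Rightarrow> 'v"
  assumes f: "C2 f" and c: "C2 c" and \<phi>: "C2 \<phi>" and g: "C2 g" and eps: "0 < \<epsilon>" and del: "0 < \<delta>"
    and v1: "bmeas v1" and v2: "bmeas v2"
    and qual1: "\<And>s. s \<in> {0..1} \<Longrightarrow> grad_qualified c \<epsilon> \<delta> (v1 s)"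
    and qual2: "\<And>s. s \<in> {0..1} \<Longrightarrow> grad_qualified c \<epsilon> \<delta> (v2 s)"
    and feas1: "\<And>s i. s \<in> {0..1} \<Longrightarrow> c (v1 s) $ i \<le> 0"
    and feas2: "\<And>s i. s \<in> {0..1} \<Longrightarrow> c (v2 s) $ i \<le> 0"
    and E_meas: "\<And>i. (\<lambda>u. E u i) \<in> borel_measurable borel"
    and E_bound: "\<And>u i. grad_qualified c \<epsilon> \<delta> u \<Longrightarrow> c u $ i \<ge> - \<delta> \<Longrightarrow> norm (E u i) \<le> 1 / \<epsilon>"
    and E_inv: "\<And>u i k. grad_qualified c \<epsilon> \<delta> u \<Longrightarrow> c u $ i \<ge> - \<delta> \<Longrightarrow> c u $ k \<ge> - \<delta> \<Longrightarrow>
       fderiv c u (E u i) $ k = (if k = i then 1 else 0)"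
    and y1: "lip_path y1 (\<lambda>s. scaled f (y1 s, \<tau>, v1 s))"
    and y2: "lip_path y2 (\<lambda>s. scaled f (y2 s, T - \<tau>, v2 s))"
    and y12: "y2 0 = y1 1" and g0: "g (y1 1) = 0"
    and k: "0 \<le> k" and rho: "0 < \<rho>"
    and opt: "\<And>\<xi> w1 w2 z1 z2. \<bar>\<xi> - \<tau>\<bar> \<le> \<rho> \<Longrightarrow> bmeas w1 \<Longrightarrow> bmeas w2 \<Longrightarrow>
      (\<And>s. s \<in> {0..1} \<Longrightarrow> norm (w1 s - v1 s) \<le> \<rho> \<and> norm (w2 s - v2 s) \<le> \<rho>) \<Longrightarrow>
      (\<And>s i. s \<in> {0..1} \<Longrightarrow> c (w1 s) $ i \<le> 0 \<and> c (w2 s) $ i \<le> 0) \<Longrightarrow>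
      z1 0 = y1 0 \<Longrightarrow> z2 0 = z1 1 \<Longrightarrow>
      lip_path z1 (\<lambda>s. scaled f (z1 s, \<xi>, w1 s)) \<Longrightarrow> lip_path z2 (\<lambda>s. scaled f (z2 s, T - \<xi>, w2 s)) \<Longrightarrow>
      (\<And>s. s \<in> {0..1} \<Longrightarrow> norm (z1 s - y1 s) \<le> \<rho> \<and> norm (z2 s - y2 s) \<le> \<rho>) \<Longrightarrow>
      \<phi> (y2 1) - \<tau> \<le> \<phi> (z2 1) - \<xi> + k * max 0 (g (z1 1))"
begin

abbreviation "F \<equiv> scaled f"

definition V1 :: "real \<Rightarrow> real \<times> 'v" where "V1 s = (\<tau>, v1 s)"
definition V2 :: "real \<Rightarrow> real \<times> 'v" where "V2 s = (T - \<tau>, v2 s)"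

lemma F: "C2 F" by (rule C2_scaled[OF f])

lemma V1: "bmeas V1" unfolding V1_def by (intro bmeas_Pair bmeas_const v1)
lemma V2: "bmeas V2" unfolding V2_def by (intro bmeas_Pair bmeas_const v2)

lemma Y1: "lip_path y1 (\<lambda>s. F (y1 s, V1 s))" using y1 by (simp add: V1_def)
lemma Y2: "lip_path y2 (\<lambda>s. F (y2 s, V2 s))" using y2 by (simp add: V2_def)

sublocale B1: qualified_block c \<epsilon> \<delta> v1 E
  by unfold_locales (fact c eps del v1 qual1 feas1 E_meas E_bound E_inv)+

sublocale B2: qualified_block c \<epsilon> \<delta> v2 E
  by unfold_locales (fact c eps del v2 qual2 feas2 E_meas E_bound E_inv)+

text \<open>The initial state is fixed and the arcs stay joined, whence the two initial
  values.\<close>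

definition linearized :: "real \<Rightarrow> (real \<Rightarrow> 'v) \<Rightarrow> (real \<Rightarrow> 'v) \<Rightarrow> (real \<Rightarrow> 'x) \<Rightarrow> (real \<Rightarrow> 'x) \<Rightarrow> bool"
  where "linearized d\<xi> h1 h2 d1 d2 \<longleftrightarrow> bmeas h1 \<and> bmeas h2 \<and> d1 0 = 0 \<and> d2 0 = d1 1 \<and>
    lip_path d1 (\<lambda>s. fderiv F (y1 s, V1 s) (d1 s, d\<xi>, h1 s)) \<and>
    lip_path d2 (\<lambda>s. fderiv F (y2 s, V2 s) (d2 s, - d\<xi>, h2 s))"

text \<open>The margin ensures that \<open>v + \<sigma> h\<close> violates no
  constraint at first order.\<close>

definition tangent :: "(real \<Rightarrow> 'v) \<Rightarrow> (real \<Rightarrow> 'v) \<Rightarrow> bool"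
  where "tangent v h \<longleftrightarrow> (\<exists>a>0. \<forall>s\<in>{0..1}. \<forall>i. c (v s) $ i \<ge> - a \<longrightarrow> fderiv c (v s) (h s) $ i = 0)"

lemma linearized_ex:
  assumes "bmeas h1" "bmeas h2"
  obtains d1 d2 where "linearized d\<xi> h1 h2 d1 d2"
proof -
  have b: "bmeas (\<lambda>s. (d\<xi>, h1 s))" "bmeas (\<lambda>s. (- d\<xi>, h2 s))" by (intro bmeas_Pair bmeas_const assms)+
  obtain d1 where 1: "d1 0 = 0" "lip_path d1 (\<lambda>s. fderiv F (y1 s, V1 s) (d1 s, d\<xi>, h1 s))"
    by (rule linear_solution[OF F V1 bmeas_lip_path[OF Y1] b(1)])
  obtain d2 where 2: "d2 0 = d1 1" "lip_path d2 (\<lambda>s. fderiv F (y2 s, V2 s) (d2 s, - d\<xi>, h2 s))"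
    by (rule linear_solution[OF F V2 bmeas_lip_path[OF Y2] b(2)])
  show ?thesis by (rule that[of d1 d2]) (use 1 2 assms in \<open>simp add: linearized_def\<close>)
qed

text \<open>The correction \<open>\<zeta>\<close> of the crossing time ranges over all reals, since
  \<open>\<xi>\<close> is free near \<open>\<tau>\<close>; this later turns an inequality into the
  equation in \<open>valid\<close>.\<close>

lemma perturbed_family:
  assumes lin: "linearized d\<xi> h1 h2 d1 d2" and t: "tangent v1 h1" "tangent v2 h2"
    and w: "second_order_feasible c v1 h1 w1" "second_order_feasible c v2 h2 w2"
  obtains \<sigma>0 C0 z1 z2 where "0 < \<sigma>0" "0 < C0"
    "\<forall>\<sigma>. 0 < \<sigma> \<longrightarrow> \<sigma> < \<sigma>0 \<longrightarrow> z1 \<sigma> 0 = y1 0 \<and> z2 \<sigma> 0 = z1 \<sigma> 1 \<and>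
       lip_path (z1 \<sigma>) (\<lambda>s. F (z1 \<sigma> s, V1 s + \<sigma> *\<^sub>R (d\<xi>, h1 s) + \<sigma>\<^sup>2 *\<^sub>R (\<zeta>, w1 s))) \<and>
       lip_path (z2 \<sigma>) (\<lambda>s. F (z2 \<sigma> s, V2 s + \<sigma> *\<^sub>R (- d\<xi>, h2 s) + \<sigma>\<^sup>2 *\<^sub>R (- \<zeta>, w2 s))) \<and>
       (\<forall>s\<in>{0..1}. norm (z1 \<sigma> s - y1 s - \<sigma> *\<^sub>R d1 s) \<le> C0 * \<sigma>\<^sup>2 \<and> norm (z2 \<sigma> s - y2 s - \<sigma> *\<^sub>R d2 s) \<le> C0 * \<sigma>\<^sup>2) \<and>
       \<phi> (y2 1) - \<tau> \<le> \<phi> (z2 \<sigma> 1) - (\<tau> + \<sigma> * d\<xi> + \<sigma>\<^sup>2 * \<zeta>) + k * max 0 (g (z1 \<sigma> 1))"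
proof -
  have l: "bmeas h1" "bmeas h2" "d1 0 = 0" "d2 0 = d1 1"
    "lip_path d1 (\<lambda>s. fderiv F (y1 s, V1 s) (d1 s, d\<xi>, h1 s))"
    "lip_path d2 (\<lambda>s. fderiv F (y2 s, V2 s) (d2 s, - d\<xi>, h2 s))"
    using lin by (auto simp: linearized_def)
  have wb: "bmeas w1" "bmeas w2" using w by (auto simp: second_order_feasible_def)
  have b: "bmeas (\<lambda>s. (d\<xi>, h1 s))" "bmeas (\<lambda>s. (- d\<xi>, h2 s))" "bmeas (\<lambda>s. (\<zeta>, w1 s))" "bmeas (\<lambda>s. (- \<zeta>, w2 s))"
    by (intro bmeas_Pair bmeas_const l wb)+
  have init1: "\<forall>\<sigma>::real. 0 < \<sigma> \<longrightarrow> \<sigma> < 1 \<longrightarrow> norm (y1 0 - y1 0 - \<sigma> *\<^sub>R d1 0) \<le> 1 * \<sigma>\<^sup>2" using l(3) by simp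
  obtain \<sigma>1 C1 z1 where 1: "0 < \<sigma>1" "\<sigma>1 \<le> 1" "0 < C1"
    "\<forall>\<sigma>. 0 < \<sigma> \<longrightarrow> \<sigma> < \<sigma>1 \<longrightarrow> z1 \<sigma> 0 = y1 0 \<and>
      lip_path (z1 \<sigma>) (\<lambda>s. F (z1 \<sigma> s, V1 s + \<sigma> *\<^sub>R (d\<xi>, h1 s) + \<sigma>\<^sup>2 *\<^sub>R (\<zeta>, w1 s))) \<and>
      (\<forall>s\<in>{0..1}. norm (z1 \<sigma> s - y1 s - \<sigma> *\<^sub>R d1 s) \<le> C1 * \<sigma>\<^sup>2)"
    by (rule perturbation_family[OF F V1 Y1 b(1) b(3) l(5) zero_less_one zero_less_one init1])
  have init2: "\<forall>\<sigma>. 0 < \<sigma> \<longrightarrow> \<sigma> < \<sigma>1 \<longrightarrow> norm (z1 \<sigma> 1 - y2 0 - \<sigma> *\<^sub>R d2 0) \<le> C1 * \<sigma>\<^sup>2"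
    using 1(4) l(4) y12 by simp
  obtain \<sigma>2 C2 z2 where 2: "0 < \<sigma>2" "\<sigma>2 \<le> \<sigma>1" "0 < C2"
    "\<forall>\<sigma>. 0 < \<sigma> \<longrightarrow> \<sigma> < \<sigma>2 \<longrightarrow> z2 \<sigma> 0 = z1 \<sigma> 1 \<and>
      lip_path (z2 \<sigma>) (\<lambda>s. F (z2 \<sigma> s, V2 s + \<sigma> *\<^sub>R (- d\<xi>, h2 s) + \<sigma>\<^sup>2 *\<^sub>R (- \<zeta>, w2 s))) \<and>
      (\<forall>s\<in>{0..1}. norm (z2 \<sigma> s - y2 s - \<sigma> *\<^sub>R d2 s) \<le> C2 * \<sigma>\<^sup>2)"
    by (rule perturbation_family[OF F V2 Y2 b(2) b(4) l(6) 1(1) 1(3) init2])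
  obtain a1 where a1: "0 < a1" "\<forall>s\<in>{0..1}. \<forall>i. c (v1 s) $ i \<ge> - a1 \<longrightarrow> fderiv c (v1 s) (h1 s) $ i = 0"
    using t(1) unfolding tangent_def by (elim exE conjE) (rule that)
  obtain a2 where a2: "0 < a2" "\<forall>s\<in>{0..1}. \<forall>i. c (v2 s) $ i \<ge> - a2 \<longrightarrow> fderiv c (v2 s) (h2 s) $ i = 0"
    using t(2) unfolding tangent_def by (elim exE conjE) (rule that)
  obtain \<sigma>3 where 3: "0 < \<sigma>3" "\<forall>\<sigma>. 0 < \<sigma> \<longrightarrow> \<sigma> < \<sigma>3 \<longrightarrow> (\<forall>s\<in>{0..1}. \<forall>i. c (v1 s + \<sigma> *\<^sub>R h1 s + \<sigma>\<^sup>2 *\<^sub>R w1 s) $ i \<le> 0)"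
    by (rule feasible_perturbation[OF c v1 feas1 l(1) w(1) a1])
  obtain \<sigma>4 where 4: "0 < \<sigma>4" "\<forall>\<sigma>. 0 < \<sigma> \<longrightarrow> \<sigma> < \<sigma>4 \<longrightarrow> (\<forall>s\<in>{0..1}. \<forall>i. c (v2 s + \<sigma> *\<^sub>R h2 s + \<sigma>\<^sup>2 *\<^sub>R w2 s) $ i \<le> 0)"
    by (rule feasible_perturbation[OF c v2 feas2 l(2) w(2) a2])
  have bb: "bmeas (\<lambda>s. (h1 s, w1 s, h2 s, w2 s, d1 s, d2 s))"
    by (intro bmeas_Pair l wb bmeas_lip_path[OF l(5)] bmeas_lip_path[OF l(6)])
  obtain M where M: "0 < M" "\<forall>s\<in>{0..1}. norm (h1 s, w1 s, h2 s, w2 s, d1 s, d2 s) \<le> M" by (rule bmeas_boundE[OF bb])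
  have Mi: "norm (h1 s) \<le> M" "norm (w1 s) \<le> M" "norm (h2 s) \<le> M" "norm (w2 s) \<le> M" "norm (d1 s) \<le> M" "norm (d2 s) \<le> M"
    if "s \<in> {0..1}" for s
  proof -
    have m: "norm (h1 s, w1 s, h2 s, w2 s, d1 s, d2 s) \<le> M" using M(2) that by blast
    show "norm (h1 s) \<le> M" using m norm_fst_le order_trans by blast
    have m: "norm (w1 s, h2 s, w2 s, d1 s, d2 s) \<le> M" using m norm_snd_le order_trans by blast
    show "norm (w1 s) \<le> M" using m norm_fst_le order_trans by blast
    have m: "norm (h2 s, w2 s, d1 s, d2 s) \<le> M" using m norm_snd_le order_trans by blast
    show "norm (h2 s) \<le> M" using m norm_fst_le order_trans by blast
    have m: "norm (w2 s, d1 s, d2 s) \<le> M" using m norm_snd_le order_trans by blast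
    show "norm (w2 s) \<le> M" using m norm_fst_le order_trans by blast
    have m: "norm (d1 s, d2 s) \<le> M" using m norm_snd_le order_trans by blast
    show "norm (d1 s) \<le> M" using m norm_fst_le order_trans by blast
    show "norm (d2 s) \<le> M" using m norm_snd_le order_trans by blast
  qed
  define C0 where "C0 = C1 + C2"
  \<comment> \<open>Bounds the sum of the first and second order coefficients of every perturbed
    quantity, so \<open>\<sigma> * m \<le> \<rho>\<close> brings all of them into the range of
    \<open>opt\<close>.\<close>
  define m where "m = C0 + M + M + \<bar>d\<xi>\<bar> + \<bar>\<zeta>\<bar>"
  have C0: "0 < C0" using 1(3) 2(3) by (simp add: C0_def)
  have m: "0 < m" using C0 M by (simp add: m_def)
  define \<sigma>0 where "\<sigma>0 = min (min 1 \<sigma>2) (min (min \<sigma>3 \<sigma>4) (\<rho> / m))"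
  have \<sigma>0: "0 < \<sigma>0" using 2 3 4 m rho by (simp add: \<sigma>0_def)
  have small: "norm (\<sigma> *\<^sub>R a + \<sigma>\<^sup>2 *\<^sub>R b) \<le> \<rho>" if "0 < \<sigma>" "\<sigma> < \<sigma>0" "norm a + norm b \<le> m" for \<sigma> and a b :: "'q::real_normed_vector"
  proof -
    have "\<sigma>\<^sup>2 \<le> \<sigma>" using that by (simp add: \<sigma>0_def power2_eq_square mult_left_le)
    then have "\<sigma>\<^sup>2 * norm b \<le> \<sigma> * norm b" by (intro mult_right_mono) auto
    then have "norm (\<sigma> *\<^sub>R a + \<sigma>\<^sup>2 *\<^sub>R b) \<le> \<sigma> * norm a + \<sigma> * norm b"
      using norm_triangle_ineq[of "\<sigma> *\<^sub>R a" "\<sigma>\<^sup>2 *\<^sub>R b"] that(1) by simp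
    also have "\<dots> = \<sigma> * (norm a + norm b)" by (simp add: distrib_left)
    also have "\<dots> \<le> \<sigma> * m" using that by (intro mult_left_mono) auto
    also have "\<dots> \<le> \<rho>" using that(2) m by (simp add: \<sigma>0_def field_simps)
    finally show ?thesis .
  qed
  \<comment> \<open>The state deviation is brought to the form
    \<open>\<sigma> *\<^sub>R d + \<sigma>\<^sup>2 *\<^sub>R b\<close> with
    \<open>norm b \<le> C0\<close>, so \<open>small\<close> covers it as well.\<close>
  have small2: "norm (z - y) \<le> \<rho>" if "0 < \<sigma>" "\<sigma> < \<sigma>0" "norm (z - y - \<sigma> *\<^sub>R d) \<le> C0 * \<sigma>\<^sup>2" "norm d \<le> M" for \<sigma> and z y d :: 'x
  proof -
    define b where "b = (z - y - \<sigma> *\<^sub>R d) /\<^sub>R \<sigma>\<^sup>2"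
    have "z - y = \<sigma> *\<^sub>R d + \<sigma>\<^sup>2 *\<^sub>R b" using that(1) by (simp add: b_def)
    moreover have "norm b \<le> C0" using that(1,3) by (simp add: b_def divide_le_eq mult.commute inverse_eq_divide)
    ultimately show ?thesis using small[OF that(1,2), of d b] that(4) M by (simp add: m_def)
  qed
  show ?thesis
  proof (rule that[of \<sigma>0 C0 z1 z2])
    show "0 < \<sigma>0" "0 < C0" by (fact \<sigma>0 C0)+
    show "\<forall>\<sigma>. 0 < \<sigma> \<longrightarrow> \<sigma> < \<sigma>0 \<longrightarrow> z1 \<sigma> 0 = y1 0 \<and> z2 \<sigma> 0 = z1 \<sigma> 1 \<and>
       lip_path (z1 \<sigma>) (\<lambda>s. F (z1 \<sigma> s, V1 s + \<sigma> *\<^sub>R (d\<xi>, h1 s) + \<sigma>\<^sup>2 *\<^sub>R (\<zeta>, w1 s))) \<and>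
       lip_path (z2 \<sigma>) (\<lambda>s. F (z2 \<sigma> s, V2 s + \<sigma> *\<^sub>R (- d\<xi>, h2 s) + \<sigma>\<^sup>2 *\<^sub>R (- \<zeta>, w2 s))) \<and>
       (\<forall>s\<in>{0..1}. norm (z1 \<sigma> s - y1 s - \<sigma> *\<^sub>R d1 s) \<le> C0 * \<sigma>\<^sup>2 \<and> norm (z2 \<sigma> s - y2 s - \<sigma> *\<^sub>R d2 s) \<le> C0 * \<sigma>\<^sup>2) \<and>
       \<phi> (y2 1) - \<tau> \<le> \<phi> (z2 \<sigma> 1) - (\<tau> + \<sigma> * d\<xi> + \<sigma>\<^sup>2 * \<zeta>) + k * max 0 (g (z1 \<sigma> 1))"
    proof (intro allI impI)
      fix \<sigma> :: real assume \<sigma>: "0 < \<sigma>" "\<sigma> < \<sigma>0"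
      then have ls: "\<sigma> < \<sigma>1" "\<sigma> < \<sigma>2" "\<sigma> < \<sigma>3" "\<sigma> < \<sigma>4" using 2(2) by (auto simp: \<sigma>0_def)
      have e1: "z1 \<sigma> 0 = y1 0" "lip_path (z1 \<sigma>) (\<lambda>s. F (z1 \<sigma> s, V1 s + \<sigma> *\<^sub>R (d\<xi>, h1 s) + \<sigma>\<^sup>2 *\<^sub>R (\<zeta>, w1 s)))"
         "\<forall>s\<in>{0..1}. norm (z1 \<sigma> s - y1 s - \<sigma> *\<^sub>R d1 s) \<le> C1 * \<sigma>\<^sup>2"
        using 1(4) \<sigma>(1) ls(1) by blast+
      have e2: "z2 \<sigma> 0 = z1 \<sigma> 1" "lip_path (z2 \<sigma>) (\<lambda>s. F (z2 \<sigma> s, V2 s + \<sigma> *\<^sub>R (- d\<xi>, h2 s) + \<sigma>\<^sup>2 *\<^sub>R (- \<zeta>, w2 s)))"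
         "\<forall>s\<in>{0..1}. norm (z2 \<sigma> s - y2 s - \<sigma> *\<^sub>R d2 s) \<le> C2 * \<sigma>\<^sup>2"
        using 2(4) \<sigma>(1) ls(2) by blast+
      have cl: "norm (z1 \<sigma> s - y1 s - \<sigma> *\<^sub>R d1 s) \<le> C0 * \<sigma>\<^sup>2" "norm (z2 \<sigma> s - y2 s - \<sigma> *\<^sub>R d2 s) \<le> C0 * \<sigma>\<^sup>2"
        if s: "s \<in> {0..1}" for s
      proof -
        have "C1 * \<sigma>\<^sup>2 \<le> C0 * \<sigma>\<^sup>2" "C2 * \<sigma>\<^sup>2 \<le> C0 * \<sigma>\<^sup>2" using 1(3) 2(3) by (auto simp: C0_def intro!: mult_right_mono)
        then show "norm (z1 \<sigma> s - y1 s - \<sigma> *\<^sub>R d1 s) \<le> C0 * \<sigma>\<^sup>2" "norm (z2 \<sigma> s - y2 s - \<sigma> *\<^sub>R d2 s) \<le> C0 * \<sigma>\<^sup>2"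
          using e1(3) e2(3) s by (meson order_trans)+
      qed
      let ?w1 = "\<lambda>s. v1 s + \<sigma> *\<^sub>R h1 s + \<sigma>\<^sup>2 *\<^sub>R w1 s"
      let ?w2 = "\<lambda>s. v2 s + \<sigma> *\<^sub>R h2 s + \<sigma>\<^sup>2 *\<^sub>R w2 s"
      let ?\<xi> = "\<tau> + \<sigma> * d\<xi> + \<sigma>\<^sup>2 * \<zeta>"
      have cost: "\<phi> (y2 1) - \<tau> \<le> \<phi> (z2 \<sigma> 1) - ?\<xi> + k * max 0 (g (z1 \<sigma> 1))"
      proof (rule opt[of ?\<xi> ?w1 ?w2 "z1 \<sigma>" "z2 \<sigma>"])
        show "\<bar>?\<xi> - \<tau>\<bar> \<le> \<rho>" using small[OF \<sigma>, of d\<xi> \<zeta>] C0 M by (simp add: m_def)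
        show "bmeas ?w1" "bmeas ?w2" by (intro bmeas_add bmeas_scaleR bmeas_const v1 v2 l wb)+
        show "z1 \<sigma> 0 = y1 0" "z2 \<sigma> 0 = z1 \<sigma> 1" by (fact e1 e2)+
        show "lip_path (z1 \<sigma>) (\<lambda>s. F (z1 \<sigma> s, ?\<xi>, ?w1 s))" using e1(2) by (simp add: V1_def)
        have eq: "V2 s + \<sigma> *\<^sub>R (- d\<xi>, h2 s) + \<sigma>\<^sup>2 *\<^sub>R (- \<zeta>, w2 s) = (T - ?\<xi>, ?w2 s)" for s by (simp add: V2_def)
        show "lip_path (z2 \<sigma>) (\<lambda>s. F (z2 \<sigma> s, T - ?\<xi>, ?w2 s))" using e2(2) unfolding eq .
        fix s :: real assume s: "s \<in> {0..1}"
        have "norm (\<sigma> *\<^sub>R h1 s + \<sigma>\<^sup>2 *\<^sub>R w1 s) \<le> \<rho>" "norm (\<sigma> *\<^sub>R h2 s + \<sigma>\<^sup>2 *\<^sub>R w2 s) \<le> \<rho>"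
          by (rule small[OF \<sigma>]; use Mi[OF s] C0 in \<open>simp add: m_def\<close>)+
        then show "norm (?w1 s - v1 s) \<le> \<rho> \<and> norm (?w2 s - v2 s) \<le> \<rho>" by (simp add: add.assoc)
        show "c (?w1 s) $ i \<le> 0 \<and> c (?w2 s) $ i \<le> 0" for i using 3(2) 4(2) \<sigma>(1) ls s by blast
        show "norm (z1 \<sigma> s - y1 s) \<le> \<rho> \<and> norm (z2 \<sigma> s - y2 s) \<le> \<rho>"
          using small2[OF \<sigma> cl(1)[OF s] Mi(5)[OF s]] small2[OF \<sigma> cl(2)[OF s] Mi(6)[OF s]] by blast
      qed
      show "z1 \<sigma> 0 = y1 0 \<and> z2 \<sigma> 0 = z1 \<sigma> 1 \<and>
       lip_path (z1 \<sigma>) (\<lambda>s. F (z1 \<sigma> s, V1 s + \<sigma> *\<^sub>R (d\<xi>, h1 s) + \<sigma>\<^sup>2 *\<^sub>R (\<zeta>, w1 s))) \<and>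
       lip_path (z2 \<sigma>) (\<lambda>s. F (z2 \<sigma> s, V2 s + \<sigma> *\<^sub>R (- d\<xi>, h2 s) + \<sigma>\<^sup>2 *\<^sub>R (- \<zeta>, w2 s))) \<and>
       (\<forall>s\<in>{0..1}. norm (z1 \<sigma> s - y1 s - \<sigma> *\<^sub>R d1 s) \<le> C0 * \<sigma>\<^sup>2 \<and> norm (z2 \<sigma> s - y2 s - \<sigma> *\<^sub>R d2 s) \<le> C0 * \<sigma>\<^sup>2) \<and>
       \<phi> (y2 1) - \<tau> \<le> \<phi> (z2 \<sigma> 1) - (\<tau> + \<sigma> * d\<xi> + \<sigma>\<^sup>2 * \<zeta>) + k * max 0 (g (z1 \<sigma> 1))"
        using e1(1,2) e2(1,2) cl cost by blast
    qed
  qed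
qed

text \<open>The second order corrections serve only to keep the perturbed controls admissible; after
  division by \<open>\<sigma>\<close> they vanish in the limit.\<close>

lemma first_order:
  assumes lin: "linearized d\<xi> h1 h2 d1 d2" and t: "tangent v1 h1" "tangent v2 h2"
  shows "0 \<le> fderiv \<phi> (y2 1) (d2 1) - d\<xi> + k * max 0 (fderiv g (y1 1) (d1 1))"
proof -
  have h: "bmeas h1" "bmeas h2" using lin by (auto simp: linearized_def)
  obtain \<sigma>0 C0 z1 z2 where p: "0 < \<sigma>0" "0 < C0"
    "\<forall>\<sigma>. 0 < \<sigma> \<longrightarrow> \<sigma> < \<sigma>0 \<longrightarrow> z1 \<sigma> 0 = y1 0 \<and> z2 \<sigma> 0 = z1 \<sigma> 1 \<and>
       lip_path (z1 \<sigma>) (\<lambda>s. F (z1 \<sigma> s, V1 s + \<sigma> *\<^sub>R (d\<xi>, h1 s) + \<sigma>\<^sup>2 *\<^sub>R (0, - (\<Sum>i\<in>UNIV. (1/2 * fderiv2 c (v1 s) (h1 s) (h1 s) $ i + 1) *\<^sub>R B1.e i s)))) \<and>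
       lip_path (z2 \<sigma>) (\<lambda>s. F (z2 \<sigma> s, V2 s + \<sigma> *\<^sub>R (- d\<xi>, h2 s) + \<sigma>\<^sup>2 *\<^sub>R (- 0, - (\<Sum>i\<in>UNIV. (1/2 * fderiv2 c (v2 s) (h2 s) (h2 s) $ i + 1) *\<^sub>R B2.e i s)))) \<and>
       (\<forall>s\<in>{0..1}. norm (z1 \<sigma> s - y1 s - \<sigma> *\<^sub>R d1 s) \<le> C0 * \<sigma>\<^sup>2 \<and> norm (z2 \<sigma> s - y2 s - \<sigma> *\<^sub>R d2 s) \<le> C0 * \<sigma>\<^sup>2) \<and>
       \<phi> (y2 1) - \<tau> \<le> \<phi> (z2 \<sigma> 1) - (\<tau> + \<sigma> * d\<xi> + \<sigma>\<^sup>2 * 0) + k * max 0 (g (z1 \<sigma> 1))"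
    by (rule perturbed_family[OF lin t B1.base_feasible[OF h(1) zero_less_one] B2.base_feasible[OF h(2) zero_less_one]])
  have z1: "norm (z1 \<sigma> 1 - y1 1 - \<sigma> *\<^sub>R d1 1) \<le> C0 * \<sigma>\<^sup>2" and z2: "norm (z2 \<sigma> 1 - y2 1 - \<sigma> *\<^sub>R d2 1) \<le> C0 * \<sigma>\<^sup>2"
    and le: "\<phi> (y2 1) - \<tau> \<le> \<phi> (z2 \<sigma> 1) - (\<tau> + \<sigma> * d\<xi>) + k * max 0 (g (z1 \<sigma> 1))" if "0 < \<sigma>" "\<sigma> < \<sigma>0" for \<sigma>
    using p(3) that by auto
  have "((\<lambda>\<sigma>. (\<phi> (z2 \<sigma> 1) - \<phi> (y2 1)) / \<sigma> - d\<xi> + k * max 0 ((g (z1 \<sigma> 1) - g (y1 1)) / \<sigma>)) \<longlongrightarrow>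
      fderiv \<phi> (y2 1) (d2 1) - d\<xi> + k * max 0 (fderiv g (y1 1) (d1 1))) (at_right 0)"
    by (intro tendsto_add tendsto_diff tendsto_mult tendsto_const tendsto_max
        point_expansion(1)[OF \<phi> p(1) z2] point_expansion(1)[OF g p(1) z1])
  moreover have "eventually (\<lambda>\<sigma>. 0 \<le> (\<phi> (z2 \<sigma> 1) - \<phi> (y2 1)) / \<sigma> - d\<xi> + k * max 0 ((g (z1 \<sigma> 1) - g (y1 1)) / \<sigma>)) (at_right 0)"
    using eventually_at_right_real[OF p(1)]
  proof eventually_elim
    case (elim \<sigma>)
    then have s: "0 < \<sigma>" "\<sigma> < \<sigma>0" by auto
    have mx: "max 0 (g (z1 \<sigma> 1) / \<sigma>) = max 0 (g (z1 \<sigma> 1)) / \<sigma>"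
      using s(1) by (simp add: max_def divide_le_0_iff zero_le_divide_iff)
    have "(\<phi> (z2 \<sigma> 1) - \<phi> (y2 1)) / \<sigma> - d\<xi> + k * max 0 (g (z1 \<sigma> 1) / \<sigma>)
        = (\<phi> (z2 \<sigma> 1) - \<phi> (y2 1) - \<sigma> * d\<xi> + k * max 0 (g (z1 \<sigma> 1))) / \<sigma>"
      unfolding mx using s(1) by (simp add: field_simps)
    also have "\<dots> \<ge> 0" using le[OF s] s(1) by (intro divide_nonneg_nonneg) auto
    finally show ?case using g0 by simp
  qed
  ultimately show ?thesis by (rule tendsto_lowerbound) simp
qed

end

section \<open>Second order condition along bounded tangent directions\<close>

context crisis_core
begin

text \<open>By linearity the costate of the first arc is \<open>P0 + \<kappa> Pg\<close> for a
  \<open>\<kappa>\<close> not yet known: \<open>P0\<close> continues the costate \<open>p2\<close>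
  of the cost across the junction, \<open>Pg\<close> starts from the gradient of the endpoint
  constraint.\<close>

definition costates :: "(real \<Rightarrow> 'x) \<Rightarrow> (real \<Rightarrow> 'x) \<Rightarrow> (real \<Rightarrow> 'x) \<Rightarrow> bool"
  where "costates P0 Pg p2 \<longleftrightarrow>
    p2 1 = grad \<phi> (y2 1) \<and> lip_path p2 (\<lambda>s. - fderiv_adj F (y2 s, V2 s) (p2 s)) \<and>
    P0 1 = p2 0 \<and> lip_path P0 (\<lambda>s. - fderiv_adj F (y1 s, V1 s) (P0 s)) \<and>
    Pg 1 = grad g (y1 1) \<and> lip_path Pg (\<lambda>s. - fderiv_adj F (y1 s, V1 s) (Pg s))"

lemma costates_ex: obtains P0 Pg p2 where "costates P0 Pg p2"
proof -
  obtain p2 where 1: "p2 1 = grad \<phi> (y2 1)" "lip_path p2 (\<lambda>s. - fderiv_adj F (y2 s, V2 s) (p2 s))"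
    by (rule adjoint_solution[OF F V2 bmeas_lip_path[OF Y2]])
  obtain P0 where 2: "P0 1 = p2 0" "lip_path P0 (\<lambda>s. - fderiv_adj F (y1 s, V1 s) (P0 s))"
    by (rule adjoint_solution[OF F V1 bmeas_lip_path[OF Y1]])
  obtain Pg where 3: "Pg 1 = grad g (y1 1)" "lip_path Pg (\<lambda>s. - fderiv_adj F (y1 s, V1 s) (Pg s))"
    by (rule adjoint_solution[OF F V1 bmeas_lip_path[OF Y1]])
  show ?thesis by (rule that[of P0 Pg p2]) (use 1 2 3 in \<open>simp add: costates_def\<close>)
qed

text \<open>First and second order parts of \<open>b + \<kappa> a\<close>, where \<open>a\<close> and \<open>b\<close> are the coefficients of \<open>\<sigma>\<^sup>2\<close> in
  \<open>g (z1 1)\<close> and in \<open>\<phi> (z2 1) - \<xi>\<close> along a perturbed trajectory.\<close>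

definition LO where "LO P0 p2 \<zeta> w1 w2 = - \<zeta> + integral {0..1} (\<lambda>s. P0 s \<bullet> fderiv F (y1 s, V1 s) (0, \<zeta>, w1 s))
    + integral {0..1} (\<lambda>s. p2 s \<bullet> fderiv F (y2 s, V2 s) (0, - \<zeta>, w2 s))"

definition LG where "LG Pg \<zeta> w1 = integral {0..1} (\<lambda>s. Pg s \<bullet> fderiv F (y1 s, V1 s) (0, \<zeta>, w1 s))"

definition QO where "QO P0 p2 d\<xi> h1 h2 d1 d2 =
    integral {0..1} (\<lambda>s. P0 s \<bullet> fderiv2 F (y1 s, V1 s) (d1 s, d\<xi>, h1 s) (d1 s, d\<xi>, h1 s))
    + integral {0..1} (\<lambda>s. p2 s \<bullet> fderiv2 F (y2 s, V2 s) (d2 s, - d\<xi>, h2 s) (d2 s, - d\<xi>, h2 s))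
    + fderiv2 \<phi> (y2 1) (d2 1) (d2 1)"

definition QG where "QG Pg d\<xi> h1 d1 =
    integral {0..1} (\<lambda>s. Pg s \<bullet> fderiv2 F (y1 s, V1 s) (d1 s, d\<xi>, h1 s) (d1 s, d\<xi>, h1 s))
    + fderiv2 g (y1 1) (d1 1) (d1 1)"

text \<open>Criticality removes the terms of order \<open>\<sigma>\<close> from
  \<open>g (z1 \<sigma> 1)\<close> and from the cost, so the penalised inequality may be divided by
  \<open>\<sigma>\<^sup>2\<close>. The state at the junction appears once for each arc with opposite
  signs and drops out.\<close>

lemma second_order:
  assumes lin: "linearized d\<xi> h1 h2 d1 d2" and t: "tangent v1 h1" "tangent v2 h2"
    and w: "second_order_feasible c v1 h1 w1" "second_order_feasible c v2 h2 w2"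
    and crit: "fderiv \<phi> (y2 1) (d2 1) = d\<xi>" "fderiv g (y1 1) (d1 1) = 0"
    and co: "costates P0 Pg p2"
  shows "0 \<le> LO P0 p2 \<zeta> w1 w2 + 1/2 * QO P0 p2 d\<xi> h1 h2 d1 d2 + k * max 0 (LG Pg \<zeta> w1 + 1/2 * QG Pg d\<xi> h1 d1)"
proof -
  have l: "bmeas h1" "bmeas h2" "d1 0 = 0" "d2 0 = d1 1"
    "lip_path d1 (\<lambda>s. fderiv F (y1 s, V1 s) (d1 s, d\<xi>, h1 s))"
    "lip_path d2 (\<lambda>s. fderiv F (y2 s, V2 s) (d2 s, - d\<xi>, h2 s))"
    using lin by (auto simp: linearized_def)
  have p: "p2 1 = grad \<phi> (y2 1)" "lip_path p2 (\<lambda>s. - fderiv_adj F (y2 s, V2 s) (p2 s))"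
    "P0 1 = p2 0" "lip_path P0 (\<lambda>s. - fderiv_adj F (y1 s, V1 s) (P0 s))"
    "Pg 1 = grad g (y1 1)" "lip_path Pg (\<lambda>s. - fderiv_adj F (y1 s, V1 s) (Pg s))"
    using co by (auto simp: costates_def)
  have wb: "bmeas w1" "bmeas w2" using w by (auto simp: second_order_feasible_def)
  have b: "bmeas (\<lambda>s. (d\<xi>, h1 s))" "bmeas (\<lambda>s. (- d\<xi>, h2 s))" "bmeas (\<lambda>s. (\<zeta>, w1 s))" "bmeas (\<lambda>s. (- \<zeta>, w2 s))"
    by (intro bmeas_Pair bmeas_const l wb)+
  obtain \<sigma>0 C0 z1 z2 where \<sigma>0: "0 < \<sigma>0" and C0: "0 < C0" and fam:
    "\<forall>\<sigma>. 0 < \<sigma> \<longrightarrow> \<sigma> < \<sigma>0 \<longrightarrow> z1 \<sigma> 0 = y1 0 \<and> z2 \<sigma> 0 = z1 \<sigma> 1 \<and>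
       lip_path (z1 \<sigma>) (\<lambda>s. F (z1 \<sigma> s, V1 s + \<sigma> *\<^sub>R (d\<xi>, h1 s) + \<sigma>\<^sup>2 *\<^sub>R (\<zeta>, w1 s))) \<and>
       lip_path (z2 \<sigma>) (\<lambda>s. F (z2 \<sigma> s, V2 s + \<sigma> *\<^sub>R (- d\<xi>, h2 s) + \<sigma>\<^sup>2 *\<^sub>R (- \<zeta>, w2 s))) \<and>
       (\<forall>s\<in>{0..1}. norm (z1 \<sigma> s - y1 s - \<sigma> *\<^sub>R d1 s) \<le> C0 * \<sigma>\<^sup>2 \<and> norm (z2 \<sigma> s - y2 s - \<sigma> *\<^sub>R d2 s) \<le> C0 * \<sigma>\<^sup>2) \<and>
       \<phi> (y2 1) - \<tau> \<le> \<phi> (z2 \<sigma> 1) - (\<tau> + \<sigma> * d\<xi> + \<sigma>\<^sup>2 * \<zeta>) + k * max 0 (g (z1 \<sigma> 1))"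
    by (rule perturbed_family[OF lin t w, where \<zeta>=\<zeta>])
  have z: "z1 \<sigma> 0 = y1 0" "z2 \<sigma> 0 = z1 \<sigma> 1"
     "lip_path (z1 \<sigma>) (\<lambda>s. F (z1 \<sigma> s, V1 s + \<sigma> *\<^sub>R (d\<xi>, h1 s) + \<sigma>\<^sup>2 *\<^sub>R (\<zeta>, w1 s)))"
     "lip_path (z2 \<sigma>) (\<lambda>s. F (z2 \<sigma> s, V2 s + \<sigma> *\<^sub>R (- d\<xi>, h2 s) + \<sigma>\<^sup>2 *\<^sub>R (- \<zeta>, w2 s)))"
     "\<phi> (y2 1) - \<tau> \<le> \<phi> (z2 \<sigma> 1) - (\<tau> + \<sigma> * d\<xi> + \<sigma>\<^sup>2 * \<zeta>) + k * max 0 (g (z1 \<sigma> 1))"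
    if "0 < \<sigma>" "\<sigma> < \<sigma>0" for \<sigma>
    using fam[rule_format, OF that] by blast+
  have cl: "norm (z1 \<sigma> s - y1 s - \<sigma> *\<^sub>R d1 s) \<le> C0 * \<sigma>\<^sup>2" "norm (z2 \<sigma> s - y2 s - \<sigma> *\<^sub>R d2 s) \<le> C0 * \<sigma>\<^sup>2"
    if "0 < \<sigma>" "\<sigma> < \<sigma>0" "s \<in> {0..1}" for \<sigma> s
    using fam[rule_format, OF that(1,2)] that(3) by blast+
  have one: "(1::real) \<in> {0..1}" by simp
  have ev: "eventually (\<lambda>\<sigma>. 0 < \<sigma> \<and> \<sigma> < \<sigma>0) (at_right 0)"
    using eventually_at_right_real[OF \<sigma>0] by (rule eventually_mono) auto
  let ?D1 = "\<lambda>\<sigma>. z1 \<sigma> 1 - y1 1"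
  let ?D2 = "\<lambda>\<sigma>. z2 \<sigma> 1 - y2 1"
  have d1m: "bmeas d1" "bmeas d2" by (rule bmeas_lip_path[OF l(5)] bmeas_lip_path[OF l(6)])+
  note ex1 = second_order_expansion[OF F V1 Y1 _ b(1) b(3) d1m(1) \<sigma>0 C0 z(3) cl(1)]
  note ex2 = second_order_expansion[OF F V2 Y2 _ b(2) b(4) d1m(2) \<sigma>0 C0 z(4) cl(2)]
  \<comment> \<open>The first order terms: this integral vanishes, and the next two add up to
    \<open>d\<xi>\<close>, which is cancelled by the variation of \<open>- \<xi>\<close> in the
    cost.\<close>
  have Ig: "integral {0..1} (\<lambda>s. Pg s \<bullet> fderiv F (y1 s, V1 s) (0, d\<xi>, h1 s)) = 0"
    using adjoint_linear_identity[OF p(6) l(5)] l(3) crit(2) p(5) by (simp add: grad_inner[OF g])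
  have I0: "integral {0..1} (\<lambda>s. P0 s \<bullet> fderiv F (y1 s, V1 s) (0, d\<xi>, h1 s)) = p2 0 \<bullet> d1 1"
    using adjoint_linear_identity[OF p(4) l(5)] l(3) p(3) by simp
  have I2: "integral {0..1} (\<lambda>s. p2 s \<bullet> fderiv F (y2 s, V2 s) (0, - d\<xi>, h2 s)) = d\<xi> - p2 0 \<bullet> d1 1"
    using adjoint_linear_identity[OF p(2) l(6)] l(4) crit(1) p(1) by (simp add: grad_inner[OF \<phi>])
  have "((\<lambda>\<sigma>. g (z1 \<sigma> 1) / \<sigma>\<^sup>2) \<longlongrightarrow> LG Pg \<zeta> w1 + 1/2 * QG Pg d\<xi> h1 d1) (at_right 0)"
  proof (rule Lim_transform_eventually)
    show "((\<lambda>\<sigma>. (Pg 1 \<bullet> (z1 \<sigma> 1 - y1 1) - Pg 0 \<bullet> (z1 \<sigma> 0 - y1 0)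
        - \<sigma> * integral {0..1} (\<lambda>s. Pg s \<bullet> fderiv F (y1 s, V1 s) (0, d\<xi>, h1 s))) / \<sigma>\<^sup>2
        + (g (z1 \<sigma> 1) - g (y1 1) - fderiv g (y1 1) (z1 \<sigma> 1 - y1 1)) / \<sigma>\<^sup>2)
      \<longlongrightarrow> LG Pg \<zeta> w1 + 1/2 * QG Pg d\<xi> h1 d1) (at_right 0)"
      using tendsto_add[OF ex1[OF p(6)] point_expansion(2)[OF g \<sigma>0 cl(1)[OF _ _ one]]]
      by (simp add: LG_def QG_def distrib_left add.assoc)
    show "eventually (\<lambda>\<sigma>. (Pg 1 \<bullet> (z1 \<sigma> 1 - y1 1) - Pg 0 \<bullet> (z1 \<sigma> 0 - y1 0)
        - \<sigma> * integral {0..1} (\<lambda>s. Pg s \<bullet> fderiv F (y1 s, V1 s) (0, d\<xi>, h1 s))) / \<sigma>\<^sup>2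
        + (g (z1 \<sigma> 1) - g (y1 1) - fderiv g (y1 1) (z1 \<sigma> 1 - y1 1)) / \<sigma>\<^sup>2 = g (z1 \<sigma> 1) / \<sigma>\<^sup>2) (at_right 0)"
      using ev
    proof eventually_elim
      case (elim \<sigma>)
      show ?case using z(1)[of \<sigma>] elim unfolding Ig p(5) grad_inner[OF g] g0
        by (simp flip: add_divide_distrib)
    qed
  qed
  note lim_a = this
  have lim_b: "((\<lambda>\<sigma>. (\<phi> (z2 \<sigma> 1) - \<phi> (y2 1) - \<sigma> * d\<xi> - \<sigma>\<^sup>2 * \<zeta>) / \<sigma>\<^sup>2) \<longlongrightarrow> LO P0 p2 \<zeta> w1 w2 + 1/2 * QO P0 p2 d\<xi> h1 h2 d1 d2) (at_right 0)"
  proof (rule Lim_transform_eventually)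
    let ?e0 = "\<lambda>\<sigma>. (P0 1 \<bullet> (z1 \<sigma> 1 - y1 1) - P0 0 \<bullet> (z1 \<sigma> 0 - y1 0)
        - \<sigma> * integral {0..1} (\<lambda>s. P0 s \<bullet> fderiv F (y1 s, V1 s) (0, d\<xi>, h1 s))) / \<sigma>\<^sup>2"
    let ?e2 = "\<lambda>\<sigma>. (p2 1 \<bullet> (z2 \<sigma> 1 - y2 1) - p2 0 \<bullet> (z2 \<sigma> 0 - y2 0)
        - \<sigma> * integral {0..1} (\<lambda>s. p2 s \<bullet> fderiv F (y2 s, V2 s) (0, - d\<xi>, h2 s))) / \<sigma>\<^sup>2"
    let ?e3 = "\<lambda>\<sigma>. (\<phi> (z2 \<sigma> 1) - \<phi> (y2 1) - fderiv \<phi> (y2 1) (z2 \<sigma> 1 - y2 1)) / \<sigma>\<^sup>2"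
    show "((\<lambda>\<sigma>. - \<zeta> + ?e0 \<sigma> + ?e2 \<sigma> + ?e3 \<sigma>) \<longlongrightarrow> LO P0 p2 \<zeta> w1 w2 + 1/2 * QO P0 p2 d\<xi> h1 h2 d1 d2) (at_right 0)"
      by (rule tendsto_eq_rhs[OF tendsto_add[OF tendsto_add[OF tendsto_add[OF tendsto_const ex1[OF p(4)]] ex2[OF p(2)]]
          point_expansion(2)[OF \<phi> \<sigma>0 cl(2)[OF _ _ one]]]]) (simp_all add: LO_def QO_def field_simps)
    show "eventually (\<lambda>\<sigma>. - \<zeta> + ?e0 \<sigma> + ?e2 \<sigma> + ?e3 \<sigma> = (\<phi> (z2 \<sigma> 1) - \<phi> (y2 1) - \<sigma> * d\<xi> - \<sigma>\<^sup>2 * \<zeta>) / \<sigma>\<^sup>2) (at_right 0)"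
      using ev
    proof eventually_elim
      case (elim \<sigma>)
      have z0: "z1 \<sigma> 0 - y1 0 = 0" "z2 \<sigma> 0 - y2 0 = z1 \<sigma> 1 - y1 1" using z(1,2)[of \<sigma>] elim y12 by simp_all
      have s: "- \<zeta> = - (\<sigma>\<^sup>2 * \<zeta>) / \<sigma>\<^sup>2" using elim by simp
      show ?case unfolding I0 I2 p(1,3) grad_inner[OF \<phi>] z0
        apply (subst s) unfolding add_divide_distrib[symmetric]
        by (rule arg_cong[where f="\<lambda>x. x / \<sigma>\<^sup>2"]) (simp add: algebra_simps)
    qed
  qed
  have "((\<lambda>\<sigma>. (\<phi> (z2 \<sigma> 1) - \<phi> (y2 1) - \<sigma> * d\<xi> - \<sigma>\<^sup>2 * \<zeta>) / \<sigma>\<^sup>2 + k * max 0 (g (z1 \<sigma> 1) / \<sigma>\<^sup>2)) \<longlongrightarrow>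
     LO P0 p2 \<zeta> w1 w2 + 1/2 * QO P0 p2 d\<xi> h1 h2 d1 d2 + k * max 0 (LG Pg \<zeta> w1 + 1/2 * QG Pg d\<xi> h1 d1)) (at_right 0)"
    by (intro tendsto_add tendsto_mult tendsto_const tendsto_max lim_a lim_b)
  moreover have "eventually (\<lambda>\<sigma>. 0 \<le> (\<phi> (z2 \<sigma> 1) - \<phi> (y2 1) - \<sigma> * d\<xi> - \<sigma>\<^sup>2 * \<zeta>) / \<sigma>\<^sup>2 + k * max 0 (g (z1 \<sigma> 1) / \<sigma>\<^sup>2)) (at_right 0)"
    using ev
  proof eventually_elim
    case (elim \<sigma>)
    have mx: "max 0 (g (z1 \<sigma> 1) / \<sigma>\<^sup>2) = max 0 (g (z1 \<sigma> 1)) / \<sigma>\<^sup>2"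
      using elim by (simp add: max_def divide_le_0_iff zero_le_divide_iff)
    have "0 \<le> \<phi> (z2 \<sigma> 1) - \<phi> (y2 1) - \<sigma> * d\<xi> - \<sigma>\<^sup>2 * \<zeta> + k * max 0 (g (z1 \<sigma> 1))" using z(5)[of \<sigma>] elim by simp
    then have "0 \<le> (\<phi> (z2 \<sigma> 1) - \<phi> (y2 1) - \<sigma> * d\<xi> - \<sigma>\<^sup>2 * \<zeta> + k * max 0 (g (z1 \<sigma> 1))) / \<sigma>\<^sup>2" by simp
    then show ?case unfolding mx by (simp add: add_divide_distrib)
  qed
  ultimately show ?thesis by (rule tendsto_lowerbound) simp
qed

lemma control_integrable:
  assumes "bmeas p" "bmeas w"
  shows "(\<lambda>s. p s \<bullet> fderiv F (y1 s, V1 s) (0, \<zeta>, w s)) integrable_on {0..1}"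
    "(\<lambda>s. p s \<bullet> fderiv F (y2 s, V2 s) (0, \<zeta>, w s)) integrable_on {0..1}"
  by (intro bmeas_integrable(1) bmeas_inner assms bmeas_fderiv F bmeas_Pair bmeas_const V1 V2
      bmeas_lip_path[OF Y1] bmeas_lip_path[OF Y2])+

lemma integral_control_affine:
  fixes A :: "real \<Rightarrow> ('x \<times> real \<times> 'v) \<Rightarrow>\<^sub>L 'x" and p :: "real \<Rightarrow> 'x" and w w' :: "real \<Rightarrow> 'v"
  assumes i: "(\<lambda>s. p s \<bullet> A s (0, \<zeta>, w s)) integrable_on {0..1}" "(\<lambda>s. p s \<bullet> A s (0, \<zeta>', w' s)) integrable_on {0..1}"
  shows "integral {0..1} (\<lambda>s. p s \<bullet> blinfun_apply (A s) (0, t * \<zeta> + t' * \<zeta>', t *\<^sub>R w s + t' *\<^sub>R w' s))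
    = t * integral {0..1} (\<lambda>s. p s \<bullet> A s (0, \<zeta>, w s)) + t' * integral {0..1} (\<lambda>s. p s \<bullet> A s (0, \<zeta>', w' s))"
proof -
  have "p s \<bullet> blinfun_apply (A s) (0, t * \<zeta> + t' * \<zeta>', t *\<^sub>R w s + t' *\<^sub>R w' s)
      = t * (p s \<bullet> A s (0, \<zeta>, w s)) + t' * (p s \<bullet> A s (0, \<zeta>', w' s))" for s
  proof -
    have eq: "(0 :: 'x, t * \<zeta> + t' * \<zeta>', t *\<^sub>R w s + t' *\<^sub>R w' s) = t *\<^sub>R (0, \<zeta>, w s) + t' *\<^sub>R (0, \<zeta>', w' s)" by simp
    show ?thesis unfolding eq by (simp only: blinfun.add_right blinfun.scaleR_right inner_add_right inner_scaleR_right)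
  qed
  then have "((\<lambda>s. p s \<bullet> blinfun_apply (A s) (0, t * \<zeta> + t' * \<zeta>', t *\<^sub>R w s + t' *\<^sub>R w' s)) has_integral
    t * integral {0..1} (\<lambda>s. p s \<bullet> A s (0, \<zeta>, w s)) + t' * integral {0..1} (\<lambda>s. p s \<bullet> A s (0, \<zeta>', w' s))) {0..1}"
    by (simp only:) (intro has_integral_add has_integral_mult_right integrable_integral i)
  then show ?thesis by (rule integral_unique)
qed

text \<open>The gradient of the Hamiltonian in the control, with the scaling component held
  fixed.\<close>

definition Hctrl :: "(real \<Rightarrow> 'x) \<Rightarrow> (real \<Rightarrow> 'x) \<Rightarrow> (real \<Rightarrow> real \<times> 'v) \<Rightarrow> real \<Rightarrow> 'v"
  where "Hctrl p y V s = (\<Sum>b\<in>Basis. (p s \<bullet> fderiv F (y s, V s) (0, 0, b)) *\<^sub>R b)"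

lemma Hctrl_inner: "Hctrl p y V s \<bullet> h = p s \<bullet> fderiv F (y s, V s) (0, 0, h)"
proof -
  have bl: "linear (\<lambda>h. p s \<bullet> fderiv F (y s, V s) (0, 0, h))"
    by (intro bounded_linear.linear bounded_linear_inner_right_comp bounded_linear_compose[OF blinfun.bounded_linear_right]
      bounded_linear_Pair bounded_linear_ident bounded_linear_zero)
  have "p s \<bullet> fderiv F (y s, V s) (0, 0, h) = (\<lambda>h. p s \<bullet> fderiv F (y s, V s) (0, 0, h)) (\<Sum>b\<in>Basis. (h \<bullet> b) *\<^sub>R b)"
    by (simp add: euclidean_representation)
  also have "\<dots> = (\<Sum>b\<in>Basis. (h \<bullet> b) * (p s \<bullet> fderiv F (y s, V s) (0, 0, b)))"
    by (subst linear_sum[OF bl]) (simp add: linear_scale[OF bl])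
  also have "\<dots> = Hctrl p y V s \<bullet> h"
    unfolding Hctrl_def inner_sum_left
    by (rule sum.cong[OF refl]) (simp add: inner_commute[of h])
  finally show ?thesis by simp
qed

lemma Hctrl_linear: "Hctrl (\<lambda>s. p s + r *\<^sub>R q s) y V s = Hctrl p y V s + r *\<^sub>R Hctrl q y V s"
  by (simp add: Hctrl_def inner_add_left scaleR_sum_right scaleR_add_left sum.distrib)

lemma bmeas_Hctrl: "bmeas p \<Longrightarrow> bmeas y \<Longrightarrow> bmeas V \<Longrightarrow> bmeas (Hctrl p y V)"
  unfolding Hctrl_def
  by (intro bmeas_sum bmeas_scaleR bmeas_inner bmeas_fderiv F bmeas_Pair bmeas_const)

text \<open>The multiplier conditions, with \<open>\<kappa>\<close> the multiplier of the constraint \<open>g (y1 1) = 0\<close>; the first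
  one says that the \<open>\<xi>\<close>-component of the costate vanishes at \<open>0\<close>.\<close>

definition valid :: "(real \<Rightarrow> 'x) \<Rightarrow> (real \<Rightarrow> 'x) \<Rightarrow> (real \<Rightarrow> 'x) \<Rightarrow> real \<Rightarrow> bool"
  where "valid P0 Pg p2 \<kappa> \<longleftrightarrow>
    integral {0..1} (\<lambda>s. (P0 s + \<kappa> *\<^sub>R Pg s) \<bullet> f (y1 s, v1 s)) - integral {0..1} (\<lambda>s. p2 s \<bullet> f (y2 s, v2 s)) = 1 \<and>
    (AE s in leb01.
      (\<forall>h. (P0 s + \<kappa> *\<^sub>R Pg s) \<bullet> fderiv F (y1 s, V1 s) (0, 0, h)
          + B1.mult (Hctrl (\<lambda>s. P0 s + \<kappa> *\<^sub>R Pg s) y1 V1) s \<bullet> fderiv c (v1 s) h = 0) \<and>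
      (\<forall>i. 0 \<le> B1.mult (Hctrl (\<lambda>s. P0 s + \<kappa> *\<^sub>R Pg s) y1 V1) s $ i \<and>
          B1.mult (Hctrl (\<lambda>s. P0 s + \<kappa> *\<^sub>R Pg s) y1 V1) s $ i * c (v1 s) $ i = 0) \<and>
      (\<forall>h. p2 s \<bullet> fderiv F (y2 s, V2 s) (0, 0, h) + B2.mult (Hctrl p2 y2 V2) s \<bullet> fderiv c (v2 s) h = 0) \<and>
      (\<forall>i. 0 \<le> B2.mult (Hctrl p2 y2 V2) s $ i \<and> B2.mult (Hctrl p2 y2 V2) s $ i * c (v2 s) $ i = 0))"

text \<open>The quadratic form \<open>Omega\<close> for \<open>\<alpha> = 1\<close> and endpoint
  multiplier \<open>\<kappa>\<close>, separated by arcs.\<close>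

definition Qtot where "Qtot P0 Pg p2 \<kappa> d\<xi> h1 h2 d1 d2 =
    QO P0 p2 d\<xi> h1 h2 d1 d2 + \<kappa> * QG Pg d\<xi> h1 d1
    + integral {0..1} (\<lambda>s. B1.mult (Hctrl (\<lambda>s. P0 s + \<kappa> *\<^sub>R Pg s) y1 V1) s \<bullet> fderiv2 c (v1 s) (h1 s) (h1 s))
    + integral {0..1} (\<lambda>s. B2.mult (Hctrl p2 y2 V2) s \<bullet> fderiv2 c (v2 s) (h2 s) (h2 s))"

text \<open>Corrections enter the expansion affinely, so the pairs of coefficients form a convex set
  to which \<open>separation_plane\<close> applies. With \<open>\<kappa>\<close> fixed there remains
  a lower bound over all corrections of the crossing time and of the two controls, and these are
  eliminated one after the other.\<close>

lemma bounded_direction: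
  assumes lin: "linearized d\<xi> h1 h2 d1 d2" and t: "tangent v1 h1" "tangent v2 h2"
    and crit: "fderiv \<phi> (y2 1) (d2 1) = d\<xi>" "fderiv g (y1 1) (d1 1) = 0"
    and co: "costates P0 Pg p2"
  obtains \<kappa> where "0 \<le> \<kappa>" "\<kappa> \<le> k" "valid P0 Pg p2 \<kappa>" "0 \<le> Qtot P0 Pg p2 \<kappa> d\<xi> h1 h2 d1 d2"
proof -
  have h: "bmeas h1" "bmeas h2" using lin by (auto simp: linearized_def)
  have pm: "bmeas p2" "bmeas P0" "bmeas Pg" using co bmeas_lip_path by (auto simp: costates_def)
  let ?A = "1/2 * QO P0 p2 d\<xi> h1 h2 d1 d2" and ?B = "1/2 * QG Pg d\<xi> h1 d1"
  define Z where "Z = {(LO P0 p2 \<zeta> w1 w2 + ?A, LG Pg \<zeta> w1 + ?B) | \<zeta> w1 w2.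
     second_order_feasible c v1 h1 w1 \<and> second_order_feasible c v2 h2 w2}"
  have conv: "(t * b + t' * b', t * a + t' * a') \<in> Z"
    if Z: "(b, a) \<in> Z" "(b', a') \<in> Z" and t: "0 < t" "0 < t'" "t + t' = 1" for b a b' a' t t'
  proof -
    obtain \<zeta> w1 w2 where 1: "b = LO P0 p2 \<zeta> w1 w2 + ?A" "a = LG Pg \<zeta> w1 + ?B"
      "second_order_feasible c v1 h1 w1" "second_order_feasible c v2 h2 w2" using Z(1) unfolding Z_def by (elim CollectE exE conjE Pair_inject) (rule that; assumption)
    obtain \<zeta>' w1' w2' where 2: "b' = LO P0 p2 \<zeta>' w1' w2' + ?A" "a' = LG Pg \<zeta>' w1' + ?B"
      "second_order_feasible c v1 h1 w1'" "second_order_feasible c v2 h2 w2'" using Z(2) unfolding Z_def by (elim CollectE exE conjE Pair_inject) (rule that; assumption)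
    have wm: "bmeas w1" "bmeas w2" "bmeas w1'" "bmeas w2'" using 1 2 by (auto simp: second_order_feasible_def)
    let ?w1 = "\<lambda>s. t *\<^sub>R w1 s + t' *\<^sub>R w1' s" and ?w2 = "\<lambda>s. t *\<^sub>R w2 s + t' *\<^sub>R w2' s" and ?\<zeta> = "t * \<zeta> + t' * \<zeta>'"
    have G: "LG Pg ?\<zeta> ?w1 = t * LG Pg \<zeta> w1 + t' * LG Pg \<zeta>' w1'"
      unfolding LG_def by (intro integral_control_affine control_integrable pm wm)
    have O: "LO P0 p2 ?\<zeta> ?w1 ?w2 = t * LO P0 p2 \<zeta> w1 w2 + t' * LO P0 p2 \<zeta>' w1' w2'"
    proof -
      have 1: "integral {0..1} (\<lambda>s. P0 s \<bullet> fderiv F (y1 s, V1 s) (0, ?\<zeta>, ?w1 s))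
        = t * integral {0..1} (\<lambda>s. P0 s \<bullet> fderiv F (y1 s, V1 s) (0, \<zeta>, w1 s)) + t' * integral {0..1} (\<lambda>s. P0 s \<bullet> fderiv F (y1 s, V1 s) (0, \<zeta>', w1' s))"
        by (intro integral_control_affine control_integrable pm wm)
      have 2: "integral {0..1} (\<lambda>s. p2 s \<bullet> fderiv F (y2 s, V2 s) (0, t * (- \<zeta>) + t' * (- \<zeta>'), ?w2 s))
        = t * integral {0..1} (\<lambda>s. p2 s \<bullet> fderiv F (y2 s, V2 s) (0, - \<zeta>, w2 s)) + t' * integral {0..1} (\<lambda>s. p2 s \<bullet> fderiv F (y2 s, V2 s) (0, - \<zeta>', w2' s))"
        by (intro integral_control_affine control_integrable pm wm)
      have 3: "- ?\<zeta> = t * (- \<zeta>) + t' * (- \<zeta>')" by simp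
      show ?thesis unfolding LO_def 1 3 2 by (simp add: algebra_simps)
    qed
    have A: "t * (x + ?A) + t' * (y + ?A) = t * x + t' * y + ?A" "t * (x + ?B) + t' * (y + ?B) = t * x + t' * y + ?B" for x y
    proof -
      have "t * r + t' * r = r" for r :: real using t(3) by (metis distrib_right mult_1)
      then show "t * (x + ?A) + t' * (y + ?A) = t * x + t' * y + ?A" "t * (x + ?B) + t' * (y + ?B) = t * x + t' * y + ?B"
        by (simp_all add: distrib_left)
    qed
    have "second_order_feasible c v1 h1 ?w1" "second_order_feasible c v2 h2 ?w2"
      by (rule second_order_feasible_convex[OF 1(3) 2(3) t] second_order_feasible_convex[OF 1(4) 2(4) t])+
    moreover have "t * b + t' * b' = LO P0 p2 ?\<zeta> ?w1 ?w2 + ?A" "t * a + t' * a' = LG Pg ?\<zeta> ?w1 + ?B"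
      unfolding 1(1,2) 2(1,2) A O G by simp_all
    ultimately show ?thesis unfolding Z_def by blast
  qed
  have pos: "0 \<le> b + k * max 0 a" if bZ: "(b, a) \<in> Z" for b a
  proof -
    obtain \<zeta> w1 w2 where 1: "b = LO P0 p2 \<zeta> w1 w2 + ?A" "a = LG Pg \<zeta> w1 + ?B"
      "second_order_feasible c v1 h1 w1" "second_order_feasible c v2 h2 w2"
      using bZ unfolding Z_def by (elim CollectE exE conjE Pair_inject) (rule that; assumption)
    show ?thesis unfolding 1(1,2) by (rule second_order[OF lin t 1(3,4) crit co])
  qed
  obtain \<kappa> where \<kappa>: "0 \<le> \<kappa>" "\<kappa> \<le> k" "\<forall>b a. (b, a) \<in> Z \<longrightarrow> 0 \<le> b + \<kappa> * a"
    by (rule separation_plane[OF conv k pos])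
  define P1 where "P1 = (\<lambda>s. P0 s + \<kappa> *\<^sub>R Pg s)"
  have P1m: "bmeas P1" unfolding P1_def by (intro bmeas_add bmeas_scaleR bmeas_const pm)
  define H1 where "H1 = Hctrl P1 y1 V1"
  define H2 where "H2 = Hctrl p2 y2 V2"
  have Hm: "bmeas H1" "bmeas H2"
    unfolding H1_def H2_def by (intro bmeas_Hctrl P1m pm V1 V2 bmeas_lip_path[OF Y1] bmeas_lip_path[OF Y2])+
  define Q where "Q = QO P0 p2 d\<xi> h1 h2 d1 d2 + \<kappa> * QG Pg d\<xi> h1 d1"
  \<comment> \<open>Coefficient of the correction \<open>\<zeta>\<close>. Since
    \<open>\<zeta>\<close> takes both signs without bound, it must vanish.\<close>
  define lam where "lam = - 1 + integral {0..1} (\<lambda>s. P1 s \<bullet> f (y1 s, v1 s)) - integral {0..1} (\<lambda>s. p2 s \<bullet> f (y2 s, v2 s))"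
  have fm: "bmeas (\<lambda>s. f (y1 s, v1 s))" "bmeas (\<lambda>s. f (y2 s, v2 s))"
    by (intro bmeas_C2[OF f] bmeas_Pair v1 v2 bmeas_lip_path[OF Y1] bmeas_lip_path[OF Y2])+
  have main: "0 \<le> \<zeta> * lam + integral {0..1} (\<lambda>s. H1 s \<bullet> w1 s) + integral {0..1} (\<lambda>s. H2 s \<bullet> w2 s) + 1/2 * Q"
    if w: "second_order_feasible c v1 h1 w1" "second_order_feasible c v2 h2 w2" for \<zeta> w1 w2
  proof -
    have wm: "bmeas w1" "bmeas w2" using w by (auto simp: second_order_feasible_def)
    have "(LO P0 p2 \<zeta> w1 w2 + ?A, LG Pg \<zeta> w1 + ?B) \<in> Z" unfolding Z_def using w by blast
    then have 0: "0 \<le> LO P0 p2 \<zeta> w1 w2 + ?A + \<kappa> * (LG Pg \<zeta> w1 + ?B)" using \<kappa>(3) by blast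
    have "((\<lambda>s. P0 s \<bullet> fderiv F (y1 s, V1 s) (0, \<zeta>, w1 s) + \<kappa> * (Pg s \<bullet> fderiv F (y1 s, V1 s) (0, \<zeta>, w1 s))) has_integral
      integral {0..1} (\<lambda>s. P0 s \<bullet> fderiv F (y1 s, V1 s) (0, \<zeta>, w1 s)) + \<kappa> * LG Pg \<zeta> w1) {0..1}"
      unfolding LG_def by (intro has_integral_add has_integral_mult_right integrable_integral control_integrable pm wm)
    moreover have "P0 s \<bullet> fderiv F (y1 s, V1 s) (0, \<zeta>, w1 s) + \<kappa> * (Pg s \<bullet> fderiv F (y1 s, V1 s) (0, \<zeta>, w1 s))
      = \<zeta> * (P1 s \<bullet> f (y1 s, v1 s)) + H1 s \<bullet> w1 s" for s
    proof -
      have "P0 s \<bullet> fderiv F (y1 s, V1 s) (0, \<zeta>, w1 s) + \<kappa> * (Pg s \<bullet> fderiv F (y1 s, V1 s) (0, \<zeta>, w1 s))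
        = P1 s \<bullet> fderiv F (y1 s, V1 s) (0, \<zeta>, w1 s)" by (simp add: P1_def inner_add_left)
      also have "\<dots> = \<zeta> * (P1 s \<bullet> f (y1 s, v1 s)) + H1 s \<bullet> w1 s"
        unfolding H1_def Hctrl_inner unfolding V1_def by (simp add: fderiv_scaled[OF f] inner_add_right inner_diff_right)
      finally show ?thesis .
    qed
    moreover have "((\<lambda>s. \<zeta> * (P1 s \<bullet> f (y1 s, v1 s)) + H1 s \<bullet> w1 s) has_integral
      \<zeta> * integral {0..1} (\<lambda>s. P1 s \<bullet> f (y1 s, v1 s)) + integral {0..1} (\<lambda>s. H1 s \<bullet> w1 s)) {0..1}"
      by (intro has_integral_add has_integral_mult_right integrable_integral bmeas_integrable(1) bmeas_inner P1m fm Hm wm)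
    ultimately have 1: "integral {0..1} (\<lambda>s. P0 s \<bullet> fderiv F (y1 s, V1 s) (0, \<zeta>, w1 s)) + \<kappa> * LG Pg \<zeta> w1
      = \<zeta> * integral {0..1} (\<lambda>s. P1 s \<bullet> f (y1 s, v1 s)) + integral {0..1} (\<lambda>s. H1 s \<bullet> w1 s)"
      using has_integral_unique by (simp only:)
    have "p2 s \<bullet> fderiv F (y2 s, V2 s) (0, - \<zeta>, w2 s) = (- \<zeta>) * (p2 s \<bullet> f (y2 s, v2 s)) + H2 s \<bullet> w2 s" for s
      unfolding H2_def Hctrl_inner unfolding V2_def by (simp add: fderiv_scaled[OF f] inner_add_right inner_diff_right)
    moreover have "((\<lambda>s. (- \<zeta>) * (p2 s \<bullet> f (y2 s, v2 s)) + H2 s \<bullet> w2 s) has_integral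
      (- \<zeta>) * integral {0..1} (\<lambda>s. p2 s \<bullet> f (y2 s, v2 s)) + integral {0..1} (\<lambda>s. H2 s \<bullet> w2 s)) {0..1}"
      by (intro has_integral_add has_integral_mult_right integrable_integral bmeas_integrable(1) bmeas_inner pm fm Hm wm)
    ultimately have 2: "integral {0..1} (\<lambda>s. p2 s \<bullet> fderiv F (y2 s, V2 s) (0, - \<zeta>, w2 s))
      = (- \<zeta>) * integral {0..1} (\<lambda>s. p2 s \<bullet> f (y2 s, v2 s)) + integral {0..1} (\<lambda>s. H2 s \<bullet> w2 s)"
      by (simp only: integral_unique)
    have "LO P0 p2 \<zeta> w1 w2 + ?A + \<kappa> * (LG Pg \<zeta> w1 + ?B)
      = - \<zeta> + (integral {0..1} (\<lambda>s. P0 s \<bullet> fderiv F (y1 s, V1 s) (0, \<zeta>, w1 s)) + \<kappa> * LG Pg \<zeta> w1)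
        + integral {0..1} (\<lambda>s. p2 s \<bullet> fderiv F (y2 s, V2 s) (0, - \<zeta>, w2 s)) + 1/2 * Q"
      by (simp add: LO_def Q_def algebra_simps)
    also have "\<dots> = \<zeta> * lam + integral {0..1} (\<lambda>s. H1 s \<bullet> w1 s) + integral {0..1} (\<lambda>s. H2 s \<bullet> w2 s) + 1/2 * Q"
      unfolding 1 2 lam_def by (simp add: algebra_simps)
    finally show ?thesis using 0 by simp
  qed
  have lam0: "lam = 0"
  proof (rule ccontr)
    assume "lam \<noteq> 0"
    let ?w1 = "\<lambda>s. - (\<Sum>i\<in>UNIV. (1/2 * fderiv2 c (v1 s) (h1 s) (h1 s) $ i + 1) *\<^sub>R B1.e i s)"
    let ?w2 = "\<lambda>s. - (\<Sum>i\<in>UNIV. (1/2 * fderiv2 c (v2 s) (h2 s) (h2 s) $ i + 1) *\<^sub>R B2.e i s)"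
    define R where "R = integral {0..1} (\<lambda>s. H1 s \<bullet> ?w1 s) + integral {0..1} (\<lambda>s. H2 s \<bullet> ?w2 s) + 1/2 * Q"
    have "0 \<le> \<zeta> * lam + R" for \<zeta>
      using main[OF B1.base_feasible[OF h(1) zero_less_one] B2.base_feasible[OF h(2) zero_less_one], of \<zeta>] by (simp add: R_def)
    from this[of "- (R + 1) / lam"] \<open>lam \<noteq> 0\<close> show False by simp
  qed
  let ?M1 = "B1.mult H1" and ?M2 = "B2.mult H2"
  let ?q1 = "integral {0..1} (\<lambda>s. ?M1 s \<bullet> fderiv2 c (v1 s) (h1 s) (h1 s))"
  let ?q2 = "integral {0..1} (\<lambda>s. ?M2 s \<bullet> fderiv2 c (v2 s) (h2 s) (h2 s))"
  \<comment> \<open>Elimination of the first control, with the second frozen in the constant; the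
    inequality that comes back supplies the constant for the second.\<close>
  have o1: "0 \<le> integral {0..1} (\<lambda>s. H1 s \<bullet> w1 s) + (integral {0..1} (\<lambda>s. H2 s \<bullet> w2 s) + 1/2 * Q)"
    if "second_order_feasible c v2 h2 w2" "second_order_feasible c v1 h1 w1" for w1 w2
    using main[OF that(2,1), of 0] by simp
  have o2: "0 \<le> integral {0..1} (\<lambda>s. H2 s \<bullet> w2 s) + (1/2 * ?q1 + 1/2 * Q)" if "second_order_feasible c v2 h2 w2" for w2
    using B1.multiplier(4)[OF Hm(1) h(1) o1[OF that]] by simp
  have w2: "second_order_feasible c v2 h2 (\<lambda>s. - (\<Sum>i\<in>UNIV. (1/2 * fderiv2 c (v2 s) (h2 s) (h2 s) $ i + 1) *\<^sub>R B2.e i s))"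
    by (rule B2.base_feasible[OF h(2) zero_less_one])
  have m1: "AE s in leb01. \<forall>h. H1 s \<bullet> h + ?M1 s \<bullet> fderiv c (v1 s) h = 0"
    "AE s in leb01. \<forall>i. 0 \<le> ?M1 s $ i" "AE s in leb01. \<forall>i. ?M1 s $ i * c (v1 s) $ i = 0"
    by (rule B1.multiplier[OF Hm(1) h(1) o1[OF w2]]; assumption)+
  have m2: "AE s in leb01. \<forall>h. H2 s \<bullet> h + ?M2 s \<bullet> fderiv c (v2 s) h = 0"
    "AE s in leb01. \<forall>i. 0 \<le> ?M2 s $ i" "AE s in leb01. \<forall>i. ?M2 s $ i * c (v2 s) $ i = 0"
    "0 \<le> 1/2 * ?q2 + (1/2 * ?q1 + 1/2 * Q)"
    by (rule B2.multiplier[OF Hm(2) h(2) o2]; assumption)+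
  have "valid P0 Pg p2 \<kappa>"
    unfolding valid_def P1_def[symmetric] H1_def[symmetric] H2_def[symmetric]
  proof (rule conjI)
    show "integral {0..1} (\<lambda>s. (P0 s + \<kappa> *\<^sub>R Pg s) \<bullet> f (y1 s, v1 s)) - integral {0..1} (\<lambda>s. p2 s \<bullet> f (y2 s, v2 s)) = 1"
      using lam0 by (simp add: lam_def P1_def)
    show "AE s in leb01.
      (\<forall>h. (P0 s + \<kappa> *\<^sub>R Pg s) \<bullet> fderiv F (y1 s, V1 s) (0, 0, h) + ?M1 s \<bullet> fderiv c (v1 s) h = 0) \<and>
      (\<forall>i. 0 \<le> ?M1 s $ i \<and> ?M1 s $ i * c (v1 s) $ i = 0) \<and>
      (\<forall>h. p2 s \<bullet> fderiv F (y2 s, V2 s) (0, 0, h) + ?M2 s \<bullet> fderiv c (v2 s) h = 0) \<and>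
      (\<forall>i. 0 \<le> ?M2 s $ i \<and> ?M2 s $ i * c (v2 s) $ i = 0)"
      using m1 m2(1-3)
    proof eventually_elim
      case (elim s)
      have "P1 s \<bullet> fderiv F (y1 s, V1 s) (0, 0, h) + ?M1 s \<bullet> fderiv c (v1 s) h = 0" for h
        using elim(1) unfolding H1_def Hctrl_inner by blast
      moreover have "p2 s \<bullet> fderiv F (y2 s, V2 s) (0, 0, h) + ?M2 s \<bullet> fderiv c (v2 s) h = 0" for h
        using elim(4) unfolding H2_def Hctrl_inner by blast
      ultimately show ?case using elim(2,3,5,6) unfolding P1_def by blast
    qed
  qed
  moreover have "0 \<le> Qtot P0 Pg p2 \<kappa> d\<xi> h1 h2 d1 d2"
  proof -
    have "Qtot P0 Pg p2 \<kappa> d\<xi> h1 h2 d1 d2 = Q + ?q1 + ?q2"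
      unfolding Qtot_def Q_def P1_def[symmetric] H1_def[symmetric] H2_def[symmetric] by simp
    then show ?thesis using m2(4) by simp
  qed
  ultimately show ?thesis using \<kappa>(1,2) by (intro that)
qed

end

section \<open>Square integrable directions\<close>

lemma abs_cont_on_diff:
  assumes "abs_cont_on a b x" "abs_cont_on a b y"
  shows "abs_cont_on a b (\<lambda>s. x s - y s)"
  unfolding abs_cont_on_def
proof (intro allI impI)
  fix e :: real assume "0 < e"
  then have e2: "0 < e / 2" by simp
  obtain d1 where d1: "d1 > 0" "\<forall>d. d division_of \<Union> d \<and> \<Union> d \<subseteq> {a..b} \<and> (\<Sum>k\<in>d. measure lborel k) < d1 \<longrightarrow>
      (\<Sum>k\<in>d. norm (x (interval_upperbound k) - x (interval_lowerbound k))) < e / 2"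
    using assms(1)[unfolded abs_cont_on_def, rule_format, OF e2] by (elim exE conjE) (rule that)
  obtain d2 where d2: "d2 > 0" "\<forall>d. d division_of \<Union> d \<and> \<Union> d \<subseteq> {a..b} \<and> (\<Sum>k\<in>d. measure lborel k) < d2 \<longrightarrow>
      (\<Sum>k\<in>d. norm (y (interval_upperbound k) - y (interval_lowerbound k))) < e / 2"
    using assms(2)[unfolded abs_cont_on_def, rule_format, OF e2] by (elim exE conjE) (rule that)
  show "\<exists>\<delta>>0. \<forall>d. d division_of \<Union> d \<and> \<Union> d \<subseteq> {a..b} \<and> (\<Sum>k\<in>d. measure lborel k) < \<delta> \<longrightarrow>
      (\<Sum>k\<in>d. norm (x (interval_upperbound k) - y (interval_upperbound k) - (x (interval_lowerbound k) - y (interval_lowerbound k)))) < e"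
  proof (intro exI[of _ "min d1 d2"] conjI allI impI)
    show "0 < min d1 d2" using d1 d2 by simp
    fix d assume d: "d division_of \<Union> d \<and> \<Union> d \<subseteq> {a..b} \<and> (\<Sum>k\<in>d. measure lborel k) < min d1 d2"
    have "(\<Sum>k\<in>d. norm (x (interval_upperbound k) - y (interval_upperbound k) - (x (interval_lowerbound k) - y (interval_lowerbound k))))
      \<le> (\<Sum>k\<in>d. norm (x (interval_upperbound k) - x (interval_lowerbound k)) + norm (y (interval_upperbound k) - y (interval_lowerbound k)))"
    proof (rule sum_mono)
      fix k
      have "x (interval_upperbound k) - y (interval_upperbound k) - (x (interval_lowerbound k) - y (interval_lowerbound k))
        = (x (interval_upperbound k) - x (interval_lowerbound k)) - (y (interval_upperbound k) - y (interval_lowerbound k))" by simp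
      then show "norm (x (interval_upperbound k) - y (interval_upperbound k) - (x (interval_lowerbound k) - y (interval_lowerbound k)))
        \<le> norm (x (interval_upperbound k) - x (interval_lowerbound k)) + norm (y (interval_upperbound k) - y (interval_lowerbound k))"
        by (simp only: norm_triangle_ineq4)
    qed
    also have "\<dots> = (\<Sum>k\<in>d. norm (x (interval_upperbound k) - x (interval_lowerbound k))) + (\<Sum>k\<in>d. norm (y (interval_upperbound k) - y (interval_lowerbound k)))"
      by (rule sum.distrib)
    also have "\<dots> < e / 2 + e / 2"
      by (rule add_strict_mono) (use d d1(2) d2(2) in auto)
    finally show "(\<Sum>k\<in>d. norm (x (interval_upperbound k) - y (interval_upperbound k) - (x (interval_lowerbound k) - y (interval_lowerbound k)))) < e"
      by simp
  qed
qed

lemma abs_cont_on_continuous: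
  fixes x :: "real \<Rightarrow> 'a::euclidean_space"
  assumes "abs_cont_on a b x"
  shows "continuous_on {a..b} x"
  unfolding continuous_on_iff
proof (intro ballI allI impI)
  fix s and e :: real assume s: "s \<in> {a..b}" and e: "0 < e"
  obtain \<delta> where \<delta>: "\<delta> > 0" "\<forall>d. d division_of \<Union> d \<and> \<Union> d \<subseteq> {a..b} \<and> (\<Sum>k\<in>d. measure lborel k) < \<delta> \<longrightarrow>
      (\<Sum>k\<in>d. norm (x (interval_upperbound k) - x (interval_lowerbound k))) < e"
    using assms[unfolded abs_cont_on_def, rule_format, OF e] by (elim exE conjE) (rule that)
  have le: "norm (x r - x q) < e" if "q \<in> {a..b}" "r \<in> {a..b}" "q \<le> r" "r - q < \<delta>" for q r
  proof -
    have "{{q..r}} division_of \<Union>{{q..r}}" using division_of_self[of q r] that(3) by (simp add: box_real)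
    moreover have "\<Union>{{q..r}} \<subseteq> {a..b}" using that by auto
    moreover have "(\<Sum>k\<in>{{q..r}}. measure lborel k) < \<delta>" using that by simp
    ultimately have "(\<Sum>k\<in>{{q..r}}. norm (x (interval_upperbound k) - x (interval_lowerbound k))) < e" using \<delta>(2) by blast
    then show ?thesis using that(3) by simp
  qed
  show "\<exists>d>0. \<forall>r\<in>{a..b}. dist r s < d \<longrightarrow> dist (x r) (x s) < e"
  proof (intro exI[of _ \<delta>] conjI ballI impI)
    fix r assume r: "r \<in> {a..b}" "dist r s < \<delta>"
    show "dist (x r) (x s) < e"
      using le[of s r] le[of r s] r s by (cases "s \<le> r") (auto simp: dist_norm norm_minus_commute)
  qed (rule \<delta>)
qed

lemma square_integrable_imp_integrable:
  fixes h :: "real \<Rightarrow> 'a::euclidean_space"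
  assumes h: "h \<in> borel_measurable leb01" and L2: "integrable leb01 (\<lambda>s. (norm (h s))\<^sup>2)"
  shows "integrable leb01 (\<lambda>s. norm (h s))"
    and "integrable leb01 (\<lambda>s. (W + norm (h s))\<^sup>2)" (is ?B)
proof -
  have one: "integrable (lebesgue_on {0..1::real}) (\<lambda>s. r :: real)" for r by (rule bmeas_integrable(2)[OF bmeas_const])
  have hm: "(\<lambda>s. norm (h s)) \<in> borel_measurable leb01" using h by simp
  show 1: "integrable leb01 (\<lambda>s. norm (h s))"
  proof (rule Bochner_Integration.integrable_bound[OF Bochner_Integration.integrable_add[OF one[of 1] L2] hm])
    show "AE s in leb01. norm (norm (h s)) \<le> norm (1 + (norm (h s))\<^sup>2)"
    proof (rule AE_I2)
      fix s
      have "0 \<le> (norm (h s) - 1)\<^sup>2" by simp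
      also have "\<dots> = 1 + (norm (h s))\<^sup>2 - 2 * norm (h s)" by (simp add: power2_diff)
      finally have "norm (h s) \<le> 1 + (norm (h s))\<^sup>2" using norm_ge_zero[of "h s"] by linarith
      then show "norm (norm (h s)) \<le> norm (1 + (norm (h s))\<^sup>2)" by simp
    qed
  qed
  have "integrable leb01 (\<lambda>s. W\<^sup>2 + 2 * W * norm (h s) + (norm (h s))\<^sup>2)"
    by (intro Bochner_Integration.integrable_add one integrable_mult_right 1 L2)
  then show ?B by (simp add: power2_sum add_ac)
qed

text \<open>Dominated convergence: the integrand is quadratic in \<open>u n\<close>, and
  \<open>(W + norm (h s))\<^sup>2\<close> is integrable. The constant \<open>W\<close> leaves room
  for the bounded state components and correction terms.\<close>

lemma quadratic_integral_limit:
  fixes G :: "'z::euclidean_space \<Rightarrow> 'y::euclidean_space"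
  assumes G: "C2 G" and p: "bmeas p" and z: "bmeas z"
    and u: "\<And>n. bmeas (u n)" and u': "u' \<in> borel_measurable leb01"
    and lim: "AE s in leb01. (\<lambda>n. u n s) \<longlonglongrightarrow> u' s"
    and h: "h \<in> borel_measurable leb01" "integrable leb01 (\<lambda>s. (norm (h s))\<^sup>2)"
    and bd: "\<And>n s. s \<in> {0..1} \<Longrightarrow> norm (u n s) \<le> W + norm (h s :: 'w::euclidean_space)"
  shows "(\<lambda>n. integral {0..1} (\<lambda>s. p s \<bullet> fderiv2 G (z s) (u n s) (u n s)))
      \<longlonglongrightarrow> integral {0..1} (\<lambda>s. p s \<bullet> fderiv2 G (z s) (u' s) (u' s))"
    and "integrable leb01 (\<lambda>s. p s \<bullet> fderiv2 G (z s) (u' s) (u' s))"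
proof -
  let ?q = "\<lambda>v s. p s \<bullet> fderiv2 G (z s) (v s) (v s)"
  obtain P where P: "0 < P" "\<forall>s\<in>{0..1}. norm (p s) \<le> P" by (rule bmeas_boundE[OF p])
  obtain R where R: "0 < R" "\<forall>s\<in>{0..1}. norm (z s) \<le> R" by (rule bmeas_boundE[OF z])
  obtain K where K: "0 < K" "\<forall>x. norm x \<le> R \<longrightarrow> norm (G x) \<le> K \<and> norm (fderiv G x) \<le> K \<and> norm (fderiv2 G x) \<le> K"
    by (rule C2_bounded_derivatives[OF G])
  have qm: "?q v \<in> borel_measurable leb01" if "v \<in> borel_measurable leb01" for v
  proof -
    have "continuous_on UNIV (\<lambda>w. fst w \<bullet> fderiv2 G (fst (snd w)) (snd (snd w)) (snd (snd w)))"
      by (intro continuous_on_inner bounded_bilinear.continuous_on[OF bounded_bilinear_blinfun_apply] continuous_intros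
        continuous_on_compose2[OF C2_continuous_fderiv2[OF G]]) auto
    then have "(\<lambda>w. fst w \<bullet> fderiv2 G (fst (snd w)) (snd (snd w)) (snd (snd w))) \<in> borel_measurable borel"
      by (rule borel_measurable_continuous_onI)
    moreover have "(\<lambda>s. (p s, z s, v s)) \<in> borel_measurable leb01"
      by (intro borel_measurable_Pair bmeasD1 p z that)
    ultimately have "(\<lambda>s. (\<lambda>w. fst w \<bullet> fderiv2 G (fst (snd w)) (snd (snd w)) (snd (snd w))) (p s, z s, v s))
        \<in> borel_measurable leb01" by (rule measurable_compose[rotated])
    then show ?thesis by simp
  qed
  have qle: "norm (?q v s) \<le> P * K * (norm (v s))\<^sup>2" if s: "s \<in> {0..1}" for v s
  proof -
    have "norm (fderiv2 G (z s) (v s)) \<le> K * norm (v s)"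
      by (rule norm_fderiv_blinfun_le) (use K(2) R(2) s in blast)
    then have "norm (fderiv2 G (z s) (v s) (v s)) \<le> K * norm (v s) * norm (v s)" by (rule norm_fderiv_blinfun_le)
    then have "norm (p s) * norm (fderiv2 G (z s) (v s) (v s)) \<le> P * (K * norm (v s) * norm (v s))"
      by (intro mult_mono) (use P s in auto)
    then show ?thesis using Cauchy_Schwarz_ineq2[of "p s" "fderiv2 G (z s) (v s) (v s)"]
      by (simp add: power2_eq_square mult.assoc)
  qed
  have dom: "integrable leb01 (\<lambda>s. P * K * (W + norm (h s))\<^sup>2)"
    by (intro integrable_mult_right square_integrable_imp_integrable(2) h)
  have lim': "AE s in leb01. (\<lambda>n. ?q (u n) s) \<longlonglongrightarrow> ?q u' s"
    using lim
  proof eventually_elim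
    case (elim s)
    then show ?case by (intro tendsto_inner tendsto_const bounded_bilinear.tendsto[OF bounded_bilinear_blinfun_apply])
  qed
  have bd': "AE s in leb01. norm (?q (u n) s) \<le> P * K * (W + norm (h s))\<^sup>2" for n
    using AE_space
  proof eventually_elim
    case (elim s)
    then have s: "s \<in> {0..1}" by simp
    have "(norm (u n s))\<^sup>2 \<le> (W + norm (h s))\<^sup>2" by (rule power_mono[OF bd[OF s]]) simp
    then have "P * K * (norm (u n s))\<^sup>2 \<le> P * K * (W + norm (h s))\<^sup>2" using P K by (intro mult_left_mono) auto
    then show ?case using qle[OF s, of "u n"] by linarith
  qed
  have mm: "?q (u n) \<in> borel_measurable leb01" for n by (rule qm[OF bmeasD1[OF u]])
  show int: "integrable leb01 (?q u')"
    by (rule integrable_dominated_convergence[OF qm[OF u'] mm dom lim' bd'])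
  have "(\<lambda>n. integral\<^sup>L leb01 (?q (u n))) \<longlonglongrightarrow> integral\<^sup>L leb01 (?q u')"
    by (rule integral_dominated_convergence[OF qm[OF u'] mm dom lim' bd'])
  moreover have "integral\<^sup>L leb01 (?q (u n)) = integral {0..1} (?q (u n))" for n
    by (rule lebesgue_integral_eq_integral) (intro bmeas_integrable(2) bmeas_inner p bmeas_fderiv2 G z u, simp)
  moreover have "integral\<^sup>L leb01 (?q u') = integral {0..1} (?q u')"
    by (rule lebesgue_integral_eq_integral[OF int]) simp
  ultimately show "(\<lambda>n. integral {0..1} (?q (u n))) \<longlonglongrightarrow> integral {0..1} (?q u')" by simp
qed

context crisis_core
begin

lemma linearized_combine:
  assumes "linearized d\<xi> h1 h2 d1 d2" "linearized d\<xi>' h1' h2' d1' d2'"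
  shows "linearized (d\<xi> + r * d\<xi>') (\<lambda>s. h1 s + r *\<^sub>R h1' s) (\<lambda>s. h2 s + r *\<^sub>R h2' s) (\<lambda>s. d1 s + r *\<^sub>R d1' s) (\<lambda>s. d2 s + r *\<^sub>R d2' s)"
proof -
  have l: "bmeas h1" "bmeas h2" "d1 0 = 0" "d2 0 = d1 1"
    "lip_path d1 (\<lambda>s. fderiv F (y1 s, V1 s) (d1 s, d\<xi>, h1 s))"
    "lip_path d2 (\<lambda>s. fderiv F (y2 s, V2 s) (d2 s, - d\<xi>, h2 s))"
    using assms(1) by (auto simp: linearized_def)
  have l': "bmeas h1'" "bmeas h2'" "d1' 0 = 0" "d2' 0 = d1' 1"
    "lip_path d1' (\<lambda>s. fderiv F (y1 s, V1 s) (d1' s, d\<xi>', h1' s))"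
    "lip_path d2' (\<lambda>s. fderiv F (y2 s, V2 s) (d2' s, - d\<xi>', h2' s))"
    using assms(2) by (auto simp: linearized_def)
  have 1: "fderiv F (y1 s, V1 s) (d1 s + r *\<^sub>R d1' s, d\<xi> + r * d\<xi>', h1 s + r *\<^sub>R h1' s)
      = fderiv F (y1 s, V1 s) (d1 s, d\<xi>, h1 s) + r *\<^sub>R fderiv F (y1 s, V1 s) (d1' s, d\<xi>', h1' s)" for s
  proof -
    have "(d1 s + r *\<^sub>R d1' s, d\<xi> + r * d\<xi>', h1 s + r *\<^sub>R h1' s) = (d1 s, d\<xi>, h1 s) + r *\<^sub>R (d1' s, d\<xi>', h1' s)" by simp
    then show ?thesis by (simp only: blinfun.add_right blinfun.scaleR_right)
  qed
  have 2: "fderiv F (y2 s, V2 s) (d2 s + r *\<^sub>R d2' s, - (d\<xi> + r * d\<xi>'), h2 s + r *\<^sub>R h2' s)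
      = fderiv F (y2 s, V2 s) (d2 s, - d\<xi>, h2 s) + r *\<^sub>R fderiv F (y2 s, V2 s) (d2' s, - d\<xi>', h2' s)" for s
  proof -
    have "(d2 s + r *\<^sub>R d2' s, - (d\<xi> + r * d\<xi>'), h2 s + r *\<^sub>R h2' s) = (d2 s, - d\<xi>, h2 s) + r *\<^sub>R (d2' s, - d\<xi>', h2' s)" by simp
    then show ?thesis by (simp only: blinfun.add_right blinfun.scaleR_right)
  qed
  show ?thesis
    unfolding linearized_def 1 2
    by (intro conjI bmeas_add bmeas_scaleR bmeas_const lip_path_add lip_path_scaleR l l') (simp_all add: l l')
qed

lemma tangent_combine:
  assumes "tangent v h" "tangent v h'"
  shows "tangent v (\<lambda>s. h s + r *\<^sub>R h' s)"
proof -
  obtain a where a: "0 < a" "\<forall>s\<in>{0..1}. \<forall>i. c (v s) $ i \<ge> - a \<longrightarrow> fderiv c (v s) (h s) $ i = 0"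
    using assms(1) unfolding tangent_def by (elim exE conjE) (rule that)
  obtain a' where a': "0 < a'" "\<forall>s\<in>{0..1}. \<forall>i. c (v s) $ i \<ge> - a' \<longrightarrow> fderiv c (v s) (h' s) $ i = 0"
    using assms(2) unfolding tangent_def by (elim exE conjE) (rule that)
  have "fderiv c (v s) (h s + r *\<^sub>R h' s) $ i = 0" if "s \<in> {0..1}" "c (v s) $ i \<ge> - min a a'" for s i
  proof -
    have "c (v s) $ i \<ge> - a" "c (v s) $ i \<ge> - a'" using that(2) by auto
    then have "fderiv c (v s) (h s) $ i = 0" "fderiv c (v s) (h' s) $ i = 0" using a(2) a'(2) that(1) by blast+
    then show ?thesis by (simp add: blinfun.add_right blinfun.scaleR_right)
  qed
  then show ?thesis unfolding tangent_def using a(1) a'(1) by (intro exI[of _ "min a a'"]) auto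
qed

lemma tangent_zero: "tangent v (\<lambda>_. 0)"
  unfolding tangent_def by (intro exI[of _ 1]) (simp add: blinfun.zero_right)

lemma linearized_zero: "linearized 0 (\<lambda>_. 0) (\<lambda>_. 0) (\<lambda>_. 0) (\<lambda>_. 0)"
proof -
  have "(0 :: 'x, 0 :: real, 0 :: 'v) = 0" by (simp add: zero_prod_def)
  then show ?thesis by (simp add: linearized_def bmeas_const lip_path_const blinfun.zero_right)
qed

text \<open>The tangent directions form a linear space on which, by the first order condition applied to
  both signs, the derivative of the cost is a multiple of the derivative of the constraint.\<close>

lemma correction_direction:
  obtains e\<xi> e1 e2 f1 f2 where "linearized e\<xi> e1 e2 f1 f2" "tangent v1 e1" "tangent v2 e2"
    "\<forall>d\<xi> h1 h2 d1 d2. linearized d\<xi> h1 h2 d1 d2 \<longrightarrow> tangent v1 h1 \<longrightarrow> tangent v2 h2 \<longrightarrow>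
       fderiv g (y1 1) (d1 1) - fderiv g (y1 1) (d1 1) * fderiv g (y1 1) (f1 1) = 0 \<and>
       (fderiv \<phi> (y2 1) (d2 1) - d\<xi>) - fderiv g (y1 1) (d1 1) * (fderiv \<phi> (y2 1) (f2 1) - e\<xi>) = 0"
proof -
  have zero: "fderiv \<phi> (y2 1) (d2 1) - d\<xi> = 0"
    if D: "linearized d\<xi> h1 h2 d1 d2" "tangent v1 h1" "tangent v2 h2" and a: "fderiv g (y1 1) (d1 1) = 0" for d\<xi> h1 h2 d1 d2
  proof -
    have "0 \<le> fderiv \<phi> (y2 1) (d2 1) - d\<xi>" using first_order[OF D] a by simp
    moreover have "0 \<le> - (fderiv \<phi> (y2 1) (d2 1) - d\<xi>)"
      using first_order[OF linearized_combine[OF linearized_zero D(1), of "-1"]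
          tangent_combine[OF tangent_zero D(2), of "-1"] tangent_combine[OF tangent_zero D(3), of "-1"]] a
      by (simp add: blinfun.minus_right)
    ultimately show ?thesis by linarith
  qed
  show ?thesis
  proof (cases "\<exists>d\<xi> h1 h2 d1 d2. linearized d\<xi> h1 h2 d1 d2 \<and> tangent v1 h1 \<and> tangent v2 h2 \<and> fderiv g (y1 1) (d1 1) \<noteq> 0")
    case True
    then obtain d\<xi> h1 h2 d1 d2 where D: "linearized d\<xi> h1 h2 d1 d2" "tangent v1 h1" "tangent v2 h2" "fderiv g (y1 1) (d1 1) \<noteq> 0"
      by (elim exE conjE) (rule that)
    \<comment> \<open>Normalised so that the rescaled direction changes the linearised endpoint
      constraint at rate 1.\<close>
    define r where "r = 1 / fderiv g (y1 1) (d1 1)"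
    define e\<xi> where "e\<xi> = 0 + r * d\<xi>"
    define e1 where "e1 = (\<lambda>s. 0 + r *\<^sub>R h1 s)"
    define e2 where "e2 = (\<lambda>s. 0 + r *\<^sub>R h2 s)"
    define f1 where "f1 = (\<lambda>s. 0 + r *\<^sub>R d1 s)"
    define f2 where "f2 = (\<lambda>s. 0 + r *\<^sub>R d2 s)"
    have e: "linearized e\<xi> e1 e2 f1 f2" "tangent v1 e1" "tangent v2 e2"
      unfolding e\<xi>_def e1_def e2_def f1_def f2_def
      by (rule linearized_combine[OF linearized_zero D(1)] tangent_combine[OF tangent_zero D(2)] tangent_combine[OF tangent_zero D(3)])+
    have g1: "fderiv g (y1 1) (f1 1) = 1" using D(4) by (simp add: f1_def r_def blinfun.scaleR_right)
    show ?thesis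
    proof (rule that[OF e], intro allI impI conjI)
      fix x\<xi> x1 x2 b1 b2 assume X: "linearized x\<xi> x1 x2 b1 b2" "tangent v1 x1" "tangent v2 x2"
      let ?a = "fderiv g (y1 1) (b1 1)"
      show "?a - ?a * fderiv g (y1 1) (f1 1) = 0" using g1 by simp
      \<comment> \<open>Subtracting the right multiple makes the endpoint derivative vanish, and
        then the derivative of the cost vanishes as well.\<close>
      have "fderiv \<phi> (y2 1) (b2 1 + (- ?a) *\<^sub>R f2 1) - (x\<xi> + (- ?a) * e\<xi>) = 0"
        by (rule zero[OF linearized_combine[OF X(1) e(1)] tangent_combine[OF X(2) e(2)] tangent_combine[OF X(3) e(3)]])
           (simp add: blinfun.diff_right blinfun.scaleR_right g1)
      then show "(fderiv \<phi> (y2 1) (b2 1) - x\<xi>) - ?a * (fderiv \<phi> (y2 1) (f2 1) - e\<xi>) = 0"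
        by (simp add: blinfun.diff_right blinfun.scaleR_right algebra_simps)
    qed
  next
    \<comment> \<open>All tangent directions satisfy the linearised endpoint constraint already, so
      the zero direction serves.\<close>
    case False
    show ?thesis
    proof (rule that[OF linearized_zero tangent_zero tangent_zero], intro allI impI)
      fix x\<xi> x1 x2 b1 b2 assume X: "linearized x\<xi> x1 x2 b1 b2" "tangent v1 x1" "tangent v2 x2"
      then have a: "fderiv g (y1 1) (b1 1) = 0" using False by blast
      show "fderiv g (y1 1) (b1 1) - fderiv g (y1 1) (b1 1) * fderiv g (y1 1) 0 = 0 \<and>
        (fderiv \<phi> (y2 1) (b2 1) - x\<xi>) - fderiv g (y1 1) (b1 1) * (fderiv \<phi> (y2 1) 0 - 0) = 0"
        using zero[OF X a] by (simp add: a)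
    qed
  qed
qed

text \<open>At a given time each constraint is either exactly active, where criticality applies, or
  has a slack that exceeds \<open>1 / real (Suc n)\<close> for large \<open>n\<close>. Cutting
  \<open>h\<close> off at the other times, and where it is large, leaves a bounded direction tangent
  with a margin and is undone in the limit.\<close>

lemma truncation:
  assumes v: "bmeas v" and feas: "\<And>s i. s \<in> {0..1} \<Longrightarrow> c (v s) $ i \<le> 0"
    and h: "h \<in> borel_measurable leb01"
    and crit: "AE s in leb01. \<forall>i. c (v s) $ i = 0 \<longrightarrow> fderiv c (v s) (h s) $ i = 0"
  obtains u where "\<forall>n::nat. bmeas (u n) \<and> tangent v (u n) \<and> (\<forall>s. norm (u n s) \<le> norm (h s))"
    "AE s in leb01. (\<lambda>n. u n s) \<longlonglongrightarrow> h s"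
proof -
  define good where "good n s \<longleftrightarrow> norm (h s) \<le> real n \<and>
    (\<forall>i. c (v s) $ i \<le> - (1 / real (Suc n)) \<or> fderiv c (v s) (h s) $ i = 0)" for n s
  define u where "u n s = (if good n s then h s else 0)" for n s
  have ch: "(\<lambda>s. fderiv c (v s) (h s) $ i) \<in> borel_measurable leb01" for i
  proof -
    have "continuous_on UNIV (\<lambda>w. fderiv c (fst w) (snd w) $ i)"
      by (intro continuous_on_component bounded_bilinear.continuous_on[OF bounded_bilinear_blinfun_apply] continuous_intros
        continuous_on_compose2[OF C2_continuous_fderiv[OF c]]) auto
    then have "(\<lambda>w. fderiv c (fst w) (snd w) $ i) \<in> borel_measurable borel" by (rule borel_measurable_continuous_onI)
    moreover have "(\<lambda>s. (v s, h s)) \<in> borel_measurable leb01" by (intro borel_measurable_Pair bmeasD1 v h)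
    ultimately have "(\<lambda>s. (\<lambda>w. fderiv c (fst w) (snd w) $ i) (v s, h s)) \<in> borel_measurable leb01"
      by (rule measurable_compose[rotated])
    then show ?thesis by simp
  qed
  have cm: "(\<lambda>s. c (v s) $ i) \<in> borel_measurable leb01" for i
    by (rule bmeasD1[OF bmeas_C2[OF C2_component[OF c] v]])
  have gp: "Measurable.pred leb01 (good n)" for n
  proof -
    have [measurable]: "Measurable.pred leb01 (\<lambda>s. norm (h s) \<le> real n)"
      unfolding pred_def using h by (intro borel_measurable_le) auto
    have [measurable]: "Measurable.pred leb01 (\<lambda>s. c (v s) $ i \<le> - (1 / real (Suc n)))" for i
      unfolding pred_def by (intro borel_measurable_le cm) auto
    have [measurable]: "Measurable.pred leb01 (\<lambda>s. fderiv c (v s) (h s) $ i = 0)" for i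
      unfolding pred_def by (intro borel_measurable_eq ch) auto
    have eq: "good n = (\<lambda>s. norm (h s) \<le> real n \<and>
        (\<forall>i. c (v s) $ i \<le> - (1 / real (Suc n)) \<or> fderiv c (v s) (h s) $ i = 0))"
      by (rule ext) (simp only: good_def)
    show ?thesis unfolding eq by measurable
  qed
  have ub: "bmeas (u n)" for n
  proof -
    have "u n \<in> borel_measurable leb01"
      unfolding u_def by (intro measurable_If h borel_measurable_const gp[unfolded pred_def])
    moreover have "\<forall>s\<in>{0..1}. norm (u n s) \<le> real n" by (simp add: u_def good_def)
    ultimately show ?thesis unfolding bmeas_def by blast
  qed
  have ut: "tangent v (u n)" for n
    unfolding tangent_def
  \<comment> \<open>The margin is strictly below \<open>1 / real (Suc n)\<close>, because
    \<open>good\<close> also admits a slack equal to that number.\<close>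
  proof (intro exI[of _ "1 / (real (Suc n) + 1)"] conjI ballI allI impI)
    show "0 < 1 / (real (Suc n) + 1)" by simp
    fix s i assume a: "- (1 / (real (Suc n) + 1)) \<le> c (v s) $ i"
    show "fderiv c (v s) (u n s) $ i = 0"
    proof (cases "good n s")
      case True
      have "1 / (real (Suc n) + 1) < 1 / real (Suc n)" by (intro divide_strict_left_mono) auto
      then have "\<not> c (v s) $ i \<le> - (1 / real (Suc n))" using a by linarith
      then show ?thesis using True by (auto simp: good_def u_def)
    qed (simp add: u_def blinfun.zero_right)
  qed
  have "AE s in leb01. (\<lambda>n. u n s) \<longlonglongrightarrow> h s"
    using crit AE_space
  proof eventually_elim
    case (elim s)
    have "eventually (\<lambda>n. norm (h s) \<le> real n) sequentially"
      using eventually_ge_at_top[of "nat \<lceil>norm (h s)\<rceil>"] by eventually_elim linarith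
    moreover have "eventually (\<lambda>n. \<forall>i. c (v s) $ i \<le> - (1 / real (Suc n)) \<or> fderiv c (v s) (h s) $ i = 0) sequentially"
    proof (rule eventually_all_finite)
      fix i
      show "eventually (\<lambda>n. c (v s) $ i \<le> - (1 / real (Suc n)) \<or> fderiv c (v s) (h s) $ i = 0) sequentially"
      proof (cases "c (v s) $ i = 0")
        case True
        then show ?thesis using elim(1) by simp
      next
        case False
        then have neg: "0 < - c (v s) $ i" using feas[of s i] elim(2) by (simp add: less_le)
        have "(\<lambda>n. 1 / real (Suc n)) \<longlonglongrightarrow> 0" by (rule LIMSEQ_Suc[OF lim_1_over_n])
        from order_tendstoD(2)[OF this neg] show ?thesis by eventually_elim simp
      qed
    qed
    ultimately have "eventually (\<lambda>n. u n s = h s) sequentially" by eventually_elim (simp add: u_def good_def)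
    then show ?case by (rule tendsto_eventually)
  qed
  then show ?thesis using ub ut by (intro that[of u]) (auto simp: u_def)
qed

text \<open>All conditions in \<open>valid\<close> are closed and affine in \<open>\<kappa>\<close>,
  and a sequence brings only countably many exceptional null sets.\<close>

lemma valid_limit:
  assumes val: "\<And>n::nat. valid P0 Pg p2 (\<kappa> n)" and lim: "\<kappa> \<longlonglongrightarrow> \<kappa>'" and co: "costates P0 Pg p2"
  shows "valid P0 Pg p2 \<kappa>'"
proof -
  have pm: "bmeas p2" "bmeas P0" "bmeas Pg" using co bmeas_lip_path by (auto simp: costates_def)
  let ?M = "\<lambda>\<kappa>. B1.mult (Hctrl (\<lambda>s. P0 s + \<kappa> *\<^sub>R Pg s) y1 V1)"
  have M: "?M r s = B1.mult (Hctrl P0 y1 V1) s + r *\<^sub>R B1.mult (Hctrl Pg y1 V1) s" for r s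
  proof -
    have "Hctrl (\<lambda>s. P0 s + r *\<^sub>R Pg s) y1 V1 = (\<lambda>s. Hctrl P0 y1 V1 s + r *\<^sub>R Hctrl Pg y1 V1 s)"
      by (rule ext) (rule Hctrl_linear)
    then show ?thesis by (simp only: B1.mult_linear)
  qed
  have fm: "bmeas (\<lambda>s. f (y1 s, v1 s))" by (intro bmeas_C2[OF f] bmeas_Pair v1 bmeas_lip_path[OF Y1])
  have I: "integral {0..1} (\<lambda>s. (P0 s + r *\<^sub>R Pg s) \<bullet> f (y1 s, v1 s))
      = integral {0..1} (\<lambda>s. P0 s \<bullet> f (y1 s, v1 s)) + r * integral {0..1} (\<lambda>s. Pg s \<bullet> f (y1 s, v1 s))" for r
  proof (rule integral_unique)
    have "((\<lambda>s. P0 s \<bullet> f (y1 s, v1 s) + r * (Pg s \<bullet> f (y1 s, v1 s))) has_integral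
      integral {0..1} (\<lambda>s. P0 s \<bullet> f (y1 s, v1 s)) + r * integral {0..1} (\<lambda>s. Pg s \<bullet> f (y1 s, v1 s))) {0..1}"
      by (intro has_integral_add has_integral_mult_right integrable_integral bmeas_integrable(1) bmeas_inner pm fm)
    then show "((\<lambda>s. (P0 s + r *\<^sub>R Pg s) \<bullet> f (y1 s, v1 s)) has_integral
      integral {0..1} (\<lambda>s. P0 s \<bullet> f (y1 s, v1 s)) + r * integral {0..1} (\<lambda>s. Pg s \<bullet> f (y1 s, v1 s))) {0..1}"
      by (simp add: inner_add_left)
  qed
  let ?I2 = "integral {0..1} (\<lambda>s. p2 s \<bullet> f (y2 s, v2 s))"
  have "(\<lambda>n. integral {0..1} (\<lambda>s. (P0 s + \<kappa> n *\<^sub>R Pg s) \<bullet> f (y1 s, v1 s)) - ?I2)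
     \<longlonglongrightarrow> integral {0..1} (\<lambda>s. (P0 s + \<kappa>' *\<^sub>R Pg s) \<bullet> f (y1 s, v1 s)) - ?I2"
    unfolding I by (intro tendsto_intros lim)
  moreover have "integral {0..1} (\<lambda>s. (P0 s + \<kappa> n *\<^sub>R Pg s) \<bullet> f (y1 s, v1 s)) - ?I2 = 1" for n
    using val[of n] by (simp add: valid_def)
  ultimately have eq1: "integral {0..1} (\<lambda>s. (P0 s + \<kappa>' *\<^sub>R Pg s) \<bullet> f (y1 s, v1 s)) - ?I2 = 1"
    by (simp add: LIMSEQ_const_iff)
  have "AE s in leb01. \<forall>n.
      (\<forall>h. (P0 s + \<kappa> n *\<^sub>R Pg s) \<bullet> fderiv F (y1 s, V1 s) (0, 0, h) + ?M (\<kappa> n) s \<bullet> fderiv c (v1 s) h = 0) \<and>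
      (\<forall>i. 0 \<le> ?M (\<kappa> n) s $ i \<and> ?M (\<kappa> n) s $ i * c (v1 s) $ i = 0) \<and>
      (\<forall>h. p2 s \<bullet> fderiv F (y2 s, V2 s) (0, 0, h) + B2.mult (Hctrl p2 y2 V2) s \<bullet> fderiv c (v2 s) h = 0) \<and>
      (\<forall>i. 0 \<le> B2.mult (Hctrl p2 y2 V2) s $ i \<and> B2.mult (Hctrl p2 y2 V2) s $ i * c (v2 s) $ i = 0)"
    unfolding AE_all_countable using val by (simp add: valid_def)
  then have "AE s in leb01.
      (\<forall>h. (P0 s + \<kappa>' *\<^sub>R Pg s) \<bullet> fderiv F (y1 s, V1 s) (0, 0, h) + ?M \<kappa>' s \<bullet> fderiv c (v1 s) h = 0) \<and>
      (\<forall>i. 0 \<le> ?M \<kappa>' s $ i \<and> ?M \<kappa>' s $ i * c (v1 s) $ i = 0) \<and>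
      (\<forall>h. p2 s \<bullet> fderiv F (y2 s, V2 s) (0, 0, h) + B2.mult (Hctrl p2 y2 V2) s \<bullet> fderiv c (v2 s) h = 0) \<and>
      (\<forall>i. 0 \<le> B2.mult (Hctrl p2 y2 V2) s $ i \<and> B2.mult (Hctrl p2 y2 V2) s $ i * c (v2 s) $ i = 0)"
  proof eventually_elim
    case (elim s)
    have Ml: "(\<lambda>n. ?M (\<kappa> n) s) \<longlonglongrightarrow> ?M \<kappa>' s" unfolding M by (intro tendsto_intros lim)
    have "(P0 s + \<kappa>' *\<^sub>R Pg s) \<bullet> fderiv F (y1 s, V1 s) (0, 0, h) + ?M \<kappa>' s \<bullet> fderiv c (v1 s) h = 0" for h
    proof -
      have "(\<lambda>n. (P0 s + \<kappa> n *\<^sub>R Pg s) \<bullet> fderiv F (y1 s, V1 s) (0, 0, h) + ?M (\<kappa> n) s \<bullet> fderiv c (v1 s) h)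
        \<longlonglongrightarrow> (P0 s + \<kappa>' *\<^sub>R Pg s) \<bullet> fderiv F (y1 s, V1 s) (0, 0, h) + ?M \<kappa>' s \<bullet> fderiv c (v1 s) h"
        by (intro tendsto_add tendsto_inner tendsto_scaleR tendsto_const lim Ml)
      moreover have "(P0 s + \<kappa> n *\<^sub>R Pg s) \<bullet> fderiv F (y1 s, V1 s) (0, 0, h) + ?M (\<kappa> n) s \<bullet> fderiv c (v1 s) h = 0" for n
        using elim by blast
      ultimately show ?thesis by (simp add: LIMSEQ_const_iff)
    qed
    moreover have "0 \<le> ?M \<kappa>' s $ i" for i
      by (rule LIMSEQ_le_const[OF tendsto_vec_nth[OF Ml]]) (use elim in blast)
    moreover have "?M \<kappa>' s $ i * c (v1 s) $ i = 0" for i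
    proof -
      have lim_i: "(\<lambda>n. ?M (\<kappa> n) s $ i * c (v1 s) $ i) \<longlonglongrightarrow> ?M \<kappa>' s $ i * c (v1 s) $ i"
        by (intro tendsto_mult tendsto_const tendsto_vec_nth[OF Ml])
      have eq0: "?M (\<kappa> n) s $ i * c (v1 s) $ i = 0" for n using elim by blast
      have "(\<lambda>n::nat. 0::real) \<longlonglongrightarrow> ?M \<kappa>' s $ i * c (v1 s) $ i" using lim_i by (simp only: eq0)
      then show ?thesis by (simp only: LIMSEQ_const_iff)
    qed
    ultimately show ?case using elim by blast
  qed
  with eq1 show ?thesis unfolding valid_def by blast
qed

end

section \<open>Limits of the quadratic form along truncated directions\<close>

lemma L1_limit_of_dominated:
  fixes u :: "nat \<Rightarrow> real \<Rightarrow> 'a::euclidean_space"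
  assumes u: "\<And>n. bmeas (u n)" and bd: "\<And>n s. norm (u n s) \<le> norm (h s)"
    and lim: "AE s in leb01. (\<lambda>n. u n s) \<longlonglongrightarrow> h s"
    and h: "h \<in> borel_measurable leb01" "integrable leb01 (\<lambda>s. (norm (h s))\<^sup>2)"
  shows "(\<lambda>n. integral {0..1} (\<lambda>s. norm (u n s - h s))) \<longlonglongrightarrow> 0" (is ?A)
    and "(\<lambda>s. norm (u n s - h s)) integrable_on {0..1}" (is ?B)
proof -
  have int: "integrable leb01 (\<lambda>s. norm (h s))" by (rule square_integrable_imp_integrable(1)[OF h])
  have dom: "integrable leb01 (\<lambda>s. 2 * norm (h s))" using int by simp
  have m: "(\<lambda>s. norm (u n s - h s)) \<in> borel_measurable leb01" for n
    using bmeasD1[OF u] h(1) by simp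
  have bd': "AE s in leb01. norm (norm (u n s - h s)) \<le> 2 * norm (h s)" for n
  proof (rule AE_I2)
    fix s
    have "norm (u n s - h s) \<le> norm (u n s) + norm (h s)" by (rule norm_triangle_ineq4)
    then show "norm (norm (u n s - h s)) \<le> 2 * norm (h s)" using bd[of n s] by simp
  qed
  have lim': "AE s in leb01. (\<lambda>n. norm (u n s - h s)) \<longlonglongrightarrow> 0"
    using lim
  proof eventually_elim
    case (elim s)
    from tendsto_norm[OF tendsto_diff[OF elim tendsto_const[of "h s"]]] show ?case by simp
  qed
  have I: "integrable leb01 (\<lambda>s. norm (u n s - h s))" for n
    by (rule Bochner_Integration.integrable_bound[OF dom m]) (use bd' in \<open>auto elim: eventually_mono\<close>)
  show ?B by (rule integrable_on_lebesgue_on[OF I]) simp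
  have "(\<lambda>n. integral\<^sup>L leb01 (\<lambda>s. norm (u n s - h s))) \<longlonglongrightarrow> integral\<^sup>L leb01 (\<lambda>s :: real. 0 :: real)"
  proof (rule integral_dominated_convergence[where w="\<lambda>s. 2 * norm (h s)"])
    show "(\<lambda>s :: real. 0 :: real) \<in> borel_measurable leb01" by simp
  qed (fact m dom lim' bd')+
  moreover have "integral\<^sup>L leb01 (\<lambda>s. norm (u n s - h s)) = integral {0..1} (\<lambda>s. norm (u n s - h s))" for n
    by (rule lebesgue_integral_eq_integral[OF I]) simp
  ultimately show ?A by simp
qed

lemma tendsto_of_norm_bound:
  assumes "\<And>n. norm (x n - y) \<le> E n" "E \<longlonglongrightarrow> (0::real)"
  shows "x \<longlonglongrightarrow> y"
proof -
  have "(\<lambda>n. x n - y) \<longlonglongrightarrow> 0"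
    by (rule Lim_null_comparison[OF _ assms(2)]) (use assms(1) in simp)
  then show ?thesis by (simp add: LIM_zero_iff)
qed

text \<open>\<open>un\<close> and \<open>dn\<close> stand for truncated controls and their states,
  and the multiple \<open>- a n\<close> of \<open>f\<close>, \<open>y\<close> and \<open>e\<close>
  is the correction that restores the endpoint constraint. States converge uniformly but controls
  only pointwise, whence the separate domination by \<open>h\<close>.\<close>

lemma corrected_quadratic_limit:
  fixes G :: "'x::euclidean_space \<times> real \<times> 'v::euclidean_space \<Rightarrow> 'y::euclidean_space"
  assumes G: "C2 G" and p: "bmeas p" and z: "bmeas z"
    and dn: "\<And>n. bmeas (dn n)" and un: "\<And>n. bmeas (un n)" and f: "bmeas f" and e: "bmeas e" and d: "bmeas d"
    and a: "a \<longlonglongrightarrow> 0" and E: "E \<longlonglongrightarrow> 0" and close: "\<And>n s. s \<in> {0..1} \<Longrightarrow> norm (dn n s - d s) \<le> E n"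
    and lim: "AE s in leb01. (\<lambda>n. un n s) \<longlonglongrightarrow> h s" and ub: "\<And>n s. norm (un n s) \<le> norm (h s)"
    and h: "h \<in> borel_measurable leb01" "integrable leb01 (\<lambda>s. (norm (h s))\<^sup>2)"
  shows "(\<lambda>n. integral {0..1} (\<lambda>s. p s \<bullet> fderiv2 G (z s)
        (dn n s + (- a n) *\<^sub>R f s, x + (- a n) * y, un n s + (- a n) *\<^sub>R e s) (dn n s + (- a n) *\<^sub>R f s, x + (- a n) * y, un n s + (- a n) *\<^sub>R e s)))
      \<longlonglongrightarrow> integral {0..1} (\<lambda>s. p s \<bullet> fderiv2 G (z s) (d s, x, h s) (d s, x, h s))"
    and "integrable leb01 (\<lambda>s. p s \<bullet> fderiv2 G (z s) (d s, x, h s) (d s, x, h s))" (is ?B)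
proof -
  let ?u = "\<lambda>n s. (dn n s + (- a n) *\<^sub>R f s, x + (- a n) * y, un n s + (- a n) *\<^sub>R e s)"
  obtain A where A: "0 < A" "\<forall>n. norm (a n) \<le> A" using convergent_imp_Bseq[OF convergentI[OF a]] by (rule BseqE)
  obtain B where B: "0 < B" "\<forall>n. norm (E n) \<le> B" using convergent_imp_Bseq[OF convergentI[OF E]] by (rule BseqE)
  obtain C where C: "0 < C" "\<forall>s\<in>{0..1}. norm (d s) \<le> C" by (rule bmeas_boundE[OF d])
  obtain D where D: "0 < D" "\<forall>s\<in>{0..1}. norm (f s) \<le> D" by (rule bmeas_boundE[OF f])
  obtain K where K: "0 < K" "\<forall>s\<in>{0..1}. norm (e s) \<le> K" by (rule bmeas_boundE[OF e])
  have 1: "bmeas (?u n)" for n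
    by (intro bmeas_Pair bmeas_add bmeas_scaleR bmeas_const dn un f e)
  have 2: "(\<lambda>s. (d s, x, h s)) \<in> borel_measurable leb01"
    by (intro borel_measurable_Pair bmeasD1[OF d] borel_measurable_const h)
  have 3: "AE s in leb01. (\<lambda>n. ?u n s) \<longlonglongrightarrow> (d s, x, h s)"
    using lim AE_space
  proof eventually_elim
    case (elim s)
    have "(\<lambda>n. dn n s) \<longlonglongrightarrow> d s" by (rule tendsto_of_norm_bound[OF close E]) (use elim in simp)
    moreover have "(\<lambda>n. - a n) \<longlonglongrightarrow> 0" using tendsto_minus[OF a] by simp
    ultimately have "(\<lambda>n. ?u n s) \<longlonglongrightarrow> (d s + 0 *\<^sub>R f s, x + 0 * y, h s + 0 *\<^sub>R e s)"
      by (intro tendsto_Pair tendsto_add tendsto_scaleR tendsto_mult tendsto_const elim(1))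
    then show ?case by simp
  qed
  define W where "W = (C + B + A * D) + (\<bar>x\<bar> + A * \<bar>y\<bar>) + A * K"
  have 4: "norm (?u n s) \<le> W + norm (h s)" if s: "s \<in> {0..1}" for n s
  proof -
    have an: "\<bar>a n\<bar> \<le> A" using A(2) by simp
    have "norm (d s + (dn n s - d s)) \<le> norm (d s) + norm (dn n s - d s)" by (rule norm_triangle_ineq)
    moreover have "norm (dn n s - d s) \<le> B" using close[OF s, of n] B(2)[rule_format, of n] by simp
    moreover have "norm (d s) \<le> C" using C(2) s by blast
    ultimately have q1: "norm (dn n s) \<le> C + B" by simp
    have q2: "norm ((- a n) *\<^sub>R f s) \<le> A * D" using an D s A by (simp add: mult_mono)
    have q3: "norm ((- a n) *\<^sub>R e s) \<le> A * K" using an K s A by (simp add: mult_mono)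
    have q4: "norm (x + (- a n) * y) \<le> \<bar>x\<bar> + A * \<bar>y\<bar>"
    proof -
      have "\<bar>(- a n) * y\<bar> \<le> A * \<bar>y\<bar>" using an by (simp add: abs_mult mult_right_mono)
      then show ?thesis using abs_triangle_ineq[of x "(- a n) * y"] by simp
    qed
    have q5: "norm (dn n s + (- a n) *\<^sub>R f s) \<le> C + B + A * D" by (rule norm_triangle_le[OF add_mono[OF q1 q2]])
    have q6: "norm (un n s + (- a n) *\<^sub>R e s) \<le> norm (h s) + A * K" by (rule norm_triangle_le[OF add_mono[OF ub q3]])
    have "norm (?u n s) \<le> norm (dn n s + (- a n) *\<^sub>R f s) + norm (x + (- a n) * y, un n s + (- a n) *\<^sub>R e s)"
      by (rule norm_Pair_le)
    also have "\<dots> \<le> norm (dn n s + (- a n) *\<^sub>R f s) + (norm (x + (- a n) * y) + norm (un n s + (- a n) *\<^sub>R e s))"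
      by (rule add_left_mono[OF norm_Pair_le])
    finally show ?thesis using q4 q5 q6 unfolding W_def by linarith
  qed
  show "(\<lambda>n. integral {0..1} (\<lambda>s. p s \<bullet> fderiv2 G (z s) (?u n s) (?u n s)))
      \<longlonglongrightarrow> integral {0..1} (\<lambda>s. p s \<bullet> fderiv2 G (z s) (d s, x, h s) (d s, x, h s))"
    by (rule quadratic_integral_limit(1)[OF G p z 1 2 3 h 4])
  show ?B
    by (rule quadratic_integral_limit(2)[OF G p z 1 2 3 h 4])
qed

lemma control_quadratic_limit:
  fixes c :: "'v::euclidean_space \<Rightarrow> 'y::euclidean_space"
  assumes c: "C2 c" and p: "bmeas p" and v: "bmeas v" and un: "\<And>n. bmeas (un n)" and e: "bmeas e" and a: "a \<longlonglongrightarrow> 0"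
    and lim: "AE s in leb01. (\<lambda>n. un n s) \<longlonglongrightarrow> h s" and ub: "\<And>n s. norm (un n s) \<le> norm (h s)"
    and h: "h \<in> borel_measurable leb01" "integrable leb01 (\<lambda>s. (norm (h s))\<^sup>2)"
  shows "(\<lambda>n. integral {0..1} (\<lambda>s. p s \<bullet> fderiv2 c (v s) (un n s + (- a n) *\<^sub>R e s) (un n s + (- a n) *\<^sub>R e s)))
      \<longlonglongrightarrow> integral {0..1} (\<lambda>s. p s \<bullet> fderiv2 c (v s) (h s) (h s))" (is ?A)
    and "integrable leb01 (\<lambda>s. p s \<bullet> fderiv2 c (v s) (h s) (h s))" (is ?B)
proof -
  have A: "bounded_linear (\<lambda>z :: real \<times> real \<times> 'v. snd (snd z))"
    by (rule bounded_linear_compose[OF bounded_linear_snd bounded_linear_snd])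
  \<comment> \<open>Dummy state and scaling components reduce the control constraint to
    \<open>corrected_quadratic_limit\<close>.\<close>
  let ?G = "\<lambda>z :: real \<times> real \<times> 'v. c (snd (snd z) + 0)"
  have G: "C2 ?G" by (rule fderiv_compose_affine(1)[OF A c])
  have D2: "fderiv2 ?G (0, 0, w) (x, y, h) (x, y, h) = fderiv2 c w h h" for w x y h
    using fderiv_compose_affine(3)[OF A c, of 0 "(0, 0, w)" "(x, y, h)" "(x, y, h)"] by simp
  have z: "bmeas (\<lambda>s. (0 :: real, 0 :: real, v s))" by (intro bmeas_Pair bmeas_const v)
  have cz: "bmeas (\<lambda>s. 0 :: real)" by (rule bmeas_const)
  have close: "norm ((0 :: real) - 0) \<le> 0" by simp
  show ?A
    using corrected_quadratic_limit(1)[OF G p z cz un cz e cz a tendsto_const close lim ub h, where x=0 and y=0] unfolding D2 .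
  show ?B
    using corrected_quadratic_limit(2)[OF G p z cz un cz e cz a tendsto_const close lim ub h, where x=0] unfolding D2 .
qed

context crisis_core
begin

text \<open>Neither coefficient depends on \<open>\<kappa>\<close>, so in the limit the direction
  and the multiplier can be handled separately.\<close>

lemma Qtot_split:
  assumes i: "(\<lambda>s. B1.mult (Hctrl P0 y1 V1) s \<bullet> fderiv2 c (v1 s) (h1 s) (h1 s)) integrable_on {0..1}"
      "(\<lambda>s. B1.mult (Hctrl Pg y1 V1) s \<bullet> fderiv2 c (v1 s) (h1 s) (h1 s)) integrable_on {0..1}"
  shows "Qtot P0 Pg p2 \<kappa> d\<xi> h1 h2 d1 d2 =
    (QO P0 p2 d\<xi> h1 h2 d1 d2
      + integral {0..1} (\<lambda>s. B1.mult (Hctrl P0 y1 V1) s \<bullet> fderiv2 c (v1 s) (h1 s) (h1 s))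
      + integral {0..1} (\<lambda>s. B2.mult (Hctrl p2 y2 V2) s \<bullet> fderiv2 c (v2 s) (h2 s) (h2 s)))
    + \<kappa> * (QG Pg d\<xi> h1 d1
      + integral {0..1} (\<lambda>s. B1.mult (Hctrl Pg y1 V1) s \<bullet> fderiv2 c (v1 s) (h1 s) (h1 s)))"
proof -
  have H: "Hctrl (\<lambda>s. P0 s + \<kappa> *\<^sub>R Pg s) y1 V1 = (\<lambda>s. Hctrl P0 y1 V1 s + \<kappa> *\<^sub>R Hctrl Pg y1 V1 s)"
    by (rule ext) (rule Hctrl_linear)
  have "integral {0..1} (\<lambda>s. B1.mult (Hctrl (\<lambda>s. P0 s + \<kappa> *\<^sub>R Pg s) y1 V1) s \<bullet> fderiv2 c (v1 s) (h1 s) (h1 s))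
    = integral {0..1} (\<lambda>s. B1.mult (Hctrl P0 y1 V1) s \<bullet> fderiv2 c (v1 s) (h1 s) (h1 s))
      + \<kappa> * integral {0..1} (\<lambda>s. B1.mult (Hctrl Pg y1 V1) s \<bullet> fderiv2 c (v1 s) (h1 s) (h1 s))"
    unfolding H B1.mult_linear inner_add_left inner_scaleR_left
    by (intro integral_unique has_integral_add has_integral_mult_right integrable_integral i)
  then show ?thesis unfolding Qtot_def by (simp add: algebra_simps)
qed

text \<open>Truncation violates the linearised endpoint constraint slightly, and
  \<open>correction_direction\<close> repairs this. The repaired directions satisfy both criticality
  equations, so \<open>bounded_direction\<close> applies to each. Measurability of the integrand is
  recorded because the one in \<open>Omega\<close> equals it only almost everywhere.\<close>

lemma square_integrable_direction:
  assumes co: "costates P0 Pg p2"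
    and h1: "h1 \<in> borel_measurable leb01" "integrable leb01 (\<lambda>s. (norm (h1 s))\<^sup>2)"
    and h2: "h2 \<in> borel_measurable leb01" "integrable leb01 (\<lambda>s. (norm (h2 s))\<^sup>2)"
    and d1: "abs_cont_on 0 1 d1" "d1 0 = 0"
      "AE s in leb01. (d1 has_vector_derivative fderiv F (y1 s, V1 s) (d1 s, d\<xi>, h1 s)) (at s within {0..1})"
    and d2: "abs_cont_on 0 1 d2" "d2 0 = d1 1"
      "AE s in leb01. (d2 has_vector_derivative fderiv F (y2 s, V2 s) (d2 s, - d\<xi>, h2 s)) (at s within {0..1})"
    and crit1: "AE s in leb01. \<forall>i. c (v1 s) $ i = 0 \<longrightarrow> fderiv c (v1 s) (h1 s) $ i = 0"
    and crit2: "AE s in leb01. \<forall>i. c (v2 s) $ i = 0 \<longrightarrow> fderiv c (v2 s) (h2 s) $ i = 0"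
    and critg: "fderiv g (y1 1) (d1 1) = 0"
  obtains \<kappa> where "0 \<le> \<kappa>" "\<kappa> \<le> k" "valid P0 Pg p2 \<kappa>"
    "0 \<le> fderiv2 \<phi> (y2 1) (d2 1) (d2 1) + \<kappa> * fderiv2 g (y1 1) (d1 1) (d1 1)
      + (LINT s|leb01.
          (P0 s + \<kappa> *\<^sub>R Pg s) \<bullet> fderiv2 F (y1 s, V1 s) (d1 s, d\<xi>, h1 s) (d1 s, d\<xi>, h1 s)
          + p2 s \<bullet> fderiv2 F (y2 s, V2 s) (d2 s, - d\<xi>, h2 s) (d2 s, - d\<xi>, h2 s)
          + B1.mult (Hctrl (\<lambda>s. P0 s + \<kappa> *\<^sub>R Pg s) y1 V1) s \<bullet> fderiv2 c (v1 s) (h1 s) (h1 s)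
          + B2.mult (Hctrl p2 y2 V2) s \<bullet> fderiv2 c (v2 s) (h2 s) (h2 s))"
    "(\<lambda>s. (P0 s + \<kappa> *\<^sub>R Pg s) \<bullet> fderiv2 F (y1 s, V1 s) (d1 s, d\<xi>, h1 s) (d1 s, d\<xi>, h1 s)
          + p2 s \<bullet> fderiv2 F (y2 s, V2 s) (d2 s, - d\<xi>, h2 s) (d2 s, - d\<xi>, h2 s)
          + B1.mult (Hctrl (\<lambda>s. P0 s + \<kappa> *\<^sub>R Pg s) y1 V1) s \<bullet> fderiv2 c (v1 s) (h1 s) (h1 s)
          + B2.mult (Hctrl p2 y2 V2) s \<bullet> fderiv2 c (v2 s) (h2 s) (h2 s)) \<in> borel_measurable leb01"
proof -
  have pm: "bmeas p2" "bmeas P0" "bmeas Pg" using co bmeas_lip_path by (auto simp: costates_def)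
  have Ym: "bmeas y1" "bmeas y2" by (rule bmeas_lip_path[OF Y1] bmeas_lip_path[OF Y2])+
  have dc: "continuous_on {0..1} d1" "continuous_on {0..1} d2" by (rule abs_cont_on_continuous[OF d1(1)] abs_cont_on_continuous[OF d2(1)])+
  obtain u1 where u1: "\<forall>n::nat. bmeas (u1 n) \<and> tangent v1 (u1 n) \<and> (\<forall>s. norm (u1 n s) \<le> norm (h1 s))"
    "AE s in leb01. (\<lambda>n. u1 n s) \<longlonglongrightarrow> h1 s"
    by (rule truncation[OF v1 feas1 h1(1) crit1])
  obtain u2 where u2: "\<forall>n::nat. bmeas (u2 n) \<and> tangent v2 (u2 n) \<and> (\<forall>s. norm (u2 n s) \<le> norm (h2 s))"
    "AE s in leb01. (\<lambda>n. u2 n s) \<longlonglongrightarrow> h2 s"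
    by (rule truncation[OF v2 feas2 h2(1) crit2])
  have u1': "bmeas (u1 n)" "tangent v1 (u1 n)" "norm (u1 n s) \<le> norm (h1 s)" for n s using u1(1) by blast+
  have u2': "bmeas (u2 n)" "tangent v2 (u2 n)" "norm (u2 n s) \<le> norm (h2 s)" for n s using u2(1) by blast+
  have "\<forall>n. \<exists>D. linearized d\<xi> (u1 n) (u2 n) (fst D) (snd D)"
  proof
    fix n
    obtain a b where "linearized d\<xi> (u1 n) (u2 n) a b" by (rule linearized_ex[OF u1'(1) u2'(1)])
    then show "\<exists>D. linearized d\<xi> (u1 n) (u2 n) (fst D) (snd D)" by (intro exI[of _ "(a, b)"]) simp
  qed
  from choice[OF this] obtain D where D: "\<forall>n. linearized d\<xi> (u1 n) (u2 n) (fst (D n)) (snd (D n))" by (elim exE) (rule that)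
  define D1 where "D1 n = fst (D n)" for n
  define D2 where "D2 n = snd (D n)" for n
  have lin: "linearized d\<xi> (u1 n) (u2 n) (D1 n) (D2 n)" for n using D by (simp add: D1_def D2_def)
  have l: "D1 n 0 = 0" "D2 n 0 = D1 n 1"
    "lip_path (D1 n) (\<lambda>s. fderiv F (y1 s, V1 s) (D1 n s, d\<xi>, u1 n s))"
    "lip_path (D2 n) (\<lambda>s. fderiv F (y2 s, V2 s) (D2 n s, - d\<xi>, u2 n s))" for n
    using lin[of n] by (simp_all add: linearized_def)
  have Dm: "bmeas (D1 n)" "bmeas (D2 n)" for n by (rule bmeas_lip_path[OF l(3)] bmeas_lip_path[OF l(4)])+
  define I1 where "I1 n = integral {0..1} (\<lambda>s. norm (u1 n s - h1 s))" for n
  define I2 where "I2 n = integral {0..1} (\<lambda>s. norm (u2 n s - h2 s))" for n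
  have I1: "I1 \<longlonglongrightarrow> 0" unfolding I1_def by (rule L1_limit_of_dominated(1)[OF u1'(1,3) u1(2) h1])
  have I2: "I2 \<longlonglongrightarrow> 0" unfolding I2_def by (rule L1_limit_of_dominated(1)[OF u2'(1,3) u2(2) h2])
  obtain C1 where C1: "0 < C1"
    "\<forall>dx dv. abs_cont_on 0 1 dx \<longrightarrow> continuous_on {0..1} dx \<longrightarrow>
      (AE s in leb01. (dx has_vector_derivative fderiv F (y1 s, V1 s) (dx s, dv s)) (at s within {0..1})) \<longrightarrow>
      (\<lambda>s. norm (dv s)) integrable_on {0..1} \<longrightarrow>
      (\<forall>t\<in>{0..1}. norm (dx t) \<le> C1 * (norm (dx 0) + integral {0..1} (\<lambda>s. norm (dv s))))"
    by (rule linear_bound[OF F V1 Ym(1)])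
  obtain C2 where C2: "0 < C2"
    "\<forall>dx dv. abs_cont_on 0 1 dx \<longrightarrow> continuous_on {0..1} dx \<longrightarrow>
      (AE s in leb01. (dx has_vector_derivative fderiv F (y2 s, V2 s) (dx s, dv s)) (at s within {0..1})) \<longrightarrow>
      (\<lambda>s. norm (dv s)) integrable_on {0..1} \<longrightarrow>
      (\<forall>t\<in>{0..1}. norm (dx t) \<le> C2 * (norm (dx 0) + integral {0..1} (\<lambda>s. norm (dv s))))"
    by (rule linear_bound[OF F V2 Ym(2)])
  define E1 where "E1 n = C1 * I1 n" for n
  \<comment> \<open>The second arc starts with the error that the first one has at its end.\<close>
  define E2 where "E2 n = C2 * (E1 n + I2 n)" for n
  have nz: "norm (0 :: real, x :: 'v) = norm x" for x by (simp add: norm_Pair)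
  have cl1: "norm (D1 n t - d1 t) \<le> E1 n" if t: "t \<in> {0..1}" for n t
  proof -
    have "AE s in leb01. ((\<lambda>s. D1 n s - d1 s) has_vector_derivative
        fderiv F (y1 s, V1 s) (D1 n s - d1 s, 0, u1 n s - h1 s)) (at s within {0..1})"
      using lip_path_deriv[OF l(3)[of n]] d1(3)
    proof eventually_elim
      case (elim s)
      have "fderiv F (y1 s, V1 s) (D1 n s - d1 s, 0, u1 n s - h1 s)
        = fderiv F (y1 s, V1 s) (D1 n s, d\<xi>, u1 n s) - fderiv F (y1 s, V1 s) (d1 s, d\<xi>, h1 s)"
        using blinfun.diff_right[of "fderiv F (y1 s, V1 s)" "(D1 n s, d\<xi>, u1 n s)" "(d1 s, d\<xi>, h1 s)"] by simp
      then show ?case using has_vector_derivative_diff[OF elim] by simp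
    qed
    from C1(2)[rule_format, OF abs_cont_on_diff[OF lip_path_abs_cont[OF l(3)] d1(1)]
        continuous_on_diff[OF lip_path_continuous[OF l(3)] dc(1)] this _ t]
    show ?thesis using L1_limit_of_dominated(2)[OF u1'(1,3) u1(2) h1, of n] l(1)[of n] d1(2)
      by (simp add: nz E1_def I1_def)
  qed
  have cl2: "norm (D2 n t - d2 t) \<le> E2 n" if t: "t \<in> {0..1}" for n t
  proof -
    have "AE s in leb01. ((\<lambda>s. D2 n s - d2 s) has_vector_derivative
        fderiv F (y2 s, V2 s) (D2 n s - d2 s, 0, u2 n s - h2 s)) (at s within {0..1})"
      using lip_path_deriv[OF l(4)[of n]] d2(3)
    proof eventually_elim
      case (elim s)
      have "fderiv F (y2 s, V2 s) (D2 n s - d2 s, 0, u2 n s - h2 s)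
        = fderiv F (y2 s, V2 s) (D2 n s, - d\<xi>, u2 n s) - fderiv F (y2 s, V2 s) (d2 s, - d\<xi>, h2 s)"
        using blinfun.diff_right[of "fderiv F (y2 s, V2 s)" "(D2 n s, - d\<xi>, u2 n s)" "(d2 s, - d\<xi>, h2 s)"] by simp
      then show ?case using has_vector_derivative_diff[OF elim] by simp
    qed
    from C2(2)[rule_format, OF abs_cont_on_diff[OF lip_path_abs_cont[OF l(4)] d2(1)]
        continuous_on_diff[OF lip_path_continuous[OF l(4)] dc(2)] this _ t]
    have "norm (D2 n t - d2 t) \<le> C2 * (norm (D2 n 0 - d2 0) + I2 n)"
      using L1_limit_of_dominated(2)[OF u2'(1,3) u2(2) h2, of n] by (simp add: nz I2_def)
    also have "\<dots> \<le> C2 * (E1 n + I2 n)"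
      using cl1[of 1 n] C2(1) l(2)[of n] d2(2) by (intro mult_left_mono add_right_mono) auto
    finally show ?thesis by (simp add: E2_def)
  qed
  have E1: "E1 \<longlonglongrightarrow> 0" unfolding E1_def using tendsto_mult_left[OF I1, of C1] by simp
  have E2: "E2 \<longlonglongrightarrow> 0" unfolding E2_def using tendsto_mult_left[OF tendsto_add[OF E1 I2], of C2] by simp
  have D1l: "(\<lambda>n. D1 n 1) \<longlonglongrightarrow> d1 1" by (rule tendsto_of_norm_bound[OF cl1 E1]) simp
  have D2l: "(\<lambda>n. D2 n 1) \<longlonglongrightarrow> d2 1" by (rule tendsto_of_norm_bound[OF cl2 E2]) simp
  \<comment> \<open>Defect of the endpoint constraint caused by truncation; subtracting
    \<open>a n\<close> times the correction direction removes it together with the defect in the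
    cost.\<close>
  define a where "a n = fderiv g (y1 1) (D1 n 1)" for n
  have a0: "a \<longlonglongrightarrow> 0"
    unfolding a_def using bounded_linear.tendsto[OF blinfun.bounded_linear_right D1l, of "fderiv g (y1 1)"] critg by simp
  have ma: "(\<lambda>n. - a n) \<longlonglongrightarrow> 0" using tendsto_minus[OF a0] by simp
  obtain e\<xi> e1 e2 f1 f2 where e: "linearized e\<xi> e1 e2 f1 f2" "tangent v1 e1" "tangent v2 e2"
    "\<forall>d\<xi> h1 h2 d1 d2. linearized d\<xi> h1 h2 d1 d2 \<longrightarrow> tangent v1 h1 \<longrightarrow> tangent v2 h2 \<longrightarrow>
       fderiv g (y1 1) (d1 1) - fderiv g (y1 1) (d1 1) * fderiv g (y1 1) (f1 1) = 0 \<and>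
       (fderiv \<phi> (y2 1) (d2 1) - d\<xi>) - fderiv g (y1 1) (d1 1) * (fderiv \<phi> (y2 1) (f2 1) - e\<xi>) = 0"
    by (rule correction_direction)
  have em: "bmeas e1" "bmeas e2" "bmeas f1" "bmeas f2"
    using e(1) bmeas_lip_path by (auto simp: linearized_def)
  define x\<xi> where "x\<xi> n = d\<xi> + (- a n) * e\<xi>" for n
  define x1 where "x1 n = (\<lambda>s. u1 n s + (- a n) *\<^sub>R e1 s)" for n
  define x2 where "x2 n = (\<lambda>s. u2 n s + (- a n) *\<^sub>R e2 s)" for n
  define w1 where "w1 n = (\<lambda>s. D1 n s + (- a n) *\<^sub>R f1 s)" for n
  define w2 where "w2 n = (\<lambda>s. D2 n s + (- a n) *\<^sub>R f2 s)" for n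
  have X: "linearized (x\<xi> n) (x1 n) (x2 n) (w1 n) (w2 n)" for n
    unfolding x\<xi>_def x1_def x2_def w1_def w2_def by (rule linearized_combine[OF lin e(1)])
  have T: "tangent v1 (x1 n)" "tangent v2 (x2 n)" for n
    unfolding x1_def x2_def by (rule tangent_combine[OF u1'(2) e(2)] tangent_combine[OF u2'(2) e(3)])+
  have cr: "fderiv \<phi> (y2 1) (w2 n 1) = x\<xi> n" "fderiv g (y1 1) (w1 n 1) = 0" for n
  proof -
    have "a n - a n * fderiv g (y1 1) (f1 1) = 0"
      "(fderiv \<phi> (y2 1) (D2 n 1) - d\<xi>) - a n * (fderiv \<phi> (y2 1) (f2 1) - e\<xi>) = 0"
      unfolding a_def using e(4)[rule_format, OF lin u1'(2) u2'(2), of n] by blast+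
    then show "fderiv \<phi> (y2 1) (w2 n 1) = x\<xi> n" "fderiv g (y1 1) (w1 n 1) = 0"
      unfolding w1_def w2_def x\<xi>_def blinfun.add_right blinfun.scaleR_right a_def[symmetric] by (simp_all add: algebra_simps)
  qed
  have "\<forall>n. \<exists>\<kappa>. 0 \<le> \<kappa> \<and> \<kappa> \<le> k \<and> valid P0 Pg p2 \<kappa> \<and> 0 \<le> Qtot P0 Pg p2 \<kappa> (x\<xi> n) (x1 n) (x2 n) (w1 n) (w2 n)"
  proof
    fix n
    obtain \<kappa> where "0 \<le> \<kappa>" "\<kappa> \<le> k" "valid P0 Pg p2 \<kappa>" "0 \<le> Qtot P0 Pg p2 \<kappa> (x\<xi> n) (x1 n) (x2 n) (w1 n) (w2 n)"
      by (rule bounded_direction[OF X T cr co])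
    then show "\<exists>\<kappa>. 0 \<le> \<kappa> \<and> \<kappa> \<le> k \<and> valid P0 Pg p2 \<kappa> \<and> 0 \<le> Qtot P0 Pg p2 \<kappa> (x\<xi> n) (x1 n) (x2 n) (w1 n) (w2 n)" by blast
  qed
  from choice[OF this] obtain \<kappa> where \<kappa>: "\<forall>n. 0 \<le> \<kappa> n \<and> \<kappa> n \<le> k \<and> valid P0 Pg p2 (\<kappa> n) \<and>
      0 \<le> Qtot P0 Pg p2 (\<kappa> n) (x\<xi> n) (x1 n) (x2 n) (w1 n) (w2 n)" by (elim exE) (rule that)
  \<comment> \<open>The bound \<open>k\<close> does not depend on the direction, which is what
    yields a convergent subsequence.\<close>
  have "\<forall>n. \<kappa> n \<in> {0..k}" using \<kappa> by simp
  then obtain \<kappa>' r where r: "\<kappa>' \<in> {0..k}" "strict_mono r" "(\<kappa> \<circ> r) \<longlonglongrightarrow> \<kappa>'"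
    using compact_Icc[of 0 k, unfolded compact_eq_seq_compact_metric seq_compact_def, rule_format, of \<kappa>] by auto
  have val: "valid P0 Pg p2 \<kappa>'"
    by (rule valid_limit[OF _ r(3) co]) (use \<kappa> in simp)
  let ?M0 = "B1.mult (Hctrl P0 y1 V1)" and ?Mg = "B1.mult (Hctrl Pg y1 V1)" and ?M2 = "B2.mult (Hctrl p2 y2 V2)"
  have Mm: "bmeas ?M0" "bmeas ?Mg" "bmeas ?M2"
    by (intro B1.bmeas_mult_ctrl B2.bmeas_mult_ctrl bmeas_Hctrl pm V1 V2 Ym)+
  have zm: "bmeas (\<lambda>s. (y1 s, V1 s))" "bmeas (\<lambda>s. (y2 s, V2 s))" by (intro bmeas_Pair Ym V1 V2)+
  have dm: "bmeas d1" "bmeas d2" by (rule bmeas_continuous[OF dc(1)] bmeas_continuous[OF dc(2)])+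
  note L1a = corrected_quadratic_limit(1)[OF F _ zm(1) Dm(1) u1'(1) em(3) em(1) dm(1) a0 E1 cl1 u1(2) u1'(3) h1, where x=d\<xi> and y=e\<xi>]
  note L1b = corrected_quadratic_limit(2)[OF F _ zm(1) Dm(1) u1'(1) em(3) em(1) dm(1) a0 E1 cl1 u1(2) u1'(3) h1, where x=d\<xi>]
  have m\<xi>: "- d\<xi> + (- a n) * (- e\<xi>) = - x\<xi> n" for n by (simp add: x\<xi>_def)
  note L2a = corrected_quadratic_limit(1)[OF F pm(1) zm(2) Dm(2) u2'(1) em(4) em(2) dm(2) a0 E2 cl2 u2(2) u2'(3) h2, where x="- d\<xi>" and y="- e\<xi>",
      unfolded m\<xi>]
  note L2b = corrected_quadratic_limit(2)[OF F pm(1) zm(2) Dm(2) u2'(1) em(4) em(2) dm(2) a0 E2 cl2 u2(2) u2'(3) h2, where x="- d\<xi>"]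
  note L3 = control_quadratic_limit[OF c _ v1 u1'(1) em(1) a0 u1(2) u1'(3) h1]
  note L4 = control_quadratic_limit[OF c Mm(3) v2 u2'(1) em(2) a0 u2(2) u2'(3) h2]
  have w1l: "(\<lambda>n. w1 n 1) \<longlonglongrightarrow> d1 1"
    unfolding w1_def using tendsto_add[OF D1l tendsto_scaleR[OF ma tendsto_const[of "f1 1"]]] by simp
  have w2l: "(\<lambda>n. w2 n 1) \<longlonglongrightarrow> d2 1"
    unfolding w2_def using tendsto_add[OF D2l tendsto_scaleR[OF ma tendsto_const[of "f2 1"]]] by simp
  define q0 where "q0 = (\<lambda>d\<xi> h1 h2 d1 d2. QO P0 p2 d\<xi> h1 h2 d1 d2
      + integral {0..1} (\<lambda>s. ?M0 s \<bullet> fderiv2 c (v1 s) (h1 s) (h1 s))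
      + integral {0..1} (\<lambda>s. ?M2 s \<bullet> fderiv2 c (v2 s) (h2 s) (h2 s)))"
  define q1 where "q1 = (\<lambda>d\<xi> h1 d1. QG Pg d\<xi> h1 d1
      + integral {0..1} (\<lambda>s. ?Mg s \<bullet> fderiv2 c (v1 s) (h1 s) (h1 s)))"
  have A1: "(\<lambda>n. integral {0..1} (\<lambda>s. p s \<bullet> fderiv2 F (y1 s, V1 s) (w1 n s, x\<xi> n, x1 n s) (w1 n s, x\<xi> n, x1 n s)))
      \<longlonglongrightarrow> integral {0..1} (\<lambda>s. p s \<bullet> fderiv2 F (y1 s, V1 s) (d1 s, d\<xi>, h1 s) (d1 s, d\<xi>, h1 s))" if "bmeas p" for p
    unfolding w1_def x\<xi>_def x1_def by (rule L1a[OF that])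
  have A2: "(\<lambda>n. integral {0..1} (\<lambda>s. p2 s \<bullet> fderiv2 F (y2 s, V2 s) (w2 n s, - x\<xi> n, x2 n s) (w2 n s, - x\<xi> n, x2 n s)))
      \<longlonglongrightarrow> integral {0..1} (\<lambda>s. p2 s \<bullet> fderiv2 F (y2 s, V2 s) (d2 s, - d\<xi>, h2 s) (d2 s, - d\<xi>, h2 s))"
    unfolding w2_def x2_def by (rule L2a)
  have A3: "(\<lambda>n. integral {0..1} (\<lambda>s. p s \<bullet> fderiv2 c (v1 s) (x1 n s) (x1 n s)))
      \<longlonglongrightarrow> integral {0..1} (\<lambda>s. p s \<bullet> fderiv2 c (v1 s) (h1 s) (h1 s))" if "bmeas p" for p
    unfolding x1_def by (rule L3(1)[OF that])
  have A4: "(\<lambda>n. integral {0..1} (\<lambda>s. ?M2 s \<bullet> fderiv2 c (v2 s) (x2 n s) (x2 n s)))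
      \<longlonglongrightarrow> integral {0..1} (\<lambda>s. ?M2 s \<bullet> fderiv2 c (v2 s) (h2 s) (h2 s))"
    unfolding x2_def by (rule L4(1))
  have Aphi: "(\<lambda>n. fderiv2 \<phi> (y2 1) (w2 n 1) (w2 n 1)) \<longlonglongrightarrow> fderiv2 \<phi> (y2 1) (d2 1) (d2 1)"
    by (intro bounded_bilinear.tendsto[OF bounded_bilinear_blinfun_apply] tendsto_const w2l)
  have Ag: "(\<lambda>n. fderiv2 g (y1 1) (w1 n 1) (w1 n 1)) \<longlonglongrightarrow> fderiv2 g (y1 1) (d1 1) (d1 1)"
    by (intro bounded_bilinear.tendsto[OF bounded_bilinear_blinfun_apply] tendsto_const w1l)
  have ql0: "(\<lambda>n. q0 (x\<xi> n) (x1 n) (x2 n) (w1 n) (w2 n)) \<longlonglongrightarrow> q0 d\<xi> h1 h2 d1 d2"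
    unfolding q0_def QO_def by (intro tendsto_add A1 A2 A3 A4 Aphi pm Mm)
  have ql1: "(\<lambda>n. q1 (x\<xi> n) (x1 n) (w1 n)) \<longlonglongrightarrow> q1 d\<xi> h1 d1"
    unfolding q1_def QG_def by (intro tendsto_add A1 A3 Ag pm Mm)
  have xm: "bmeas (x1 n)" for n unfolding x1_def by (intro bmeas_add bmeas_scaleR bmeas_const u1' em)
  have split_n: "Qtot P0 Pg p2 \<kappa>'' (x\<xi> n) (x1 n) (x2 n) (w1 n) (w2 n)
      = q0 (x\<xi> n) (x1 n) (x2 n) (w1 n) (w2 n) + \<kappa>'' * q1 (x\<xi> n) (x1 n) (w1 n)" for \<kappa>'' n
    unfolding q0_def q1_def
    by (rule Qtot_split) (intro bmeas_integrable(1) bmeas_inner Mm bmeas_fderiv2 c v1 xm)+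
  have i3: "(\<lambda>s. ?M0 s \<bullet> fderiv2 c (v1 s) (h1 s) (h1 s)) integrable_on {0..1}"
    "(\<lambda>s. ?Mg s \<bullet> fderiv2 c (v1 s) (h1 s) (h1 s)) integrable_on {0..1}"
    by (rule integrable_on_lebesgue_on[OF L3(2)[OF Mm(1)]], simp) (rule integrable_on_lebesgue_on[OF L3(2)[OF Mm(2)]], simp)
  have split: "Qtot P0 Pg p2 \<kappa>' d\<xi> h1 h2 d1 d2 = q0 d\<xi> h1 h2 d1 d2 + \<kappa>' * q1 d\<xi> h1 d1"
    unfolding q0_def q1_def by (rule Qtot_split[OF i3])
  have "(\<lambda>n. q0 (x\<xi> (r n)) (x1 (r n)) (x2 (r n)) (w1 (r n)) (w2 (r n)) + (\<kappa> \<circ> r) n * q1 (x\<xi> (r n)) (x1 (r n)) (w1 (r n)))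
     \<longlonglongrightarrow> q0 d\<xi> h1 h2 d1 d2 + \<kappa>' * q1 d\<xi> h1 d1"
    using LIMSEQ_subseq_LIMSEQ[OF ql0 r(2)] LIMSEQ_subseq_LIMSEQ[OF ql1 r(2)]
    by (intro tendsto_add tendsto_mult r(3)) (simp_all add: comp_def)
  then have "0 \<le> q0 d\<xi> h1 h2 d1 d2 + \<kappa>' * q1 d\<xi> h1 d1"
  proof (rule LIMSEQ_le_const, intro exI allI impI)
    fix n
    have "0 \<le> Qtot P0 Pg p2 (\<kappa> (r n)) (x\<xi> (r n)) (x1 (r n)) (x2 (r n)) (w1 (r n)) (w2 (r n))" using \<kappa> by blast
    then show "0 \<le> q0 (x\<xi> (r n)) (x1 (r n)) (x2 (r n)) (w1 (r n)) (w2 (r n)) + (\<kappa> \<circ> r) n * q1 (x\<xi> (r n)) (x1 (r n)) (w1 (r n))"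
      unfolding split_n by simp
  qed
  then have Q: "0 \<le> Qtot P0 Pg p2 \<kappa>' d\<xi> h1 h2 d1 d2" unfolding split .
  have P1m: "bmeas (\<lambda>s. P0 s + \<kappa>' *\<^sub>R Pg s)" by (intro bmeas_add bmeas_scaleR bmeas_const pm)
  have M1m: "bmeas (B1.mult (Hctrl (\<lambda>s. P0 s + \<kappa>' *\<^sub>R Pg s) y1 V1))"
    by (intro B1.bmeas_mult_ctrl bmeas_Hctrl P1m V1 Ym)
  let ?k1 = "\<lambda>p s. p s \<bullet> fderiv2 F (y1 s, V1 s) (d1 s, d\<xi>, h1 s) (d1 s, d\<xi>, h1 s)"
  let ?k2 = "\<lambda>s. p2 s \<bullet> fderiv2 F (y2 s, V2 s) (d2 s, - d\<xi>, h2 s) (d2 s, - d\<xi>, h2 s)"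
  let ?k3 = "\<lambda>s. B1.mult (Hctrl (\<lambda>s. P0 s + \<kappa>' *\<^sub>R Pg s) y1 V1) s \<bullet> fderiv2 c (v1 s) (h1 s) (h1 s)"
  let ?k4 = "\<lambda>s. ?M2 s \<bullet> fderiv2 c (v2 s) (h2 s) (h2 s)"
  have HL: "integral\<^sup>L leb01 q = integral {0..1} q" if "integrable leb01 q" for q :: "real \<Rightarrow> real"
    by (rule lebesgue_integral_eq_integral[OF that]) simp
  have k1: "integral\<^sup>L leb01 (?k1 (\<lambda>s. P0 s + \<kappa>' *\<^sub>R Pg s)) = integral {0..1} (?k1 P0) + \<kappa>' * integral {0..1} (?k1 Pg)"
    using L1b[OF pm(2)] L1b[OF pm(3)] by (simp add: inner_add_left HL)
  have k2: "integral\<^sup>L leb01 ?k2 = integral {0..1} ?k2" by (rule HL, rule L2b)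
  have k3: "integral\<^sup>L leb01 ?k3 = integral {0..1} ?k3" by (rule HL, rule L3(2)[OF M1m])
  have k4: "integral\<^sup>L leb01 ?k4 = integral {0..1} ?k4" by (rule HL, rule L4(2))
  have "(LINT s|leb01. ?k1 (\<lambda>s. P0 s + \<kappa>' *\<^sub>R Pg s) s + ?k2 s + ?k3 s + ?k4 s)
      = (integral {0..1} (?k1 P0) + \<kappa>' * integral {0..1} (?k1 Pg)) + integral {0..1} ?k2 + integral {0..1} ?k3 + integral {0..1} ?k4"
  proof -
    let ?p1 = "?k1 (\<lambda>s. P0 s + \<kappa>' *\<^sub>R Pg s)"
    have i1: "integrable leb01 ?p1" by (rule L1b[OF P1m])
    have i2: "integrable leb01 ?k2" by (rule L2b)
    have i3: "integrable leb01 ?k3" by (rule L3(2)[OF M1m])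
    have i4: "integrable leb01 ?k4" by (rule L4(2))
    have i12: "integrable leb01 (\<lambda>s. ?p1 s + ?k2 s)" by (rule Bochner_Integration.integrable_add[OF i1 i2])
    have i123: "integrable leb01 (\<lambda>s. ?p1 s + ?k2 s + ?k3 s)" by (rule Bochner_Integration.integrable_add[OF i12 i3])
    from Bochner_Integration.integral_add[OF i1 i2] Bochner_Integration.integral_add[OF i12 i3] Bochner_Integration.integral_add[OF i123 i4]
    show ?thesis using k1 k2 k3 k4 by linarith
  qed
  then have Q': "0 \<le> fderiv2 \<phi> (y2 1) (d2 1) (d2 1) + \<kappa>' * fderiv2 g (y1 1) (d1 1) (d1 1)
      + (LINT s|leb01. ?k1 (\<lambda>s. P0 s + \<kappa>' *\<^sub>R Pg s) s + ?k2 s + ?k3 s + ?k4 s)"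
    using Q unfolding Qtot_def QO_def QG_def by (simp add: algebra_simps)
  have m: "(\<lambda>s. ?k1 (\<lambda>s. P0 s + \<kappa>' *\<^sub>R Pg s) s + ?k2 s + ?k3 s + ?k4 s) \<in> borel_measurable leb01"
    by (rule borel_measurable_integrable)
       (intro Bochner_Integration.integrable_add L1b[OF P1m] L2b L3(2)[OF M1m] L4(2))
  show ?thesis
    by (rule that[OF _ _ val Q' m]) (use r(1) in auto)
qed

end

section \<open>Exact penalisation of the crossing\<close>

lemma lip_path_affine:
  fixes x :: "real \<Rightarrow> 'a::euclidean_space"
  assumes L: "L-lipschitz_on {a..b} x"
    and der: "AE t in lebesgue_on {a..b}. (x has_vector_derivative d t) (at t within {a..b})"
    and m: "0 < m" and ab: "a \<le> k" "m + k \<le> b"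
  shows "lip_path (\<lambda>s. x (m * s + k)) (\<lambda>s. m *\<^sub>R d (m * s + k))"
proof -
  have sub: "m * s + k \<in> {a..b}" if "s \<in> {0..1}" for s
  proof -
    have "0 \<le> m * s" "m * s \<le> m" using that m by (auto simp: mult_left_le)
    then show ?thesis using ab by simp
  qed
  have L0: "0 \<le> L" by (rule lipschitz_on_nonneg[OF L])
  have "(L * m)-lipschitz_on {0..1} (\<lambda>s. x (m * s + k))"
  proof (rule lipschitz_onI)
    fix s t :: real assume st: "s \<in> {0..1}" "t \<in> {0..1}"
    have "dist (x (m * s + k)) (x (m * t + k)) \<le> L * dist (m * s + k) (m * t + k)"
      by (rule lipschitz_onD[OF L sub[OF st(1)] sub[OF st(2)]])
    also have "dist (m * s + k) (m * t + k) = m * dist s t"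
      using m by (simp add: dist_real_def abs_mult flip: right_diff_distrib)
    finally show "dist (x (m * s + k)) (x (m * t + k)) \<le> L * m * dist s t" by (simp only: mult.assoc)
  qed (use L0 m in simp)
  moreover have "AE s in leb01. ((\<lambda>s. x (m * s + k)) has_vector_derivative m *\<^sub>R d (m * s + k)) (at s within {0..1})"
  proof -
    have "AE s in leb01. (x has_vector_derivative d (m * s + k)) (at (m * s + k) within {a..b})"
      by (rule AE_affine[OF der _ sub]) (use m in auto)
    then show ?thesis
    proof eventually_elim
      case (elim s)
      have "((\<lambda>s. m * s + k) has_vector_derivative m) (at s within {0..1})"
        by (auto intro!: derivative_eq_intros simp flip: has_real_derivative_iff_has_vector_derivative)
      moreover have "(x has_vector_derivative d (m * s + k)) (at (m * s + k) within (\<lambda>s. m * s + k) ` {0..1})"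
        by (rule has_vector_derivative_within_subset[OF elim]) (use sub in blast)
      ultimately show ?case using vector_diff_chain_within by (fastforce simp: comp_def)
    qed
  qed
  ultimately show ?thesis unfolding lip_path_def by blast
qed

lemma lip_path_C2:
  fixes h :: "'a::euclidean_space \<Rightarrow> 'b::euclidean_space"
  assumes h: "C2 h" and z: "lip_path z d"
  shows "lip_path (\<lambda>s. h (z s)) (\<lambda>s. fderiv h (z s) (d s))"
proof -
  obtain B where B: "0 < B" "\<forall>s\<in>{0..1}. norm (z s) \<le> B" by (rule lip_path_bounded[OF z])
  obtain C where C: "0 < C"
    "\<forall>x y. norm x \<le> B \<longrightarrow> norm y \<le> B \<longrightarrow> norm (h y - h x) \<le> C * norm (y - x) \<and>
      norm (fderiv h y - fderiv h x) \<le> C * norm (y - x) \<and>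
      norm (h y - h x - fderiv h x (y - x)) \<le> C * (norm (y - x))\<^sup>2"
    by (rule C2_taylor1[OF h])
  obtain L where L: "L-lipschitz_on {0..1} z" using z by (auto simp: lip_path_def)
  have "(C * L)-lipschitz_on {0..1} (\<lambda>s. h (z s))"
  proof (rule lipschitz_onI)
    fix s t :: real assume st: "s \<in> {0..1}" "t \<in> {0..1}"
    have "norm (h (z s) - h (z t)) \<le> C * norm (z s - z t)" using C(2) B(2) st by blast
    also have "\<dots> \<le> C * (L * dist s t)"
      using lipschitz_onD[OF L st] C(1) by (intro mult_left_mono) (auto simp: dist_norm)
    finally show "dist (h (z s)) (h (z t)) \<le> C * L * dist s t" by (simp add: dist_norm mult.assoc)
  qed (use C lipschitz_on_nonneg[OF L] in simp)
  moreover have "AE s in leb01. ((\<lambda>s. h (z s)) has_vector_derivative fderiv h (z s) (d s)) (at s within {0..1})"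
    using lip_path_deriv[OF z]
  proof eventually_elim
    case (elim s)
    from vector_derivative_diff_chain_within[OF elim has_derivative_at_withinI[OF C2_has_derivative[OF h]]]
    show ?case by (simp add: comp_def)
  qed
  ultimately show ?thesis unfolding lip_path_def by blast
qed

lemma lip_path_increment_ge:
  fixes z :: "real \<Rightarrow> real"
  assumes z: "lip_path z d" and a: "0 \<le> a" "a \<le> 1" and ge: "AE s in lebesgue_on {a..1}. m \<le> d s"
  shows "m * (1 - a) \<le> z 1 - z a"
proof -
  obtain N where N: "negligible N" "\<forall>s\<in>{a..1} - N. m \<le> d s" by (rule AE_lebesgue_onE[OF ge])
  have "(d has_integral (z 1 - z a)) {a..1}" by (rule lip_path_has_integral[OF z]) (use a in auto)
  then have 1: "((\<lambda>s. if s \<in> N then m else d s) has_integral (z 1 - z a)) {a..1}"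
    by (rule has_integral_spike[OF N(1), rotated]) simp
  have 2: "((\<lambda>s. m) has_integral (m * (1 - a))) {a..1}"
    using has_integral_const_real[of m a 1] a by (simp add: mult.commute)
  show ?thesis by (rule has_integral_le[OF 2 1]) (use N(2) in auto)
qed

text \<open>Inverse of the time change with crossing time \<open>\<xi>\<close>: two arcs on
  \<open>{0..1}\<close> become one function on \<open>{0..T}\<close>.\<close>

definition splice :: "real \<Rightarrow> real \<Rightarrow> (real \<Rightarrow> 'a) \<Rightarrow> (real \<Rightarrow> 'a) \<Rightarrow> real \<Rightarrow> 'a"
  where "splice T \<xi> w1 w2 t = (if t \<le> \<xi> then w1 (t / \<xi>) else w2 ((t - \<xi>) / (T - \<xi>)))"

lemma splice_in:
  assumes "0 < \<xi>" "\<xi> < T" "t \<in> {0..T}" "\<And>s. s \<in> {0..1} \<Longrightarrow> w1 s \<in> U \<and> w2 s \<in> U"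
  shows "splice T \<xi> w1 w2 t \<in> U"
proof (cases "t \<le> \<xi>")
  case True
  then have "t / \<xi> \<in> {0..1}" using assms by simp
  then show ?thesis using assms(4) True by (simp add: splice_def)
next
  case False
  then have "(t - \<xi>) / (T - \<xi>) \<in> {0..1}" using assms by simp
  then show ?thesis using assms(4) False by (simp add: splice_def)
qed

lemma splice_measurable:
  fixes w1 w2 :: "real \<Rightarrow> 'a::euclidean_space"
  assumes w: "w1 \<in> borel_measurable leb01" "w2 \<in> borel_measurable leb01"
    and \<xi>: "0 < \<xi>" "\<xi> < T"
  shows "splice T \<xi> w1 w2 \<in> borel_measurable (lebesgue_on {0..T})"
proof -
  let ?W1 = "\<lambda>t. if (1 / \<xi>) * t + 0 \<in> {0..1} then w1 ((1 / \<xi>) * t + 0) else 0"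
  let ?W2 = "\<lambda>t. if (1 / (T - \<xi>)) * t + (- \<xi> / (T - \<xi>)) \<in> {0..1} then w2 ((1 / (T - \<xi>)) * t + (- \<xi> / (T - \<xi>))) else 0"
  have W: "?W1 \<in> borel_measurable lebesgue" "?W2 \<in> borel_measurable lebesgue"
    by (rule borel_measurable_affine_extension[OF w(1)], use \<xi> in simp)
       (rule borel_measurable_affine_extension[OF w(2)], use \<xi> in simp)
  have "(\<lambda>t. if t \<le> \<xi> then ?W1 t else ?W2 t) \<in> borel_measurable lebesgue"
  proof (rule measurable_If[OF W])
    have "{t \<in> space lebesgue. t \<le> \<xi>} = {..\<xi>}" by auto
    then show "{t \<in> space lebesgue. t \<le> \<xi>} \<in> sets lebesgue" by simp
  qed
  then have "(\<lambda>t. if t \<le> \<xi> then ?W1 t else ?W2 t) \<in> borel_measurable (lebesgue_on {0..T})"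
    by (rule measurable_restrict_space1)
  then show ?thesis
  proof (rule measurable_cong[THEN iffD1, rotated])
    fix t assume "t \<in> space (lebesgue_on {0..T})"
    then have t: "0 \<le> t" "t \<le> T" by auto
    have e: "(1 / (T - \<xi>)) * t + (- \<xi> / (T - \<xi>)) = (t - \<xi>) / (T - \<xi>)" by (simp add: diff_divide_distrib)
    show "(if t \<le> \<xi> then ?W1 t else ?W2 t) = splice T \<xi> w1 w2 t"
      unfolding e splice_def using t \<xi> by auto
  qed
qed

text \<open>The factors \<open>1 / \<xi>\<close> and \<open>1 / (T - \<xi>)\<close> from rescaling
  time cancel those in \<open>scaled\<close>, so a spliced pair of arcs solves the original
  equation. The matching condition \<open>z2 0 = z1 1\<close> makes it Lipschitz across the
  junction.\<close>

lemma splice_lipschitz_derivative: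
  fixes z1 z2 :: "real \<Rightarrow> 'a::euclidean_space"
  assumes z: "lip_path z1 e1" "lip_path z2 e2" "z2 0 = z1 1" and \<xi>: "0 < \<xi>" "\<xi> < T"
  shows "\<exists>L. L-lipschitz_on {0..T} (splice T \<xi> z1 z2)" (is ?A)
    and "AE t in lebesgue_on {0..T}. (splice T \<xi> z1 z2 has_vector_derivative
      splice T \<xi> (\<lambda>s. (1 / \<xi>) *\<^sub>R e1 s) (\<lambda>s. (1 / (T - \<xi>)) *\<^sub>R e2 s) t) (at t within {0..T})" (is ?B)
proof -
  obtain L1 where L1: "L1-lipschitz_on {0..1} z1" using z(1) by (auto simp: lip_path_def)
  obtain L2 where L2: "L2-lipschitz_on {0..1} z2" using z(2) by (auto simp: lip_path_def)
  have m: "0 < 1 / \<xi>" "0 < 1 / (T - \<xi>)" using \<xi> by simp_all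
  have "(L1 * (1 / \<xi>))-lipschitz_on {0..\<xi>} (\<lambda>t. z1 (t / \<xi>))"
  proof (rule lipschitz_onI)
    fix s t assume st: "s \<in> {0..\<xi>}" "t \<in> {0..\<xi>}"
    have "dist (z1 (s / \<xi>)) (z1 (t / \<xi>)) \<le> L1 * dist (s / \<xi>) (t / \<xi>)"
      by (rule lipschitz_onD[OF L1]) (use st \<xi> in auto)
    also have "dist (s / \<xi>) (t / \<xi>) = (1 / \<xi>) * dist s t"
      using \<xi> by (simp add: dist_real_def flip: diff_divide_distrib)
    finally show "dist (z1 (s / \<xi>)) (z1 (t / \<xi>)) \<le> L1 * (1 / \<xi>) * dist s t" by (simp only: mult.assoc)
  qed (use lipschitz_on_nonneg[OF L1] \<xi> in simp)
  moreover have "(L2 * (1 / (T - \<xi>)))-lipschitz_on {\<xi>..T} (\<lambda>t. z2 ((t - \<xi>) / (T - \<xi>)))"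
  proof (rule lipschitz_onI)
    fix s t assume st: "s \<in> {\<xi>..T}" "t \<in> {\<xi>..T}"
    have "dist (z2 ((s - \<xi>) / (T - \<xi>))) (z2 ((t - \<xi>) / (T - \<xi>))) \<le> L2 * dist ((s - \<xi>) / (T - \<xi>)) ((t - \<xi>) / (T - \<xi>))"
      by (rule lipschitz_onD[OF L2]) (use st \<xi> in auto)
    also have "dist ((s - \<xi>) / (T - \<xi>)) ((t - \<xi>) / (T - \<xi>)) = (1 / (T - \<xi>)) * dist s t"
      using \<xi> by (simp add: dist_real_def flip: diff_divide_distrib)
    finally show "dist (z2 ((s - \<xi>) / (T - \<xi>))) (z2 ((t - \<xi>) / (T - \<xi>))) \<le> L2 * (1 / (T - \<xi>)) * dist s t" by (simp only: mult.assoc)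
  qed (use lipschitz_on_nonneg[OF L2] \<xi> in simp)
  ultimately have "(max (L1 * (1 / \<xi>)) (L2 * (1 / (T - \<xi>))))-lipschitz_on {0..T} (\<lambda>t. if t \<le> \<xi> then z1 (t / \<xi>) else z2 ((t - \<xi>) / (T - \<xi>)))"
    by (rule lipschitz_on_concat_max) (use z(3) \<xi> in simp)
  then show ?A by (auto simp: splice_def[abs_def])
  have A1: "AE t in lebesgue_on {0..\<xi>}. (z1 has_vector_derivative e1 ((1 / \<xi>) * t + 0)) (at ((1 / \<xi>) * t + 0) within {0..1})"
    by (rule AE_affine[OF lip_path_deriv[OF z(1)]]) (use \<xi> in auto)
  have A2: "AE t in lebesgue_on {\<xi>..T}. (z2 has_vector_derivative e2 ((1 / (T - \<xi>)) * t + (- \<xi> / (T - \<xi>)))) (at ((1 / (T - \<xi>)) * t + (- \<xi> / (T - \<xi>))) within {0..1})"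
  proof (rule AE_affine[OF lip_path_deriv[OF z(2)]])
    fix t assume t: "t \<in> {\<xi>..T}"
    have "(1 / (T - \<xi>)) * t + (- \<xi> / (T - \<xi>)) = (t - \<xi>) / (T - \<xi>)" by (simp add: diff_divide_distrib)
    then show "(1 / (T - \<xi>)) * t + (- \<xi> / (T - \<xi>)) \<in> {0..1}" using t \<xi> by auto
  qed (use \<xi> in simp)
  obtain N1 where N1: "negligible N1" "\<forall>t\<in>{0..\<xi>} - N1. (z1 has_vector_derivative e1 ((1 / \<xi>) * t + 0)) (at ((1 / \<xi>) * t + 0) within {0..1})"
    by (rule AE_lebesgue_onE[OF A1])
  obtain N2 where N2: "negligible N2" "\<forall>t\<in>{\<xi>..T} - N2. (z2 has_vector_derivative e2 ((1 / (T - \<xi>)) * t + (- \<xi> / (T - \<xi>)))) (at ((1 / (T - \<xi>)) * t + (- \<xi> / (T - \<xi>))) within {0..1})"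
    by (rule AE_lebesgue_onE[OF A2])
  have chain: "((\<lambda>t. z (m * t + k)) has_vector_derivative m *\<^sub>R d) (at t)"
    if "(z has_vector_derivative d) (at (m * t + k) within {0..1})" "0 < m * t + k" "m * t + k < 1" for z :: "real \<Rightarrow> 'a" and d m k t
  proof -
    have "(z has_vector_derivative d) (at (m * t + k))" using that by (simp only: at_within_Icc_at)
    moreover have "((\<lambda>t. m * t + k) has_vector_derivative m) (at t)"
      by (auto intro!: derivative_eq_intros simp flip: has_real_derivative_iff_has_vector_derivative)
    ultimately have "(z \<circ> (\<lambda>t. m * t + k) has_vector_derivative m *\<^sub>R d) (at t)" by (rule vector_diff_chain_at[rotated])
    then show ?thesis by (simp only: comp_def)
  qed
  have "(splice T \<xi> z1 z2 has_vector_derivative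
      splice T \<xi> (\<lambda>s. (1 / \<xi>) *\<^sub>R e1 s) (\<lambda>s. (1 / (T - \<xi>)) *\<^sub>R e2 s) t) (at t within {0..T})"
    if t: "t \<in> {0..T} - (N1 \<union> N2 \<union> {0, \<xi>, T})" for t
  proof (cases "t < \<xi>")
    case True
    have t': "0 < t" using t by auto
    have "((\<lambda>t. z1 ((1 / \<xi>) * t + 0)) has_vector_derivative (1 / \<xi>) *\<^sub>R e1 ((1 / \<xi>) * t + 0)) (at t)"
      by (rule chain) (use N1(2) t True t' \<xi> in auto)
    then have "(splice T \<xi> z1 z2 has_vector_derivative (1 / \<xi>) *\<^sub>R e1 ((1 / \<xi>) * t + 0)) (at t)"
      by (rule has_vector_derivative_transform_within_open[where S="{0<..<\<xi>}"]) (use t' True in \<open>auto simp: splice_def\<close>)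
    then have "(splice T \<xi> z1 z2 has_vector_derivative splice T \<xi> (\<lambda>s. (1 / \<xi>) *\<^sub>R e1 s) (\<lambda>s. (1 / (T - \<xi>)) *\<^sub>R e2 s) t) (at t)"
      using True by (simp add: splice_def)
    then show ?thesis by (rule has_vector_derivative_at_within)
  next
    case False
    then have t': "\<xi> < t" "t < T" using t by auto
    have e: "(1 / (T - \<xi>)) * t + (- \<xi> / (T - \<xi>)) = (t - \<xi>) / (T - \<xi>)" for t by (simp add: diff_divide_distrib)
    have "((\<lambda>t. z2 ((1 / (T - \<xi>)) * t + (- \<xi> / (T - \<xi>)))) has_vector_derivative (1 / (T - \<xi>)) *\<^sub>R e2 ((1 / (T - \<xi>)) * t + (- \<xi> / (T - \<xi>)))) (at t)"
    proof (rule chain)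
      have "t \<in> {\<xi>..T} - N2" using t t' by auto
      then show "(z2 has_vector_derivative e2 ((1 / (T - \<xi>)) * t + (- \<xi> / (T - \<xi>)))) (at ((1 / (T - \<xi>)) * t + (- \<xi> / (T - \<xi>))) within {0..1})"
        using N2(2) by blast
      show "0 < (1 / (T - \<xi>)) * t + (- \<xi> / (T - \<xi>))" "(1 / (T - \<xi>)) * t + (- \<xi> / (T - \<xi>)) < 1"
        unfolding e using t' by simp_all
    qed
    then have "(splice T \<xi> z1 z2 has_vector_derivative (1 / (T - \<xi>)) *\<^sub>R e2 ((t - \<xi>) / (T - \<xi>))) (at t)"
      unfolding e
      by (rule has_vector_derivative_transform_within_open[where S="{\<xi><..<T}"]) (use t' in \<open>auto simp: splice_def\<close>)
    then have "(splice T \<xi> z1 z2 has_vector_derivative splice T \<xi> (\<lambda>s. (1 / \<xi>) *\<^sub>R e1 s) (\<lambda>s. (1 / (T - \<xi>)) *\<^sub>R e2 s) t) (at t)"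
      using t' by (simp add: splice_def)
    then show ?thesis by (rule has_vector_derivative_at_within)
  qed
  moreover have "negligible (N1 \<union> N2 \<union> {0, \<xi>, T})" using N1(1) N2(1) by simp
  ultimately show ?B
    by (intro AE_lebesgue_onI) blast+
qed

lemma integral_indicator_interval:
  assumes "0 \<le> a" "a \<le> (T::real)"
  shows "(LINT t|lebesgue_on {0..T}. indicator {a..T} t) = T - a" (is ?A) "(LINT t|lebesgue_on {0..T}. indicator {a<..T} t) = T - a"
    "integrable (lebesgue_on {0..T}) (indicator {a..T} :: real \<Rightarrow> real)" (is ?C)
proof -
  have m1: "measure (lebesgue_on {0..T}) {a..T} = T - a"
    using assms by (subst measure_restrict_space) auto
  have m2: "measure (lebesgue_on {0..T}) {a<..T} = T - a"
    using assms by (subst measure_restrict_space) auto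
  have s: "{a..T} \<inter> {0..T} = {a..T}" "{a<..T} \<inter> {0..T} = {a<..T}" using assms by auto
  show ?A "(LINT t|lebesgue_on {0..T}. indicator {a<..T} t) = T - a"
    using m1 m2 s assms by (simp_all add: max_absorb1 del: Int_atLeastAtMost)
  have "{a..T} \<in> sets (lebesgue_on {0..T})" using assms by (subst sets_restrict_space_iff) auto
  then show ?C
    by (intro bounded_measurable_integrable[where B=1]) (auto simp: indicator_def)
qed

text \<open>After the time \<open>a\<close> the trajectory is counted as if it were outside
  \<open>K\<close>, which can only overestimate the cost.\<close>

lemma crisis_cost_le:
  fixes x :: "real \<Rightarrow> 'a::euclidean_space"
  assumes x: "continuous_on {0..T} x" and K: "closed K" and a: "0 \<le> a" "a \<le> T"
    and inK: "\<And>t. 0 \<le> t \<Longrightarrow> t < a \<Longrightarrow> x t \<in> K"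
  shows "crisis_cost T \<phi> K x \<le> \<phi> (x T) + (T - a)"
proof -
  have xm: "x \<in> borel_measurable (lebesgue_on {0..T})" by (rule continuous_imp_measurable_on_sets_lebesgue[OF x]) simp
  have "(\<lambda>t. indicator (- K) (x t) :: real) \<in> borel_measurable (lebesgue_on {0..T})"
    by (rule measurable_compose[OF xm]) (use K in simp)
  then have i: "integrable (lebesgue_on {0..T}) (\<lambda>t. indicator (- K) (x t) :: real)"
    by (rule bounded_measurable_integrable[where B=1]) (auto simp: indicator_def)
  have "(LINT t|lebesgue_on {0..T}. indicator (- K) (x t)) \<le> (LINT t|lebesgue_on {0..T}. indicator {a..T} t :: real)"
    by (rule integral_mono[OF i integral_indicator_interval(3)[OF a]])
       (use inK in \<open>auto simp: indicator_def simp flip: not_less\<close>)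
  then show ?thesis unfolding crisis_cost_def integral_indicator_interval(1)[OF a] by simp
qed

text \<open>Competitors come from splicing, with no condition on \<open>g (z1 1)\<close>. The first
  arc is split at a parameter \<open>a\<close>: up to it compactness keeps \<open>g\<close> negative
  with a margin, after it transversality and the left limit of the control give \<open>g\<close> a
  speed of at least \<open>\<gamma> / 2\<close> in original time. Only the second part can leave
  \<open>K\<close>, and \<open>g (z1 1)\<close> measures how early.\<close>

lemma crossing_penalty:
  fixes f :: "'x::euclidean_space \<times> 'v::euclidean_space \<Rightarrow> 'x" and c :: "'v \<Rightarrow> real ^ 'l" and \<phi> g :: "'x \<Rightarrow> real"
  assumes f: "C2 f" and g: "C2 g" and tau: "\<tau> \<in> {0<..<T}" and K: "closed K" and K_eq: "K = {x. g x \<le> 0}"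
    and U_eq: "U = {u. \<forall>i. c u $ i \<le> 0}"
    and state: "is_state T f x0 ubar xbar"
    and minimizer: "\<And>u x. u \<in> controls T U \<Longrightarrow> is_state T f x0 u x \<Longrightarrow> crisis_cost T \<phi> K xbar \<le> crisis_cost T \<phi> K x"
    and lim: "(ubar \<longlongrightarrow> u_left) (at_left \<tau>)"
    and trans: "0 < fderiv g (xbar \<tau>) (f (xbar \<tau>, u_left))"
    and neg: "\<And>t. t \<in> {0..<\<tau>} \<Longrightarrow> g (xbar t) < 0" and zero: "g (xbar \<tau>) = 0" and pos: "\<And>t. t \<in> {\<tau><..T} \<Longrightarrow> 0 < g (xbar t)"
    and v1: "AE s in leb01. v1 s = ubar (\<tau> * s)"
    and y1: "\<And>s. s \<in> {0..1} \<Longrightarrow> y1 s = xbar (\<tau> * s)" and y2: "y2 1 = xbar T"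
  obtains k \<rho> where "0 \<le> k" "0 < \<rho>" "\<forall>\<xi> w1 w2 z1 z2. \<bar>\<xi> - \<tau>\<bar> \<le> \<rho> \<longrightarrow> bmeas w1 \<longrightarrow> bmeas w2 \<longrightarrow>
      (\<forall>s\<in>{0..1}. norm (w1 s - v1 s) \<le> \<rho> \<and> norm (w2 s - v2 s) \<le> \<rho>) \<longrightarrow>
      (\<forall>s\<in>{0..1}. \<forall>i. c (w1 s) $ i \<le> 0 \<and> c (w2 s) $ i \<le> 0) \<longrightarrow>
      z1 0 = y1 0 \<longrightarrow> z2 0 = z1 1 \<longrightarrow>
      lip_path z1 (\<lambda>s. scaled f (z1 s, \<xi>, w1 s)) \<longrightarrow> lip_path z2 (\<lambda>s. scaled f (z2 s, T - \<xi>, w2 s)) \<longrightarrow>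
      (\<forall>s\<in>{0..1}. norm (z1 s - y1 s) \<le> \<rho> \<and> norm (z2 s - y2 s) \<le> \<rho>) \<longrightarrow>
      \<phi> (y2 1) - \<tau> \<le> \<phi> (z2 1) - \<xi> + k * max 0 (g (z1 1))"
proof -
  have t: "0 < \<tau>" "\<tau> < T" using tau by auto
  have xc: "continuous_on {0..T} xbar" using state by (intro abs_cont_on_continuous) (simp add: is_state_def)
  have x0: "xbar 0 = x0" using state by (simp add: is_state_def)
  have gc: "continuous_on UNIV g" by (rule C2_continuous[OF g])
  have y1c: "continuous_on {0..1} y1"
  proof -
    have "continuous_on {0..1} (\<lambda>s. xbar (\<tau> * s))"
      by (rule continuous_on_compose2[OF xc]) (use t in \<open>auto intro!: continuous_intros simp: mult_le_one mult_left_le order_trans[OF mult_left_le]\<close>)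
    then show ?thesis by (rule continuous_on_eq) (simp add: y1)
  qed
  have cost_bar: "crisis_cost T \<phi> K xbar = \<phi> (y2 1) + (T - \<tau>)"
  proof -
    have "(LINT t|lebesgue_on {0..T}. indicator (- K) (xbar t) :: real) = (LINT t|lebesgue_on {0..T}. indicator {\<tau><..T} t)"
    proof (rule Bochner_Integration.integral_cong[OF refl])
      fix s assume "s \<in> space (lebesgue_on {0..T})"
      then have s: "s \<in> {0..T}" by simp
      consider "s < \<tau>" | "s = \<tau>" | "\<tau> < s" by linarith
      then show "indicator (- K) (xbar s) = (indicator {\<tau><..T} s :: real)"
        using neg[of s] zero pos[of s] s by cases (auto simp: indicator_def K_eq)
    qed
    then show ?thesis unfolding crisis_cost_def y2 using integral_indicator_interval(2)[of \<tau> T] t by simp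
  qed
  define \<gamma> where "\<gamma> = fderiv g (xbar \<tau>) (f (xbar \<tau>, u_left))"
  have \<gamma>: "0 < \<gamma>" using trans by (simp add: \<gamma>_def)
  \<comment> \<open>Continuity of the speed in state and control; half of \<open>\<gamma>\<close> is
    kept.\<close>
  obtain r where r: "0 < r" "\<And>x u. norm (x - xbar \<tau>) < r \<Longrightarrow> norm (u - u_left) < r \<Longrightarrow> \<gamma> / 2 < fderiv g x (f (x, u))"
  proof -
    have "continuous_on UNIV (\<lambda>w. fderiv g (fst w) (f w))"
      by (intro bounded_bilinear.continuous_on[OF bounded_bilinear_blinfun_apply] C2_continuous[OF f]
          continuous_on_compose2[OF C2_continuous_fderiv[OF g]] continuous_intros) auto
    then have "isCont (\<lambda>w. fderiv g (fst w) (f w)) (xbar \<tau>, u_left)" by (simp add: continuous_on_eq_continuous_at)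
    then obtain d where d: "0 < d" "\<forall>w. dist w (xbar \<tau>, u_left) < d \<longrightarrow> dist (fderiv g (fst w) (f w)) (fderiv g (xbar \<tau>) (f (xbar \<tau>, u_left))) < \<gamma> / 2"
      unfolding continuous_at_eps_delta using half_gt_zero[OF \<gamma>] by fastforce
    show ?thesis
    proof (rule that[of "d / 2"])
      fix x u assume a: "norm (x - xbar \<tau>) < d / 2" "norm (u - u_left) < d / 2"
      have "dist (x, u) (xbar \<tau>, u_left) \<le> norm (x - xbar \<tau>) + norm (u - u_left)"
        using norm_Pair_le[of "x - xbar \<tau>" "u - u_left"] by (simp add: dist_norm)
      also have "\<dots> < d" using a by simp
      finally have "dist (fderiv g x (f (x, u))) \<gamma> < \<gamma> / 2" using d(2) unfolding \<gamma>_def by fastforce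
      then show "\<gamma> / 2 < fderiv g x (f (x, u))" unfolding dist_real_def by linarith
    qed (use d in simp)
  qed
  have r4: "0 < r / 4" using r by simp
  obtain b where b: "b < \<tau>" "\<forall>t. b < t \<longrightarrow> t < \<tau> \<longrightarrow> norm (ubar t - u_left) < r / 4"
    using tendstoD[OF lim r4] unfolding eventually_at_left_field dist_norm by (elim exE conjE) (rule that)
  obtain d where d: "0 < d" "\<forall>s\<in>{0..1}. dist s 1 < d \<longrightarrow> dist (y1 s) (y1 1) < r / 4"
    using y1c[unfolded continuous_on_iff, rule_format, of 1 "r / 4"] r4 by auto
  \<comment> \<open>Beyond \<open>a\<close> the control and state of the reference are within
    \<open>r / 4\<close> of their left limits. The midpoint between \<open>b / \<tau>\<close> and 1
    and the half of \<open>d\<close> make the inequalities strict.\<close>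
  define a where "a = max (max 0 ((b / \<tau> + 1) / 2)) (1 - d / 2)"
  have b1: "b / \<tau> < 1" using b(1) t by simp
  have a: "0 \<le> a" "a < 1" using b1 d(1) by (auto simp: a_def)
  have near: "norm (ubar (\<tau> * s) - u_left) < r / 4" "norm (y1 s - xbar \<tau>) < r / 4" if s: "a \<le> s" "s < 1" for s
  proof -
    have "b / \<tau> < s" using s(1) b1 by (simp add: a_def)
    then have "b < \<tau> * s" using t by (simp add: divide_less_eq mult.commute)
    moreover have "\<tau> * s < \<tau>" using s t by simp
    ultimately show "norm (ubar (\<tau> * s) - u_left) < r / 4" using b(2) by blast
    have "1 - d / 2 \<le> s" using s by (simp add: a_def)
    then have "dist s 1 < d" using s d(1) by (simp add: dist_real_def)
    moreover have "s \<in> {0..1}" using s a by simp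
    ultimately have "dist (y1 s) (y1 1) < r / 4" using d(2) by blast
    then show "norm (y1 s - xbar \<tau>) < r / 4" using y1[of 1] by (simp add: dist_norm)
  qed
  obtain m where m: "0 < m" "\<forall>s\<in>{0..a}. g (y1 s) \<le> - m"
  proof -
    have "continuous_on {0..a} (\<lambda>s. g (y1 s))"
      by (rule continuous_on_compose2[OF gc continuous_on_subset[OF y1c]]) (use a in auto)
    then obtain s1 where s1: "s1 \<in> {0..a}" "\<forall>s\<in>{0..a}. g (y1 s) \<le> g (y1 s1)"
      using continuous_attains_sup[of "{0..a}" "\<lambda>s. g (y1 s)"] a by auto
    have "\<tau> * s1 < \<tau>" "0 \<le> \<tau> * s1" using s1 a t by auto
    then have "g (y1 s1) < 0" using neg[of "\<tau> * s1"] y1[of s1] s1 a by simp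
    then show ?thesis by (intro that[of "- g (y1 s1)"]) (use s1 in auto)
  qed
  obtain B where B: "0 < B" "\<forall>s\<in>{0..1}. norm (y1 s) \<le> B" by (rule bmeas_boundE[OF bmeas_continuous[OF y1c]])
  obtain C where C: "0 < C"
    "\<forall>x y. norm x \<le> B + 1 \<longrightarrow> norm y \<le> B + 1 \<longrightarrow> norm (g y - g x) \<le> C * norm (y - x) \<and>
      norm (fderiv g y - fderiv g x) \<le> C * norm (y - x) \<and>
      norm (g y - g x - fderiv g x (y - x)) \<le> C * (norm (y - x))\<^sup>2"
    by (rule C2_taylor1[OF g])
  \<comment> \<open>The first pair keeps \<open>\<xi>\<close> strictly between 0 and
    \<open>T\<close>; \<open>r / 4\<close> keeps the perturbed control and state within
    \<open>r\<close> of their limits; 1 and \<open>m / C\<close> keep \<open>g\<close> nonpositive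
    on the part before \<open>a\<close>.\<close>
  define \<rho> where "\<rho> = min (min (\<tau> / 2) ((T - \<tau>) / 2)) (min (min (r / 4) 1) (m / C))"
  have \<rho>: "0 < \<rho>" "\<rho> \<le> \<tau> / 2" "\<rho> \<le> (T - \<tau>) / 2" "\<rho> \<le> r / 4" "\<rho> \<le> 1" "\<rho> \<le> m / C"
    using t r m C by (simp add: \<rho>_def) (simp_all only: \<rho>_def min_le_iff_disj order_refl simp_thms)
  define k where "k = 2 / \<gamma>"
  have k: "0 \<le> k" using \<gamma> by (simp add: k_def)
  have "\<phi> (y2 1) - \<tau> \<le> \<phi> (z2 1) - \<xi> + k * max 0 (g (z1 1))"
    if \<xi>: "\<bar>\<xi> - \<tau>\<bar> \<le> \<rho>" and w: "bmeas w1" "bmeas w2"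
      and wv: "\<forall>s\<in>{0..1}. norm (w1 s - v1 s) \<le> \<rho> \<and> norm (w2 s - v2 s) \<le> \<rho>"
      and wc: "\<forall>s\<in>{0..1}. \<forall>i. c (w1 s) $ i \<le> 0 \<and> c (w2 s) $ i \<le> 0"
      and z0: "z1 0 = y1 0" "z2 0 = z1 1"
      and z1: "lip_path z1 (\<lambda>s. scaled f (z1 s, \<xi>, w1 s))" and z2: "lip_path z2 (\<lambda>s. scaled f (z2 s, T - \<xi>, w2 s))"
      and zy: "\<forall>s\<in>{0..1}. norm (z1 s - y1 s) \<le> \<rho> \<and> norm (z2 s - y2 s) \<le> \<rho>" for \<xi> w1 w2 z1 z2
  proof -
    have \<xi>T: "0 < \<xi>" "\<xi> < T" using \<xi> \<rho>(2,3) t by (auto simp: abs_le_iff)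
    let ?u = "splice T \<xi> w1 w2" and ?x = "splice T \<xi> z1 z2"
    have uU: "?u \<in> controls T U"
    proof -
      have "?u \<in> borel_measurable (lebesgue_on {0..T})" by (rule splice_measurable[OF bmeasD1[OF w(1)] bmeasD1[OF w(2)] \<xi>T])
      moreover have "\<forall>t\<in>{0..T}. ?u t \<in> U" using wc unfolding U_eq by (intro ballI splice_in[OF \<xi>T]) auto
      ultimately show ?thesis by (simp add: controls_def)
    qed
    obtain L where L: "L-lipschitz_on {0..T} ?x" using splice_lipschitz_derivative(1)[OF z1 z2 z0(2) \<xi>T] by blast
    have xst: "is_state T f x0 ?u ?x"
      unfolding is_state_def
    proof (intro conjI)
      show "abs_cont_on 0 T ?x" by (rule lipschitz_on_abs_cont_on[OF L])
      show "?x 0 = x0" using \<xi>T z0(1) y1[of 0] x0 by (simp add: splice_def)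
      show "AE t in lebesgue_on {0..T}. (?x has_vector_derivative f (?x t, ?u t)) (at t within {0..T})"
        using splice_lipschitz_derivative(2)[OF z1 z2 z0(2) \<xi>T]
      proof eventually_elim
        case (elim t)
        have "splice T \<xi> (\<lambda>s. (1 / \<xi>) *\<^sub>R scaled f (z1 s, \<xi>, w1 s)) (\<lambda>s. (1 / (T - \<xi>)) *\<^sub>R scaled f (z2 s, T - \<xi>, w2 s)) t = f (?x t, ?u t)"
          using \<xi>T by (simp add: splice_def scaled_apply)
        then show ?case using elim by simp
      qed
    qed
    \<comment> \<open>In the variable \<open>s\<close> the speed carries the length
      \<open>\<xi>\<close> of the arc as a factor.\<close>
    have inc: "(\<xi> * (\<gamma> / 2)) * (1 - s) \<le> g (z1 1) - g (z1 s)" if s: "a \<le> s" "s \<le> 1" for s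
    proof (rule lip_path_increment_ge[OF lip_path_C2[OF g z1]])
      show "0 \<le> s" "s \<le> 1" using s a by auto
      have sub: "{s..1} \<subseteq> {0..1}" using s a by auto
      have "AE q in lebesgue_on {s..1}. v1 q = ubar (\<tau> * q)" by (rule AE_lebesgue_on_subset[OF v1 sub])
      moreover have "AE q in lebesgue_on {s..1}. q \<noteq> 1"
        by (rule AE_lebesgue_onI[of "{1}"]) auto
      ultimately show "AE q in lebesgue_on {s..1}. \<xi> * (\<gamma> / 2) \<le> fderiv g (z1 q) (scaled f (z1 q, \<xi>, w1 q))"
        using AE_space
      proof eventually_elim
        case (elim q)
        then have q: "q \<in> {0..1}" "a \<le> q" "q < 1" using s a by auto
        have n1: "norm (w1 q - v1 q) \<le> \<rho>" "norm (z1 q - y1 q) \<le> \<rho>" using wv zy q(1) by blast+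
        have "norm (w1 q - u_left) \<le> norm (w1 q - v1 q) + norm (v1 q - u_left)" using norm_triangle_ineq[of "w1 q - v1 q" "v1 q - u_left"] by simp
        then have "norm (w1 q - u_left) < r" using n1(1) near(1)[OF q(2,3)] elim(1) \<rho>(4) r(1) by simp
        moreover have "norm (z1 q - xbar \<tau>) < r"
        proof -
          have "z1 q - xbar \<tau> = (z1 q - y1 q) + (y1 q - xbar \<tau>)" by simp
          then have "norm (z1 q - xbar \<tau>) \<le> norm (z1 q - y1 q) + norm (y1 q - xbar \<tau>)" by (metis norm_triangle_ineq)
          then show ?thesis using n1(2) near(2)[OF q(2,3)] \<rho>(4) r(1) by linarith
        qed
        ultimately have "\<gamma> / 2 < fderiv g (z1 q) (f (z1 q, w1 q))" by (intro r(2))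
        then have "\<xi> * (\<gamma> / 2) \<le> \<xi> * fderiv g (z1 q) (f (z1 q, w1 q))" using \<xi>T by (intro mult_left_mono) auto
        then show ?case by (simp add: scaled_apply blinfun.scaleR_right)
      qed
    qed
    define G where "G = g (z1 1)"
    \<comment> \<open>A time up to which the spliced trajectory is certainly in \<open>K\<close>;
      the maximum with 0 covers large overshoots.\<close>
    define t' where "t' = max 0 (\<xi> - k * max 0 G)"
    have t': "0 \<le> t'" "t' \<le> \<xi>" using k \<xi>T by (auto simp: t'_def)
    have inK: "?x t \<in> K" if tt: "0 \<le> t" "t < t'" for t
    proof -
      define s where "s = t / \<xi>"
      have s: "0 \<le> s" "s < 1" "t = \<xi> * s" using tt t' \<xi>T by (auto simp: s_def)
      have xt: "?x t = z1 s" using tt t' by (simp add: splice_def s_def)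
      have "g (z1 s) \<le> 0"
      proof (cases "s \<le> a")
        case True
        have s01: "s \<in> {0..1}" using s by simp
        have n: "norm (z1 s - y1 s) \<le> \<rho>" using zy s01 by blast
        have "norm (y1 s) \<le> B" using B(2) s01 by blast
        moreover have "norm (z1 s) \<le> norm (y1 s) + norm (z1 s - y1 s)" by (rule norm_triangle_sub)
        ultimately have "norm (z1 s) \<le> B + 1" "norm (y1 s) \<le> B + 1" using n \<rho>(5) by linarith+
        then have "norm (g (z1 s) - g (y1 s)) \<le> C * norm (z1 s - y1 s)" using C(2) by blast
        also have "\<dots> \<le> C * \<rho>" using n C(1) by (intro mult_left_mono) auto
        also have "\<dots> \<le> m" using \<rho>(6) C(1) by (simp add: pos_le_divide_eq mult.commute)
        finally show ?thesis using m(2) True s(1) by (simp add: abs_le_iff) (smt (verit) atLeastAtMost_iff)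
      next
        case False
        then have "(\<xi> * (\<gamma> / 2)) * (1 - s) \<le> G - g (z1 s)" unfolding G_def by (intro inc) (use s in auto)
        moreover have "max 0 G \<le> (\<xi> * (\<gamma> / 2)) * (1 - s)"
        proof -
          have "t < \<xi> - k * max 0 G" using tt by (auto simp: t'_def max_def split: if_splits)
          then have "k * max 0 G \<le> \<xi> * (1 - s)" unfolding s(3) by (simp add: right_diff_distrib)
          then have "(\<gamma> / 2) * (k * max 0 G) \<le> (\<gamma> / 2) * (\<xi> * (1 - s))" using \<gamma> by (intro mult_left_mono) auto
          then show ?thesis using \<gamma> by (simp add: k_def mult_ac)
        qed
        ultimately show ?thesis by linarith
      qed
      then show ?thesis unfolding xt K_eq by simp
    qed
    have "crisis_cost T \<phi> K ?x \<le> \<phi> (?x T) + (T - t')"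
      by (rule crisis_cost_le[OF lipschitz_on_continuous_on[OF L] K t'(1) _ inK]) (use t' \<xi>T in auto)
    moreover have "?x T = z2 1" using \<xi>T by (simp add: splice_def)
    moreover have "\<xi> - k * max 0 G \<le> t'" by (simp add: t'_def)
    ultimately show ?thesis using minimizer[OF uU xst] cost_bar unfolding G_def by simp
  qed
  then show ?thesis by (intro that[OF k \<rho>(1)]) blast
qed

section \<open>Derivatives of the data of the transformed problem\<close>

lemma measurable_lebesgue_on_AE_eq:
  fixes f g :: "real \<Rightarrow> 'a::euclidean_space"
  assumes f: "f \<in> borel_measurable (lebesgue_on {a..b})" and ae: "AE s in lebesgue_on {a..b}. f s = g s"
  shows "g \<in> borel_measurable (lebesgue_on {a..b})"
proof -
  have 1: "(\<lambda>s. if s \<in> {a..b} then f s else 0) \<in> borel_measurable lebesgue"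
    by (subst borel_measurable_if) (simp_all add: f)
  have 2: "AE s in lebesgue. (if s \<in> {a..b} then f s else 0) = (if s \<in> {a..b} then g s else 0)"
    using ae by (simp add: AE_restrict_space_iff)
  have "(\<lambda>s. if s \<in> {a..b} then g s else 0) \<in> borel_measurable lebesgue"
    by (rule borel_measurable_AE[OF 1 2])
  then show ?thesis by (subst (asm) borel_measurable_if) simp_all
qed

lemma abs_cont_on_linear:
  assumes L: "bounded_linear L" and x: "abs_cont_on a b x"
  shows "abs_cont_on a b (\<lambda>s. L (x s))"
  unfolding abs_cont_on_def
proof (intro allI impI)
  fix e :: real assume e: "0 < e"
  obtain K where K: "0 < K" "\<forall>u. norm (L u) \<le> norm u * K" using bounded_linear.pos_bounded[OF L] by blast
  have "0 < e / K" using e K(1) by simp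
  from x[unfolded abs_cont_on_def, rule_format, OF this]
  obtain \<delta> where \<delta>: "0 < \<delta>" "\<forall>d. d division_of (\<Union>d) \<and> \<Union>d \<subseteq> {a..b} \<and> (\<Sum>k\<in>d. measure lborel k) < \<delta>
        \<longrightarrow> (\<Sum>k\<in>d. norm (x (interval_upperbound k) - x (interval_lowerbound k))) < e / K" by (elim exE conjE) (rule that)
  show "\<exists>\<delta>>0. \<forall>d. d division_of (\<Union>d) \<and> \<Union>d \<subseteq> {a..b} \<and> (\<Sum>k\<in>d. measure lborel k) < \<delta>
        \<longrightarrow> (\<Sum>k\<in>d. norm (L (x (interval_upperbound k)) - L (x (interval_lowerbound k)))) < e"
  proof (intro exI[of _ \<delta>] conjI allI impI, fact \<delta>(1))
    fix d assume d: "d division_of (\<Union>d) \<and> \<Union>d \<subseteq> {a..b} \<and> (\<Sum>k\<in>d. measure lborel k) < \<delta>"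
    have "(\<Sum>k\<in>d. norm (L (x (interval_upperbound k)) - L (x (interval_lowerbound k))))
      \<le> (\<Sum>k\<in>d. norm (x (interval_upperbound k) - x (interval_lowerbound k)) * K)"
      by (rule sum_mono) (simp add: K(2) flip: linear_diff[OF bounded_linear.linear[OF L]])
    also have "\<dots> = (\<Sum>k\<in>d. norm (x (interval_upperbound k) - x (interval_lowerbound k))) * K"
      by (rule sum_distrib_right[symmetric])
    also have "\<dots> < e" using \<delta>(2)[rule_format, OF d] K(1) by (simp add: pos_less_divide_eq)
    finally show "(\<Sum>k\<in>d. norm (L (x (interval_upperbound k)) - L (x (interval_lowerbound k)))) < e" .
  qed
qed

lemma fderiv_const: "fderiv (\<lambda>_. c) x = 0"
  by (rule fderiv_eqI) (simp add: zero_blinfun.rep_eq)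

lemma fderiv2_linear: "bounded_linear L \<Longrightarrow> fderiv2 L x = 0"
  using C2_affine(2)[of L 0] by (simp add: fderiv_const)

lemma fderiv_Pair:
  assumes f: "C2 f" and g: "C2 g"
  shows "fderiv (\<lambda>x. (f x, g x)) x h = (fderiv f x h, fderiv g x h)"
    and "fderiv (fderiv (\<lambda>x. (f x, g x))) x h k = (fderiv2 f x h k, fderiv2 g x h k)"
  using fderiv_linear_compose[OF bounded_linear_fst C2_Pair[OF f g], of x h]
    fderiv_linear_compose[OF bounded_linear_snd C2_Pair[OF f g], of x h]
    fderiv2_linear_compose[OF bounded_linear_fst C2_Pair[OF f g], of x h k]
    fderiv2_linear_compose[OF bounded_linear_snd C2_Pair[OF f g], of x h k]
  by (simp_all add: prod_eq_iff)

text \<open>\<open>dyn2\<close> consists of \<open>scaled f\<close> at affine images of its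
  argument, one for each arc. The blocks are their linear parts; the minus sign in
  \<open>block2\<close> comes from the length \<open>T - \<xi>\<close>, whose constant
  \<open>T\<close> is added as a shift.\<close>

definition block1 :: "'n::finite state2 \<times> 'm::finite control2 \<Rightarrow> (real ^ 'n) \<times> real \<times> (real ^ 'm)"
  where "block1 z = (fst (fst z), snd (snd (fst z)), fst (snd z))"

definition block2 :: "'n::finite state2 \<times> 'm::finite control2 \<Rightarrow> (real ^ 'n) \<times> real \<times> (real ^ 'm)"
  where "block2 z = (fst (snd (fst z)), - snd (snd (fst z)), snd (snd z))"

lemma bounded_linear_block: "bounded_linear block1" "bounded_linear block2"
  unfolding block1_def[abs_def] block2_def[abs_def]
  by (intro bounded_linear_Pair bounded_linear_minus bounded_linear_compose[OF bounded_linear_fst]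
    bounded_linear_compose[OF bounded_linear_snd] bounded_linear_ident)+

lemma
  fixes f :: "(real ^ 'n) \<times> (real ^ 'm) \<Rightarrow> real ^ 'n"
  assumes f: "C2 f"
  shows C2_dyn2: "C2 (dyn2 T f)"
    and fderiv_dyn2: "fderiv (dyn2 T f) ((y1, y2, \<xi>), (v1, v2)) ((h1, h2, k), (u1, u2)) =
      (fderiv (scaled f) (y1, \<xi>, v1) (h1, k, u1), fderiv (scaled f) (y2, T - \<xi>, v2) (h2, - k, u2), 0)" (is ?B)
    and fderiv2_dyn2: "fderiv (fderiv (dyn2 T f)) ((y1, y2, \<xi>), (v1, v2)) ((h1, h2, k), (u1, u2)) ((h1, h2, k), (u1, u2)) =
      (fderiv (fderiv (scaled f)) (y1, \<xi>, v1) (h1, k, u1) (h1, k, u1),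
       fderiv (fderiv (scaled f)) (y2, T - \<xi>, v2) (h2, - k, u2) (h2, - k, u2), 0)" (is ?C)
proof -
  note F = C2_scaled[OF f]
  let ?b = "(0, T, 0) :: (real ^ 'n) \<times> real \<times> (real ^ 'm)"
  have eq: "dyn2 T f = (\<lambda>z. (scaled f (block1 z + 0), scaled f (block2 z + ?b), 0))"
    by (auto simp: dyn2_def scaled_def fun_eq_iff block1_def block2_def)
  note D = fderiv_compose_affine[OF bounded_linear_block(1) F, of 0]
  note E = fderiv_compose_affine[OF bounded_linear_block(2) F, of ?b]
  note P = C2_Pair[OF E(1) C2_const]
  show "C2 (dyn2 T f)" unfolding eq by (rule C2_Pair[OF D(1) P])
  show ?B
    unfolding eq fderiv_Pair(1)[OF D(1) P] fderiv_Pair(1)[OF E(1) C2_const] D(2) E(2)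
    by (simp add: fderiv_const block1_def block2_def)
  have z: "fderiv (fderiv (\<lambda>_. c)) x = 0" for c :: real and x :: "'n state2 \<times> 'm control2"
    by (simp add: fderiv_const[abs_def])
  show ?C
    unfolding eq fderiv_Pair(2)[OF D(1) P] fderiv_Pair(2)[OF E(1) C2_const] D(3) E(3)
    by (simp add: z block1_def block2_def)
qed

lemma
  fixes g :: "real ^ 'n \<Rightarrow> real"
  assumes g: "C2 g"
  shows C2_endpoint_map: "C2 (endpoint_map g)"
    and fderiv_endpoint_map: "fderiv (endpoint_map g) (a, b) (h, k) =
      (fst h, snd (snd h), fst (snd h) - fst k, fderiv g (fst b) (fst k))" (is ?B)
    and fderiv2_endpoint_map: "fderiv (fderiv (endpoint_map g)) (a, b) (h, k) (h, k) =
      (0, 0, 0, fderiv2 g (fst b) (fst k) (fst k))" (is ?C)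
proof -
  have eq: "endpoint_map g = (\<lambda>x. (fst (fst x), snd (snd (fst x)), fst (snd (fst x)) - fst (snd x), g (fst (snd x) + 0)))"
    by (auto simp: endpoint_map_def fun_eq_iff)
  have l: "bounded_linear (\<lambda>x :: 'n state2 \<times> 'n state2. fst (fst x))"
    "bounded_linear (\<lambda>x :: 'n state2 \<times> 'n state2. snd (snd (fst x)))"
    "bounded_linear (\<lambda>x :: 'n state2 \<times> 'n state2. fst (snd (fst x)) - fst (snd x))"
    "bounded_linear (\<lambda>x :: 'n state2 \<times> 'n state2. fst (snd x))"
    by (intro bounded_linear_sub bounded_linear_compose[OF bounded_linear_fst]
      bounded_linear_compose[OF bounded_linear_snd] bounded_linear_ident)+
  note D = fderiv_compose_affine[OF l(4) g, of 0]
  note L = C2_linear[OF l(1)] C2_linear[OF l(2)] C2_linear[OF l(3)]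
  note P3 = C2_Pair[OF L(3) D(1)]
  note P2 = C2_Pair[OF L(2) P3]
  show "C2 (endpoint_map g)" unfolding eq by (rule C2_Pair[OF L(1) P2])
  show ?B
    unfolding eq fderiv_Pair(1)[OF L(1) P2] fderiv_Pair(1)[OF L(2) P3] fderiv_Pair(1)[OF L(3) D(1)] D(2)
      fderiv_linear[OF l(1)] fderiv_linear[OF l(2)] fderiv_linear[OF l(3)] by simp
  show ?C
    unfolding eq fderiv_Pair(2)[OF L(1) P2] fderiv_Pair(2)[OF L(2) P3] fderiv_Pair(2)[OF L(3) D(1)] D(3)
      fderiv2_linear[OF l(1)] fderiv2_linear[OF l(2)] fderiv2_linear[OF l(3)] by simp
qed

text \<open>The blocks of the endpoint map list \<open>\<xi>\<close> before the junction while the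
  state lists it last; hence \<open>\<beta>2\<close> and \<open>\<beta>3\<close> change
  places.\<close>

lemma adjoint_endpoint_map:
  fixes g :: "real ^ 'n \<Rightarrow> real"
  assumes g: "C2 g"
  shows "adjoint (fderiv (\<lambda>z. endpoint_map g (z, b)) a) (\<beta>1, \<beta>2, \<beta>3, \<beta>4) = (\<beta>1, \<beta>3, \<beta>2)" (is ?A)
    and "adjoint (fderiv (\<lambda>z. endpoint_map g (a, z)) b) (\<beta>1, \<beta>2, \<beta>3, \<beta>4) = (- \<beta>3 + \<beta>4 *\<^sub>R grad g (fst b), 0, 0)" (is ?B)
proof -
  have l: "bounded_linear (\<lambda>z :: 'n state2. (z, 0 :: 'n state2))" "bounded_linear (\<lambda>z :: 'n state2. (0 :: 'n state2, z))"
    by (intro bounded_linear_Pair bounded_linear_ident bounded_linear_zero)+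
  have 1: "fderiv (\<lambda>z. endpoint_map g (z, b)) a h = fderiv (endpoint_map g) (a, b) (h, 0)" for h
    using fderiv_compose_affine(2)[OF l(1) C2_endpoint_map[OF g], of "(0, b)" a h] by simp
  have 2: "fderiv (\<lambda>z. endpoint_map g (a, z)) b h = fderiv (endpoint_map g) (a, b) (0, h)" for h
    using fderiv_compose_affine(2)[OF l(2) C2_endpoint_map[OF g], of "(a, 0)" b h] by simp
  have "adjoint (fderiv (\<lambda>z. endpoint_map g (z, b)) a) = (\<lambda>(\<beta>1, \<beta>2, \<beta>3, \<beta>4). (\<beta>1, \<beta>3, \<beta>2))"
    by (rule Linear_Algebra.adjoint_unique) (auto simp: 1 fderiv_endpoint_map[OF g] inner_prod_def)
  then show ?A by simp
  have "adjoint (fderiv (\<lambda>z. endpoint_map g (a, z)) b) = (\<lambda>(\<beta>1, \<beta>2, \<beta>3, \<beta>4). (- \<beta>3 + \<beta>4 *\<^sub>R grad g (fst b), 0, 0))"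
    by (rule Linear_Algebra.adjoint_unique)
       (auto simp: 2 fderiv_endpoint_map[OF g] inner_prod_def inner_add_right inner_diff_right grad_inner[OF g] inner_commute[of _ "grad g (fst b)"] mult.commute)
  then show ?B by simp
qed

lemma
  fixes \<phi> :: "real ^ 'n \<Rightarrow> real"
  assumes \<phi>: "C2 \<phi>"
  shows fderiv2_final_cost: "fderiv (fderiv (final_cost T \<phi>)) y h h = fderiv2 \<phi> (fst (snd y)) (fst (snd h)) (fst (snd h))" (is ?A)
    and grad_final_cost: "grad (final_cost T \<phi>) y = (0, grad \<phi> (fst (snd y)), - 1)" (is ?B)
proof -
  have eq: "final_cost T \<phi> = (\<lambda>y. \<phi> (fst (snd y) + 0) + (- snd (snd y) + T))"
    by (auto simp: final_cost_def fun_eq_iff)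
  have l: "bounded_linear (\<lambda>y :: 'n state2. fst (snd y))" "bounded_linear (\<lambda>y :: 'n state2. - snd (snd y))"
    by (intro bounded_linear_minus bounded_linear_compose[OF bounded_linear_fst]
      bounded_linear_compose[OF bounded_linear_snd] bounded_linear_ident)+
  note D = fderiv_compose_affine[OF l(1) \<phi>, of 0]
  note A = C2_affine[OF l(2), of T]
  show ?A
    unfolding eq fderiv2_add[OF D(1) A(1)] D(3) A(2) by (simp add: fderiv_const)
  have C: "C2 (final_cost T \<phi>)" unfolding eq by (rule C2_add(1)[OF D(1) A(1)])
  have "fderiv (final_cost T \<phi>) y h = (0, grad \<phi> (fst (snd y)), - 1) \<bullet> h" for h
    unfolding eq C2_add(2)[OF D(1) A(1)] A(2) plus_blinfun.rep_eq D(2)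
    by (simp add: bounded_linear_Blinfun_apply[OF l(2)] grad_inner[OF \<phi>] inner_prod_def)
  then have "grad (final_cost T \<phi>) y \<bullet> h = (0, grad \<phi> (fst (snd y)), - 1) \<bullet> h" for h
    unfolding grad_inner[OF C] .
  then show ?B using vector_eq_rdot by blast
qed

text \<open>The third entry, the derivative in \<open>\<xi>\<close>, drives the third costate
  component, whose total increment is the integral condition in \<open>valid\<close>.\<close>

lemma grad_hamiltonian:
  fixes f :: "(real ^ 'n) \<times> (real ^ 'm) \<Rightarrow> real ^ 'n"
  assumes f: "C2 f"
  shows "grad (\<lambda>z. hamiltonian T f z q (v1, v2)) (y1, y2, \<xi>) =
    (fderiv_adj (scaled f) (y1, \<xi>, v1) (fst q), fderiv_adj (scaled f) (y2, T - \<xi>, v2) (fst (snd q)),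
     fst q \<bullet> f (y1, v1) - fst (snd q) \<bullet> f (y2, v2))"
proof -
  have l: "bounded_linear (\<lambda>z :: 'n state2. (z, 0 :: 'm control2))"
    by (intro bounded_linear_Pair bounded_linear_ident bounded_linear_zero)
  note D = fderiv_compose_affine[OF l C2_dyn2[OF f, of T], of "(0, v1, v2)"]
  note B = bounded_linear_inner_right[of q]
  have eq: "(\<lambda>z. hamiltonian T f z q (v1, v2)) = (\<lambda>z. q \<bullet> dyn2 T f ((z, 0) + (0, v1, v2)))"
    by (auto simp: hamiltonian_def)
  have C: "C2 (\<lambda>z. hamiltonian T f z q (v1, v2))" unfolding eq by (rule C2_linear_compose[OF B D(1)])
  have sp: "p \<bullet> fderiv (scaled f) (y, r, v) (h, k, 0) = fderiv_adj (scaled f) (y, r, v) p \<bullet> h + k * (p \<bullet> f (y, v))" for p y r v h k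
  proof -
    have "fderiv (scaled f) (y, r, v) (h, k, 0) = fderiv (scaled f) (y, r, v) ((h, 0) + (0, k, 0))" by (simp add: zero_prod_def)
    also have "\<dots> = fderiv (scaled f) (y, r, v) (h, 0) + k *\<^sub>R f (y, v)"
      unfolding blinfun.add_right by (simp add: fderiv_scaled[OF f] flip: zero_prod_def)
    finally show ?thesis by (simp add: inner_add_right fderiv_adj_inner)
  qed
  have "grad (\<lambda>z. hamiltonian T f z q (v1, v2)) (y1, y2, \<xi>) \<bullet> h =
    (fderiv_adj (scaled f) (y1, \<xi>, v1) (fst q), fderiv_adj (scaled f) (y2, T - \<xi>, v2) (fst (snd q)),
     fst q \<bullet> f (y1, v1) - fst (snd q) \<bullet> f (y2, v2)) \<bullet> h" for h
  proof -
    obtain h1 h2 k where h: "h = (h1, h2, k)" by (cases h)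
    have "grad (\<lambda>z. hamiltonian T f z q (v1, v2)) (y1, y2, \<xi>) \<bullet> h = q \<bullet> fderiv (dyn2 T f) ((y1, y2, \<xi>), (v1, v2)) ((h1, h2, k), (0, 0))"
      unfolding grad_inner[OF C] unfolding eq fderiv_linear_compose[OF B D(1)] D(2) by (simp add: h zero_prod_def)
    also have "\<dots> = fst q \<bullet> fderiv (scaled f) (y1, \<xi>, v1) (h1, k, 0) + fst (snd q) \<bullet> fderiv (scaled f) (y2, T - \<xi>, v2) (h2, - k, 0)"
      unfolding fderiv_dyn2[OF f] by (simp add: inner_prod_def)
    finally show ?thesis unfolding sp by (simp add: h inner_prod_def algebra_simps)
  qed
  then show ?thesis using vector_eq_rdot by blast
qed

lemma
  fixes f :: "(real ^ 'n) \<times> (real ^ 'm) \<Rightarrow> real ^ 'n" and c :: "real ^ 'm \<Rightarrow> real ^ 'l"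
  assumes f: "C2 f" and c: "C2 c"
  shows grad_aug_hamiltonian: "grad (\<lambda>w. aug_hamiltonian T f c (y1, y2, \<xi>) q w \<mu>) (v1, v2) \<bullet> (h1, h2) =
      fst q \<bullet> fderiv (scaled f) (y1, \<xi>, v1) (0, 0, h1) + fst (snd q) \<bullet> fderiv (scaled f) (y2, T - \<xi>, v2) (0, 0, h2)
      + fst \<mu> \<bullet> fderiv c v1 h1 + snd \<mu> \<bullet> fderiv c v2 h2" (is ?A)
    and fderiv2_aug_hamiltonian: "fderiv (fderiv (\<lambda>(z, w). aug_hamiltonian T f c z q w \<mu>)) ((y1, y2, \<xi>), (v1, v2))
        ((a1, a2, k), (h1, h2)) ((a1, a2, k), (h1, h2)) =
      fst q \<bullet> fderiv (fderiv (scaled f)) (y1, \<xi>, v1) (a1, k, h1) (a1, k, h1)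
      + fst (snd q) \<bullet> fderiv (fderiv (scaled f)) (y2, T - \<xi>, v2) (a2, - k, h2) (a2, - k, h2)
      + fst \<mu> \<bullet> fderiv2 c v1 h1 h1 + snd \<mu> \<bullet> fderiv2 c v2 h2 h2" (is ?B)
proof -
  let ?H = "\<lambda>x. q \<bullet> dyn2 T f x + (fst \<mu> \<bullet> c (fst (snd x) + 0) + snd \<mu> \<bullet> c (snd (snd x) + 0))"
  have eq: "(\<lambda>(z, w). aug_hamiltonian T f c z q w \<mu>) = ?H"
    by (auto simp: aug_hamiltonian_def hamiltonian_def fun_eq_iff)
  have l: "bounded_linear (\<lambda>x :: 'n state2 \<times> 'm control2. fst (snd x))" "bounded_linear (\<lambda>x :: 'n state2 \<times> 'm control2. snd (snd x))"
    by (intro bounded_linear_compose[OF bounded_linear_fst] bounded_linear_compose[OF bounded_linear_snd] bounded_linear_ident)+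
  note I = bounded_linear_inner_right
  note D1 = fderiv_compose_affine[OF l(1) c, of 0]
  note D2 = fderiv_compose_affine[OF l(2) c, of 0]
  note A0 = C2_linear_compose[OF I[of q] C2_dyn2[OF f, of T]]
  note A1 = C2_linear_compose[OF I[of "fst \<mu>"] D1(1)]
  note A2 = C2_linear_compose[OF I[of "snd \<mu>"] D2(1)]
  note A3 = C2_add(1)[OF A1 A2]
  show ?B
    unfolding eq fderiv2_add[OF A0 A3] fderiv2_add[OF A1 A2] fderiv2_linear_compose[OF I C2_dyn2[OF f]]
      fderiv2_linear_compose[OF I D1(1)] fderiv2_linear_compose[OF I D2(1)] D1(3) D2(3) fderiv2_dyn2[OF f]
    by (simp add: inner_prod_def)
  have CH: "C2 ?H" by (rule C2_add(1)[OF A0 A3])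
  have DH: "fderiv ?H x h = q \<bullet> fderiv (dyn2 T f) x h + (fst \<mu> \<bullet> fderiv c (fst (snd x)) (fst (snd h)) + snd \<mu> \<bullet> fderiv c (snd (snd x)) (snd (snd h)))" for x h
    unfolding C2_add(2)[OF A0 A3] C2_add(2)[OF A1 A2] plus_blinfun.rep_eq fderiv_linear_compose[OF I C2_dyn2[OF f]]
      fderiv_linear_compose[OF I D1(1)] fderiv_linear_compose[OF I D2(1)] D1(2) D2(2) by simp
  have l': "bounded_linear (\<lambda>w :: 'm control2. (0 :: 'n state2, w))"
    by (intro bounded_linear_Pair bounded_linear_ident bounded_linear_zero)
  note W = fderiv_compose_affine[OF l' CH, of "((y1, y2, \<xi>), 0)"]
  have eq': "(\<lambda>w. aug_hamiltonian T f c (y1, y2, \<xi>) q w \<mu>) = (\<lambda>w. ?H ((0, w) + ((y1, y2, \<xi>), 0)))"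
    by (auto simp: aug_hamiltonian_def hamiltonian_def fun_eq_iff)
  have C': "C2 (\<lambda>w. aug_hamiltonian T f c (y1, y2, \<xi>) q w \<mu>)" unfolding eq' by (rule W(1))
  have "grad (\<lambda>w. aug_hamiltonian T f c (y1, y2, \<xi>) q w \<mu>) (v1, v2) \<bullet> (h1, h2) = fderiv ?H ((y1, y2, \<xi>), (v1, v2)) ((0, 0, 0), (h1, h2))"
    unfolding grad_inner[OF C'] unfolding eq' W(2) by (simp add: zero_prod_def)
  then show ?A
    unfolding DH fderiv_dyn2[OF f] by (simp add: inner_prod_def)
qed

text \<open>Translation between the problem (P) and the two arcs. The reference control agrees with
  \<open>(v1, v2)\<close> only almost everywhere, and \<open>costate\<close> is an arbitrary choice,
  so the costate in \<open>Omega\<close> is identified with the constructed one by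
  uniqueness.\<close>

lemma second_order_condition:
  fixes f :: "(real ^ 'n) \<times> (real ^ 'm) \<Rightarrow> real ^ 'n" and c :: "real ^ 'm \<Rightarrow> real ^ 'l"
  assumes core: "crisis_core f c \<phi> g \<epsilon> \<delta> T \<tau> k \<rho> y1 y2 v1 v2 E"
    and Y: "\<And>s. s \<in> {0..1} \<Longrightarrow> Y s = (y1 s, y2 s, \<tau>)"
    and V: "AE s in leb01. V s = (v1 s, v2 s)"
    and d: "d \<in> critical_cone T f \<phi> g c Y V"
  shows "\<exists>m \<in> lagrange_multipliers T f \<phi> g c Y V. 0 \<le> Omega T f \<phi> g c Y V m d"
proof -
  interpret crisis_core f c \<phi> g \<epsilon> \<delta> T \<tau> k \<rho> y1 y2 v1 v2 E by (rule core)
  obtain \<delta>y \<delta>v where dd: "d = (\<delta>y, \<delta>v)" by (cases d)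
  define d1 where "d1 = (\<lambda>s. fst (\<delta>y s))"
  define d2 where "d2 = (\<lambda>s. fst (snd (\<delta>y s)))"
  define x where "x = (\<lambda>s. snd (snd (\<delta>y s)))"
  define h1 where "h1 = (\<lambda>s. fst (\<delta>v s))"
  define h2 where "h2 = (\<lambda>s. snd (\<delta>v s))"
  define d\<xi> where "d\<xi> = x 0"
  have dy: "\<delta>y s = (d1 s, d2 s, x s)" and dv: "\<delta>v s = (h1 s, h2 s)" for s
    by (simp_all add: d1_def d2_def x_def h1_def h2_def)
  have crit: "abs_cont_on 0 1 \<delta>y" "L2_on 0 1 \<delta>v"
    "AE s in leb01. (\<delta>y has_vector_derivative fderiv (dyn2 T f) (Y s, V s) (\<delta>y s, \<delta>v s)) (at s within {0..1})"
    "case fderiv (endpoint_map g) (Y 0, Y 1) (\<delta>y 0, \<delta>y 1) of (e1, e2, e3, e4) \<Rightarrow> e1 = 0 \<and> e3 = 0 \<and> e4 = 0"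
    "\<forall>i. AE s in leb01.
       (c (fst (V s)) $ i = 0 \<longrightarrow> fderiv (\<lambda>w. c w $ i) (fst (V s)) (fst (\<delta>v s)) = 0) \<and>
       (c (snd (V s)) $ i = 0 \<longrightarrow> fderiv (\<lambda>w. c w $ i) (snd (V s)) (snd (\<delta>v s)) = 0)"
    using d unfolding dd critical_cone_def H1_on_def by auto
  have s01: "s \<in> {0..1}" if "s \<in> space leb01" for s :: real using that by simp
  have Y01: "Y 0 = (y1 0, y2 0, \<tau>)" "Y 1 = (y1 1, y2 1, \<tau>)" by (simp_all add: Y)
  have ends: "d1 0 = 0" "d2 0 = d1 1" "fderiv g (y1 1) (d1 1) = 0"
    using crit(4) unfolding fderiv_endpoint_map[OF g] by (simp_all add: Y01 dy)
  have DY: "AE s in leb01. (\<delta>y has_vector_derivative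
      (fderiv F (y1 s, V1 s) (d1 s, x s, h1 s), fderiv F (y2 s, V2 s) (d2 s, - x s, h2 s), 0)) (at s within {0..1})"
    using crit(3) V AE_space
  proof eventually_elim
    case (elim s)
    have "fderiv (dyn2 T f) (Y s, V s) (\<delta>y s, \<delta>v s) =
      (fderiv F (y1 s, V1 s) (d1 s, x s, h1 s), fderiv F (y2 s, V2 s) (d2 s, - x s, h2 s), 0)"
      unfolding Y[OF s01[OF elim(3)]] elim(2) dy dv V1_def V2_def by (rule fderiv_dyn2[OF f])
    then show ?case using elim(1) by simp
  qed
  have bl: "bounded_linear (\<lambda>z :: 'n state2. fst (snd z))" "bounded_linear (\<lambda>z :: 'n state2. snd (snd z))"
    by (intro bounded_linear_compose[OF bounded_linear_fst] bounded_linear_compose[OF bounded_linear_snd] bounded_linear_ident)+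
  have ac: "abs_cont_on 0 1 d1" "abs_cont_on 0 1 d2" "abs_cont_on 0 1 x"
    unfolding d1_def d2_def x_def
    by (rule abs_cont_on_linear[OF bounded_linear_fst crit(1)] abs_cont_on_linear[OF bl(1) crit(1)] abs_cont_on_linear[OF bl(2) crit(1)])+
  have xder: "AE s in leb01. (x has_vector_derivative 0) (at s within {0..1})"
    using DY
  proof eventually_elim
    case (elim s)
    from bounded_linear.has_vector_derivative[OF bl(2) elim] show ?case by (simp add: x_def)
  qed
  \<comment> \<open>The third component of the dynamics is 0, so the variation of the crossing time
    is a constant.\<close>
  have xc: "x t = d\<xi>" if t: "t \<in> {0..1}" for t
  proof -
    have "((\<lambda>s. 0) has_integral (x t - x 0)) {0..t}"
      by (rule abs_cont_on_has_integral_subinterval[OF ac(3) xder]) (use t in auto)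
    then have "x t - x 0 = 0" using has_integral_0 has_integral_unique by blast
    then show ?thesis by (simp add: d\<xi>_def)
  qed
  have D1: "AE s in leb01. (d1 has_vector_derivative fderiv F (y1 s, V1 s) (d1 s, d\<xi>, h1 s)) (at s within {0..1})"
    using DY AE_space
  proof eventually_elim
    case (elim s)
    from bounded_linear.has_vector_derivative[OF bounded_linear_fst elim(1)] show ?case
      unfolding xc[OF s01[OF elim(2)]] by (simp add: d1_def)
  qed
  have D2: "AE s in leb01. (d2 has_vector_derivative fderiv F (y2 s, V2 s) (d2 s, - d\<xi>, h2 s)) (at s within {0..1})"
    using DY AE_space
  proof eventually_elim
    case (elim s)
    from bounded_linear.has_vector_derivative[OF bl(1) elim(1)] show ?case
      unfolding xc[OF s01[OF elim(2)]] by (simp add: d2_def)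
  qed
  have vm: "\<delta>v \<in> borel_measurable leb01" and vi: "integrable leb01 (\<lambda>s. (norm (\<delta>v s))\<^sup>2)"
    using crit(2) by (auto simp: L2_on_def)
  have hm: "h1 \<in> borel_measurable leb01" "h2 \<in> borel_measurable leb01"
    unfolding h1_def h2_def
    by (rule measurable_compose[OF vm borel_measurable_continuous_onI]; intro continuous_intros)+
  have hn: "norm (h1 s) \<le> norm (\<delta>v s)" "norm (h2 s) \<le> norm (\<delta>v s)" for s
    unfolding h1_def h2_def by (metis norm_fst_le norm_snd_le prod.collapse)+
  have hi: "integrable leb01 (\<lambda>s. (norm (h s))\<^sup>2)"
    if "h \<in> borel_measurable leb01" "\<And>s. norm (h s) \<le> norm (\<delta>v s)" for h :: "real \<Rightarrow> real ^ 'm"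
  proof (rule Bochner_Integration.integrable_bound[OF vi])
    show "(\<lambda>s. (norm (h s))\<^sup>2) \<in> borel_measurable leb01" using that(1) by simp
    show "AE s in leb01. norm ((norm (h s))\<^sup>2) \<le> norm ((norm (\<delta>v s))\<^sup>2)"
      using that(2) by (intro AE_I2) (simp add: power_mono)
  qed
  have "AE s in leb01. \<forall>i\<in>UNIV.
       (c (fst (V s)) $ i = 0 \<longrightarrow> fderiv (\<lambda>w. c w $ i) (fst (V s)) (fst (\<delta>v s)) = 0) \<and>
       (c (snd (V s)) $ i = 0 \<longrightarrow> fderiv (\<lambda>w. c w $ i) (snd (V s)) (snd (\<delta>v s)) = 0)"
    by (rule AE_finite_allI) (use crit(5) in simp_all)
  then have act: "AE s in leb01. \<forall>i. (c (v1 s) $ i = 0 \<longrightarrow> fderiv c (v1 s) (h1 s) $ i = 0) \<and>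
     (c (v2 s) $ i = 0 \<longrightarrow> fderiv c (v2 s) (h2 s) $ i = 0)"
    using V by eventually_elim (simp add: fderiv_component[OF c] dv)
  have act1: "AE s in leb01. \<forall>i. c (v1 s) $ i = 0 \<longrightarrow> fderiv c (v1 s) (h1 s) $ i = 0"
    and act2: "AE s in leb01. \<forall>i. c (v2 s) $ i = 0 \<longrightarrow> fderiv c (v2 s) (h2 s) $ i = 0"
    using act by (eventually_elim, blast)+
  obtain P0 Pg p2 where co: "costates P0 Pg p2" by (rule costates_ex)
  obtain \<kappa> where \<kappa>: "0 \<le> \<kappa>" "\<kappa> \<le> k" "valid P0 Pg p2 \<kappa>"
    "0 \<le> fderiv2 \<phi> (y2 1) (d2 1) (d2 1) + \<kappa> * fderiv2 g (y1 1) (d1 1) (d1 1)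
      + (LINT s|leb01.
          (P0 s + \<kappa> *\<^sub>R Pg s) \<bullet> fderiv2 F (y1 s, V1 s) (d1 s, d\<xi>, h1 s) (d1 s, d\<xi>, h1 s)
          + p2 s \<bullet> fderiv2 F (y2 s, V2 s) (d2 s, - d\<xi>, h2 s) (d2 s, - d\<xi>, h2 s)
          + B1.mult (Hctrl (\<lambda>s. P0 s + \<kappa> *\<^sub>R Pg s) y1 V1) s \<bullet> fderiv2 c (v1 s) (h1 s) (h1 s)
          + B2.mult (Hctrl p2 y2 V2) s \<bullet> fderiv2 c (v2 s) (h2 s) (h2 s))"
    "(\<lambda>s. (P0 s + \<kappa> *\<^sub>R Pg s) \<bullet> fderiv2 F (y1 s, V1 s) (d1 s, d\<xi>, h1 s) (d1 s, d\<xi>, h1 s)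
          + p2 s \<bullet> fderiv2 F (y2 s, V2 s) (d2 s, - d\<xi>, h2 s) (d2 s, - d\<xi>, h2 s)
          + B1.mult (Hctrl (\<lambda>s. P0 s + \<kappa> *\<^sub>R Pg s) y1 V1) s \<bullet> fderiv2 c (v1 s) (h1 s) (h1 s)
          + B2.mult (Hctrl p2 y2 V2) s \<bullet> fderiv2 c (v2 s) (h2 s) (h2 s)) \<in> borel_measurable leb01"
    by (rule square_integrable_direction[OF co hm(1) hi[OF hm(1) hn(1)] hm(2) hi[OF hm(2) hn(2)] ac(1) ends(1) D1
      ac(2) ends(2) D2 act1 act2 ends(3)])
  define p1 where "p1 = (\<lambda>s. P0 s + \<kappa> *\<^sub>R Pg s)"
  define \<mu>1 where "\<mu>1 = B1.mult (Hctrl p1 y1 V1)"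
  define \<mu>2 where "\<mu>2 = B2.mult (Hctrl p2 y2 V2)"
  have cs: "p2 1 = grad \<phi> (y2 1)" "lip_path p2 (\<lambda>s. - fderiv_adj F (y2 s, V2 s) (p2 s))"
    "P0 1 = p2 0" "lip_path P0 (\<lambda>s. - fderiv_adj F (y1 s, V1 s) (P0 s))"
    "Pg 1 = grad g (y1 1)" "lip_path Pg (\<lambda>s. - fderiv_adj F (y1 s, V1 s) (Pg s))"
    using co by (auto simp: costates_def)
  have p1: "lip_path p1 (\<lambda>s. - fderiv_adj F (y1 s, V1 s) (p1 s))"
    using lip_path_add[OF cs(4) lip_path_scaleR[OF cs(6), of \<kappa>]] unfolding p1_def
    by (simp add: fderiv_adj_linear)
  have p1_1: "p1 1 = p2 0 + \<kappa> *\<^sub>R grad g (y1 1)" by (simp add: p1_def cs)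
  have val: "integral {0..1} (\<lambda>s. p1 s \<bullet> f (y1 s, v1 s)) - integral {0..1} (\<lambda>s. p2 s \<bullet> f (y2 s, v2 s)) = 1"
    "AE s in leb01.
      (\<forall>h. p1 s \<bullet> fderiv F (y1 s, V1 s) (0, 0, h) + \<mu>1 s \<bullet> fderiv c (v1 s) h = 0) \<and>
      (\<forall>i. 0 \<le> \<mu>1 s $ i \<and> \<mu>1 s $ i * c (v1 s) $ i = 0) \<and>
      (\<forall>h. p2 s \<bullet> fderiv F (y2 s, V2 s) (0, 0, h) + \<mu>2 s \<bullet> fderiv c (v2 s) h = 0) \<and>
      (\<forall>i. 0 \<le> \<mu>2 s $ i \<and> \<mu>2 s $ i * c (v2 s) $ i = 0)"
    using \<kappa>(3) unfolding valid_def p1_def \<mu>1_def \<mu>2_def by blast+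
  have Ym: "bmeas y1" "bmeas y2" by (rule bmeas_lip_path[OF Y1] bmeas_lip_path[OF Y2])+
  have pm: "bmeas p1" "bmeas p2" by (rule bmeas_lip_path[OF p1] bmeas_lip_path[OF cs(2)])+
  have fm: "bmeas (\<lambda>s. f (y1 s, v1 s))" "bmeas (\<lambda>s. f (y2 s, v2 s))"
    by (intro bmeas_C2[OF f] bmeas_Pair Ym v1 v2)+
  have Hm: "bmeas (\<lambda>s. p1 s \<bullet> f (y1 s, v1 s))" "bmeas (\<lambda>s. p2 s \<bullet> f (y2 s, v2 s))"
    by (intro bmeas_inner pm fm)+
  \<comment> \<open>Derivative of the third costate component \<open>l\<close>. It starts at 0
    because the second entry of \<open>\<beta>\<close> is 0 and must end at \<open>- 1\<close>, the
    derivative of the final cost in \<open>\<xi>\<close>; the integral condition in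
    \<open>valid\<close> says that it does.\<close>
  define e where "e = (\<lambda>s. p2 s \<bullet> f (y2 s, v2 s) - p1 s \<bullet> f (y1 s, v1 s))"
  define l where "l t = integral {0..t} e" for t
  have em: "bmeas e"
    using bmeas_add[OF Hm(2) bmeas_mult[OF bmeas_const[of "- 1"] Hm(1)]] by (simp add: e_def)
  have l0: "l 0 = 0" by (simp add: l_def)
  have l1: "l 1 = - 1"
    using val(1) Henstock_Kurzweil_Integration.integral_diff[OF bmeas_integrable(1)[OF Hm(2)] bmeas_integrable(1)[OF Hm(1)]]
    by (simp add: l_def e_def)
  have lip: "lip_path l e"
  proof -
    obtain M where M: "0 < M" "\<forall>s\<in>{0..1}. norm (e s) \<le> M" by (rule bmeas_boundE[OF em])
    show ?thesis
    proof (rule lip_pathI_integral[OF bmeasD1[OF em]])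
      show "norm (e s) \<le> M" if "s \<in> {0..1}" for s using M(2) that by blast
      show "(e has_integral (l t - l 0)) {0..t}" if "t \<in> {0..1}" for t
      proof -
        have "e integrable_on {0..t}"
          by (rule integrable_subinterval_real[OF bmeas_integrable(1)[OF em]]) (use that in auto)
        then show ?thesis unfolding l0 by (simp add: l_def integrable_integral)
      qed
    qed
  qed
  \<comment> \<open>Read off from the condition at time 0. The junction entry also fits the
    condition at time 1, because
    \<open>p1 1 = p2 0 + \<kappa> *\<^sub>R grad g (y1 1)\<close>.\<close>
  define \<beta> where "\<beta> = (- p1 0, 0 :: real, - p2 0, \<kappa>)"
  define \<mu> where "\<mu> = (\<lambda>s. (\<mu>1 s, \<mu>2 s))"
  let ?D = "\<lambda>q s. - (fderiv_adj F (y1 s, V1 s) (fst (q s)), fderiv_adj F (y2 s, V2 s) (fst (snd (q s))),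
      fst (q s) \<bullet> f (y1 s, v1 s) - fst (snd (q s)) \<bullet> f (y2 s, v2 s))"
  have costate_iff: "is_costate T f \<phi> g Y V 1 \<beta> q \<longleftrightarrow> abs_cont_on 0 1 q \<and>
      (AE s in leb01. (q has_vector_derivative ?D q s) (at s within {0..1})) \<and>
      q 0 = (p1 0, p2 0, 0) \<and> q 1 = (p1 1, p2 1, - 1)" for q
  proof -
    have "AE s in leb01. (q has_vector_derivative - grad (\<lambda>z. hamiltonian T f z (q s) (V s)) (Y s)) (at s within {0..1})
       = (q has_vector_derivative ?D q s) (at s within {0..1})"
      using V AE_space
    proof eventually_elim
      case (elim s)
      show ?case unfolding elim(1) Y[OF s01[OF elim(2)]] grad_hamiltonian[OF f] V1_def V2_def ..
    qed
    from eventually_subst[OF this]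
    have 1: "(AE s in leb01. (q has_vector_derivative - grad (\<lambda>z. hamiltonian T f z (q s) (V s)) (Y s)) (at s within {0..1}))
       \<longleftrightarrow> (AE s in leb01. (q has_vector_derivative ?D q s) (at s within {0..1}))" .
    have 2: "- q 0 = adjoint (fderiv (\<lambda>z. endpoint_map g (z, Y 1)) (Y 0)) \<beta> \<longleftrightarrow> q 0 = (p1 0, p2 0, 0)"
      unfolding \<beta>_def adjoint_endpoint_map[OF g] by (auto simp: minus_equation_iff[of "q 0"])
    have 3: "q 1 = adjoint (fderiv (\<lambda>z. endpoint_map g (Y 0, z)) (Y 1)) \<beta> + 1 *\<^sub>R grad (final_cost T \<phi>) (Y 1)
      \<longleftrightarrow> q 1 = (p1 1, p2 1, - 1)"
      unfolding \<beta>_def adjoint_endpoint_map[OF g] grad_final_cost[OF \<phi>] by (simp add: Y01 p1_1 cs(1))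
    show ?thesis unfolding is_costate_def 1 2 3 ..
  qed
  have q0: "is_costate T f \<phi> g Y V 1 \<beta> (\<lambda>s. (p1 s, p2 s, l s))"
  proof -
    have L: "lip_path (\<lambda>s. (p1 s, p2 s, l s)) (\<lambda>s. (- fderiv_adj F (y1 s, V1 s) (p1 s), - fderiv_adj F (y2 s, V2 s) (p2 s), e s))"
      by (rule lip_path_Pair[OF p1 lip_path_Pair[OF cs(2) lip]])
    show ?thesis unfolding costate_iff
      using lip_path_abs_cont[OF L] lip_path_deriv[OF L] by (simp add: l0 l1 e_def)
  qed
  define q where "q = costate T f \<phi> g Y V 1 \<beta>"
  have "is_costate T f \<phi> g Y V 1 \<beta> q" unfolding q_def costate_def by (rule someI[of "is_costate T f \<phi> g Y V 1 \<beta>", OF q0])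
  then have qc: "abs_cont_on 0 1 q" "AE s in leb01. (q has_vector_derivative ?D q s) (at s within {0..1})"
    "q 1 = (p1 1, p2 1, - 1)"
    unfolding costate_iff by blast+
  \<comment> \<open>Only the first two components of the costate enter the Hessian, as the third
    component of \<open>dyn2\<close> is 0.\<close>
  have q1: "fst (q t) = p1 t" if t: "t \<in> {0..1}" for t
  proof (rule adjoint_unique[OF F V1 Ym(1) _ _ _ p1 _ t])
    show ac1: "abs_cont_on 0 1 (\<lambda>s. fst (q s))" by (rule abs_cont_on_linear[OF bounded_linear_fst qc(1)])
    show "continuous_on {0..1} (\<lambda>s. fst (q s))" by (rule abs_cont_on_continuous[OF ac1])
    show "AE s in leb01. ((\<lambda>s. fst (q s)) has_vector_derivative - fderiv_adj F (y1 s, V1 s) (fst (q s))) (at s within {0..1})"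
      using qc(2)
    proof eventually_elim
      case (elim s)
      from bounded_linear.has_vector_derivative[OF bounded_linear_fst elim] show ?case by simp
    qed
    show "fst (q 1) = p1 1" by (simp add: qc)
  qed
  have q2: "fst (snd (q t)) = p2 t" if t: "t \<in> {0..1}" for t
  proof (rule adjoint_unique[OF F V2 Ym(2) _ _ _ cs(2) _ t])
    show ac2: "abs_cont_on 0 1 (\<lambda>s. fst (snd (q s)))" by (rule abs_cont_on_linear[OF bl(1) qc(1)])
    show "continuous_on {0..1} (\<lambda>s. fst (snd (q s)))" by (rule abs_cont_on_continuous[OF ac2])
    show "AE s in leb01. ((\<lambda>s. fst (snd (q s))) has_vector_derivative - fderiv_adj F (y2 s, V2 s) (fst (snd (q s)))) (at s within {0..1})"
      using qc(2)
    proof eventually_elim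
      case (elim s)
      from bounded_linear.has_vector_derivative[OF bl(1) elim] show ?case by simp
    qed
    show "fst (snd (q 1)) = p2 1" by (simp add: qc)
  qed
  have \<mu>m: "bmeas \<mu>"
    unfolding \<mu>_def \<mu>1_def \<mu>2_def
    by (intro bmeas_Pair B1.bmeas_mult_ctrl B2.bmeas_mult_ctrl bmeas_Hctrl pm Ym V1 V2)
  have "(1, \<beta>, \<mu>) \<in> lagrange_multipliers T f \<phi> g c Y V"
    unfolding lagrange_multipliers_def mem_Collect_eq prod.case
  proof (intro conjI exI)
    show "Linf_on 0 1 \<mu>"
    proof -
      obtain M where M: "0 < M" "\<forall>s\<in>{0..1}. norm (\<mu> s) \<le> M" by (rule bmeas_boundE[OF \<mu>m])
      have "AE s in leb01. norm (\<mu> s) \<le> M" using AE_space by eventually_elim (use M(2) in auto)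
      then show ?thesis unfolding Linf_on_def using bmeasD1[OF \<mu>m] by blast
    qed
    show "fst (snd \<beta>) = 0" by (simp add: \<beta>_def)
    show "AE s in leb01. (\<forall>i. 0 \<le> fst (\<mu> s) $ i \<and> 0 \<le> snd (\<mu> s) $ i) \<and>
       fst (\<mu> s) \<bullet> c (fst (V s)) + snd (\<mu> s) \<bullet> c (snd (V s)) = 0"
      using V val(2)
    proof eventually_elim
      case (elim s)
      then have "\<mu>1 s $ i * c (v1 s) $ i = 0" "\<mu>2 s $ i * c (v2 s) $ i = 0" "0 \<le> \<mu>1 s $ i" "0 \<le> \<mu>2 s $ i" for i by blast+
      then show ?case by (simp only: elim(1) \<mu>_def inner_vec_def inner_real_def fst_conv snd_conv sum.neutral_const) simp
    qed
    show "is_costate T f \<phi> g Y V 1 \<beta> (\<lambda>s. (p1 s, p2 s, l s))" by (rule q0)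
    show "AE s in leb01. grad (\<lambda>w. aug_hamiltonian T f c (Y s) (p1 s, p2 s, l s) w (\<mu> s)) (V s) = 0"
      using V val(2) AE_space
    proof eventually_elim
      case (elim s)
      have "grad (\<lambda>w. aug_hamiltonian T f c (y1 s, y2 s, \<tau>) (p1 s, p2 s, l s) w (\<mu> s)) (v1 s, v2 s) \<bullet> h = 0 \<bullet> h" for h
      proof -
        obtain a b where h: "h = (a, b)" by (cases h)
        have "p1 s \<bullet> fderiv F (y1 s, V1 s) (0, 0, a) + \<mu>1 s \<bullet> fderiv c (v1 s) a = 0"
          "p2 s \<bullet> fderiv F (y2 s, V2 s) (0, 0, b) + \<mu>2 s \<bullet> fderiv c (v2 s) b = 0" using elim(2) by blast+
        then show ?thesis unfolding h grad_aug_hamiltonian[OF f c] by (simp add: \<mu>_def V1_def V2_def)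
      qed
      then have "grad (\<lambda>w. aug_hamiltonian T f c (y1 s, y2 s, \<tau>) (p1 s, p2 s, l s) w (\<mu> s)) (v1 s, v2 s) = 0"
        using vector_eq_rdot by blast
      then show ?case unfolding elim(1) Y[OF s01[OF elim(3)]] .
    qed
  qed simp_all
  moreover have "0 \<le> Omega T f \<phi> g c Y V (1, \<beta>, \<mu>) d"
  proof -
    let ?K = "\<lambda>s. p1 s \<bullet> fderiv2 F (y1 s, V1 s) (d1 s, d\<xi>, h1 s) (d1 s, d\<xi>, h1 s)
          + p2 s \<bullet> fderiv2 F (y2 s, V2 s) (d2 s, - d\<xi>, h2 s) (d2 s, - d\<xi>, h2 s)
          + \<mu>1 s \<bullet> fderiv2 c (v1 s) (h1 s) (h1 s) + \<mu>2 s \<bullet> fderiv2 c (v2 s) (h2 s) (h2 s)"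
    let ?J = "\<lambda>s. fderiv (fderiv (\<lambda>(z, w). aug_hamiltonian T f c z (q s) w (\<mu> s))) (Y s, V s) (\<delta>y s, \<delta>v s) (\<delta>y s, \<delta>v s)"
    have Km: "?K \<in> borel_measurable leb01" using \<kappa>(5) by (simp only: p1_def \<mu>1_def \<mu>2_def)
    have KJ: "AE s in leb01. ?K s = ?J s"
      using V AE_space
    proof eventually_elim
      case (elim s)
      note s = s01[OF elim(2)]
      show ?case
        unfolding elim(1) Y[OF s] dy dv fderiv2_aug_hamiltonian[OF f c] q1[OF s] q2[OF s] xc[OF s]
        by (simp add: \<mu>_def V1_def V2_def)
    qed
    \<comment> \<open>Lebesgue measure is complete, so measurability passes to a function that
      agrees almost everywhere.\<close>
    have KJi: "integral\<^sup>L leb01 ?J = integral\<^sup>L leb01 ?K"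
      by (rule sym, rule integral_cong_AE[OF Km measurable_lebesgue_on_AE_eq[OF Km KJ] KJ])
    have "Omega T f \<phi> g c Y V (1, \<beta>, \<mu>) d = fderiv2 \<phi> (y2 1) (d2 1) (d2 1) + \<kappa> * fderiv2 g (y1 1) (d1 1) (d1 1)
      + integral\<^sup>L leb01 ?J"
      unfolding Omega_def dd prod.case Let_def q_def[symmetric] fderiv2_final_cost[OF \<phi>] fderiv2_endpoint_map[OF g]
      by (simp add: \<beta>_def Y01 dy inner_prod_def)
    then show ?thesis unfolding KJi using \<kappa>(4) by (simp only: p1_def \<mu>1_def \<mu>2_def)
  qed
  ultimately show ?thesis by blast
qed

section \<open>Regularity and signs of the reference data\<close>

lemma AE_greaterThanLessThan_imp_Icc:
  assumes "AE t in lebesgue_on {a<..<b :: real}. P t"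
  shows "AE t in lebesgue_on {a..b}. P t"
proof -
  have "AE t in lebesgue. t \<notin> {a, b}"
    by (rule AE_not_in) (simp flip: negligible_iff_null_sets)
  moreover have "AE t in lebesgue. t \<in> {a<..<b} \<longrightarrow> P t"
    using assms by (simp add: AE_restrict_space_iff)
  ultimately have "AE t in lebesgue. t \<in> {a..b} \<longrightarrow> P t" by eventually_elim auto
  then show ?thesis by (simp add: AE_restrict_space_iff)
qed

text \<open>On the exceptional null set the function is replaced by one of its own good values, so
  no other point satisfying \<open>P\<close> has to be known.\<close>

lemma bounded_modification:
  fixes w :: "real \<Rightarrow> 'a::euclidean_space"
  assumes w: "w \<in> borel_measurable leb01" and ae: "AE s in leb01. P (w s)"
    and bd: "\<And>u. P u \<Longrightarrow> norm u \<le> M"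
  obtains v where "bmeas v" "\<forall>s\<in>{0..1}. P (v s)" "AE s in leb01. v s = w s"
proof -
  obtain N where N: "negligible N" "\<forall>s\<in>{0..1} - N. P (w s)" by (rule AE_lebesgue_onE[OF ae])
  have "\<not> {0..1 :: real} \<subseteq> N"
    using negligible_subset[OF N(1)] negligible_interval(1)[of "0 :: real" 1] by (auto simp: box_real)
  then obtain s0 where s0: "s0 \<in> {0..1}" "s0 \<notin> N" by blast
  define v where "v = (\<lambda>s. if s \<in> {0..1} - N then w s else w s0)"
  have P: "P (v s)" for s using N(2) s0 by (simp add: v_def)
  have eq: "AE s in leb01. w s = v s" by (rule AE_lebesgue_onI[OF N(1)]) (simp add: v_def)
  have "bmeas v" unfolding bmeas_def using measurable_lebesgue_on_AE_eq[OF w eq] bd[OF P] by blast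
  then show ?thesis by (rule that) (use P eq in \<open>auto elim: eventually_mono\<close>)
qed

lemma state_lipschitz:
  fixes f :: "'y::euclidean_space \<times> 'v::euclidean_space \<Rightarrow> 'y"
  assumes f: "C2 f" and x: "is_state T f x0 u x" and u: "Linf_on 0 T u"
  obtains L where "L-lipschitz_on {0..T} x"
proof -
  have ac: "abs_cont_on 0 T x" and der: "AE t in lebesgue_on {0..T}. (x has_vector_derivative f (x t, u t)) (at t within {0..T})"
    using x by (auto simp: is_state_def)
  have um: "u \<in> borel_measurable (lebesgue_on {0..T})" using u by (simp add: Linf_on_def)
  obtain M where M: "AE t in lebesgue_on {0..T}. norm (u t) \<le> M" using u by (auto simp: Linf_on_def)
  have xc: "continuous_on {0..T} x" by (rule abs_cont_on_continuous[OF ac])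
  have xm: "x \<in> borel_measurable (lebesgue_on {0..T})" by (rule continuous_imp_measurable_on_sets_lebesgue[OF xc]) simp
  have "bounded (x ` {0..T})" by (intro compact_imp_bounded compact_continuous_image xc compact_Icc)
  then obtain B where B: "\<forall>t\<in>{0..T}. norm (x t) \<le> B" unfolding bounded_iff by auto
  obtain C where C: "0 < C" "\<forall>z. norm z \<le> B + M \<longrightarrow> norm (f z) \<le> C \<and> norm (fderiv f z) \<le> C \<and> norm (fderiv2 f z) \<le> C"
    by (rule C2_bounded_derivatives[OF f])
  have "(\<lambda>t. f (x t, u t)) \<in> borel_measurable (lebesgue_on {0..T})"
    by (rule measurable_compose[OF borel_measurable_Pair[OF xm um] borel_measurable_continuous_onI[OF C2_continuous[OF f]]])
  moreover have "AE t in lebesgue_on {0..T}. norm (f (x t, u t)) \<le> C"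
    using M AE_space
  proof eventually_elim
    case (elim t)
    have "norm (x t, u t) \<le> norm (x t) + norm (u t)" by (rule norm_Pair_le)
    also have "\<dots> \<le> B + M" using elim B by (intro add_mono) auto
    finally show ?case using C(2) by blast
  qed
  moreover have "((\<lambda>s. f (x s, u s)) has_integral (x t - x 0)) {0..t}" if "t \<in> {0..T}" for t
    by (rule abs_cont_on_has_integral_subinterval[OF ac der]) (use that in auto)
  ultimately have "C-lipschitz_on {0..T} x"
    by (rule indefinite_integral_AE_derivative(1)[OF _ _ _ less_imp_le[OF C(1)]])
  then show ?thesis by (rule that)
qed

lemma connected_neg:
  fixes h :: "'a::topological_space \<Rightarrow> real"
  assumes S: "connected S" and h: "continuous_on S h" and nz: "\<And>s. s \<in> S \<Longrightarrow> h s \<noteq> 0"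
    and s0: "s0 \<in> S" "h s0 < 0" and s: "s \<in> S"
  shows "h s < 0"
proof (rule ccontr)
  assume "\<not> h s < 0"
  then have "0 \<in> {h s0..h s}" using s0 by simp
  also have "{h s0..h s} \<subseteq> h ` S"
    by (rule connected_contains_Icc[OF connected_continuous_image[OF h S]]) (use s0 s in auto)
  finally show False using nz by (metis imageE)
qed

text \<open>Off the crossing time \<open>g\<close> has no zero along the trajectory, so by
  connectedness its sign on each side is the one seen near the crossing. The normal speed is nonzero
  and cannot be negative: \<open>g\<close> would then decrease to 0 at \<open>\<tau>\<close> and be
  positive just before.\<close>

lemma outward_crossing:
  fixes f :: "'x::euclidean_space \<times> 'v::euclidean_space \<Rightarrow> 'x" and g :: "'x \<Rightarrow> real"
  assumes f: "C2 f" and g: "C2 g" and tau: "\<tau> \<in> {0<..<T}"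
    and L: "L-lipschitz_on {0..T} x" and x: "is_state T f x0 u x" and lim: "(u \<longlongrightarrow> u_left) (at_left \<tau>)"
    and cross: "crosses_out {x. g x \<le> 0} x \<tau>" and nz: "\<forall>t\<in>{0..T} - {\<tau>}. g (x t) \<noteq> 0"
    and trans: "f (x \<tau>, u_left) \<bullet> grad g (x \<tau>) \<noteq> 0"
  shows "g (x \<tau>) = 0" and "t \<in> {0..<\<tau>} \<Longrightarrow> g (x t) < 0" and "t \<in> {\<tau><..T} \<Longrightarrow> 0 < g (x t)"
    and "0 < fderiv g (x \<tau>) (f (x \<tau>, u_left))" (is ?D)
proof -
  have t: "0 < \<tau>" "\<tau> < T" using tau by auto
  have xc: "continuous_on {0..T} x" by (rule lipschitz_on_continuous_on[OF L])
  have gc: "continuous_on {0..T} (\<lambda>t. g (x t))" by (rule continuous_on_compose2[OF C2_continuous[OF g] xc]) simp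
  obtain \<eta> where \<eta>: "0 < \<eta>" "\<forall>t\<in>{\<tau> - \<eta><..\<tau>}. g (x t) \<le> 0" "\<forall>t\<in>{\<tau><..<\<tau> + \<eta>}. \<not> g (x t) \<le> 0"
    using cross unfolding crosses_out_def by auto
  have neg: "g (x t) < 0" if "t \<in> {0..<\<tau>}" for t
  proof (rule connected_neg[where S="{0..<\<tau>}" and h="\<lambda>t. g (x t)"])
    show "continuous_on {0..<\<tau>} (\<lambda>t. g (x t))" by (rule continuous_on_subset[OF gc]) (use t in auto)
    show "g (x s) \<noteq> 0" if "s \<in> {0..<\<tau>}" for s by (rule nz[rule_format]) (use that t in auto)
    show m: "max 0 (\<tau> - \<eta> / 2) \<in> {0..<\<tau>}" using t \<eta>(1) by auto
    have "g (x (max 0 (\<tau> - \<eta> / 2))) \<le> 0" using \<eta>(1) t by (intro \<eta>(2)[rule_format]) auto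
    moreover have "g (x (max 0 (\<tau> - \<eta> / 2))) \<noteq> 0" by (rule nz[rule_format]) (use m t in auto)
    ultimately show "g (x (max 0 (\<tau> - \<eta> / 2))) < 0" by simp
  qed (use that in auto)
  have pos: "0 < g (x t)" if "t \<in> {\<tau><..T}" for t
  proof -
    have "- g (x t) < 0"
    proof (rule connected_neg[where S="{\<tau><..T}" and h="\<lambda>t. - g (x t)"])
      show "continuous_on {\<tau><..T} (\<lambda>t. - g (x t))"
        by (intro continuous_on_minus continuous_on_subset[OF gc]) (use t in auto)
      show "- g (x s) \<noteq> 0" if "s \<in> {\<tau><..T}" for s using nz[rule_format, of s] that t by auto
      show "min T (\<tau> + \<eta> / 2) \<in> {\<tau><..T}" using t \<eta>(1) by auto
      have "\<not> g (x (min T (\<tau> + \<eta> / 2))) \<le> 0" using \<eta>(1) t by (intro \<eta>(3)[rule_format]) auto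
      then show "- g (x (min T (\<tau> + \<eta> / 2))) < 0" by simp
    qed (use that in auto)
    then show ?thesis by simp
  qed
  have gt: "isCont (\<lambda>t. g (x t)) \<tau>" by (rule continuous_on_interior[OF gc]) (use t in simp)
  have zero: "g (x \<tau>) = 0"
  proof (rule antisym)
    show "g (x \<tau>) \<le> 0" using \<eta> by simp
    have "((\<lambda>t. g (x t)) \<longlongrightarrow> g (x \<tau>)) (at_right \<tau>)" using gt by (auto simp: isCont_def intro: tendsto_within_subset)
    moreover have "eventually (\<lambda>t. 0 \<le> g (x t)) (at_right \<tau>)"
      using eventually_at_right_real[OF t(2)] by eventually_elim (use pos in \<open>auto simp: less_imp_le\<close>)
    ultimately show "0 \<le> g (x \<tau>)" by (rule tendsto_lowerbound) simp
  qed
  have "\<not> fderiv g (x \<tau>) (f (x \<tau>, u_left)) < 0"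
  proof
    define \<gamma> where "\<gamma> = fderiv g (x \<tau>) (f (x \<tau>, u_left))"
    assume "fderiv g (x \<tau>) (f (x \<tau>, u_left)) < 0"
    then have \<gamma>: "\<gamma> < \<gamma> / 2" "\<gamma> < 0" by (simp_all add: \<gamma>_def)
    have "isCont x \<tau>" by (rule continuous_on_interior[OF xc]) (use t in simp)
    then have xl: "(x \<longlongrightarrow> x \<tau>) (at_left \<tau>)" by (auto simp: isCont_def intro: tendsto_within_subset)
    have fl: "((\<lambda>t. f (x t, u t)) \<longlongrightarrow> f (x \<tau>, u_left)) (at_left \<tau>)"
      by (rule isCont_tendsto_compose[OF _ tendsto_Pair[OF xl lim]])
         (use C2_continuous[OF f] in \<open>simp add: continuous_on_eq_continuous_at\<close>)
    have gl: "((\<lambda>t. fderiv g (x t)) \<longlongrightarrow> fderiv g (x \<tau>)) (at_left \<tau>)"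
      by (rule isCont_tendsto_compose[OF _ xl])
         (use C2_continuous_fderiv[OF g] in \<open>simp add: continuous_on_eq_continuous_at\<close>)
    have "((\<lambda>t. fderiv g (x t) (f (x t, u t))) \<longlongrightarrow> \<gamma>) (at_left \<tau>)"
      unfolding \<gamma>_def by (rule bounded_bilinear.tendsto[OF bounded_bilinear_blinfun_apply gl fl])
    from order_tendstoD(2)[OF this \<gamma>(1)]
    obtain b where b: "b < \<tau>" "\<forall>t>b. t < \<tau> \<longrightarrow> fderiv g (x t) (f (x t, u t)) < \<gamma> / 2"
      unfolding eventually_at_left_field by (elim exE conjE) (rule that)
    have "AE t in lebesgue_on {0..T}. (x has_vector_derivative f (x t, u t)) (at t within {0..T})"
      using x by (simp add: is_state_def)
    then have lp: "lip_path (\<lambda>s. x (\<tau> * s + 0)) (\<lambda>s. \<tau> *\<^sub>R f (x (\<tau> * s + 0), u (\<tau> * s + 0)))"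
      by (rule lip_path_affine[OF L]) (use t in auto)
    note lg = lip_path_linear[OF bounded_linear_minus[OF bounded_linear_ident] lip_path_C2[OF g lp]]
    define r where "r = b / \<tau>"
    \<comment> \<open>Strictly between \<open>b / \<tau>\<close> and 1, so that the negative speed
      holds on all of \<open>{a..<1}\<close>.\<close>
    define a where "a = max 0 ((r + 1) / 2)"
    have r: "r < 1" using b(1) t by (simp add: r_def)
    have a: "0 \<le> a" "a < 1" "r < a" using r by (auto simp: a_def less_max_iff_disj)
    have "(- (\<tau> * (\<gamma> / 2))) * (1 - a) \<le> - g (x (\<tau> * 1 + 0)) - - g (x (\<tau> * a + 0))"
    proof (rule lip_path_increment_ge[OF lg])
      show "AE s in lebesgue_on {a..1}. - (\<tau> * (\<gamma> / 2)) \<le> - fderiv g (x (\<tau> * s + 0)) (\<tau> *\<^sub>R f (x (\<tau> * s + 0), u (\<tau> * s + 0)))"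
      proof (rule AE_lebesgue_onI[of "{1}"])
        fix s :: real assume s: "s \<in> {a..1} - {1}"
        then have "r < s" using a by auto
        then have "b < \<tau> * s" using t by (simp add: r_def pos_divide_less_eq mult.commute)
        moreover have "\<tau> * s < \<tau>" using s t by auto
        ultimately have "fderiv g (x (\<tau> * s)) (f (x (\<tau> * s), u (\<tau> * s))) < \<gamma> / 2" using b(2) by blast
        then have "\<tau> * fderiv g (x (\<tau> * s)) (f (x (\<tau> * s), u (\<tau> * s))) \<le> \<tau> * (\<gamma> / 2)" using t by (intro mult_left_mono) auto
        then show "- (\<tau> * (\<gamma> / 2)) \<le> - fderiv g (x (\<tau> * s + 0)) (\<tau> *\<^sub>R f (x (\<tau> * s + 0), u (\<tau> * s + 0)))"
          by (simp add: blinfun.scaleR_right)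
      qed simp
    qed (use a in auto)
    moreover have "0 < (- (\<tau> * (\<gamma> / 2))) * (1 - a)" using t \<gamma>(2) a by (intro mult_pos_pos) (auto simp: mult_less_0_iff)
    moreover have "g (x (\<tau> * a)) < 0" by (rule neg) (use a t in auto)
    ultimately show False using zero by simp
  qed
  moreover have "fderiv g (x \<tau>) (f (x \<tau>, u_left)) \<noteq> 0"
    using trans by (simp add: inner_commute grad_inner[OF g])
  ultimately show ?D by linarith
  show "g (x \<tau>) = 0" "t \<in> {0..<\<tau>} \<Longrightarrow> g (x t) < 0" "t \<in> {\<tau><..T} \<Longrightarrow> 0 < g (x t)" by (fact zero neg pos)+
qed

theorem lemma4p3:
  fixes T :: real
    and x0 :: "real ^ 'n"
    and U :: "(real ^ 'm) set"
    and f :: "(real ^ 'n) \<times> (real ^ 'm) \<Rightarrow> real ^ 'n"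
    and c1 c2 :: real
    and \<phi> :: "real ^ 'n \<Rightarrow> real"
    and K :: "(real ^ 'n) set"
    and ubar :: "real \<Rightarrow> real ^ 'm"
    and xbar :: "real \<Rightarrow> real ^ 'n"
    and c :: "real ^ 'm \<Rightarrow> real ^ 'l"
    and \<epsilon> \<delta> :: real
    and g :: "real ^ 'n \<Rightarrow> real"
    and \<tau> :: real
    and u_left u_right :: "real ^ 'm"
  assumes T_pos: "0 < T"
    and U_closed: "U \<noteq> {}" "closed U"
    and f_C2: "C2 f"
    and f_growth: "0 < c1" "0 < c2" "\<And>x u. u \<in> U \<Longrightarrow> norm (f (x, u)) \<le> c1 * norm x + c2"
    and f_convex: "\<And>x. (\<lambda>u. f (x, u)) ` U \<noteq> {}" "\<And>x. compact ((\<lambda>u. f (x, u)) ` U)"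
                  "\<And>x. convex ((\<lambda>u. f (x, u)) ` U)"
    and phi_C2: "C2 \<phi>"
    and K_closed: "closed K" "interior K \<noteq> {}"
    and ubar_control: "ubar \<in> controls T U"
    and ubar_bounded: "Linf_on 0 T ubar"
    and xbar_state: "is_state T f x0 ubar xbar"
    and minimizer: "\<And>u x. u \<in> controls T U \<Longrightarrow> is_state T f x0 u x \<Longrightarrow>
                      crisis_cost T \<phi> K xbar \<le> crisis_cost T \<phi> K x"
    and c_C2: "C2 c"
    and U_eq: "U = {u. \<forall>i. c u $ i \<le> 0}"
    and c_qualified: "0 < \<epsilon>" "0 < \<delta>"
      "AE t in lebesgue_on {0<..<T}. let I = {i. c (ubar t) $ i \<ge> - \<delta>} in
         \<forall>\<xi> :: 'l \<Rightarrow> real.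
           \<epsilon> * L2_set \<xi> I \<le> norm (\<Sum>i\<in>I. \<xi> i *\<^sub>R grad (\<lambda>u. c u $ i) (ubar t))"
    and g_C2: "C2 g"
    and K_eq: "K = {x. g x \<le> 0}"
    and tau: "\<tau> \<in> {0<..<T}"
    and tau_crossing: "crosses_out K xbar \<tau>"
    and tau_unique: "\<And>t. t \<in> {0<..<T} \<Longrightarrow> crosses_out K xbar t \<or> crosses_in K xbar t \<Longrightarrow> t = \<tau>"
    and ubar_limits: "(ubar \<longlongrightarrow> u_left) (at_left \<tau>)" "(ubar \<longlongrightarrow> u_right) (at_right \<tau>)"
    and transverse: "f (xbar \<tau>, u_left) \<bullet> grad g (xbar \<tau>) \<noteq> 0"
                    "f (xbar \<tau>, u_right) \<bullet> grad g (xbar \<tau>) \<noteq> 0"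
    and g_nonzero: "\<And>t. t \<in> {0..T} - {\<tau>} \<Longrightarrow> g (xbar t) \<noteq> 0"
  shows "\<forall>d \<in> critical_cone T f \<phi> g c (ref_y T \<tau> xbar) (ref_v T \<tau> ubar).
           \<exists>m \<in> lagrange_multipliers T f \<phi> g c (ref_y T \<tau> xbar) (ref_v T \<tau> ubar).
             Omega T f \<phi> g c (ref_y T \<tau> xbar) (ref_v T \<tau> ubar) m d \<ge> 0"
proof
  fix d assume d: "d \<in> critical_cone T f \<phi> g c (ref_y T \<tau> xbar) (ref_v T \<tau> ubar)"
  have t: "0 < \<tau>" "\<tau> < T" "\<tau> \<noteq> 0" "T - \<tau> \<noteq> 0" using tau by auto
  obtain L where L: "L-lipschitz_on {0..T} xbar" by (rule state_lipschitz[OF f_C2 xbar_state ubar_bounded])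
  have nz: "\<forall>t\<in>{0..T} - {\<tau>}. g (xbar t) \<noteq> 0" using g_nonzero by blast
  note signs = outward_crossing[OF f_C2 g_C2 tau L xbar_state ubar_limits(1) tau_crossing[unfolded K_eq] nz transverse(1)]
  have xder: "AE t in lebesgue_on {0..T}. (xbar has_vector_derivative f (xbar t, ubar t)) (at t within {0..T})"
    using xbar_state by (simp add: is_state_def)
  have um: "ubar \<in> borel_measurable (lebesgue_on {0..T})" and uU: "\<forall>t\<in>{0..T}. ubar t \<in> U"
    using ubar_control by (auto simp: controls_def)
  obtain M where M: "AE t in lebesgue_on {0..T}. norm (ubar t) \<le> M" using ubar_bounded by (auto simp: Linf_on_def)
  \<comment> \<open>Everything required of a control value, so that one modification on a null set
    secures it at all times.\<close>
  define P where "P u \<longleftrightarrow> u \<in> U \<and> norm u \<le> M \<and> grad_qualified c \<epsilon> \<delta> u" for u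
  have Pu: "AE t in lebesgue_on {0..T}. P (ubar t)"
    using AE_greaterThanLessThan_imp_Icc[OF c_qualified(3)] M AE_space
    by eventually_elim (use uU in \<open>auto simp: P_def grad_qualified_def Let_def\<close>)
  have PM: "norm u \<le> M" if "P u" for u using that by (simp add: P_def)
  have sub1: "\<tau> * s + 0 \<in> {0..T}" if "s \<in> {0..1}" for s
  proof -
    have "0 \<le> \<tau> * s" "\<tau> * s \<le> \<tau>" using that t by (auto simp: mult_left_le)
    then show ?thesis using t unfolding atLeastAtMost_iff by (intro conjI; linarith)
  qed
  have sub2: "(T - \<tau>) * s + \<tau> \<in> {0..T}" if "s \<in> {0..1}" for s
  proof -
    have "0 \<le> (T - \<tau>) * s" "(T - \<tau>) * s \<le> T - \<tau>" using that t by (auto simp: mult_left_le)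
    then show ?thesis using t unfolding atLeastAtMost_iff by (intro conjI; linarith)
  qed
  obtain v1 where v1: "bmeas v1" "\<forall>s\<in>{0..1}. P (v1 s)" "AE s in leb01. v1 s = ubar (\<tau> * s + 0)"
    by (rule bounded_modification[OF borel_measurable_affine_lebesgue_on[OF um t(3) sub1] AE_affine[OF Pu t(3) sub1] PM])
  obtain v2 where v2: "bmeas v2" "\<forall>s\<in>{0..1}. P (v2 s)" "AE s in leb01. v2 s = ubar ((T - \<tau>) * s + \<tau>)"
    by (rule bounded_modification[OF borel_measurable_affine_lebesgue_on[OF um t(4) sub2] AE_affine[OF Pu t(4) sub2] PM])
  define y1 where "y1 = (\<lambda>s. xbar (\<tau> * s + 0))"
  define y2 where "y2 = (\<lambda>s. xbar ((T - \<tau>) * s + \<tau>))"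
  have y1: "lip_path y1 (\<lambda>s. scaled f (y1 s, \<tau>, v1 s))"
  proof (rule lip_path_cong_AE)
    show "lip_path y1 (\<lambda>s. \<tau> *\<^sub>R f (xbar (\<tau> * s + 0), ubar (\<tau> * s + 0)))"
      unfolding y1_def by (rule lip_path_affine[OF L xder]) (use t in auto)
    show "AE s in leb01. \<tau> *\<^sub>R f (xbar (\<tau> * s + 0), ubar (\<tau> * s + 0)) = scaled f (y1 s, \<tau>, v1 s)"
      using v1(3) by eventually_elim (simp add: scaled_apply y1_def)
  qed
  have y2: "lip_path y2 (\<lambda>s. scaled f (y2 s, T - \<tau>, v2 s))"
  proof (rule lip_path_cong_AE)
    show "lip_path y2 (\<lambda>s. (T - \<tau>) *\<^sub>R f (xbar ((T - \<tau>) * s + \<tau>), ubar ((T - \<tau>) * s + \<tau>)))"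
      unfolding y2_def by (rule lip_path_affine[OF L xder]) (use t in auto)
    show "AE s in leb01. (T - \<tau>) *\<^sub>R f (xbar ((T - \<tau>) * s + \<tau>), ubar ((T - \<tau>) * s + \<tau>)) = scaled f (y2 s, T - \<tau>, v2 s)"
      using v2(3) by eventually_elim (simp add: scaled_apply y2_def)
  qed
  obtain E where E: "\<forall>i. (\<lambda>u. E u i) \<in> borel_measurable borel"
    "\<forall>u i. grad_qualified c \<epsilon> \<delta> u \<longrightarrow> c u $ i \<ge> - \<delta> \<longrightarrow> norm (E u i) \<le> 1 / \<epsilon>"
    "\<forall>u i k. grad_qualified c \<epsilon> \<delta> u \<longrightarrow> c u $ i \<ge> - \<delta> \<longrightarrow> c u $ k \<ge> - \<delta> \<longrightarrow>
       fderiv c u (E u i) $ k = (if k = i then 1 else 0)"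
    by (rule qualified_right_inverse[OF c_C2 c_qualified(1)])
  have v1': "AE s in leb01. v1 s = ubar (\<tau> * s)" using v1(3) by simp
  have y1': "y1 s = xbar (\<tau> * s)" for s by (simp add: y1_def)
  have y2': "y2 1 = xbar T" by (simp add: y2_def)
  obtain k \<rho> where k: "0 \<le> k" "0 < \<rho>" "\<forall>\<xi> w1 w2 z1 z2. \<bar>\<xi> - \<tau>\<bar> \<le> \<rho> \<longrightarrow> bmeas w1 \<longrightarrow> bmeas w2 \<longrightarrow>
      (\<forall>s\<in>{0..1}. norm (w1 s - v1 s) \<le> \<rho> \<and> norm (w2 s - v2 s) \<le> \<rho>) \<longrightarrow>
      (\<forall>s\<in>{0..1}. \<forall>i. c (w1 s) $ i \<le> 0 \<and> c (w2 s) $ i \<le> 0) \<longrightarrow>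
      z1 0 = y1 0 \<longrightarrow> z2 0 = z1 1 \<longrightarrow>
      lip_path z1 (\<lambda>s. scaled f (z1 s, \<xi>, w1 s)) \<longrightarrow> lip_path z2 (\<lambda>s. scaled f (z2 s, T - \<xi>, w2 s)) \<longrightarrow>
      (\<forall>s\<in>{0..1}. norm (z1 s - y1 s) \<le> \<rho> \<and> norm (z2 s - y2 s) \<le> \<rho>) \<longrightarrow>
      \<phi> (y2 1) - \<tau> \<le> \<phi> (z2 1) - \<xi> + k * max 0 (g (z1 1))"
    by (rule crossing_penalty[where ?\<phi> = \<phi> and ?v1.0 = v1 and ?v2.0 = v2 and ?y1.0 = y1 and ?y2.0 = y2,
          OF f_C2 g_C2 tau K_closed(1) K_eq U_eq xbar_state _ ubar_limits(1) signs(4) _ signs(1) _ v1' y1' y2'],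
        rule minimizer, assumption+, rule signs(2), assumption, rule signs(3), assumption, rule that, assumption+)
  have core: "crisis_core f c \<phi> g \<epsilon> \<delta> T \<tau> k \<rho> y1 y2 v1 v2 E"
  proof (rule crisis_core.intro)
    show "C2 f" "C2 c" "C2 \<phi>" "C2 g" "0 < \<epsilon>" "0 < \<delta>" "bmeas v1" "bmeas v2" "0 \<le> k" "0 < \<rho>"
      by (fact f_C2 c_C2 phi_C2 g_C2 c_qualified v1 v2 k)+
    show "grad_qualified c \<epsilon> \<delta> (v1 s)" "grad_qualified c \<epsilon> \<delta> (v2 s)" if "s \<in> {0..1}" for s
      using v1(2) v2(2) that unfolding P_def by blast+
    show "c (v1 s) $ i \<le> 0" "c (v2 s) $ i \<le> 0" if "s \<in> {0..1}" for s i
      using v1(2) v2(2) that unfolding P_def U_eq by blast+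
    show "(\<lambda>u. E u i) \<in> borel_measurable borel" for i using E(1) by blast
    show "norm (E u i) \<le> 1 / \<epsilon>" if "grad_qualified c \<epsilon> \<delta> u" "c u $ i \<ge> - \<delta>" for u i
      using E(2) that by blast
    show "fderiv c u (E u i) $ k = (if k = i then 1 else 0)"
      if "grad_qualified c \<epsilon> \<delta> u" "c u $ i \<ge> - \<delta>" "c u $ k \<ge> - \<delta>" for u i k
      using E(3) that by blast
    show "lip_path y1 (\<lambda>s. scaled f (y1 s, \<tau>, v1 s))" "lip_path y2 (\<lambda>s. scaled f (y2 s, T - \<tau>, v2 s))" by (fact y1 y2)+
    show "y2 0 = y1 1" by (simp add: y1_def y2_def)
    show "g (y1 1) = 0" using signs(1) by (simp add: y1_def)
    show "\<phi> (y2 1) - \<tau> \<le> \<phi> (z2 1) - \<xi> + k * max 0 (g (z1 1))"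
      if "\<bar>\<xi> - \<tau>\<bar> \<le> \<rho>" "bmeas w1" "bmeas w2"
        "\<And>s. s \<in> {0..1} \<Longrightarrow> norm (w1 s - v1 s) \<le> \<rho> \<and> norm (w2 s - v2 s) \<le> \<rho>"
        "\<And>s i. s \<in> {0..1} \<Longrightarrow> c (w1 s) $ i \<le> 0 \<and> c (w2 s) $ i \<le> 0"
        "z1 0 = y1 0" "z2 0 = z1 1"
        "lip_path z1 (\<lambda>s. scaled f (z1 s, \<xi>, w1 s))" "lip_path z2 (\<lambda>s. scaled f (z2 s, T - \<xi>, w2 s))"
        "\<And>s. s \<in> {0..1} \<Longrightarrow> norm (z1 s - y1 s) \<le> \<rho> \<and> norm (z2 s - y2 s) \<le> \<rho>" for \<xi> w1 w2 z1 z2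
      by (rule k(3)[rule_format, OF that])
  qed
  \<comment> \<open>At \<open>s = 0\<close> the second value falls into the first branch of
    \<open>time_change\<close>, since \<open>s + 1 = 1\<close>; both branches give
    \<open>\<tau>\<close> there.\<close>
  have tc: "time_change T \<tau> s = \<tau> * s + 0" "time_change T \<tau> (s + 1) = (T - \<tau>) * s + \<tau>" if "s \<in> {0..1}" for s
    using that by (auto simp: time_change_def algebra_simps)
  have Y: "ref_y T \<tau> xbar s = (y1 s, y2 s, \<tau>)" if "s \<in> {0..1}" for s
    using tc[OF that] by (simp add: ref_y_def y1_def y2_def)
  have V: "AE s in leb01. ref_v T \<tau> ubar s = (v1 s, v2 s)"
    using v1(3) v2(3) AE_space
  proof eventually_elim
    case (elim s)
    then have "s \<in> {0..1}" by simp
    then show ?case using tc[of s] elim(1,2) by (simp add: ref_v_def)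
  qed
  show "\<exists>m \<in> lagrange_multipliers T f \<phi> g c (ref_y T \<tau> xbar) (ref_v T \<tau> ubar).
      Omega T f \<phi> g c (ref_y T \<tau> xbar) (ref_v T \<tau> ubar) m d \<ge> 0"
    by (rule second_order_condition[OF core Y V d])
qed

end
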